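(* There exist numerical constants $c_1,c_2>0$ such that the following holds. Let $\mathbf{D}=\mathbf{L}+\mathbf{C}\in\mathbb{R}^{N_1\times N_2}$ follow Data Model 1 (see context), with $\operatorname{rank}(\mathbf{L})=r$, $K\ge1$ non-zero columns (outliers) in $\mathbf{C}$, $N_2'=N_2-K$ inlier columns; let $\mu_v$ be the row-space incoherency parameter and $\eta_u$ the column-space incoherency parameter of $\mathbf{L}$. Suppose the non-zero elements of $\mathbf{C}$ (the entries of its $K$ non-zero columns) are sampled independently from a zero-mean normal distribution. Let $0<\delta<1/4$, and suppose that $$m_1\ge\frac{N_2}{N_2'}\zeta,\qquad g\ge\frac{N_2'}{N_2}\big(1+6r\mu_v(121/9)\big),\qquad \frac{K}{N_2'}\le\frac{g\frac{N_2}{N_2'}-(1+6r\mu_v(121/9))}{g\,(1+6r\mu_v(121/9))},$$ $$m_2\ge\max\Bigg[r\eta_u^2\max\Big(c_1\log r,\,c_2\log\frac3\delta\Big),\ r+1+2\log\frac{2K}{\delta}+\sqrt{8\log\frac{2K}{\delta}}\Bigg],$$ where $$\zeta=\max\Big(3g^2\frac{K}{N_2'}\log\frac2\delta,\ \frac{N_2'}{N_2}\,10\,r\mu_v\log\frac{2r}{\delta}\Big).$$ Suppose the $m_1$ columns of $\mathbf{D}_s$ are sampled from $\mathbf{D}$ uniformly at random with replacement and $m_2$ rows are sampled uniformly at random without replacement. Then, with probability at least $1-4\delta$, Algorithm 2 with row sampling (described in the context) recovers the exact subspace, i.e. its output $\mathbf{T}$ is a basis for the column space of $\mathbf{L}$,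 and the non-zero columns of the matrix $\mathbf{H}$ (defined in the context) are located exactly at the indices of the non-zero columns of $\mathbf{C}$.
   Context: **Data Model 1.** $\mathbf{D}=\mathbf{L}+\mathbf{C}\in\mathbb{R}^{N_1\times N_2}$ with $\operatorname{rank}(\mathbf{L})=r$. $\mathbf{C}$ has exactly $K$ non-zero columns, with index set $\mathcal{I}$; if $\mathbf{U}\in\mathbb{R}^{N_1\times r}$ is an orthonormal basis for the column space of $\mathbf{L}$, then $(\mathbf{I}-\mathbf{U}\mathbf{U}^T)\mathbf{C}_i\ne 0$ for $i\in\mathcal{I}$, where $\mathbf{C}_i$ is the $i$th column. Moreover $\mathbf{L}_i=\mathbf{0}$ for $i\in\mathcal{I}$. Columns of $\mathbf{D}$ with index in $\mathcal{I}$ are outliers, the others are inliers. $N_2'$ is the number of inlier columns (the non-zero columns of $\mathbf{L}$), with $N_2=K+N_2'$. **Randomness.** $\mathbf{L}$ and $\mathcal{I}$ are fixed; all entries of the columns of $\mathbf{C}$ indexed by $\mathcal{I}$ are i.i.d. $\mathcal{N}(0,\sigma^2)$ for some $\sigma>0$; the column sampling, row sampling and $\mathbf{C}$ are mutually independent. **Incoherency.** If $\mathbf{V}\in\mathbb{R}^{N_2\times r}$ is an orthonormal basis for the row space of $\mathbf{L}$, then $\mu_v$ satisfies $\max_i\|\mathbf{V}^T\mathbf{e}_i\|_2^2\le r\mu_v/N_2$. Also $\eta_u=\sqrt{N_1}\max_{i,j}|\mathbf{U}(i,j)|$, with $\mathbf{U}$ an orthonormal basis for the column space of $\mathbf{L}$.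 **Algorithm 2 with row sampling (RRD).** 1. Sample columns: $\mathbf{D}_s=\mathbf{D}\mathbf{S}\in\mathbb{R}^{N_1\times m_1}$, where the columns of $\mathbf{S}$ are standard basis vectors selecting the sampled columns. 2. Compress: $\mathbf{D}_s^\phi=\mathbf{\Phi}\mathbf{D}_s$, where the rows of $\mathbf{\Phi}\in\mathbb{R}^{m_2\times N_1}$ are standard basis vectors selecting the $m_2$ sampled rows. 3. Let $(\hat{\mathbf{L}}_s^\phi,\hat{\mathbf{C}}_s^\phi)$ be an optimal solution of $$\min_{\dot{\mathbf{L}},\dot{\mathbf{C}}}\ \lambda\|\dot{\mathbf{C}}\|_{1,2}+\|\dot{\mathbf{L}}\|_*\quad\text{subject to}\quad\dot{\mathbf{L}}+\dot{\mathbf{C}}=\mathbf{D}_s^\phi,$$ where $\|\cdot\|_*$ is the nuclear norm and $\|\cdot\|_{1,2}$ is the sum of the $\ell_2$-norms of the columns. Here $\lambda=3/(7\sqrt{K_s})$, where $K_s$ is the number of non-zero columns of $\mathbf{C}\mathbf{S}$ (if $K_s=0$, take $\lambda=+\infty$, i.e. $\hat{\mathbf{C}}_s^\phi=0$). Columns of $\mathbf{D}_s^\phi$ at the locations of non-zero columns of $\hat{\mathbf{C}}_s^\phi$ are declared outliers, the others inliers. 4. Output $\mathbf{T}$: the columns of $\mathbf{D}_s$ corresponding to a linearly independent set of declared-inlier columns of $\mathbf{D}_s^\phi$ that spans the span of all declared-inlier columns of $\mathbf{D}_s^\phi$. **Outlier identification.** Let $\hat{\mathbf{U}}^\phi$ be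 an orthonormal basis for the span of the declared-inlier columns of $\mathbf{D}_s^\phi$ (the learned estimate of the column space of $\mathbf{\Phi}\mathbf{L}$). Define $\mathbf{H}=(\mathbf{I}-\hat{\mathbf{U}}^\phi(\hat{\mathbf{U}}^\phi)^T)\,\mathbf{\Phi}\mathbf{D}$. *)

theory Defs
  imports
    "HOL-Probability.Probability"
    "Jordan_Normal_Form.Char_Poly"
    "Jordan_Normal_Form.DL_Rank"
begin

text \<open>Matrices are those of \<^theory>\<open>Jordan_Normal_Form.Matrix\<close>, with dimensions given by natural
  numbers, because the numerical constants of the theorem have to be independent of all dimensions.
  Row and column indices start at \<open>0\<close>.\<close>

abbreviation vspan :: "nat \<Rightarrow> real vec set \<Rightarrow> real vec set" where
  "vspan n \<equiv> LinearCombinations.module.span class_ring (module_vec TYPE(real) n)"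

abbreviation lin_independent :: "nat \<Rightarrow> real vec set \<Rightarrow> bool" where
  "lin_independent n B \<equiv> \<not> LinearCombinations.module.lin_dep class_ring (module_vec TYPE(real) n) B"

abbreviation colspace :: "real mat \<Rightarrow> real vec set" where
  "colspace A \<equiv> vec_space.col_space (dim_row A) A"

abbreviation rowspace :: "real mat \<Rightarrow> real vec set" where
  "rowspace A \<equiv> vec_space.row_space (dim_col A) A"

definition nonzero_cols :: "real mat \<Rightarrow> nat set" where
  "nonzero_cols A = {j. j < dim_col A \<and> col A j \<noteq> 0\<^sub>v (dim_row A)}"

text \<open>The columns of \<open>B\<close>, as an indexed family, form a basis of the subspace \<open>W\<close>; distinctness of
  the columns is part of the linear independence of the family.\<close>

definition columns_basis :: "real mat \<Rightarrow> real vec set \<Rightarrow> bool" where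
  "columns_basis B W \<longleftrightarrow> distinct (cols B) \<and> lin_independent (dim_row B) (set (cols B))
     \<and> vspan (dim_row B) (set (cols B)) = W"

definition orthonormal_basis :: "real mat \<Rightarrow> real vec set \<Rightarrow> bool" where
  "orthonormal_basis B W \<longleftrightarrow> transpose_mat B * B = 1\<^sub>m (dim_col B)
     \<and> vspan (dim_row B) (set (cols B)) = W"

definition vec_l2_norm :: "real vec \<Rightarrow> real" where
  "vec_l2_norm v = sqrt (v \<bullet> v)"

definition norm_1_2 :: "real mat \<Rightarrow> real" where
  "norm_1_2 A = (\<Sum>j<dim_col A. vec_l2_norm (col A j))"

text \<open>The nuclear norm is the sum of the singular values, i.e. of the square roots of the
  eigenvalues of \<open>A\<^sup>T A\<close>, each counted with its multiplicity as a root of the characteristic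
  polynomial.\<close>

definition nuclear_norm :: "real mat \<Rightarrow> real" where
  "nuclear_norm A =
     (let G = transpose_mat A * A
      in \<Sum>e | eigenvalue G e. real (Polynomial.order e (char_poly G)) * sqrt e)"

definition data_model ::
  "nat \<Rightarrow> nat \<Rightarrow> nat \<Rightarrow> nat \<Rightarrow> nat \<Rightarrow> real mat \<Rightarrow> real mat \<Rightarrow> nat set \<Rightarrow> bool" where
  "data_model N1 N2 r K N2' L C I \<longleftrightarrow>
     L \<in> carrier_mat N1 N2 \<and> C \<in> carrier_mat N1 N2 \<and>
     vec_space.rank N1 L = r \<and>
     I = nonzero_cols C \<and> card I = K \<and>
     (\<forall>U \<in> carrier_mat N1 r. orthonormal_basis U (colspace L) \<longrightarrow>
        (\<forall>i\<in>I. (1\<^sub>m N1 - U * transpose_mat U) *\<^sub>v col C i \<noteq> 0\<^sub>v N1)) \<and>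
     (\<forall>i\<in>I. col L i = 0\<^sub>v N1) \<and>
     N2' = card (nonzero_cols L) \<and> N2 = K + N2'"

text \<open>Only the entries \<open>(i, j)\<close> with \<open>j \<in> I\<close> are random; \<open>outlier_mat\<close> extends them by zero.\<close>

definition outlier_mat :: "nat \<Rightarrow> nat \<Rightarrow> nat set \<Rightarrow> (nat \<times> nat \<Rightarrow> real) \<Rightarrow> real mat" where
  "outlier_mat N1 N2 I x = mat N1 N2 (\<lambda>(i, j). if j \<in> I then x (i, j) else 0)"

definition gaussian_entries :: "nat \<Rightarrow> nat set \<Rightarrow> real \<Rightarrow> (nat \<times> nat \<Rightarrow> real) measure" where
  "gaussian_entries N1 I \<sigma> = PiM ({..<N1} \<times> I) (\<lambda>_. density lborel (normal_density 0 \<sigma>))"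

definition column_sampling :: "nat \<Rightarrow> nat \<Rightarrow> nat list pmf" where
  "column_sampling N2 m1 = replicate_pmf m1 (pmf_of_set {..<N2})"

definition row_sampling :: "nat \<Rightarrow> nat \<Rightarrow> nat list pmf" where
  "row_sampling N1 m2 = pmf_of_set {is. length is = m2 \<and> distinct is \<and> set is \<subseteq> {..<N1}}"

text \<open>The product measure makes the column sample, the row sample and the entries of \<open>C\<close>
  mutually independent.\<close>

definition rrd_space ::
  "nat \<Rightarrow> nat \<Rightarrow> nat \<Rightarrow> nat \<Rightarrow> nat set \<Rightarrow> real \<Rightarrow> (nat list \<times> nat list \<times> (nat \<times> nat \<Rightarrow> real)) measure" where
  "rrd_space N1 N2 m1 m2 I \<sigma> =
     measure_pmf (column_sampling N2 m1) \<Otimes>\<^sub>M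
       (measure_pmf (row_sampling N1 m2) \<Otimes>\<^sub>M gaussian_entries N1 I \<sigma>)"

definition col_selection :: "nat \<Rightarrow> nat list \<Rightarrow> real mat" where
  "col_selection N2 js = mat_of_cols N2 (map (unit_vec N2) js)"

definition row_selection :: "nat \<Rightarrow> nat list \<Rightarrow> real mat" where
  "row_selection N1 is = mat_of_rows N1 (map (unit_vec N1) is)"

definition feasible :: "real mat \<Rightarrow> real mat \<times> real mat \<Rightarrow> bool" where
  "feasible M = (\<lambda>(L', C'). L' \<in> carrier_mat (dim_row M) (dim_col M) \<and>
     C' \<in> carrier_mat (dim_row M) (dim_col M) \<and> L' + C' = M)"

definition objective :: "real \<Rightarrow> real mat \<times> real mat \<Rightarrow> real" where
  "objective lam = (\<lambda>(L', C'). lam * norm_1_2 C' + nuclear_norm L')"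

text \<open>For \<open>Ks = 0\<close> the weight is \<open>\<lambda> = +\<infinity>\<close>, which forces the second component to vanish.\<close>

definition program_solution :: "nat \<Rightarrow> real mat \<Rightarrow> real mat \<times> real mat \<Rightarrow> bool" where
  "program_solution Ks M P \<longleftrightarrow> feasible M P \<and>
     (if Ks = 0 then snd P = 0\<^sub>m (dim_row M) (dim_col M)
      else \<forall>Q. feasible M Q \<longrightarrow>
             objective (3 / (7 * sqrt (real Ks))) P \<le> objective (3 / (7 * sqrt (real Ks))) Q)"

definition declared_inliers :: "real mat \<Rightarrow> nat set" where
  "declared_inliers Ch = {..<dim_col Ch} - nonzero_cols Ch"

definition inlier_span :: "real mat \<Rightarrow> real mat \<Rightarrow> real vec set" where
  "inlier_span M Ch = vspan (dim_row M) (col M ` declared_inliers Ch)"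

text \<open>\<open>T\<close> is a possible output: the columns of \<open>Ds\<close> at positions \<open>js\<close>, where the columns of the
  compressed matrix \<open>M\<close> at the same positions are a basis of the span of its declared inliers.\<close>

definition rrd_output :: "real mat \<Rightarrow> real mat \<Rightarrow> real mat \<Rightarrow> real mat \<Rightarrow> bool" where
  "rrd_output Ds M Ch T \<longleftrightarrow>
     (\<exists>js. set js \<subseteq> declared_inliers Ch \<and>
        columns_basis (mat_of_cols (dim_row M) (map (col M) js)) (inlier_span M Ch) \<and>
        T = mat_of_cols (dim_row Ds) (map (col Ds) js))"

text \<open>Success is required for every optimal solution of the program, every choice of the columns
  of \<open>T\<close>, and every orthonormal basis \<open>Uh\<close> of the learned subspace.\<close>

definition rrd_success :: "real mat \<Rightarrow> real mat \<Rightarrow> nat list \<Rightarrow> nat list \<Rightarrow> bool" where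
  "rrd_success L C js is \<longleftrightarrow>
     (let D = L + C;
          S = col_selection (dim_col D) js;
          \<Phi> = row_selection (dim_row D) is;
          Ds = D * S;
          M = \<Phi> * Ds;
          Ks = card (nonzero_cols (C * S))
      in \<forall>Lh Ch. program_solution Ks M (Lh, Ch) \<longrightarrow>
           (\<forall>T. rrd_output Ds M Ch T \<longrightarrow> columns_basis T (colspace L)) \<and>
           (\<forall>Uh. dim_row Uh = dim_row M \<and> orthonormal_basis Uh (inlier_span M Ch) \<longrightarrow>
              nonzero_cols ((1\<^sub>m (dim_row M) - Uh * transpose_mat Uh) * (\<Phi> * D))
                = nonzero_cols C))"

end

theory Submission
  imports Defs
begin

text \<open>The event is a product of an event on the column sample, one on the row sample and one of
  probability one on the Gaussian entries.

  Columns: the sampled rows \<open>v\<^sub>j\<close> of \<open>V\<close> satisfy \<open>\<Sum> (v\<^sub>j \<bullet> z)\<^sup>2 \<ge> m\<^sub>1 / (4 N\<^sub>2) * |z|\<^sup>2\<close>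
  by a matrix Chernoff argument, with high powers of the resolvent of the Gram matrix instead of
  the matrix exponential, and a scalar Chernoff bound controls the number of sampled outliers.
  Rows: drawing rows of \<open>U\<close> one by one, the expected dimension of the complement of their span
  decays geometrically, so the row-sampled \<open>U\<close> is injective. Gaussian entries: more than \<open>r\<close> rows
  are kept, so almost surely no compressed outlier lies in the compressed column space.

  On this event the program is analysed by convex duality. The problem restricted to low-rank
  parts with the correct column space has a minimizer by compactness, and its stationarity
  conditions yield a dual certificate that is strict on the inlier columns. Hence every optimal
  solution of the full program has exactly the outliers as non-zero columns.\<close>

unbundle no inner_syntax and no vec_syntax

section \<open>Real matrices and the spectral theorem\<close>

text \<open>The weight is chosen so that \<open>lam\<^sup>2 * card J = 9/49\<close>, and most
  constants descend from this. At the restricted optimum the outlier columns of the polar factor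
  have norm at most \<open>lam\<close>, so the outlier columns carry at most 9/49 of the Gram energy
  of the low-rank part in every direction, hence at most 9/40 of the inlier energy. This ratio keeps
  the correction inside the certificate small, and costs only the factor 2041/1960 in the leverage
  condition.

  Taking the exact minimizer of the restricted problem gives the certificate its prescribed outlier
  columns without error, so no iterative construction is needed.

  The leverage condition compares quadratic forms only. It therefore passes unchanged from the rows
  of \<open>V\<close> to the row-compressed data, however badly conditioned the compressed basis is,
  and the row sample needs injectivity alone.

  The loss 4 in the Gram bound and the threshold \<open>7/2 * m1 / \<beta>\<close> for sampled
  outliers are balanced against the 121/9 of the hypotheses: \<open>4 * 7/2 * 2041/1960\<close> is
  about 14.58, and \<open>6 * 121/9 * 9/49\<close> is about 14.82.\<close>

lemma mat_assoc: fixes A :: "'a::semiring_0 mat"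
  assumes "dim_col A = dim_row B" "dim_col B = dim_row C"
  shows "A * B * C = A * (B * C)"
  using assms by (intro assoc_mult_mat[of _ "dim_row A" "dim_row B" _ "dim_row C" _ "dim_col C"]) auto

text \<open>Stated for a product associated to the right, so that together with
  \<open>mat_assoc\<close> the simplifier can delete a pair of inverse factors in front of any
  remaining product.\<close>

lemma mat_cancel_left: fixes A :: "'a::semiring_1 mat"
  assumes "A * B = 1\<^sub>m n" "dim_col A = dim_row B" "dim_col B = dim_row X"
  shows "A * (B * X) = X"
proof -
  have "A * (B * X) = (A * B) * X" using assms by (intro mat_assoc[symmetric]) auto
  moreover have "dim_row X = n" using arg_cong[OF assms(1), of dim_col] assms(3) by simp
  ultimately show ?thesis using assms(1) by simp
qed

lemma mat_vec_assoc: fixes A :: "'a::semiring_0 mat"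
  assumes "dim_col A = dim_row B" "dim_col B = dim_vec v"
  shows "A * B *\<^sub>v v = A *\<^sub>v (B *\<^sub>v v)"
  using assms by (intro assoc_mult_mat_vec[of _ "dim_row A" "dim_row B" _ "dim_vec v"]) (auto intro: carrier_vecI)

lemma mat_transpose_mult: fixes A :: "real mat"
  assumes "dim_col A = dim_row B"
  shows "transpose_mat (A * B) = transpose_mat B * transpose_mat A"
  using assms by (intro transpose_mult) auto

lemma scalar_prod_adjoint: fixes A :: "real mat"
  assumes "dim_vec x = dim_row A" "dim_vec y = dim_col A"
  shows "x \<bullet> (A *\<^sub>v y) = (transpose_mat A *\<^sub>v x) \<bullet> y"
  using assms by (intro transpose_vec_mult_scalar[symmetric]) (auto intro: carrier_vecI)

lemma scalar_prod_commute: fixes x :: "real vec" assumes "dim_vec x = dim_vec y" shows "x \<bullet> y = y \<bullet> x"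
  using assms by (intro comm_scalar_prod) (auto intro: carrier_vecI)

lemma add_scalar_prod: fixes x :: "real vec"
  shows "dim_vec x = dim_vec z \<Longrightarrow> dim_vec y = dim_vec z \<Longrightarrow> (x + y) \<bullet> z = x \<bullet> z + y \<bullet> z"
  by (simp add: scalar_prod_def sum.distrib algebra_simps)

lemma scalar_prod_add: fixes x :: "real vec"
  shows "dim_vec x = dim_vec z \<Longrightarrow> dim_vec y = dim_vec z \<Longrightarrow> z \<bullet> (x + y) = z \<bullet> x + z \<bullet> y"
  by (simp add: scalar_prod_def sum.distrib algebra_simps)

lemma minus_scalar_prod: fixes x :: "real vec"
  shows "dim_vec x = dim_vec z \<Longrightarrow> dim_vec y = dim_vec z \<Longrightarrow> (x - y) \<bullet> z = x \<bullet> z - y \<bullet> z"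
  by (simp add: scalar_prod_def sum_subtractf algebra_simps)

lemma scalar_prod_minus: fixes x :: "real vec"
  shows "dim_vec x = dim_vec z \<Longrightarrow> dim_vec y = dim_vec z \<Longrightarrow> z \<bullet> (x - y) = z \<bullet> x - z \<bullet> y"
  by (simp add: scalar_prod_def sum_subtractf algebra_simps)

lemma mat_vec_add: fixes A :: "real mat"
  shows "dim_vec x = dim_col A \<Longrightarrow> dim_vec y = dim_col A \<Longrightarrow> A *\<^sub>v (x + y) = A *\<^sub>v x + A *\<^sub>v y"
  by (intro eq_vecI) (simp_all add: scalar_prod_add)

lemma mat_vec_minus: fixes A :: "real mat"
  shows "dim_vec x = dim_col A \<Longrightarrow> dim_vec y = dim_col A \<Longrightarrow> A *\<^sub>v (x - y) = A *\<^sub>v x - A *\<^sub>v y"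
  by (intro eq_vecI) (simp_all add: scalar_prod_minus)

lemma mat_vec_smult: fixes A :: "real mat"
  shows "dim_vec x = dim_col A \<Longrightarrow> A *\<^sub>v (a \<cdot>\<^sub>v x) = a \<cdot>\<^sub>v (A *\<^sub>v x)"
  by (intro eq_vecI) simp_all

lemma add_mat_vec: fixes A :: "real mat"
  shows "dim_vec x = dim_col A \<Longrightarrow> dim_row B = dim_row A \<Longrightarrow> dim_col B = dim_col A
    \<Longrightarrow> (A + B) *\<^sub>v x = A *\<^sub>v x + B *\<^sub>v x"
  by (intro eq_vecI) (simp_all add: scalar_prod_def sum.distrib algebra_simps)

lemma minus_mat_vec: fixes A :: "real mat"
  shows "dim_vec x = dim_col A \<Longrightarrow> dim_row B = dim_row A \<Longrightarrow> dim_col B = dim_col A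
    \<Longrightarrow> (A - B) *\<^sub>v x = A *\<^sub>v x - B *\<^sub>v x"
  by (intro eq_vecI) (simp_all add: scalar_prod_def sum_subtractf algebra_simps)

lemma smult_mat_vec: fixes A :: "real mat"
  shows "dim_vec x = dim_col A \<Longrightarrow> (a \<cdot>\<^sub>m A) *\<^sub>v x = a \<cdot>\<^sub>v (A *\<^sub>v x)"
  by (intro eq_vecI) (simp_all add: scalar_prod_def sum_distrib_left algebra_simps)

lemma zero_mat_vec: "dim_vec x = m \<Longrightarrow> 0\<^sub>m n m *\<^sub>v (x :: real vec) = 0\<^sub>v n"
  by (intro eq_vecI) (simp_all add: scalar_prod_def)

lemma one_mat_vec: "dim_vec x = n \<Longrightarrow> 1\<^sub>m n *\<^sub>v (x :: real vec) = x"
  by (rule one_mult_mat_vec) (auto intro: carrier_vecI)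

lemma mat_vec_zero: "dim_col A = m \<Longrightarrow> (A :: real mat) *\<^sub>v 0\<^sub>v m = 0\<^sub>v (dim_row A)"
  by (intro eq_vecI) (simp_all add: scalar_prod_def)

lemma smult_vec_zero: "a \<cdot>\<^sub>v 0\<^sub>v n = (0\<^sub>v n :: real vec)"
  by (intro eq_vecI) auto

lemma mat_eqI_vec: fixes A B :: "real mat"
  assumes "A \<in> carrier_mat n m" "B \<in> carrier_mat n m"
    and "\<And>x. x \<in> carrier_vec m \<Longrightarrow> A *\<^sub>v x = B *\<^sub>v x"
  shows "A = B"
proof (rule eq_matI)
  fix i j assume ij: "i < dim_row B" "j < dim_col B"
  have "(A *\<^sub>v unit_vec m j) $ i = (B *\<^sub>v unit_vec m j) $ i" using assms(3) by simp
  then show "A $$ (i, j) = B $$ (i, j)" using ij assms(1,2) by simp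
qed (use assms in auto)

lemma vec_eqI_scalar: fixes x y :: "real vec"
  assumes "x \<in> carrier_vec n" "y \<in> carrier_vec n"
    and "\<And>z. z \<in> carrier_vec n \<Longrightarrow> z \<bullet> x = z \<bullet> y"
  shows "x = y"
proof (rule eq_vecI)
  fix i assume i: "i < dim_vec y"
  have "unit_vec n i \<bullet> x = unit_vec n i \<bullet> y" using assms(3) by simp
  then show "x $ i = y $ i" using i assms(1,2) by simp
qed (use assms in auto)

lemma scalar_prod_self_nonneg [simp]: "0 \<le> (x :: real vec) \<bullet> x"
  by (simp add: scalar_prod_def sum_nonneg)

lemma scalar_prod_self_eq_0: "(x :: real vec) \<in> carrier_vec n \<Longrightarrow> x \<bullet> x = 0 \<longleftrightarrow> x = 0\<^sub>v n"
  by (auto simp: scalar_prod_def sum_nonneg_eq_0_iff intro!: eq_vecI)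

lemma scalar_prod_self_pos: "(x :: real vec) \<in> carrier_vec n \<Longrightarrow> x \<noteq> 0\<^sub>v n \<Longrightarrow> 0 < x \<bullet> x"
  using scalar_prod_self_eq_0[of x n] scalar_prod_self_nonneg[of x] by linarith

lemma scalar_prod_Cauchy_Schwarz: fixes x y :: "real vec"
  assumes "dim_vec x = dim_vec y"
  shows "(x \<bullet> y)\<^sup>2 \<le> (x \<bullet> x) * (y \<bullet> y)"
  using Cauchy_Schwarz_ineq_sum[of "\<lambda>i. x $ i" "\<lambda>i. y $ i" "{0..<dim_vec y}"] assms
  by (simp add: scalar_prod_def power2_eq_square)

lemma vec_l2_norm_nonneg [simp]: "0 \<le> vec_l2_norm x" by (simp add: vec_l2_norm_def)

lemma vec_l2_norm_square: "(vec_l2_norm x)\<^sup>2 = x \<bullet> x" by (simp add: vec_l2_norm_def)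

lemma vec_l2_norm_eq_0: "x \<in> carrier_vec n \<Longrightarrow> vec_l2_norm x = 0 \<longleftrightarrow> x = 0\<^sub>v n"
  by (simp add: vec_l2_norm_def scalar_prod_self_eq_0)

lemma scalar_prod_le_norms:
  assumes "dim_vec x = dim_vec y" shows "x \<bullet> y \<le> vec_l2_norm x * vec_l2_norm y"
proof -
  have "\<bar>x \<bullet> y\<bar> \<le> sqrt ((x \<bullet> x) * (y \<bullet> y))"
    using scalar_prod_Cauchy_Schwarz[OF assms] by (simp add: real_le_rsqrt)
  then show ?thesis by (simp add: vec_l2_norm_def real_sqrt_mult)
qed

section \<open>Rank-one matrices, reflections and diagonalization\<close>

definition outer :: "real vec \<Rightarrow> real vec \<Rightarrow> real mat" where
  "outer u v = mat (dim_vec u) (dim_vec v) (\<lambda>(i, j). u $ i * v $ j)"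

lemma outer_dim [simp]: "dim_row (outer u v) = dim_vec u" "dim_col (outer u v) = dim_vec v"
  by (simp_all add: outer_def)

lemma outer_vec: "dim_vec x = dim_vec v \<Longrightarrow> outer u v *\<^sub>v x = (v \<bullet> x) \<cdot>\<^sub>v u"
  by (intro eq_vecI) (simp_all add: outer_def scalar_prod_def sum_distrib_left sum_distrib_right algebra_simps)

lemma outer_transpose: "transpose_mat (outer u v) = outer v u"
  by (intro eq_matI) (simp_all add: outer_def)

lemma mat_transpose_minus: "dim_row A = dim_row B \<Longrightarrow> dim_col A = dim_col B \<Longrightarrow>
  transpose_mat ((A :: real mat) - B) = transpose_mat A - transpose_mat B"
  by (intro eq_matI) simp_all

lemma mat_transpose_smult: "transpose_mat (a \<cdot>\<^sub>m (A :: real mat)) = a \<cdot>\<^sub>m transpose_mat A"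
  by (intro eq_matI) simp_all

text \<open>The reflection in the hyperplane orthogonal to \<open>v - unit_vec n 0\<close> exchanges
  these two unit vectors. It provides an orthogonal matrix with first column \<open>v\<close>
  without extending \<open>v\<close> to an orthonormal basis.\<close>

lemma householder_exists:
  fixes v :: "real vec"
  assumes v: "v \<in> carrier_vec n" "v \<bullet> v = 1" and n: "0 < n"
  shows "\<exists>H \<in> carrier_mat n n. transpose_mat H = H \<and> H * H = 1\<^sub>m n \<and> H *\<^sub>v unit_vec n 0 = v"
proof (cases "v = unit_vec n 0")
  case True
  then show ?thesis
    by (intro bexI[of _ "1\<^sub>m n"]) (auto simp: one_mat_vec left_mult_one_mat[OF one_carrier_mat])
next
  case False
  define w where "w = v - unit_vec n 0"
  have w: "w \<in> carrier_vec n" "dim_vec w = n" using v by (auto simp: w_def)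
  have "w \<noteq> 0\<^sub>v n"
  proof
    assume "w = 0\<^sub>v n"
    then have "w $ i = 0" if "i < n" for i using that by simp
    then have "v $ i = unit_vec n 0 $ i" if "i < n" for i
      using that v by (simp add: w_def del: index_unit_vec(1,2))
    then show False using False v by (auto intro!: eq_vecI)
  qed
  then have pos: "0 < w \<bullet> w" using scalar_prod_self_pos w by blast
  define c where "c = 2 / (w \<bullet> w)"
  have c: "c * (w \<bullet> w) = 2" using pos by (simp add: c_def)
  define H where "H = 1\<^sub>m n - c \<cdot>\<^sub>m outer w w"
  have Hdim: "H \<in> carrier_mat n n" using w by (auto simp: H_def)
  have Hx: "H *\<^sub>v x = x - (c * (w \<bullet> x)) \<cdot>\<^sub>v w" if "x \<in> carrier_vec n" for x
    using that w by (simp add: H_def minus_mat_vec smult_mat_vec outer_vec one_mat_vec smult_smult_assoc)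
  have "H *\<^sub>v (H *\<^sub>v x) = x" if x: "x \<in> carrier_vec n" for x
  proof -
    have "w \<bullet> (H *\<^sub>v x) = w \<bullet> x - (c * (w \<bullet> w)) * (w \<bullet> x)"
      using x w by (simp add: Hx scalar_prod_minus)
    then have *: "w \<bullet> (H *\<^sub>v x) = - (w \<bullet> x)" using c by simp
    have "H *\<^sub>v (H *\<^sub>v x) = H *\<^sub>v x - (c * (w \<bullet> (H *\<^sub>v x))) \<cdot>\<^sub>v w"
      by (rule Hx) (use Hdim x in simp)
    then show ?thesis unfolding * using x w by (intro eq_vecI) (auto simp: Hx)
  qed
  then have "H * H = 1\<^sub>m n"
    using Hdim by (intro mat_eqI_vec[of _ n n]) (auto simp: mat_vec_assoc one_mat_vec)
  moreover have "transpose_mat H = H"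
    using w by (simp add: H_def mat_transpose_minus mat_transpose_smult outer_transpose)
  moreover have "H *\<^sub>v unit_vec n 0 = v"
  proof -
    have "w \<bullet> unit_vec n 0 = v $ 0 - 1" using v n by (simp add: w_def)
    moreover have "w \<bullet> w = 2 - 2 * v $ 0"
    proof -
      have "w \<bullet> w = v \<bullet> v - v \<bullet> unit_vec n 0 - (unit_vec n 0 \<bullet> v - unit_vec n 0 \<bullet> unit_vec n 0)"
        unfolding w_def using v by (simp add: scalar_prod_minus minus_scalar_prod)
      then show ?thesis using v n by simp
    qed
    ultimately have "c * (w \<bullet> unit_vec n 0) = -1" using c pos by (simp add: c_def field_simps)
    then have "H *\<^sub>v unit_vec n 0 = unit_vec n 0 - (-1) \<cdot>\<^sub>v w" by (simp add: Hx)
    also have "\<dots> = v" using v by (intro eq_vecI) (auto simp: w_def)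
    finally show ?thesis .
  qed
  ultimately show ?thesis using Hdim by blast
qed

lemma symmetric_scalar_prod: fixes A :: "real mat"
  assumes "A \<in> carrier_mat n n" "transpose_mat A = A" "x \<in> carrier_vec n" "y \<in> carrier_vec n"
  shows "x \<bullet> (A *\<^sub>v y) = (A *\<^sub>v x) \<bullet> y"
  using assms scalar_prod_adjoint[of x A y] by simp

text \<open>The fundamental theorem of algebra gives a complex eigenvector \<open>a + i b\<close>
  with eigenvalue \<open>z\<close>. Comparing \<open>a \<bullet> (A *\<^sub>v b)\<close> with
  \<open>(A *\<^sub>v a) \<bullet> b\<close> yields
  \<open>Im z * (a \<bullet> a + b \<bullet> b) = 0\<close>, so \<open>z\<close> is real and
  whichever of \<open>a\<close> and \<open>b\<close> is nonzero is a real eigenvector.\<close>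

lemma symmetric_real_eigenvector:
  fixes A :: "real mat"
  assumes A: "A \<in> carrier_mat n n" "transpose_mat A = A" and n: "0 < n"
  shows "\<exists>v \<in> carrier_vec n. \<exists>e. v \<bullet> v = 1 \<and> A *\<^sub>v v = e \<cdot>\<^sub>v v"
proof -
  define C where "C = map_mat complex_of_real A"
  have C: "C \<in> carrier_mat n n" using A by (simp add: C_def)
  have "degree (char_poly C) = n" using degree_monic_char_poly[OF C] by simp
  then have "\<not> constant (poly (char_poly C))" using n by (simp add: constant_degree)
  then obtain z where "poly (char_poly C) z = 0" using fundamental_theorem_of_algebra by blast
  then obtain w where w: "w \<in> carrier_vec n" "w \<noteq> 0\<^sub>v n" "C *\<^sub>v w = z \<cdot>\<^sub>v w"
    using eigenvalue_root_char_poly[OF C] C by (auto simp: eigenvalue_def eigenvector_def)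
  define a b where "a = map_vec Re w" and "b = map_vec Im w"
  have ab: "a \<in> carrier_vec n" "b \<in> carrier_vec n" using w by (auto simp: a_def b_def)
  have ent: "(\<Sum>j = 0..<n. complex_of_real (A $$ (i, j)) * w $ j) = z * w $ i" if "i < n" for i
  proof -
    have "(C *\<^sub>v w) $ i = z * w $ i" using w that by simp
    then show ?thesis using that A w by (simp add: C_def scalar_prod_def)
  qed
  have Aa: "A *\<^sub>v a = Re z \<cdot>\<^sub>v a - Im z \<cdot>\<^sub>v b"
  proof (rule eq_vecI)
    fix i assume "i < dim_vec (Re z \<cdot>\<^sub>v a - Im z \<cdot>\<^sub>v b)"
    then have i: "i < n" using ab by simp
    show "(A *\<^sub>v a) $ i = (Re z \<cdot>\<^sub>v a - Im z \<cdot>\<^sub>v b) $ i"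
      using arg_cong[OF ent[OF i], of Re] i A w by (simp add: a_def b_def scalar_prod_def)
  qed (use A ab in simp)
  have Ab: "A *\<^sub>v b = Re z \<cdot>\<^sub>v b + Im z \<cdot>\<^sub>v a"
  proof (rule eq_vecI)
    fix i assume "i < dim_vec (Re z \<cdot>\<^sub>v b + Im z \<cdot>\<^sub>v a)"
    then have i: "i < n" using ab by simp
    show "(A *\<^sub>v b) $ i = (Re z \<cdot>\<^sub>v b + Im z \<cdot>\<^sub>v a) $ i"
      using arg_cong[OF ent[OF i], of Im] i A w by (simp add: a_def b_def scalar_prod_def)
  qed (use A ab in simp)
  have nz: "a \<noteq> 0\<^sub>v n \<or> b \<noteq> 0\<^sub>v n"
  proof (rule ccontr)
    assume "\<not> ?thesis"
    then have "a $ i = 0" "b $ i = 0" if "i < n" for i using that by auto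
    then have "Re (w $ i) = 0 \<and> Im (w $ i) = 0" if "i < n" for i
      using that w by (simp add: a_def b_def)
    then have "w = 0\<^sub>v n" using w by (intro eq_vecI) (auto simp: complex_eq_iff)
    then show False using w by simp
  qed
  have "a \<bullet> (A *\<^sub>v b) = (A *\<^sub>v a) \<bullet> b" by (rule symmetric_scalar_prod[OF A ab])
  then have "Im z * (a \<bullet> a + b \<bullet> b) = 0"
    using ab by (simp add: Aa Ab scalar_prod_add minus_scalar_prod algebra_simps)
  moreover have "a \<bullet> a + b \<bullet> b > 0"
    using nz scalar_prod_self_pos[OF ab(1)] scalar_prod_self_pos[OF ab(2)]
      scalar_prod_self_nonneg[of a] scalar_prod_self_nonneg[of b] by linarith
  ultimately have Im: "Im z = 0" by simp
  have "\<exists>u \<in> carrier_vec n. u \<noteq> 0\<^sub>v n \<and> A *\<^sub>v u = Re z \<cdot>\<^sub>v u"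
    using nz
  proof
    assume "a \<noteq> 0\<^sub>v n"
    then show ?thesis using Aa Im ab by (intro bexI[of _ a]) (auto intro!: eq_vecI)
  next
    assume "b \<noteq> 0\<^sub>v n"
    then show ?thesis using Ab Im ab by (intro bexI[of _ b]) (auto intro!: eq_vecI)
  qed
  then obtain u where u: "u \<in> carrier_vec n" "u \<noteq> 0\<^sub>v n" "A *\<^sub>v u = Re z \<cdot>\<^sub>v u" by blast
  have pos: "0 < u \<bullet> u" using u scalar_prod_self_pos by blast
  define v where "v = (1 / sqrt (u \<bullet> u)) \<cdot>\<^sub>v u"
  have "v \<bullet> v = 1" using u pos by (simp add: v_def)
  moreover have "A *\<^sub>v v = Re z \<cdot>\<^sub>v v"
    using u A by (simp add: v_def mat_vec_smult smult_smult_assoc mult.commute)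
  ultimately show ?thesis using u by (intro bexI[of _ v] exI[of _ "Re z"]) (auto simp: v_def)
qed

text \<open>Deflation: conjugating by a reflection that sends the first unit vector to a unit
  eigenvector clears the first column, symmetry clears the first row, and the remaining block is a
  symmetric matrix of smaller size.\<close>

theorem symmetric_diagonalization:
  fixes A :: "real mat"
  assumes "A \<in> carrier_mat n n" "transpose_mat A = A"
  shows "\<exists>Q d. Q \<in> carrier_mat n n \<and> transpose_mat Q * Q = 1\<^sub>m n \<and> A = Q * mat_diag n d * transpose_mat Q"
  using assms
proof (induction n arbitrary: A)
  case 0
  then show ?case by (intro exI[of _ "1\<^sub>m 0"] exI[of _ "\<lambda>_. 0"]) (auto intro!: eq_matI)
next
  case (Suc k)
  let ?n = "Suc k"
  note A = Suc.prems
  obtain v e where v: "v \<in> carrier_vec ?n" "v \<bullet> v = 1" "A *\<^sub>v v = e \<cdot>\<^sub>v v"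
    using symmetric_real_eigenvector[OF A] by auto
  obtain H where H: "H \<in> carrier_mat ?n ?n" "transpose_mat H = H" "H * H = 1\<^sub>m ?n" "H *\<^sub>v unit_vec ?n 0 = v"
    using householder_exists[OF v(1,2)] by auto
  define B where "B = H * (A * H)"
  have B: "B \<in> carrier_mat ?n ?n" using H A by (simp add: B_def)
  have Bsym: "transpose_mat B = B"
    using H A by (simp add: B_def mat_transpose_mult mat_assoc)
  have Hv: "H *\<^sub>v v = unit_vec ?n 0"
  proof -
    have "H *\<^sub>v v = (H * H) *\<^sub>v unit_vec ?n 0"
      unfolding H(4)[symmetric] by (rule mat_vec_assoc[symmetric]) (use H in auto)
    then show ?thesis using H by (simp add: one_mat_vec)
  qed
  have "B *\<^sub>v unit_vec ?n 0 = e \<cdot>\<^sub>v unit_vec ?n 0"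
    using H A v Hv by (simp add: B_def mat_vec_assoc mat_vec_smult)
  then have "(B *\<^sub>v unit_vec ?n 0) $ i = e * unit_vec ?n 0 $ i" if "i < ?n" for i using that by simp
  then have col0: "B $$ (i, 0) = (if i = 0 then e else 0)" if "i < ?n" for i
    using that B by (cases "i = 0") auto
  have row0: "B $$ (0, i) = (if i = 0 then e else 0)" if "i < ?n" for i
    using col0[OF that] that B arg_cong[OF Bsym, of "\<lambda>M. M $$ (0, i)"] by simp
  define B' where "B' = mat k k (\<lambda>(i, j). B $$ (Suc i, Suc j))"
  have B': "B' \<in> carrier_mat k k" by (simp add: B'_def)
  have "transpose_mat B' = B'"
  proof (rule eq_matI)
    fix i j assume "i < dim_row B'" "j < dim_col B'"
    then show "transpose_mat B' $$ (i, j) = B' $$ (i, j)"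
      using B arg_cong[OF Bsym, of "\<lambda>M. M $$ (Suc i, Suc j)"] by (simp add: B'_def)
  qed (simp_all add: B'_def)
  then obtain Q' d' where Q': "Q' \<in> carrier_mat k k" "transpose_mat Q' * Q' = 1\<^sub>m k"
    "B' = Q' * mat_diag k d' * transpose_mat Q'"
    using Suc.IH[OF B'] by auto
  define P where "P = four_block_mat (1\<^sub>m 1) (0\<^sub>m 1 k) (0\<^sub>m k 1) Q'"
  have P: "P \<in> carrier_mat ?n ?n"
    using Q' four_block_carrier_mat[of "1\<^sub>m 1" 1 1 Q' k k] by (simp add: P_def)
  have PT: "transpose_mat P = four_block_mat (1\<^sub>m 1) (0\<^sub>m 1 k) (0\<^sub>m k 1) (transpose_mat Q')"
    unfolding P_def by (subst transpose_four_block_mat[of _ 1 1 _ k _ k]) (use Q' in auto)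
  define d where "d = case_nat e d'"
  have D: "mat_diag ?n d = four_block_mat (mat_diag 1 (\<lambda>_. e)) (0\<^sub>m 1 k) (0\<^sub>m k 1) (mat_diag k d')"
    by (intro eq_matI) (auto simp: mat_diag_def d_def split: nat.splits)
  have Bblock: "B = four_block_mat (mat_diag 1 (\<lambda>_. e)) (0\<^sub>m 1 k) (0\<^sub>m k 1) B'"
  proof (rule eq_matI)
    fix i j
    assume "i < dim_row (four_block_mat (mat_diag 1 (\<lambda>_. e)) (0\<^sub>m 1 k) (0\<^sub>m k 1) B')"
      "j < dim_col (four_block_mat (mat_diag 1 (\<lambda>_. e)) (0\<^sub>m 1 k) (0\<^sub>m k 1) B')"
    then show "B $$ (i, j) = four_block_mat (mat_diag 1 (\<lambda>_. e)) (0\<^sub>m 1 k) (0\<^sub>m k 1) B' $$ (i, j)"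
      using col0[of i] row0[of j] B'
      by (auto simp: mat_diag_def less_Suc_eq_0_disj, auto simp: B'_def)
  qed (use B B' in \<open>auto simp: mat_diag_def\<close>)
  have PP: "transpose_mat P * P = 1\<^sub>m ?n"
    unfolding PT unfolding P_def
    by (subst mult_four_block_mat[of _ 1 1 _ k _ k _ _ 1 _ k]) (use Q' in \<open>auto simp: four_block_one_mat[of 1 k, simplified]\<close>)
  have "P * mat_diag ?n d = four_block_mat (mat_diag 1 (\<lambda>_. e)) (0\<^sub>m 1 k) (0\<^sub>m k 1) (Q' * mat_diag k d')"
    unfolding P_def D
    by (subst mult_four_block_mat[of _ 1 1 _ k _ k _ _ 1 _ k]) (use Q' in \<open>auto simp: mat_diag_def\<close>)
  then have BP: "B = P * mat_diag ?n d * transpose_mat P"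
    unfolding PT Bblock
    by (simp, subst mult_four_block_mat[of _ 1 1 _ k _ k _ _ 1 _ k]) (use Q' in \<open>auto simp: mat_diag_def\<close>)
  have "A = H * (H * (A * (H * H)))"
  using H A by (simp add: mat_cancel_left[OF H(3)])
  also have "\<dots> = H * B * H" using H A by (simp add: B_def mat_assoc)
  also have "\<dots> = (H * P) * mat_diag ?n d * transpose_mat (H * P)"
    using H P by (simp add: BP mat_transpose_mult mat_assoc mat_diag_def)
  finally have "A = (H * P) * mat_diag ?n d * transpose_mat (H * P)" .
  moreover have "transpose_mat (H * P) * (H * P) = 1\<^sub>m ?n"
    using H P PP by (simp add: mat_transpose_mult mat_assoc mat_cancel_left[OF H(3)])
  ultimately show ?case using H P by (intro exI[of _ "H * P"] exI[of _ d]) simp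
qed

section \<open>Positive definite matrices and the nuclear norm\<close>

definition mat_trace :: "real mat \<Rightarrow> real" where
  "mat_trace A = (\<Sum>i<dim_row A. A $$ (i, i))"

lemma mat_trace_mult_transpose:
  assumes "dim_row A = dim_row B" "dim_col A = dim_col B"
  shows "mat_trace (transpose_mat A * B) = (\<Sum>j<dim_col A. col A j \<bullet> col B j)"
  using assms by (simp add: mat_trace_def)

lemma mat_trace_mult_commute:
  assumes "dim_col A = dim_row B" "dim_col B = dim_row A"
  shows "mat_trace (A * B) = mat_trace (B * A)"
proof -
  have "mat_trace (A * B) = (\<Sum>i<dim_row A. \<Sum>j<dim_row B. A $$ (i, j) * B $$ (j, i))"
    using assms by (simp add: mat_trace_def scalar_prod_def atLeast0LessThan)
  also have "\<dots> = (\<Sum>j<dim_row B. \<Sum>i<dim_row A. B $$ (j, i) * A $$ (i, j))"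
    by (subst sum.swap) (simp add: mult.commute)
  also have "\<dots> = mat_trace (B * A)"
    using assms by (simp add: mat_trace_def scalar_prod_def atLeast0LessThan)
  finally show ?thesis .
qed

lemma mat_trace_minus: "dim_row B = dim_row A \<Longrightarrow> dim_col A = dim_row A \<Longrightarrow> dim_col B = dim_row A \<Longrightarrow>
    mat_trace (A - B) = mat_trace A - mat_trace B"
  by (simp add: mat_trace_def sum_subtractf)

lemma mat_trace_diag: "mat_trace (mat_diag n d) = (\<Sum>i<n. d i)"
  by (simp add: mat_trace_def mat_diag_def)

lemma mat_vec_unit: "dim_col A = n \<Longrightarrow> i < n \<Longrightarrow> (A :: real mat) *\<^sub>v unit_vec n i = col A i"
  by (intro eq_vecI) auto

lemma mat_diag_vec: "dim_vec x = n \<Longrightarrow> i < n \<Longrightarrow> (mat_diag n d *\<^sub>v (x :: real vec)) $ i = d i * x $ i"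
  by (simp add: mat_diag_def scalar_prod_def if_distrib[of "\<lambda>c. c * _"] cong: if_cong)

lemma mat_diag_quadratic: "dim_vec x = n \<Longrightarrow> x \<bullet> (mat_diag n d *\<^sub>v (x :: real vec)) = (\<Sum>i<n. d i * (x $ i)\<^sup>2)"
  unfolding scalar_prod_def[of x]
  by (simp add: mat_diag_vec power2_eq_square algebra_simps atLeast0LessThan carrier_matD[OF mat_diag_dim]
      del: index_mult_mat_vec)

lemma mat_diag_dims [simp]: "dim_row (mat_diag n d) = n" "dim_col (mat_diag n d) = n"
  by (simp_all add: mat_diag_def)

lemma mat_diag_transpose [simp]: "transpose_mat (mat_diag n d) = mat_diag n d"
  by (intro eq_matI) (auto simp: mat_diag_def)

section \<open>Positive definite matrices, their square roots and inverses\<close>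

definition pos_def :: "nat \<Rightarrow> real mat \<Rightarrow> bool" where
  "pos_def n A \<longleftrightarrow> A \<in> carrier_mat n n \<and> transpose_mat A = A \<and>
     (\<forall>x \<in> carrier_vec n. x \<noteq> 0\<^sub>v n \<longrightarrow> 0 < x \<bullet> (A *\<^sub>v x))"

lemma pos_def_dims: "pos_def n A \<Longrightarrow> dim_row A = n" "pos_def n A \<Longrightarrow> dim_col A = n"
  "pos_def n A \<Longrightarrow> A \<in> carrier_mat n n" "pos_def n A \<Longrightarrow> transpose_mat A = A"
  by (auto simp: pos_def_def)

lemma pos_def_nonneg: "pos_def n A \<Longrightarrow> x \<in> carrier_vec n \<Longrightarrow> 0 \<le> x \<bullet> (A *\<^sub>v x)"
  by (cases "x = 0\<^sub>v n") (auto simp: pos_def_def mat_vec_zero less_imp_le)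

lemma pos_def_conj_diag:
  assumes Q: "Q \<in> carrier_mat n n" "transpose_mat Q * Q = 1\<^sub>m n" and d: "\<And>i. i < n \<Longrightarrow> 0 < d i"
  shows "pos_def n (Q * mat_diag n d * transpose_mat Q)"
  unfolding pos_def_def
proof (intro conjI ballI impI)
  show "Q * mat_diag n d * transpose_mat Q \<in> carrier_mat n n" using Q by auto
  show "transpose_mat (Q * mat_diag n d * transpose_mat Q) = Q * mat_diag n d * transpose_mat Q"
    using Q by (simp add: mat_transpose_mult mat_assoc)
  fix x :: "real vec" assume x: "x \<in> carrier_vec n" "x \<noteq> 0\<^sub>v n"
  define y where "y = transpose_mat Q *\<^sub>v x"
  have y: "y \<in> carrier_vec n" using Q x by (simp add: y_def)
  have QQ: "Q * transpose_mat Q = 1\<^sub>m n"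
    using Q by (intro mat_mult_left_right_inverse[of "transpose_mat Q" n]) auto
  have "Q *\<^sub>v y = (Q * transpose_mat Q) *\<^sub>v x"
    unfolding y_def by (rule mat_vec_assoc[symmetric]) (use Q x in auto)
  then have Qy: "Q *\<^sub>v y = x" unfolding QQ using x by (simp add: one_mat_vec)
  then have "y \<noteq> 0\<^sub>v n" using x(2) Q by (auto simp: mat_vec_zero)
  then obtain i where i: "i < n" "y $ i \<noteq> 0" using y by (metis carrier_vecD eq_vecI index_zero_vec)
  have "x \<bullet> (Q * mat_diag n d * transpose_mat Q *\<^sub>v x) = y \<bullet> (mat_diag n d *\<^sub>v y)"
    using Q x y by (simp add: mat_vec_assoc scalar_prod_adjoint[of x Q] y_def[symmetric])
  also have "\<dots> = (\<Sum>i<n. d i * (y $ i)\<^sup>2)" using y by (simp add: mat_diag_quadratic)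
  also have "\<dots> > 0"
    using i d by (intro sum_pos2[of _ i]) (auto intro: mult_pos_pos simp: less_imp_le)
  finally show "0 < x \<bullet> (Q * mat_diag n d * transpose_mat Q *\<^sub>v x)" .
qed

lemma conj_diag_mult:
  fixes Q :: "real mat"
  assumes Q: "Q \<in> carrier_mat n n" "transpose_mat Q * Q = 1\<^sub>m n"
  shows "(Q * mat_diag n f * transpose_mat Q) * (Q * mat_diag n g * transpose_mat Q)
    = Q * mat_diag n (\<lambda>i. f i * g i) * transpose_mat Q"
proof -
  have "(Q * mat_diag n f * transpose_mat Q) * (Q * mat_diag n g * transpose_mat Q)
      = Q * (mat_diag n f * (mat_diag n g * transpose_mat Q))"
    using Q by (simp add: mat_assoc mat_cancel_left[OF Q(2)])
  also have "mat_diag n f * (mat_diag n g * transpose_mat Q) = (mat_diag n f * mat_diag n g) * transpose_mat Q"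
    by (rule mat_assoc[symmetric]) (use Q in auto)
  finally show ?thesis using Q by (simp add: mat_assoc)
qed

lemma conj_diag_cong:
  fixes Q :: "real mat"
  assumes "\<And>i. i < n \<Longrightarrow> f i = g i"
  shows "Q * mat_diag n f * transpose_mat Q = Q * mat_diag n g * transpose_mat Q"
proof -
  have "mat_diag n f = mat_diag n g" using assms by (intro eq_matI) (auto simp: mat_diag_def)
  then show ?thesis by simp
qed

lemma conj_diag_one:
  assumes "Q \<in> carrier_mat n n" "transpose_mat Q * Q = (1\<^sub>m n :: real mat)"
  shows "Q * mat_diag n (\<lambda>_. 1) * transpose_mat Q = 1\<^sub>m n"
  using assms mat_mult_left_right_inverse[of "transpose_mat Q" n Q] by simp

text \<open>The eigenvalue \<open>d i\<close> appears as a quadratic form at a unit vector, so that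
  sign and size information about the matrix passes directly to its eigenvalues.\<close>

lemma conj_diag_col:
  fixes Q :: "real mat"
  assumes Q: "Q \<in> carrier_mat n n" "transpose_mat Q * Q = 1\<^sub>m n" and i: "i < n"
  shows "col Q i \<bullet> ((Q * mat_diag n d * transpose_mat Q) *\<^sub>v col Q i) = d i" "col Q i \<bullet> col Q i = 1"
proof -
  have e: "transpose_mat Q *\<^sub>v col Q i = unit_vec n i"
  proof -
    have "transpose_mat Q *\<^sub>v (Q *\<^sub>v unit_vec n i) = (transpose_mat Q * Q) *\<^sub>v unit_vec n i"
      by (rule mat_vec_assoc[symmetric]) (use Q in auto)
    then show ?thesis unfolding Q(2) using Q i by (simp add: mat_vec_unit one_mat_vec)
  qed
  have "col Q i \<bullet> ((Q * mat_diag n d * transpose_mat Q) *\<^sub>v col Q i)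
      = unit_vec n i \<bullet> (mat_diag n d *\<^sub>v unit_vec n i)"
    using Q i by (simp add: mat_vec_assoc scalar_prod_adjoint[of "col Q i" Q] e)
  also have "\<dots> = d i" using i by (simp add: mat_vec_unit[of _ n] scalar_prod_left_unit[OF _ i]) (simp add: mat_diag_def)
  finally show "col Q i \<bullet> ((Q * mat_diag n d * transpose_mat Q) *\<^sub>v col Q i) = d i" .
  have "(transpose_mat Q * Q) $$ (i, i) = col Q i \<bullet> col Q i" using Q(1) i by simp
  then show "col Q i \<bullet> col Q i = 1" using i by (simp add: Q(2))
qed

lemma pos_def_diagonalization:
  assumes A: "pos_def n A"
  obtains Q d where "Q \<in> carrier_mat n n" "transpose_mat Q * Q = 1\<^sub>m n"
    "A = Q * mat_diag n d * transpose_mat Q" "\<And>i. i < n \<Longrightarrow> 0 < d i"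
proof -
  obtain Q d where Q: "Q \<in> carrier_mat n n" "transpose_mat Q * Q = 1\<^sub>m n"
    "A = Q * mat_diag n d * transpose_mat Q"
    using symmetric_diagonalization A unfolding pos_def_def by blast
  have "0 < d i" if i: "i < n" for i
  proof -
    have "col Q i \<noteq> 0\<^sub>v n" using conj_diag_col(2)[OF Q(1,2) i] by auto
    then have "0 < col Q i \<bullet> (A *\<^sub>v col Q i)" using A Q(1) i unfolding pos_def_def by simp
    then show ?thesis unfolding Q(3) using conj_diag_col(1)[OF Q(1,2) i] by simp
  qed
  then show thesis using that Q by blast
qed

text \<open>The inverse root \<open>W\<close> is returned along with \<open>G\<close> because
  \<open>W * F\<close> is the polar factor of any \<open>F\<close> with
  \<open>F * transpose_mat F = A\<close>.\<close>

lemma pos_def_sqrt: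
  assumes A: "pos_def n A"
  obtains G W where "pos_def n G" "pos_def n W" "G * G = A" "W * G = 1\<^sub>m n" "G * W = 1\<^sub>m n"
proof -
  obtain Q d where Q: "Q \<in> carrier_mat n n" "transpose_mat Q * Q = 1\<^sub>m n"
    "A = Q * mat_diag n d * transpose_mat Q" and d: "\<And>i. i < n \<Longrightarrow> 0 < d i"
    using pos_def_diagonalization[OF A] by metis
  define G where "G = Q * mat_diag n (\<lambda>i. sqrt (d i)) * transpose_mat Q"
  define W where "W = Q * mat_diag n (\<lambda>i. 1 / sqrt (d i)) * transpose_mat Q"
  have nz: "sqrt (d i) * sqrt (d i) = d i" "sqrt (d i) \<noteq> 0" if "i < n" for i
    using d[OF that] by simp_all
  have "pos_def n G" "pos_def n W"
    unfolding G_def W_def using d by (auto intro!: pos_def_conj_diag[OF Q(1,2)])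
  moreover have "G * G = A"
    unfolding G_def Q(3) conj_diag_mult[OF Q(1,2)] using nz by (intro conj_diag_cong)
  moreover have "W * G = 1\<^sub>m n"
    unfolding G_def W_def conj_diag_mult[OF Q(1,2)] conj_diag_one[OF Q(1,2), symmetric]
    using nz by (intro conj_diag_cong) simp
  moreover have "G * W = 1\<^sub>m n"
    unfolding G_def W_def conj_diag_mult[OF Q(1,2)] conj_diag_one[OF Q(1,2), symmetric]
    using nz by (intro conj_diag_cong) simp
  ultimately show thesis using that by blast
qed

lemma pos_def_inverse:
  assumes A: "pos_def n A"
  obtains H where "pos_def n H" "H * A = 1\<^sub>m n" "A * H = 1\<^sub>m n"
proof -
  obtain Q d where Q: "Q \<in> carrier_mat n n" "transpose_mat Q * Q = 1\<^sub>m n"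
    "A = Q * mat_diag n d * transpose_mat Q" and d: "\<And>i. i < n \<Longrightarrow> 0 < d i"
    using pos_def_diagonalization[OF A] by metis
  define H where "H = Q * mat_diag n (\<lambda>i. 1 / d i) * transpose_mat Q"
  have nz: "d i \<noteq> 0" if "i < n" for i using d[OF that] by simp
  have "pos_def n H" unfolding H_def using d by (auto intro!: pos_def_conj_diag[OF Q(1,2)])
  moreover have "H * A = 1\<^sub>m n"
    unfolding H_def Q(3) conj_diag_mult[OF Q(1,2)] conj_diag_one[OF Q(1,2), symmetric]
    using nz by (intro conj_diag_cong) simp
  moreover have "A * H = 1\<^sub>m n"
    unfolding H_def Q(3) conj_diag_mult[OF Q(1,2)] conj_diag_one[OF Q(1,2), symmetric]
    using nz by (intro conj_diag_cong) simp
  ultimately show thesis using that by blast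
qed

section \<open>The nuclear norm as a sum over an eigenbasis\<close>

lemma order_prod_linear_factors:
  "Polynomial.order e (\<Prod>a\<leftarrow>xs. [:- a, 1:]) = count_list xs (e :: real)"
proof (induction xs)
  case (Cons a xs)
  have "[:- a, 1:] * (\<Prod>a\<leftarrow>xs. [:- a, 1:]) \<noteq> 0" by (auto simp: prod_list_zero_iff simp del: mult_pCons_left)
  from order_mult[OF this] show ?case
    using Cons by (auto simp: order_linear' simp del: mult_pCons_left)
qed simp

text \<open>Bridges the sum over distinct eigenvalues weighted by multiplicity, as in
  \<open>nuclear_norm\<close>, and a sum over the list of diagonal entries.\<close>

lemma sum_count_list_mult:
  fixes f :: "'b \<Rightarrow> real"
  assumes "finite S" "set xs \<subseteq> S"
  shows "(\<Sum>x\<in>S. real (count_list xs x) * f x) = sum_list (map f xs)"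
  using assms(2)
proof (induction xs)
  case (Cons a xs)
  have "(\<Sum>x\<in>S. real (count_list (a # xs) x) * f x)
      = (\<Sum>x\<in>S. (if x = a then f x else 0) + real (count_list xs x) * f x)"
    by (rule sum.cong) (auto simp: algebra_simps)
  then show ?case using Cons assms(1) by (simp add: sum.distrib)
qed simp

text \<open>Orthogonal similarity preserves the characteristic polynomial, and for a diagonal matrix
  this polynomial splits into one linear factor per diagonal entry, so the root multiplicities count
  repetitions in the list of entries.\<close>

lemma nuclear_norm_eq_sum:
  assumes L: "L \<in> carrier_mat m n" and Q: "Q \<in> carrier_mat n n" "transpose_mat Q * Q = 1\<^sub>m n"
    and LL: "transpose_mat L * L = Q * mat_diag n d * transpose_mat Q"
  shows "nuclear_norm L = (\<Sum>i<n. sqrt (d i))"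
proof -
  define G where "G = transpose_mat L * L"
  have G: "G \<in> carrier_mat n n" using L by (simp add: G_def)
  have QQ: "Q * transpose_mat Q = 1\<^sub>m n"
    using Q by (intro mat_mult_left_right_inverse[of "transpose_mat Q" n]) auto
  have "similar_mat G (mat_diag n d)"
    by (rule similar_matI[of _ _ Q "transpose_mat Q" n]) (use G Q QQ LL in \<open>auto simp: G_def\<close>)
  then have "char_poly G = char_poly (mat_diag n d)" by (rule char_poly_similar)
  also have "\<dots> = (\<Prod>a\<leftarrow>diag_mat (mat_diag n d). [:- a, 1:])"
    by (rule char_poly_upper_triangular[of _ n]) (auto simp: mat_diag_def)
  also have "diag_mat (mat_diag n d) = map d [0..<n]"
    by (auto simp: diag_mat_def mat_diag_def)
  finally have cp: "char_poly G = (\<Prod>a\<leftarrow>map d [0..<n]. [:- a, 1:])" .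
  have ev: "{e. eigenvalue G e} = set (map d [0..<n])"
  proof -
    have "eigenvalue G e \<longleftrightarrow> e \<in> set (map d [0..<n])" for e
      unfolding eigenvalue_root_char_poly[OF G] cp poly_prod_list prod_list_zero_iff
      by (auto simp: image_iff)
    then show ?thesis by blast
  qed
  have "nuclear_norm L = (\<Sum>e \<in> set (map d [0..<n]). real (count_list (map d [0..<n]) e) * sqrt e)"
    unfolding nuclear_norm_def Let_def G_def[symmetric] ev cp order_prod_linear_factors ..
  also have "\<dots> = sum_list (map sqrt (map d [0..<n]))"
    by (rule sum_count_list_mult) auto
  also have "\<dots> = (\<Sum>i<n. sqrt (d i))"
    by (simp add: sum_list_distinct_conv_sum_set atLeast0LessThan comp_def)
  finally show ?thesis .
qed

section \<open>Duality between the nuclear norm and contractions\<close>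

definition contraction :: "real mat \<Rightarrow> bool" where
  "contraction Q \<longleftrightarrow> (\<forall>y \<in> carrier_vec (dim_col Q). (Q *\<^sub>v y) \<bullet> (Q *\<^sub>v y) \<le> y \<bullet> y)"

lemma contractionD: "contraction Q \<Longrightarrow> dim_vec y = dim_col Q \<Longrightarrow> (Q *\<^sub>v y) \<bullet> (Q *\<^sub>v y) \<le> y \<bullet> y"
  unfolding contraction_def by (blast intro: carrier_vecI)

text \<open>With \<open>z = transpose_mat Q *\<^sub>v y\<close>, Cauchy-Schwarz on
  \<open>z \<bullet> z = y \<bullet> (Q *\<^sub>v z)\<close> bounds the square of
  \<open>z \<bullet> z\<close> by \<open>(y \<bullet> y) * (z \<bullet> z)\<close>, and one factor
  cancels.\<close>

lemma contraction_transpose: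
  assumes "contraction Q" shows "contraction (transpose_mat Q)"
  unfolding contraction_def
proof
  fix y :: "real vec" assume "y \<in> carrier_vec (dim_col (transpose_mat Q))"
  then have y: "dim_vec y = dim_row Q" by simp
  define z where "z = transpose_mat Q *\<^sub>v y"
  have z: "dim_vec z = dim_col Q" by (simp add: z_def)
  have "z \<bullet> z = y \<bullet> (Q *\<^sub>v z)" using y z by (simp add: scalar_prod_adjoint z_def[symmetric])
  then have "(z \<bullet> z)\<^sup>2 \<le> (y \<bullet> y) * ((Q *\<^sub>v z) \<bullet> (Q *\<^sub>v z))"
    using scalar_prod_Cauchy_Schwarz[of y "Q *\<^sub>v z"] y by simp
  also have "\<dots> \<le> (y \<bullet> y) * (z \<bullet> z)" using contractionD[OF assms z] by (intro mult_left_mono) auto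
  finally have "(z \<bullet> z) * (z \<bullet> z) \<le> (y \<bullet> y) * (z \<bullet> z)" by (simp add: power2_eq_square)
  then have "z \<bullet> z \<le> y \<bullet> y"
    using scalar_prod_self_nonneg[of z] scalar_prod_self_nonneg[of y]
    by (cases "z \<bullet> z = 0") (auto simp: mult_le_cancel_right)
  then show "(transpose_mat Q *\<^sub>v y) \<bullet> (transpose_mat Q *\<^sub>v y) \<le> y \<bullet> y" by (simp add: z_def)
qed

lemma isometry_norm:
  assumes "transpose_mat U * U = 1\<^sub>m r" "dim_col U = r" "dim_vec y = r" "dim_vec x = r"
  shows "(U *\<^sub>v x) \<bullet> (U *\<^sub>v y) = x \<bullet> (y :: real vec)"
proof -
  have "(U *\<^sub>v x) \<bullet> (U *\<^sub>v y) = (transpose_mat U *\<^sub>v (U *\<^sub>v x)) \<bullet> y"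
    using assms by (intro scalar_prod_adjoint) auto
  also have "transpose_mat U *\<^sub>v (U *\<^sub>v x) = (transpose_mat U * U) *\<^sub>v x"
    using assms by (intro mat_vec_assoc[symmetric]) auto
  finally show ?thesis using assms by (simp add: one_mat_vec)
qed

lemma isometry_contraction:
  assumes "transpose_mat U * U = (1\<^sub>m (dim_col U) :: real mat)"
  shows "contraction U" "contraction (transpose_mat U)"
proof -
  show "contraction U" using isometry_norm[OF assms] by (auto simp: contraction_def)
  then show "contraction (transpose_mat U)" by (rule contraction_transpose)
qed

lemma contraction_mult:
  assumes "contraction A" "contraction B" "dim_col A = dim_row B"
  shows "contraction (A * B)"
  unfolding contraction_def
proof
  fix y :: "real vec" assume y: "y \<in> carrier_vec (dim_col (A * B))"
  have "(A *\<^sub>v (B *\<^sub>v y)) \<bullet> (A *\<^sub>v (B *\<^sub>v y)) \<le> (B *\<^sub>v y) \<bullet> (B *\<^sub>v y)"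
    by (rule contractionD[OF assms(1)]) (use assms in simp)
  also have "\<dots> \<le> y \<bullet> y" by (rule contractionD[OF assms(2)]) (use y in simp)
  finally show "(A * B *\<^sub>v y) \<bullet> (A * B *\<^sub>v y) \<le> y \<bullet> y" using y assms by (simp add: mat_vec_assoc)
qed

text \<open>In the eigenbasis of \<open>transpose_mat L * L\<close> the columns of
  \<open>L * Q\<close> have norms \<open>sqrt (d j)\<close> and those of \<open>P * Q\<close> have
  norm at most 1, so Cauchy-Schwarz column by column suffices. Equality is supplied separately, by
  the polar factor in \<open>nuclear_norm_isometry_mult\<close>.\<close>

lemma nuclear_norm_dual:
  assumes L: "L \<in> carrier_mat m n" and P: "P \<in> carrier_mat m n" "contraction P"
  shows "mat_trace (transpose_mat P * L) \<le> nuclear_norm L"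
proof -
  have sym: "transpose_mat L * L \<in> carrier_mat n n" "transpose_mat (transpose_mat L * L) = transpose_mat L * L"
    using L by (auto simp: mat_transpose_mult)
  obtain Q d where Q: "Q \<in> carrier_mat n n" "transpose_mat Q * Q = 1\<^sub>m n"
    and LL: "transpose_mat L * L = Q * mat_diag n d * transpose_mat Q"
    using symmetric_diagonalization[OF sym] by blast
  have QQ: "Q * transpose_mat Q = 1\<^sub>m n"
    using Q by (intro mat_mult_left_right_inverse[of "transpose_mat Q" n]) auto
  \<comment> \<open>Inserting \<open>Q * transpose_mat Q\<close> and cycling the trace rotates both
    matrices into the eigenbasis.\<close>
  have "mat_trace (transpose_mat P * L) = mat_trace ((transpose_mat P * L) * (Q * transpose_mat Q))"
    using L P QQ by simp
  also have "\<dots> = mat_trace ((transpose_mat P * (L * Q)) * transpose_mat Q)"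
    using L P Q by (simp add: mat_assoc)
  also have "\<dots> = mat_trace (transpose_mat Q * (transpose_mat P * (L * Q)))"
    using L P Q by (intro mat_trace_mult_commute) auto
  also have "\<dots> = mat_trace (transpose_mat (P * Q) * (L * Q))"
    using L P Q by (simp add: mat_assoc mat_transpose_mult)
  also have "\<dots> = (\<Sum>j<n. col (P * Q) j \<bullet> col (L * Q) j)"
    using L P Q by (subst mat_trace_mult_transpose) auto
  also have "\<dots> \<le> (\<Sum>j<n. sqrt (d j))"
  proof (intro sum_mono)
    fix j assume "j \<in> {..<n}"
    then have j: "j < n" by simp
    have c: "col (P * Q) j = P *\<^sub>v col Q j" "col (L * Q) j = L *\<^sub>v col Q j"
      using L P Q j by (auto simp: col_mult2[of _ m n _ n])
    have 1: "(P *\<^sub>v col Q j) \<bullet> (P *\<^sub>v col Q j) \<le> 1"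
      using contractionD[OF P(2), of "col Q j"] conj_diag_col(2)[OF Q j] P Q by simp
    have "(L *\<^sub>v col Q j) \<bullet> (L *\<^sub>v col Q j) = col Q j \<bullet> ((transpose_mat L * L) *\<^sub>v col Q j)"
      using L Q j by (simp add: mat_vec_assoc scalar_prod_adjoint[of "col Q j" "transpose_mat L"])
    then have 2: "(L *\<^sub>v col Q j) \<bullet> (L *\<^sub>v col Q j) = d j"
      unfolding LL conj_diag_col(1)[OF Q j] .
    have "(P *\<^sub>v col Q j) \<bullet> (L *\<^sub>v col Q j) \<le> vec_l2_norm (P *\<^sub>v col Q j) * vec_l2_norm (L *\<^sub>v col Q j)"
      using L P by (intro scalar_prod_le_norms) simp
    also have "\<dots> \<le> 1 * sqrt (d j)"
      using 1 2 scalar_prod_self_nonneg[of "L *\<^sub>v col Q j"]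
      by (intro mult_mono) (auto simp: vec_l2_norm_def)
    finally show "col (P * Q) j \<bullet> col (L * Q) j \<le> sqrt (d j)" unfolding c by simp
  qed
  also have "\<dots> = nuclear_norm L" by (rule nuclear_norm_eq_sum[OF L Q LL, symmetric])
  finally show ?thesis .
qed

text \<open>Writing \<open>G = Y * Y\<close> and cycling one factor turns the trace into a sum of
  \<open>y \<bullet> (X *\<^sub>v y)\<close> over the columns \<open>y\<close> of \<open>Y\<close>,
  where \<open>X\<close> is applied to one vector at a time.\<close>

lemma mat_trace_contraction_le:
  assumes G: "pos_def r G" and X: "X \<in> carrier_mat r r" "contraction X"
  shows "mat_trace (G * X) \<le> mat_trace G"
proof -
  obtain Y Z where Y: "pos_def r Y" "Y * Y = G" using pos_def_sqrt[OF G] by metis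
  note Yd = pos_def_dims[OF Y(1)]
  have "mat_trace (G * X) = mat_trace (Y * (Y * X))"
    using Y Yd X by (simp add: Y(2)[symmetric] mat_assoc)
  also have "\<dots> = mat_trace ((Y * X) * Y)"
    using Yd X by (intro mat_trace_mult_commute) auto
  also have "\<dots> = mat_trace (transpose_mat Y * (X * Y))"
    using Yd X by (simp add: mat_assoc)
  also have "\<dots> = (\<Sum>j<r. col Y j \<bullet> col (X * Y) j)"
    using Yd X by (subst mat_trace_mult_transpose) auto
  also have "\<dots> \<le> (\<Sum>j<r. col Y j \<bullet> col Y j)"
  proof (intro sum_mono)
    fix j assume "j \<in> {..<r}"
    then have c: "col (X * Y) j = X *\<^sub>v col Y j" using X Yd by (intro col_mult2[of _ r r _ r]) auto
    have "(col Y j \<bullet> (X *\<^sub>v col Y j))\<^sup>2 \<le> (col Y j \<bullet> col Y j) * ((X *\<^sub>v col Y j) \<bullet> (X *\<^sub>v col Y j))"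
      using X Yd by (intro scalar_prod_Cauchy_Schwarz) simp
    also have "\<dots> \<le> (col Y j \<bullet> col Y j) * (col Y j \<bullet> col Y j)"
      using X Yd by (intro mult_left_mono contractionD) auto
    finally have "(col Y j \<bullet> (X *\<^sub>v col Y j))\<^sup>2 \<le> (col Y j \<bullet> col Y j)\<^sup>2"
      by (simp add: power2_eq_square)
    then show "col Y j \<bullet> col (X * Y) j \<le> col Y j \<bullet> col Y j"
      unfolding c by (rule power2_le_imp_le) simp
  qed
  also have "\<dots> = mat_trace (transpose_mat Y * Y)"
    using Yd by (subst mat_trace_mult_transpose) auto
  also have "\<dots> = mat_trace G" using Yd Y by simp
  finally show ?thesis .
qed

text \<open>The nuclear norm is defined through the \<open>n\<close> by \<open>n\<close> matrix
  \<open>transpose_mat F * F\<close>, whereas \<open>G\<close> is a root of the \<open>r\<close> by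
  \<open>r\<close> matrix \<open>F * transpose_mat F\<close>. One inequality is duality against the
  polar factor \<open>U * (W * F)\<close>. The other writes the sum of singular values as the trace
  of \<open>G\<close> times a contraction built from singular vectors.\<close>

lemma nuclear_norm_isometry_mult:
  assumes U: "U \<in> carrier_mat m r" "transpose_mat U * U = 1\<^sub>m r"
    and F: "F \<in> carrier_mat r n" and G: "pos_def r G" "G * G = F * transpose_mat F"
    and W: "pos_def r W" "W * G = 1\<^sub>m r" "G * W = 1\<^sub>m r"
  shows "nuclear_norm (U * F) = mat_trace G"
    and "contraction (W * F)"
    and "mat_trace (transpose_mat (U * (W * F)) * (U * F)) = mat_trace G"
proof -
  note d = pos_def_dims[OF G(1)] pos_def_dims[OF W(1)]
  \<comment> \<open>\<open>F = G * transpose_mat V\<close> is the polar decomposition, and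
    \<open>V\<close> has orthonormal columns.\<close>
  define V where "V = transpose_mat F * W"
  have V: "V \<in> carrier_mat n r" "transpose_mat V = W * F" using F d by (auto simp: V_def mat_transpose_mult)
  have "transpose_mat V * V = W * (F * transpose_mat F) * W"
    using F d by (simp add: V(2), simp add: V_def mat_assoc)
  also have "\<dots> = 1\<^sub>m r"
    using d W by (simp add: G(2)[symmetric] mat_assoc mat_cancel_left[OF W(2)])
  finally have VV: "transpose_mat V * V = 1\<^sub>m r" .
  show con: "contraction (W * F)" using isometry_contraction(2)[of V] VV V by simp
  define P where "P = U * (W * F)"
  have P: "P \<in> carrier_mat m n" using U F d by (simp add: P_def)
  have conP: "contraction P"
    unfolding P_def by (rule contraction_mult[OF isometry_contraction(1)[of U] con]) (use U d F in auto)
  have "transpose_mat P * (U * F) = transpose_mat F * (W * F)"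
    using U F d by (simp add: P_def mat_transpose_mult mat_assoc mat_cancel_left[OF U(2)])
  then have "mat_trace (transpose_mat P * (U * F)) = mat_trace (transpose_mat F * (W * F))" by simp
  also have "\<dots> = mat_trace ((W * F) * transpose_mat F)"
    using F d by (intro mat_trace_mult_commute) auto
  also have "(W * F) * transpose_mat F = G"
    using F d by (simp add: mat_assoc G(2)[symmetric] mat_cancel_left[OF W(2)])
  finally show tr: "mat_trace (transpose_mat (U * (W * F)) * (U * F)) = mat_trace G"
    unfolding P_def .
  have UF: "U * F \<in> carrier_mat m n" using U F by simp
  have ge: "mat_trace G \<le> nuclear_norm (U * F)"
    using nuclear_norm_dual[OF UF P conP] tr by (simp add: P_def)
  have FF: "transpose_mat (U * F) * (U * F) = transpose_mat F * F"
    using U F by (simp add: mat_transpose_mult mat_assoc mat_cancel_left[OF U(2)])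
  have sym: "transpose_mat F * F \<in> carrier_mat n n" "transpose_mat (transpose_mat F * F) = transpose_mat F * F"
    using F by (auto simp: mat_transpose_mult)
  obtain Q e where Q: "Q \<in> carrier_mat n n" "transpose_mat Q * Q = 1\<^sub>m n"
    and FQ: "transpose_mat F * F = Q * mat_diag n e * transpose_mat Q"
    using symmetric_diagonalization[OF sym] by blast
  have nn: "nuclear_norm (U * F) = (\<Sum>i<n. sqrt (e i))"
    by (rule nuclear_norm_eq_sum[OF UF Q]) (simp add: FF FQ)
  have e0: "0 \<le> e i" if i: "i < n" for i
  proof -
    have "e i = col Q i \<bullet> ((transpose_mat F * F) *\<^sub>v col Q i)"
      unfolding FQ using conj_diag_col(1)[OF Q i] by simp
    also have "\<dots> = (F *\<^sub>v col Q i) \<bullet> (F *\<^sub>v col Q i)"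
      using F Q i by (simp add: mat_vec_assoc scalar_prod_adjoint[of "col Q i" "transpose_mat F"])
    finally show ?thesis by simp
  qed
  \<comment> \<open>Reciprocal singular values, with default 0 on the kernel. The columns of
    \<open>Z\<close> are then left singular vectors or zero, which makes \<open>Z\<close> a
    contraction.\<close>
  define s where "s i = (if e i = 0 then 0 else 1 / sqrt (e i))" for i
  define Z where "Z = F * (Q * mat_diag n s)"
  have Z: "Z \<in> carrier_mat r n" using F Q by (simp add: Z_def)
  have QFQ: "transpose_mat Q * (transpose_mat F * (F * Q)) = mat_diag n e"
  proof -
    have "transpose_mat Q * (transpose_mat F * (F * Q)) = transpose_mat Q * ((transpose_mat F * F) * Q)"
      using F Q by (simp add: mat_assoc)
    also have "\<dots> = mat_diag n e"
      unfolding FQ using F Q by (simp add: mat_assoc mat_cancel_left[OF Q(2)])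
    finally show ?thesis .
  qed
  have ZF: "transpose_mat Z * (F * Q) = mat_diag n (\<lambda>i. s i * e i)"
    using F Q by (simp add: Z_def mat_transpose_mult mat_assoc QFQ)
  have "transpose_mat Z * Z = (transpose_mat Z * (F * Q)) * mat_diag n s"
    using F Q Z by (simp add: mat_assoc) (simp add: Z_def mat_assoc)
  then have ZZ: "transpose_mat Z * Z = mat_diag n (\<lambda>i. s i * e i * s i)" unfolding ZF by simp
  have "contraction Z"
    unfolding contraction_def
  proof
    fix y :: "real vec" assume "y \<in> carrier_vec (dim_col Z)"
    then have y: "dim_vec y = n" using Z by simp
    have "(Z *\<^sub>v y) \<bullet> (Z *\<^sub>v y) = y \<bullet> ((transpose_mat Z * Z) *\<^sub>v y)"
      using Z y by (simp add: mat_vec_assoc scalar_prod_adjoint[of y "transpose_mat Z"])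
    also have "\<dots> = (\<Sum>i<n. (s i * e i * s i) * (y $ i)\<^sup>2)" unfolding ZZ using y by (simp add: mat_diag_quadratic)
    also have "\<dots> \<le> (\<Sum>i<n. 1 * (y $ i)\<^sup>2)"
      using e0 by (intro sum_mono mult_right_mono) (auto simp: s_def)
    also have "\<dots> = y \<bullet> y" using y by (simp add: scalar_prod_def power2_eq_square atLeast0LessThan)
    finally show "(Z *\<^sub>v y) \<bullet> (Z *\<^sub>v y) \<le> y \<bullet> y" .
  qed
  then have conX: "contraction (transpose_mat V * (Q * transpose_mat Z))"
    using isometry_contraction(1)[of Q] isometry_contraction(2)[of V] Q Z VV V(1)
    by (intro contraction_mult contraction_transpose[of Z]) auto
  have GV: "F = G * transpose_mat V"
    using F d by (simp add: V mat_cancel_left[OF W(3)])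
  have "nuclear_norm (U * F) = (\<Sum>i<n. s i * e i)"
    unfolding nn using e0 by (intro sum.cong) (auto simp: s_def real_div_sqrt)
  also have "\<dots> = mat_trace (transpose_mat Z * (F * Q))" unfolding ZF by (simp add: mat_trace_diag)
  also have "\<dots> = mat_trace ((F * Q) * transpose_mat Z)"
    using F Q Z by (intro mat_trace_mult_commute) auto
  also have "(F * Q) * transpose_mat Z = G * (transpose_mat V * (Q * transpose_mat Z))"
    using F Q Z V d by (subst GV) (simp add: mat_assoc)
  also have "mat_trace \<dots> \<le> mat_trace G"
    using V Q Z F d conX by (intro mat_trace_contraction_le[OF G(1)]) auto
  finally show "nuclear_norm (U * F) = mat_trace G" using ge by simp
qed

section \<open>Outlier pursuit\<close>

lemma mat_vec_Frobenius:
  fixes A :: "real mat"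
  assumes y: "dim_vec y = dim_col A"
  shows "(A *\<^sub>v y) \<bullet> (A *\<^sub>v y) \<le> (\<Sum>j<dim_col A. col A j \<bullet> col A j) * (y \<bullet> y)"
proof -
  have "(A *\<^sub>v y) \<bullet> (A *\<^sub>v y) = (\<Sum>i<dim_row A. (row A i \<bullet> y)\<^sup>2)"
    by (simp add: scalar_prod_def[of "A *\<^sub>v y"] atLeast0LessThan power2_eq_square)
  also have "\<dots> \<le> (\<Sum>i<dim_row A. (row A i \<bullet> row A i) * (y \<bullet> y))"
    using y by (intro sum_mono scalar_prod_Cauchy_Schwarz) simp
  also have "\<dots> = (\<Sum>i<dim_row A. \<Sum>j<dim_col A. A $$ (i, j) * A $$ (i, j)) * (y \<bullet> y)"
    by (simp add: sum_distrib_right scalar_prod_def[of "row A _"] atLeast0LessThan)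
  also have "(\<Sum>i<dim_row A. \<Sum>j<dim_col A. A $$ (i, j) * A $$ (i, j)) = (\<Sum>j<dim_col A. col A j \<bullet> col A j)"
    by (subst sum.swap) (simp add: scalar_prod_def atLeast0LessThan)
  finally show ?thesis .
qed

lemma mat_vec_transpose_norm:
  fixes F :: "real mat"
  assumes "dim_vec x = dim_row F"
  shows "(transpose_mat F *\<^sub>v x) \<bullet> (transpose_mat F *\<^sub>v x) = (\<Sum>i<dim_col F. (col F i \<bullet> x)\<^sup>2)"
    and "x \<bullet> ((F * transpose_mat F) *\<^sub>v x) = (\<Sum>i<dim_col F. (col F i \<bullet> x)\<^sup>2)"
proof -
  show 1: "(transpose_mat F *\<^sub>v x) \<bullet> (transpose_mat F *\<^sub>v x) = (\<Sum>i<dim_col F. (col F i \<bullet> x)\<^sup>2)"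
    by (simp add: scalar_prod_def[of "transpose_mat F *\<^sub>v x"] atLeast0LessThan power2_eq_square)
  have "x \<bullet> ((F * transpose_mat F) *\<^sub>v x) = (transpose_mat F *\<^sub>v x) \<bullet> (transpose_mat F *\<^sub>v x)"
    using assms by (simp add: mat_vec_assoc scalar_prod_adjoint)
  then show "x \<bullet> ((F * transpose_mat F) *\<^sub>v x) = (\<Sum>i<dim_col F. (col F i \<bullet> x)\<^sup>2)" using 1 by simp
qed

lemma vec_l2_norm_triangle:
  assumes "dim_vec x = dim_vec y"
  shows "vec_l2_norm (x + y) \<le> vec_l2_norm x + vec_l2_norm y"
proof (rule power2_le_imp_le)
  have "(vec_l2_norm (x + y))\<^sup>2 = x \<bullet> x + y \<bullet> y + 2 * (x \<bullet> y)"
    using assms by (simp add: vec_l2_norm_square scalar_prod_add add_scalar_prod scalar_prod_commute[of y x])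
  also have "\<dots> \<le> x \<bullet> x + y \<bullet> y + 2 * (vec_l2_norm x * vec_l2_norm y)"
    using scalar_prod_le_norms[OF assms] by simp
  also have "\<dots> = (vec_l2_norm x + vec_l2_norm y)\<^sup>2" by (simp add: power2_sum vec_l2_norm_square)
  finally show "(vec_l2_norm (x + y))\<^sup>2 \<le> (vec_l2_norm x + vec_l2_norm y)\<^sup>2" .
qed simp

lemma nuclear_norm_nonneg: "0 \<le> nuclear_norm L"
proof -
  have "mat_trace (transpose_mat (0\<^sub>m (dim_row L) (dim_col L)) * L) \<le> nuclear_norm L"
    by (rule nuclear_norm_dual[of _ "dim_row L" "dim_col L"])
      (auto simp: contraction_def zero_mat_vec)
  then show ?thesis by (simp add: mat_trace_def)
qed

text \<open>The gradient of \<open>x \<mapsto> sqrt x\<close>, hence of the nuclear norm, is only ever used through this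
  quadratic majorizer, which is tight at \<open>G' = G\<close>.\<close>

lemma mat_trace_sqrt_majorizer:
  assumes G: "pos_def r G" and W: "pos_def r W" "W * G = 1\<^sub>m r" and G': "pos_def r G'"
  shows "2 * mat_trace G' \<le> mat_trace (W * (G' * G')) + mat_trace G"
proof -
  note d = pos_def_dims[OF G] pos_def_dims[OF W(1)] pos_def_dims[OF G']
  have GW: "G * W = 1\<^sub>m r" using W(2) d by (intro mat_mult_left_right_inverse[of W r]) auto
  define X where "X = G' - G"
  have X: "X \<in> carrier_mat r r" "transpose_mat X = X" using d by (auto simp: X_def mat_transpose_minus)
  have "mat_trace (W * (X * X)) = mat_trace ((W * X) * X)" using d X by (simp add: mat_assoc)
  also have "\<dots> = mat_trace (transpose_mat X * (W * X))"
    using d X by (subst mat_trace_mult_commute) auto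
  also have "\<dots> = (\<Sum>j<r. col X j \<bullet> (W *\<^sub>v col X j))"
    using d X by (subst mat_trace_mult_transpose) (auto intro!: sum.cong arg_cong2[where f = scalar_prod] col_mult2[of _ r r _ r])
  also have "\<dots> \<ge> 0" using X by (intro sum_nonneg pos_def_nonneg[OF W(1)]) auto
  finally have "0 \<le> mat_trace (W * (X * X))" .
  also have "W * (X * X) = W * (G' * G') - W * (G' * G) - (G' - G)"
  proof -
    have "X * X = (G' - G) * G' - (G' - G) * G"
      using d unfolding X_def by (intro mult_minus_distrib_mat[of _ r r _ r]) auto
    also have "\<dots> = (G' * G' - G * G') - (G' * G - G * G)"
      using d by (simp add: minus_mult_distrib_mat[of _ r r _ _ r])
    also have "\<dots> = G' * G' - G' * G - (G * G' - G * G)"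
      using d by (intro eq_matI) (simp_all del: index_mult_mat(1))
    finally have "X * X = G' * G' - G' * G - (G * G' - G * G)" .
    then have "W * (X * X) = (W * (G' * G') - W * (G' * G)) - (W * (G * G') - W * (G * G))"
      using d by (simp add: mult_minus_distrib_mat[of _ r r _ r] minus_carrier_mat)
    then show ?thesis using d by (simp add: mat_cancel_left[OF W(2)])
  qed
  also have "mat_trace \<dots> = mat_trace (W * (G' * G')) - mat_trace (W * (G' * G)) - (mat_trace G' - mat_trace G)"
    using d by (simp add: mat_trace_minus)
  also have "mat_trace (W * (G' * G)) = mat_trace G'"
  proof -
    have "mat_trace (W * (G' * G)) = mat_trace ((G' * G) * W)"
      using d by (intro mat_trace_mult_commute) auto
    then show ?thesis using d GW by (simp add: mat_assoc)
  qed
  finally show ?thesis by simp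
qed

text \<open>From \<open>2 * a * b \<le> a\<^sup>2 + b\<^sup>2\<close> for the new and the old norm.
  The bound is exact at \<open>t = 0\<close> and has the right slope there, so it can replace the
  derivative in an optimality argument.\<close>

lemma vec_l2_norm_perturb:
  assumes "dim_vec h = dim_vec c" and c: "0 < vec_l2_norm c"
  shows "vec_l2_norm (c - t \<cdot>\<^sub>v h) \<le> vec_l2_norm c + (t\<^sup>2 * (h \<bullet> h) - 2 * t * (c \<bullet> h)) / (2 * vec_l2_norm c)"
proof -
  let ?c = "vec_l2_norm c"
  have sq: "(c - t \<cdot>\<^sub>v h) \<bullet> (c - t \<cdot>\<^sub>v h) = ?c\<^sup>2 + (t\<^sup>2 * (h \<bullet> h) - 2 * t * (c \<bullet> h))"
    using assms by (simp add: vec_l2_norm_square scalar_prod_minus minus_scalar_prod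
        scalar_prod_commute[of h c] power2_eq_square[of t] algebra_simps)
  have "2 * vec_l2_norm (c - t \<cdot>\<^sub>v h) * ?c \<le> (vec_l2_norm (c - t \<cdot>\<^sub>v h))\<^sup>2 + ?c\<^sup>2"
    by (rule sum_squares_bound)
  also have "\<dots> = 2 * ?c\<^sup>2 + (t\<^sup>2 * (h \<bullet> h) - 2 * t * (c \<bullet> h))"
    by (simp add: vec_l2_norm_square[of "c - t \<cdot>\<^sub>v h"] sq)
  finally show ?thesis using c by (simp add: field_simps power2_eq_square)
qed

text \<open>Extracts a first-order condition from quadratic majorizers, without differentiating. The
  point \<open>t = - a / (\<bar>b\<bar> + 1)\<close> makes the linear term outweigh the quadratic
  one.\<close>

lemma linear_coeff_zero:
  assumes "\<And>t :: real. 0 \<le> t * a + t\<^sup>2 * b"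
  shows "a = 0"
proof (rule ccontr)
  assume a: "a \<noteq> 0"
  define q where "q = a / (\<bar>b\<bar> + 1)"
  have q: "a = q * (\<bar>b\<bar> + 1)" unfolding q_def by (simp add: add_nonneg_eq_0_iff)
  have "0 \<le> (- q) * a + (- q)\<^sup>2 * b" by (rule assms)
  also have "\<dots> \<le> (- q) * a + q\<^sup>2 * \<bar>b\<bar>" by (simp add: mult_left_mono)
  also have "\<dots> = - (q\<^sup>2)" by (subst q) (simp add: power2_eq_square algebra_simps)
  finally show False using a q by simp
qed

text \<open>\<open>J\<close> is the set of outlier columns of \<open>M\<close>, \<open>U\<close> an orthonormal basis of the span of the other
  columns, and \<open>ell\<close> bounds their leverage scores, expressed without an inverse Gram matrix. The
  constant \<open>2041 / 1960 = 1 + 9/49 * 9/40\<close> comes from the column norms of the dual certificate.\<close>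

locale outlier_pursuit =
  fixes M U :: "real mat" and d n r :: nat and J :: "nat set" and lam ell :: real
  assumes M: "M \<in> carrier_mat d n" and U: "U \<in> carrier_mat d r" and UU: "transpose_mat U * U = 1\<^sub>m r"
    and J: "J \<subseteq> {..<n}"
    and inlier: "\<And>i. i < n \<Longrightarrow> i \<notin> J \<Longrightarrow> U *\<^sub>v (transpose_mat U *\<^sub>v col M i) = col M i"
    and outlier: "\<And>j. j \<in> J \<Longrightarrow> U *\<^sub>v (transpose_mat U *\<^sub>v col M j) \<noteq> col M j"
    and nondeg: "\<And>z. z \<in> carrier_vec r \<Longrightarrow> z \<noteq> 0\<^sub>v r \<Longrightarrow>
      0 < (\<Sum>i\<in>{..<n} - J. ((transpose_mat U *\<^sub>v col M i) \<bullet> z)\<^sup>2)"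
    and leverage: "\<And>i z. i < n \<Longrightarrow> i \<notin> J \<Longrightarrow> z \<in> carrier_vec r \<Longrightarrow>
      ((transpose_mat U *\<^sub>v col M i) \<bullet> z)\<^sup>2 \<le> ell * (\<Sum>i\<in>{..<n} - J. ((transpose_mat U *\<^sub>v col M i) \<bullet> z)\<^sup>2)"
    and lam: "0 < lam" "lam\<^sup>2 * real (card J) = 9 / 49" and ell: "0 \<le> ell" "ell * 2041 / 1960 < lam\<^sup>2"
begin

lemma finite_J: "finite J" using J finite_subset by blast

lemma sum_split: "(\<Sum>i<n. f i) = (\<Sum>i\<in>J. f i) + (\<Sum>i\<in>{..<n} - J. f i)" for f :: "nat \<Rightarrow> real"
  using sum.subset_diff[OF J, of f] by simp

text \<open>Inlier columns in the coordinates of \<open>U\<close>. Zero columns are kept at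
  \<open>J\<close>, so that \<open>A\<close> and the free part \<open>B\<close> of a candidate have
  complementary column supports and the same shape.\<close>

definition A :: "real mat" where
  "A = mat r n (\<lambda>(a, i). if i \<in> J then 0 else (transpose_mat U *\<^sub>v col M i) $ a)"

lemma A: "A \<in> carrier_mat r n" by (simp add: A_def)

lemma col_A: "i < n \<Longrightarrow> col A i = (if i \<in> J then 0\<^sub>v r else transpose_mat U *\<^sub>v col M i)"
  using U by (intro eq_vecI) (auto simp: A_def)

text \<open>The candidates for the low-rank part in the restricted problem are \<open>U * (A + B)\<close>: they have
  the correct column space and agree with \<open>M\<close> outside \<open>J\<close>.\<close>

definition supp :: "real mat \<Rightarrow> bool" where
  "supp B \<longleftrightarrow> B \<in> carrier_mat r n \<and> (\<forall>i<n. i \<notin> J \<longrightarrow> col B i = 0\<^sub>v r)"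

lemma suppD: "supp B \<Longrightarrow> B \<in> carrier_mat r n" "supp B \<Longrightarrow> i < n \<Longrightarrow> i \<notin> J \<Longrightarrow> col B i = 0\<^sub>v r"
  by (auto simp: supp_def)

lemma col_sum: "supp B \<Longrightarrow> i < n \<Longrightarrow> col (A + B) i = (if i \<in> J then col B i else transpose_mat U *\<^sub>v col M i)"
  using A suppD[of B] U col_A[of i] by (auto simp: col_add[of _ r n])

lemma energy_A:
  assumes "dim_vec z = r"
  shows "(transpose_mat A *\<^sub>v z) \<bullet> (transpose_mat A *\<^sub>v z) = (\<Sum>i\<in>{..<n} - J. ((transpose_mat U *\<^sub>v col M i) \<bullet> z)\<^sup>2)"
proof -
  have z: "z \<in> carrier_vec r" using assms by (intro carrier_vecI)
  have "(transpose_mat A *\<^sub>v z) \<bullet> (transpose_mat A *\<^sub>v z) = (\<Sum>i<n. (col A i \<bullet> z)\<^sup>2)"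
    using A assms by (subst mat_vec_transpose_norm) auto
  also have "\<dots> = (\<Sum>i\<in>{..<n} - J. ((transpose_mat U *\<^sub>v col M i) \<bullet> z)\<^sup>2)"
    unfolding sum_split using J z by (auto simp: col_A subset_eq intro!: sum.neutral)
  finally show ?thesis .
qed

text \<open>Complementary column supports make the Gram matrices add, so the Gram matrix of any
  candidate dominates that of \<open>A\<close>.\<close>

lemma energy_sum:
  assumes B: "supp B" and z: "dim_vec z = r"
  shows "(transpose_mat (A + B) *\<^sub>v z) \<bullet> (transpose_mat (A + B) *\<^sub>v z)
    = (transpose_mat A *\<^sub>v z) \<bullet> (transpose_mat A *\<^sub>v z) + (transpose_mat B *\<^sub>v z) \<bullet> (transpose_mat B *\<^sub>v z)"
proof -
  note d = A suppD(1)[OF B]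
  have zc: "z \<in> carrier_vec r" using z by (intro carrier_vecI)
  have "(transpose_mat B *\<^sub>v z) \<bullet> (transpose_mat B *\<^sub>v z) = (\<Sum>i<n. (col B i \<bullet> z)\<^sup>2)"
    using d z by (subst mat_vec_transpose_norm) auto
  also have "\<dots> = (\<Sum>i\<in>J. (col B i \<bullet> z)\<^sup>2)"
    unfolding sum_split using suppD(2)[OF B] zc by (auto intro!: sum.neutral)
  finally have 1: "(transpose_mat B *\<^sub>v z) \<bullet> (transpose_mat B *\<^sub>v z) = (\<Sum>i\<in>J. (col B i \<bullet> z)\<^sup>2)" .
  have "(transpose_mat (A + B) *\<^sub>v z) \<bullet> (transpose_mat (A + B) *\<^sub>v z) = (\<Sum>i<n. (col (A + B) i \<bullet> z)\<^sup>2)"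
    using d z by (subst mat_vec_transpose_norm) auto
  also have "\<dots> = (\<Sum>i\<in>J. (col B i \<bullet> z)\<^sup>2) + (\<Sum>i\<in>{..<n} - J. ((transpose_mat U *\<^sub>v col M i) \<bullet> z)\<^sup>2)"
    unfolding sum_split using J by (intro arg_cong2[where f = plus] sum.cong) (auto simp: col_sum[OF B])
  finally show ?thesis using 1 energy_A[OF z] by simp
qed

text \<open>The inlier columns alone are nondegenerate by \<open>nondeg\<close>, and outlier columns
  only add energy. Hence every candidate has full row rank and its nuclear norm is given by the
  trace formula of \<open>nuclear_norm_isometry_mult\<close>.\<close>

lemma gram_pos_def: assumes "supp B" shows "pos_def r ((A + B) * transpose_mat (A + B))"
  unfolding pos_def_def
proof (intro conjI ballI impI)
  note d = A suppD(1)[OF assms]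
  show "(A + B) * transpose_mat (A + B) \<in> carrier_mat r r" using d by auto
  show "transpose_mat ((A + B) * transpose_mat (A + B)) = (A + B) * transpose_mat (A + B)"
    using d by (simp add: mat_transpose_mult)
  fix x :: "real vec" assume x: "x \<in> carrier_vec r" "x \<noteq> 0\<^sub>v r"
  have "x \<bullet> ((A + B) * transpose_mat (A + B) *\<^sub>v x)
    = (transpose_mat (A + B) *\<^sub>v x) \<bullet> (transpose_mat (A + B) *\<^sub>v x)"
    using d x by (simp add: mat_vec_assoc scalar_prod_adjoint[of x "A + B"])
  also have "\<dots> \<ge> (transpose_mat A *\<^sub>v x) \<bullet> (transpose_mat A *\<^sub>v x)"
    using energy_sum[OF assms, of x] x by simp
  finally show "0 < x \<bullet> ((A + B) * transpose_mat (A + B) *\<^sub>v x)"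
    using nondeg[OF x] energy_A[of x] x by simp
qed

lemma supp_zero: "supp (0\<^sub>m r n)" by (auto simp: supp_def intro!: eq_vecI)

lemma gram_A_pos_def: "pos_def r (A * transpose_mat A)"
  using gram_pos_def[OF supp_zero] A by simp

section \<open>Existence of a restricted minimizer\<close>

definition restricted_cost :: "real mat \<Rightarrow> real" where
  "restricted_cost B = lam * (\<Sum>j\<in>J. vec_l2_norm (col M j - U *\<^sub>v col B j)) + nuclear_norm (U * (A + B))"

text \<open>Lipschitz continuity by duality: the polar factor of the first candidate attains its
  nuclear norm and is admissible for the second, and the entries of a contraction are at most 1 in
  absolute value.\<close>

lemma nuclear_norm_diff_le:
  assumes B: "supp B" and B': "supp B'"
  shows "nuclear_norm (U * (A + B)) - nuclear_norm (U * (A + B'))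
    \<le> (\<Sum>i<n. \<Sum>a<r. \<bar>B $$ (a, i) - B' $$ (a, i)\<bar>)"
proof -
  note d = A suppD(1)[OF B] suppD(1)[OF B']
  obtain G W where G: "pos_def r G" "G * G = (A + B) * transpose_mat (A + B)"
    and W: "pos_def r W" "W * G = 1\<^sub>m r" "G * W = 1\<^sub>m r"
    using pos_def_sqrt[OF gram_pos_def[OF B]] by metis
  have F: "A + B \<in> carrier_mat r n" "A + B' \<in> carrier_mat r n" using d by auto
  note n = nuclear_norm_isometry_mult[OF U UU F(1) G W]
  note dd = pos_def_dims[OF W(1)] pos_def_dims[OF G(1)]
  define X where "X = W * (A + B)"
  have X: "X \<in> carrier_mat r n" "contraction X" using dd F n(2) by (auto simp: X_def)
  have UX: "U * X \<in> carrier_mat d n" "contraction (U * X)"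
    using U X isometry_contraction(1)[of U] UU by (auto intro!: contraction_mult)
  have UF: "U * (A + B') \<in> carrier_mat d n" using U F by auto
  have "nuclear_norm (U * (A + B)) - nuclear_norm (U * (A + B'))
    \<le> mat_trace (transpose_mat (U * X) * (U * (A + B))) - mat_trace (transpose_mat (U * X) * (U * (A + B')))"
    using n(1,3) nuclear_norm_dual[OF UF UX] by (simp add: X_def)
  also have "\<dots> = mat_trace (transpose_mat X * (A + B)) - mat_trace (transpose_mat X * (A + B'))"
    using U X F d by (simp add: mat_transpose_mult mat_assoc mat_cancel_left[OF UU])
  also have "\<dots> = (\<Sum>i<n. col X i \<bullet> col (A + B) i - col X i \<bullet> col (A + B') i)"
    using X d by (subst (1 2) mat_trace_mult_transpose) (auto simp: sum_subtractf)
  also have "\<dots> = (\<Sum>i<n. \<Sum>a<r. X $$ (a, i) * (B $$ (a, i) - B' $$ (a, i)))"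
    using X d by (intro sum.cong) (auto simp: scalar_prod_def sum_subtractf[symmetric] algebra_simps atLeast0LessThan)
  also have "\<dots> \<le> (\<Sum>i<n. \<Sum>a<r. \<bar>B $$ (a, i) - B' $$ (a, i)\<bar>)"
  proof (intro sum_mono)
    fix i a assume i: "i \<in> {..<n}" and a: "a \<in> {..<r}"
    have "(X $$ (a, i))\<^sup>2 \<le> col X i \<bullet> col X i"
      using i a X member_le_sum[of a "{0..<r}" "\<lambda>a. X $$ (a, i) * X $$ (a, i)"]
      by (simp add: scalar_prod_def power2_eq_square)
    also have "\<dots> \<le> 1"
      using contractionD[OF X(2), of "unit_vec n i"] X i by (simp add: mat_vec_unit del: index_mult_mat_vec)
    finally have "\<bar>X $$ (a, i)\<bar> \<le> 1" by (simp add: abs_square_le_1)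
    then have "\<bar>X $$ (a, i)\<bar> * \<bar>B $$ (a, i) - B' $$ (a, i)\<bar> \<le> 1 * \<bar>B $$ (a, i) - B' $$ (a, i)\<bar>"
      by (intro mult_right_mono) auto
    then show "X $$ (a, i) * (B $$ (a, i) - B' $$ (a, i)) \<le> \<bar>B $$ (a, i) - B' $$ (a, i)\<bar>"
      by (simp add: abs_mult[symmetric])
  qed
  finally show ?thesis .
qed

text \<open>Candidates are parametrized by functions on all index pairs, so that continuity and
  compactness can be taken in the product topology of a function space.\<close>

definition block :: "(nat \<times> nat \<Rightarrow> real) \<Rightarrow> real mat" where
  "block b = mat r n (\<lambda>(a, i). if i \<in> J then b (a, i) else 0)"

lemma supp_block: "supp (block b)" by (auto simp: supp_def block_def intro!: eq_vecI)

lemma continuous_restricted_cost: "continuous_on UNIV (\<lambda>b. restricted_cost (block b))"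
proof -
  have norm_eq: "vec_l2_norm (col M j - U *\<^sub>v col (block b) j)
      = sqrt (\<Sum>x<d. (M $$ (x, j) - (\<Sum>a<r. U $$ (x, a) * b (a, j)))\<^sup>2)" if "j \<in> J" for j b
    using that J M U by (auto simp: vec_l2_norm_def scalar_prod_def atLeast0LessThan block_def power2_eq_square)
  have coord: "continuous_on UNIV (\<lambda>b :: nat \<times> nat \<Rightarrow> real. b (a, j))" for a j
    by simp
  have 1: "continuous_on UNIV (\<lambda>b. lam * (\<Sum>j\<in>J. vec_l2_norm (col M j - U *\<^sub>v col (block b) j)))"
    by (simp add: norm_eq cong: sum.cong) (intro continuous_intros coord)
  have 2: "continuous_on UNIV (\<lambda>b. nuclear_norm (U * (A + block b)))"
    unfolding continuous_on_def
  proof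
    fix b
    define D where "D b' = (\<Sum>i<n. \<Sum>a<r. \<bar>block b' $$ (a, i) - block b $$ (a, i)\<bar>)" for b'
    have Deq: "D b' = (\<Sum>i<n. \<Sum>a<r. \<bar>if i \<in> J then b' (a, i) - b (a, i) else 0\<bar>)" for b'
      unfolding D_def by (intro sum.cong) (auto simp: block_def)
    have "continuous_on UNIV (\<lambda>b'. if i \<in> J then b' (a, i) - b (a, i) else 0)" for a i
      by (cases "i \<in> J") (auto intro!: continuous_intros coord)
    then have "continuous_on UNIV D" unfolding Deq by (intro continuous_intros) auto
    then have "(D \<longlongrightarrow> D b) (at b within UNIV)" unfolding continuous_on_def by blast
    then have D: "(D \<longlongrightarrow> 0) (at b within UNIV)" by (simp add: D_def)
    show "((\<lambda>b. nuclear_norm (U * (A + block b))) \<longlongrightarrow> nuclear_norm (U * (A + block b))) (at b within UNIV)"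
    proof (rule LIM_zero_cancel, rule tendsto_rabs_zero_cancel, rule tendsto_sandwich[OF _ _ tendsto_const D])
      show "\<forall>\<^sub>F x in at b. \<bar>nuclear_norm (U * (A + block x)) - nuclear_norm (U * (A + block b))\<bar> \<le> D x"
      proof (intro always_eventually allI)
        fix x
        show "\<bar>nuclear_norm (U * (A + block x)) - nuclear_norm (U * (A + block b))\<bar> \<le> D x"
          using nuclear_norm_diff_le[OF supp_block[of x] supp_block[of b]]
            nuclear_norm_diff_le[OF supp_block[of b] supp_block[of x]]
          unfolding D_def by (simp add: abs_le_iff abs_minus_commute)
      qed
    qed auto
  qed
  show ?thesis unfolding restricted_cost_def using 1 2 by (intro continuous_on_add)
qed

text \<open>The nuclear norm is nonnegative, so the cost bounds each residual. Since
  \<open>U\<close> is an isometry, a column of \<open>B\<close> is bounded by its residual plus the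
  data column.\<close>

lemma restricted_cost_coercive:
  assumes B: "supp B" and le: "restricted_cost B \<le> c" and j: "j \<in> J" and a: "a < r"
  shows "\<bar>B $$ (a, j)\<bar> \<le> c / lam + (\<Sum>j\<in>J. vec_l2_norm (col M j))"
proof -
  note d = suppD(1)[OF B]
  have jn: "j < n" using j J by auto
  have "lam * vec_l2_norm (col M j - U *\<^sub>v col B j)
      \<le> lam * (\<Sum>j\<in>J. vec_l2_norm (col M j - U *\<^sub>v col B j))"
    using finite_J j lam by (intro mult_left_mono member_le_sum) auto
  also have "\<dots> \<le> c" using le nuclear_norm_nonneg[of "U * (A + B)"] by (simp add: restricted_cost_def)
  finally have 1: "vec_l2_norm (col M j - U *\<^sub>v col B j) \<le> c / lam" using lam by (simp add: field_simps)
  have 2: "vec_l2_norm (col M j) \<le> (\<Sum>j\<in>J. vec_l2_norm (col M j))"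
    using finite_J j by (intro member_le_sum) auto
  have "col B j \<bullet> col B j = (U *\<^sub>v col B j) \<bullet> (U *\<^sub>v col B j)"
    using isometry_norm[OF UU, of "col B j" "col B j"] U d by simp
  then have "vec_l2_norm (col B j) = vec_l2_norm (U *\<^sub>v col B j)" by (simp add: vec_l2_norm_def)
  also have "U *\<^sub>v col B j = (- 1) \<cdot>\<^sub>v (col M j - U *\<^sub>v col B j) + col M j"
    using M U by (intro eq_vecI) auto
  also have "vec_l2_norm \<dots> \<le> vec_l2_norm ((- 1) \<cdot>\<^sub>v (col M j - U *\<^sub>v col B j)) + vec_l2_norm (col M j)"
    using M U by (intro vec_l2_norm_triangle) simp
  also have "vec_l2_norm ((- 1) \<cdot>\<^sub>v (col M j - U *\<^sub>v col B j)) = vec_l2_norm (col M j - U *\<^sub>v col B j)"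
    by (simp add: vec_l2_norm_def)
  finally have "vec_l2_norm (col B j) \<le> c / lam + (\<Sum>j\<in>J. vec_l2_norm (col M j))" using 1 2 by linarith
  moreover have "\<bar>B $$ (a, j)\<bar> \<le> vec_l2_norm (col B j)"
    unfolding vec_l2_norm_def
  proof (rule real_le_rsqrt)
    show "\<bar>B $$ (a, j)\<bar>\<^sup>2 \<le> col B j \<bullet> col B j"
      using jn a d member_le_sum[of a "{0..<r}" "\<lambda>a. B $$ (a, j) * B $$ (a, j)"]
      by (simp add: scalar_prod_def power2_eq_square)
  qed
  ultimately show ?thesis by linarith
qed

lemma restricted_cost_minimizer: obtains B where "supp B" "\<And>B'. supp B' \<Longrightarrow> restricted_cost B \<le> restricted_cost B'"
proof -
  define c where "c = restricted_cost (block (\<lambda>_. 0))"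
  define R where "R = \<bar>c / lam + (\<Sum>j\<in>J. vec_l2_norm (col M j))\<bar>"
  \<comment> \<open>The box also bounds the coordinates that \<open>block\<close> ignores, so it is
    a full product of intervals and compact by Tychonoff. A competitor of cost at most
    \<open>c\<close> lies in it after extension by zero.\<close>
  define K where "K = PiE UNIV (\<lambda>_ :: nat \<times> nat. {- R .. R})"
  have "compact K"
    using compactin_PiE[of "\<lambda>_ :: nat \<times> nat. euclidean :: real topology" UNIV "\<lambda>_. {- R .. R}"]
    by (simp add: euclidean_product_topology K_def)
  moreover have z: "(\<lambda>_. 0) \<in> K" by (auto simp: K_def R_def)
  then have "K \<noteq> {}" by blast
  ultimately obtain b where b: "b \<in> K" "\<And>b'. b' \<in> K \<Longrightarrow> restricted_cost (block b) \<le> restricted_cost (block b')"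
    using continuous_attains_inf[of K "\<lambda>b. restricted_cost (block b)"] continuous_on_subset[OF continuous_restricted_cost]
    by (metis subset_UNIV)
  show thesis
  proof (rule that[OF supp_block[of b]])
    fix B' assume B': "supp B'"
    show "restricted_cost (block b) \<le> restricted_cost B'"
    proof (cases "restricted_cost B' \<le> c")
      case True
      define b' where "b' = (\<lambda>(a, i). if i \<in> J \<and> a < r then B' $$ (a, i) else 0)"
      have "b' \<in> K"
        using restricted_cost_coercive[OF B' True] unfolding K_def R_def b'_def
        by (auto simp: abs_le_iff; fastforce)
      moreover have "block b' = B'"
      proof (rule eq_matI)
        fix a i assume ai: "a < dim_row B'" "i < dim_col B'"
        have "B' $$ (a, i) = 0" if "i \<notin> J"
        proof -
          have "col B' i $ a = 0" using suppD[OF B'] ai that by simp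
          then show ?thesis using ai by simp
        qed
        then show "block b' $$ (a, i) = B' $$ (a, i)"
          using ai suppD(1)[OF B'] by (auto simp: block_def b'_def)
      qed (use suppD(1)[OF B'] in \<open>auto simp: block_def\<close>)
      ultimately show ?thesis using b(2) by metis
    next
      case False
      then show ?thesis using b(2)[OF z] by (simp add: c_def)
    qed
  qed
qed


text \<open>No outlier lies in the range of \<open>U\<close>, so every norm in the restricted cost
  stays away from its kink, and the stationarity conditions are equations instead of subgradient
  inclusions.\<close>

lemma outlier_residual_nonzero:
  assumes "j \<in> J" "b \<in> carrier_vec r"
  shows "0 < vec_l2_norm (col M j - U *\<^sub>v b)"
proof -
  have jn: "j < n" using assms J by auto
  have "col M j - U *\<^sub>v b \<noteq> 0\<^sub>v d"
  proof
    assume 0: "col M j - U *\<^sub>v b = 0\<^sub>v d"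
    have e: "col M j = U *\<^sub>v b"
    proof (rule eq_vecI)
      fix i assume "i < dim_vec (U *\<^sub>v b)"
      then have i: "i < d" using U by simp
      have "(col M j - U *\<^sub>v b) $ i = 0" using 0 i by simp
      then show "col M j $ i = (U *\<^sub>v b) $ i" using i U by simp
    qed (use M U in simp)
    have "transpose_mat U *\<^sub>v (U *\<^sub>v b) = (transpose_mat U * U) *\<^sub>v b"
      by (rule mat_vec_assoc[symmetric]) (use U assms in auto)
    then have "U *\<^sub>v (transpose_mat U *\<^sub>v col M j) = col M j"
      unfolding e UU using assms by (simp add: one_mat_vec)
    then show False using outlier[OF assms(1)] by simp
  qed
  then have "vec_l2_norm (col M j - U *\<^sub>v b) \<noteq> 0"
    using M U by (subst vec_l2_norm_eq_0[of _ d]) (auto intro!: carrier_vecI)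
  then show ?thesis using vec_l2_norm_nonneg[of "col M j - U *\<^sub>v b"] by linarith
qed

section \<open>Stationarity of the restricted minimizer\<close>

lemma mat_trace_weighted:
  assumes "W \<in> carrier_mat r r" "F \<in> carrier_mat r n"
  shows "mat_trace (W * (F * transpose_mat F)) = (\<Sum>i<n. col F i \<bullet> (W *\<^sub>v col F i))"
proof -
  have "mat_trace (W * (F * transpose_mat F)) = mat_trace ((W * F) * transpose_mat F)"
    using assms by (simp add: mat_assoc)
  also have "\<dots> = mat_trace (transpose_mat F * (W * F))"
    using assms by (intro mat_trace_mult_commute) auto
  also have "\<dots> = (\<Sum>i<n. col F i \<bullet> col (W * F) i)"
    using assms by (subst mat_trace_mult_transpose) auto
  also have "\<dots> = (\<Sum>i<n. col F i \<bullet> (W *\<^sub>v col F i))"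
    using assms by (intro sum.cong refl arg_cong2[where f = scalar_prod] col_mult2[of _ r r _ n]) auto
  finally show ?thesis .
qed

text \<open>Column \<open>j\<close> is perturbed by \<open>t \<cdot>\<^sub>v h\<close>. The
  majorizers of the nuclear norm and of the residual norm are both exact at \<open>t = 0\<close>, so
  minimality makes a quadratic polynomial in \<open>t\<close> nonnegative everywhere and its linear
  coefficient vanishes. As \<open>h\<close> is arbitrary, this is the vector equation.\<close>

lemma stationarity:
  assumes B: "supp B" and min: "\<And>B'. supp B' \<Longrightarrow> restricted_cost B \<le> restricted_cost B'"
    and G: "pos_def r G" "G * G = (A + B) * transpose_mat (A + B)"
    and W: "pos_def r W" "W * G = 1\<^sub>m r" "G * W = 1\<^sub>m r"
    and j: "j \<in> J"
  shows "W *\<^sub>v col B j = (lam / vec_l2_norm (col M j - U *\<^sub>v col B j)) \<cdot>\<^sub>v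
    (transpose_mat U *\<^sub>v (col M j - U *\<^sub>v col B j))"
proof -
  note d = A suppD(1)[OF B] pos_def_dims[OF G(1)] pos_def_dims[OF W(1)]
  have jn: "j < n" using j J by auto
  define c where "c = col M j - U *\<^sub>v col B j"
  have c: "c \<in> carrier_vec d" unfolding c_def using M U by (intro carrier_vecI) simp
  have bj: "col B j \<in> carrier_vec r" using d by auto
  have cpos: "0 < vec_l2_norm c" unfolding c_def by (rule outlier_residual_nonzero[OF j bj])
  have nB: "nuclear_norm (U * (A + B)) = mat_trace G"
    by (rule nuclear_norm_isometry_mult(1)[OF U UU _ G W]) (use d in auto)
  show ?thesis unfolding c_def[symmetric]
  proof (rule vec_eqI_scalar[of _ r])
    fix h :: "real vec" assume h: "h \<in> carrier_vec r"
    have Uh: "U *\<^sub>v h \<in> carrier_vec d" using U h by auto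
    have key: "0 \<le> t * (h \<bullet> (W *\<^sub>v col B j) - lam * (c \<bullet> (U *\<^sub>v h)) / vec_l2_norm c)
      + t\<^sup>2 * (h \<bullet> (W *\<^sub>v h) / 2 + lam * ((U *\<^sub>v h) \<bullet> (U *\<^sub>v h)) / (2 * vec_l2_norm c))" for t
    proof -
      define B' where "B' = mat r n (\<lambda>(a, i). B $$ (a, i) + (if i = j then t * h $ a else 0))"
      have colB': "col B' i = (if i = j then col B j + t \<cdot>\<^sub>v h else col B i)" if "i < n" for i
        using that d h by (auto simp: B'_def intro!: eq_vecI)
      have B': "supp B'" using suppD[OF B] j colB' by (auto simp: supp_def B'_def)
      note d' = suppD(1)[OF B']
      obtain G' W' where G': "pos_def r G'" "G' * G' = (A + B') * transpose_mat (A + B')"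
        and W': "pos_def r W'" "W' * G' = 1\<^sub>m r" "G' * W' = 1\<^sub>m r"
        using pos_def_sqrt[OF gram_pos_def[OF B']] by metis
      have nB': "nuclear_norm (U * (A + B')) = mat_trace G'"
        by (rule nuclear_norm_isometry_mult(1)[OF U UU _ G' W']) (use d d' in auto)
      let ?q = "\<lambda>B. \<Sum>i<n. col (A + B) i \<bullet> (W *\<^sub>v col (A + B) i)"
      have 1: "2 * mat_trace G' \<le> ?q B' + mat_trace G"
        using mat_trace_sqrt_majorizer[OF G(1) W(1,2) G'(1)] d d'
        by (simp add: G'(2) mat_trace_weighted)
      \<comment> \<open>Exactness of the majorizer at the unperturbed point: the same quadratic form
        with weight \<open>W\<close> evaluates to the trace of \<open>G\<close>.\<close>
      have "mat_trace G = mat_trace (W * (G * G))"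
        using d by (simp add: mat_cancel_left[OF W(2)])
      also have "\<dots> = ?q B" unfolding G(2) using d by (intro mat_trace_weighted) auto
      finally have 2: "2 * mat_trace G = ?q B + mat_trace G" by simp
      have "?q B' = (\<Sum>i<n. col (A + B) i \<bullet> (W *\<^sub>v col (A + B) i) + (if i = j then
          2 * t * (h \<bullet> (W *\<^sub>v col B j)) + t\<^sup>2 * (h \<bullet> (W *\<^sub>v h)) else 0))"
      proof (intro sum.cong refl)
        fix i assume "i \<in> {..<n}"
        then have i: "i < n" by simp
        show "col (A + B') i \<bullet> (W *\<^sub>v col (A + B') i) = col (A + B) i \<bullet> (W *\<^sub>v col (A + B) i) + (if i = j then
          2 * t * (h \<bullet> (W *\<^sub>v col B j)) + t\<^sup>2 * (h \<bullet> (W *\<^sub>v h)) else 0)"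
        proof (cases "i = j")
          case True
          have "col B j \<bullet> (W *\<^sub>v h) = (W *\<^sub>v col B j) \<bullet> h"
            using d bj h by (intro symmetric_scalar_prod[of W r]) auto
          also have "\<dots> = h \<bullet> (W *\<^sub>v col B j)" using d h by (intro scalar_prod_commute) auto
          finally have s: "col B j \<bullet> (W *\<^sub>v h) = h \<bullet> (W *\<^sub>v col B j)" .
          have cs: "col (A + B') i = col B j + t \<cdot>\<^sub>v h" "col (A + B) i = col B j"
            using True j i col_sum[OF B i] col_sum[OF B' i] colB'[OF i] by auto
          show ?thesis
            unfolding cs using True d bj h
            by (simp add: mat_vec_add mat_vec_smult scalar_prod_add add_scalar_prod s power2_eq_square algebra_simps)
        next
          case False
          then show ?thesis using i by (simp add: col_sum[OF B] col_sum[OF B'] colB')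
        qed
      qed
      then have 3: "?q B' = ?q B + (2 * t * (h \<bullet> (W *\<^sub>v col B j)) + t\<^sup>2 * (h \<bullet> (W *\<^sub>v h)))"
        using jn by (simp add: sum.distrib)
      have nd: "nuclear_norm (U * (A + B')) - nuclear_norm (U * (A + B))
          \<le> t * (h \<bullet> (W *\<^sub>v col B j)) + t\<^sup>2 * (h \<bullet> (W *\<^sub>v h)) / 2"
        unfolding nB nB' using 1 2 3 by simp
      have sumJ: "(\<Sum>i\<in>J. vec_l2_norm (col M i - U *\<^sub>v col B' i))
          - (\<Sum>i\<in>J. vec_l2_norm (col M i - U *\<^sub>v col B i)) = vec_l2_norm (c - t \<cdot>\<^sub>v (U *\<^sub>v h)) - vec_l2_norm c"
      proof -
        have "col M j - U *\<^sub>v (col B j + t \<cdot>\<^sub>v h) = c - t \<cdot>\<^sub>v (U *\<^sub>v h)"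
          using M U d h by (intro eq_vecI) (auto simp: c_def scalar_prod_add)
        then have "(\<Sum>i\<in>J. vec_l2_norm (col M i - U *\<^sub>v col B' i)) =
          (\<Sum>i\<in>J. vec_l2_norm (col M i - U *\<^sub>v col B i) + (if i = j then vec_l2_norm (c - t \<cdot>\<^sub>v (U *\<^sub>v h)) - vec_l2_norm c else 0))"
          using J by (intro sum.cong) (auto simp: colB' c_def)
        then show ?thesis using finite_J j by (simp add: sum.distrib)
      qed
      have "0 \<le> restricted_cost B' - restricted_cost B" using min[OF B'] by simp
      also have "\<dots> = lam * (vec_l2_norm (c - t \<cdot>\<^sub>v (U *\<^sub>v h)) - vec_l2_norm c)
          + (nuclear_norm (U * (A + B')) - nuclear_norm (U * (A + B)))"
        unfolding restricted_cost_def sumJ[symmetric] by (simp add: algebra_simps)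
      also have "\<dots> \<le> lam * ((t\<^sup>2 * ((U *\<^sub>v h) \<bullet> (U *\<^sub>v h)) - 2 * t * (c \<bullet> (U *\<^sub>v h))) / (2 * vec_l2_norm c))
          + (t * (h \<bullet> (W *\<^sub>v col B j)) + t\<^sup>2 * (h \<bullet> (W *\<^sub>v h)) / 2)"
        using nd vec_l2_norm_perturb[of "U *\<^sub>v h" c t] cpos c U lam by (intro add_mono mult_left_mono) auto
      also have "\<dots> = t * (h \<bullet> (W *\<^sub>v col B j) - lam * (c \<bullet> (U *\<^sub>v h)) / vec_l2_norm c)
        + t\<^sup>2 * (h \<bullet> (W *\<^sub>v h) / 2 + lam * ((U *\<^sub>v h) \<bullet> (U *\<^sub>v h)) / (2 * vec_l2_norm c))"
        by (simp add: diff_divide_distrib algebra_simps)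
      finally show ?thesis .
    qed
    have "h \<bullet> (W *\<^sub>v col B j) = lam * (c \<bullet> (U *\<^sub>v h)) / vec_l2_norm c"
      using linear_coeff_zero[OF key] by simp
    also have "c \<bullet> (U *\<^sub>v h) = h \<bullet> (transpose_mat U *\<^sub>v c)"
      using c U h by (subst scalar_prod_adjoint) (auto intro!: scalar_prod_commute)
    finally show "h \<bullet> (W *\<^sub>v col B j) = h \<bullet> ((lam / vec_l2_norm c) \<cdot>\<^sub>v (transpose_mat U *\<^sub>v c))"
      using h U by simp
  qed (use d U c in auto)
qed

end

text \<open>\<open>U * (W * F)\<close> is the polar factor of the restricted optimum \<open>U * F\<close>. The dual certificate \<open>Q\<close>
  adds to it \<open>Lam\<close>, which is prescribed on \<open>J\<close> by the subgradient of the column norms, and the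
  correction outside \<open>J\<close> that makes the sum vanish on the row space of \<open>F\<close>.\<close>

locale outlier_certificate = outlier_pursuit +
  fixes B G W H :: "real mat"
  assumes B: "supp B" and B_min: "\<And>B'. supp B' \<Longrightarrow> restricted_cost B \<le> restricted_cost B'"
    and G: "pos_def r G" "G * G = (A + B) * transpose_mat (A + B)"
    and W: "pos_def r W" "W * G = 1\<^sub>m r" "G * W = 1\<^sub>m r"
    and H: "pos_def r H" "H * (A * transpose_mat A) = 1\<^sub>m r" "(A * transpose_mat A) * H = 1\<^sub>m r"
begin

section \<open>Construction of the dual certificate\<close>

definition F :: "real mat" where "F = A + B"

lemmas dims = A suppD(1)[OF B] pos_def_dims[OF G(1)] pos_def_dims[OF W(1)] pos_def_dims[OF H(1)]

lemma F: "F \<in> carrier_mat r n" using dims by (simp add: F_def)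

definition resid :: "nat \<Rightarrow> real vec" where "resid j = col M j - U *\<^sub>v col B j"

definition dir :: "nat \<Rightarrow> real vec" where "dir j = (1 / vec_l2_norm (resid j)) \<cdot>\<^sub>v resid j"

definition perp :: "real vec \<Rightarrow> real vec" where "perp x = x - U *\<^sub>v (transpose_mat U *\<^sub>v x)"

text \<open>The component of \<open>lam \<cdot>\<^sub>v dir j\<close> inside the range of
  \<open>U\<close> is already supplied by the polar factor (\<open>W_col_B\<close>), so only the
  orthogonal component is prescribed here.\<close>

definition Lam :: "real mat" where
  "Lam = mat d n (\<lambda>(a, j). if j \<in> J then lam * perp (dir j) $ a else 0)"

text \<open>The factor \<open>transpose_mat B * (H * A)\<close> sends \<open>transpose_mat F\<close>
  to \<open>transpose_mat B\<close>, because \<open>A * transpose_mat B = 0\<close> and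
  \<open>H\<close> inverts \<open>A * transpose_mat A\<close>. Hence \<open>T\<close> applied to
  \<open>transpose_mat F\<close> is \<open>Lam * transpose_mat A = 0\<close>. As \<open>A\<close>
  vanishes on \<open>J\<close>, the columns of \<open>T\<close> there are still those of
  \<open>Lam\<close>.\<close>

definition T :: "real mat" where "T = Lam - Lam * (transpose_mat B * (H * A))"

definition Q :: "real mat" where "Q = U * (W * F) + T"

lemma resid: "resid j \<in> carrier_vec d" "j \<in> J \<Longrightarrow> 0 < vec_l2_norm (resid j)"
proof -
  show "resid j \<in> carrier_vec d" unfolding resid_def using M U by (intro carrier_vecI) simp
  assume "j \<in> J"
  then show "0 < vec_l2_norm (resid j)"
    unfolding resid_def using J dims by (intro outlier_residual_nonzero) auto
qed

lemma dir: "dir j \<in> carrier_vec d" "j \<in> J \<Longrightarrow> dir j \<bullet> dir j = 1"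
proof -
  show "dir j \<in> carrier_vec d" using resid(1) by (simp add: dir_def)
  assume "j \<in> J"
  then have "resid j \<bullet> resid j = vec_l2_norm (resid j) * vec_l2_norm (resid j)" "vec_l2_norm (resid j) > 0"
    using vec_l2_norm_square[of "resid j"] resid(2)[of j] by (auto simp: power2_eq_square)
  then show "dir j \<bullet> dir j = 1" by (simp add: dir_def)
qed

lemma U_transpose_U: "dim_vec x = r \<Longrightarrow> transpose_mat U *\<^sub>v (U *\<^sub>v x) = x"
proof -
  assume x: "dim_vec x = r"
  have "transpose_mat U *\<^sub>v (U *\<^sub>v x) = (transpose_mat U * U) *\<^sub>v x"
    by (rule mat_vec_assoc[symmetric]) (use U x in auto)
  then show ?thesis unfolding UU using x by (simp add: one_mat_vec)
qed

lemma perp: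
  assumes "dim_vec x = d"
  shows "dim_vec (perp x) = d" "transpose_mat U *\<^sub>v perp x = 0\<^sub>v r" "perp x \<bullet> perp x \<le> x \<bullet> x"
    "dim_vec z = r \<Longrightarrow> (U *\<^sub>v z) \<bullet> perp x = 0"
proof -
  have d: "dim_vec (perp x) = d" using U by (simp add: perp_def)
  have 0: "transpose_mat U *\<^sub>v perp x = 0\<^sub>v r"
    using U assms by (simp add: perp_def mat_vec_minus U_transpose_U) (intro eq_vecI, auto)
  have 1: "(U *\<^sub>v z) \<bullet> perp x = 0" if "dim_vec z = r" for z
  proof -
    have "(U *\<^sub>v z) \<bullet> perp x = perp x \<bullet> (U *\<^sub>v z)" using U d by (intro scalar_prod_commute) simp
    also have "\<dots> = (transpose_mat U *\<^sub>v perp x) \<bullet> z" using U d that by (intro scalar_prod_adjoint) auto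
    finally show ?thesis unfolding 0 using that by (simp add: scalar_prod_def)
  qed
  define y where "y = U *\<^sub>v (transpose_mat U *\<^sub>v x)"
  have y: "dim_vec y = d" using U by (simp add: y_def)
  have yp: "y \<bullet> perp x = 0" unfolding y_def by (rule 1) (use U in simp)
  have "x = perp x + y" unfolding perp_def y_def using U assms by (intro eq_vecI) auto
  then have "x \<bullet> x = (perp x + y) \<bullet> (perp x + y)" by simp
  also have "\<dots> = perp x \<bullet> perp x + y \<bullet> y"
    using d y yp by (simp add: scalar_prod_add add_scalar_prod scalar_prod_commute[of "perp x" y])
  finally show "perp x \<bullet> perp x \<le> x \<bullet> x" by simp
  show "dim_vec (perp x) = d" "transpose_mat U *\<^sub>v perp x = 0\<^sub>v r"
    "dim_vec z = r \<Longrightarrow> (U *\<^sub>v z) \<bullet> perp x = 0" using d 0 1 by auto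
qed

lemma W_col_B:
  assumes "j \<in> J"
  shows "W *\<^sub>v col B j = lam \<cdot>\<^sub>v (transpose_mat U *\<^sub>v dir j)"
  using stationarity[OF B B_min G W assms] resid(1)[of j] U
  by (simp add: resid_def[symmetric] dir_def mat_vec_smult smult_smult_assoc)

lemma W_col_B_norm:
  assumes "j \<in> J"
  shows "(W *\<^sub>v col B j) \<bullet> (W *\<^sub>v col B j) \<le> lam\<^sup>2"
proof -
  have "(transpose_mat U *\<^sub>v dir j) \<bullet> (transpose_mat U *\<^sub>v dir j) \<le> dir j \<bullet> dir j"
    using isometry_contraction(2)[of U] U UU dir(1)[of j] by (intro contractionD) auto
  then show ?thesis using dir[of j] assms U
    by (simp add: W_col_B power2_eq_square mult_left_le mult.assoc[symmetric])
qed

lemma Lam: "Lam \<in> carrier_mat d n" by (simp add: Lam_def)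

lemma col_Lam: "j < n \<Longrightarrow> col Lam j = (if j \<in> J then lam \<cdot>\<^sub>v perp (dir j) else 0\<^sub>v d)"
  using perp(1)[of "dir j"] dir(1)[of j] by (intro eq_vecI) (auto simp: Lam_def)

lemma T: "T \<in> carrier_mat d n" using Lam dims by (auto simp: T_def minus_carrier_mat)

lemma Q: "Q \<in> carrier_mat d n" using T U F dims by (auto simp: Q_def)

text \<open>The Frobenius norm is enough: \<open>card J\<close> columns of norm at most
  \<open>lam\<close>, and \<open>lam\<^sup>2 * card J = 9/49\<close>.\<close>

lemma Lam_norm:
  assumes "dim_vec y = n"
  shows "(Lam *\<^sub>v y) \<bullet> (Lam *\<^sub>v y) \<le> 9 / 49 * (y \<bullet> y)"
proof -
  have "(\<Sum>j<n. col Lam j \<bullet> col Lam j) = (\<Sum>j\<in>J. (lam \<cdot>\<^sub>v perp (dir j)) \<bullet> (lam \<cdot>\<^sub>v perp (dir j)))"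
    unfolding sum_split using J by (auto simp: col_Lam intro!: sum.cong sum.neutral arg_cong2[where f = plus])
  also have "\<dots> \<le> (\<Sum>j\<in>J. lam\<^sup>2)"
  proof (intro sum_mono)
    fix j assume j: "j \<in> J"
    have "perp (dir j) \<bullet> perp (dir j) \<le> 1" using perp(3)[of "dir j"] dir[of j] j by simp
    then show "(lam \<cdot>\<^sub>v perp (dir j)) \<bullet> (lam \<cdot>\<^sub>v perp (dir j)) \<le> lam\<^sup>2"
      using lam by (simp add: power2_eq_square mult_left_le mult.assoc[symmetric])
  qed
  also have "\<dots> = 9 / 49" using lam by (simp add: mult.commute)
  finally show ?thesis
    using mat_vec_Frobenius[of y Lam] Lam assms scalar_prod_self_nonneg[of y]
    by (smt (verit) carrier_matD(2) mult_right_mono)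
qed

lemma Lam_mult_zero:
  assumes "X \<in> carrier_mat k n" "\<And>j. j \<in> J \<Longrightarrow> col X j = 0\<^sub>v k"
  shows "Lam * transpose_mat X = 0\<^sub>m d k"
proof (rule eq_matI)
  fix a b assume "a < dim_row (0\<^sub>m d k)" "b < dim_col (0\<^sub>m d k)"
  then have ab: "a < d" "b < k" by auto
  have z: "Lam $$ (a, i) * X $$ (b, i) = 0" if "i < n" for i
  proof (cases "i \<in> J")
    case True
    then have "col X i $ b = 0" using assms ab by simp
    then show ?thesis using that assms ab by simp
  next
    case False
    then show ?thesis using that ab by (simp add: Lam_def)
  qed
  have "(Lam * transpose_mat X) $$ (a, b) = (\<Sum>i<n. Lam $$ (a, i) * X $$ (b, i))"
    using ab assms Lam by (simp add: scalar_prod_def atLeast0LessThan)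
  then show "(Lam * transpose_mat X) $$ (a, b) = 0\<^sub>m d k $$ (a, b)" using ab z by simp
qed (use assms Lam in auto)

lemma Lam_A: "Lam * transpose_mat A = 0\<^sub>m d r"
  using A J by (intro Lam_mult_zero) (auto simp: col_A)

lemma A_B: "A * transpose_mat B = 0\<^sub>m r r"
proof (rule eq_matI)
  fix a b assume "a < dim_row (0\<^sub>m r r)" "b < dim_col (0\<^sub>m r r)"
  then have ab: "a < r" "b < r" by auto
  have z: "A $$ (a, i) * B $$ (b, i) = 0" if "i < n" for i
  proof (cases "i \<in> J")
    case True
    then show ?thesis using that ab by (simp add: A_def)
  next
    case False
    then have "col B i $ b = 0" using suppD[OF B] ab that by simp
    then show ?thesis using that dims ab by simp
  qed
  have "(A * transpose_mat B) $$ (a, b) = (\<Sum>i<n. A $$ (a, i) * B $$ (b, i))"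
    using ab dims by (simp add: scalar_prod_def atLeast0LessThan)
  then show "(A * transpose_mat B) $$ (a, b) = 0\<^sub>m r r $$ (a, b)" using ab z by simp
qed (use dims in auto)

text \<open>Each column of \<open>B\<close> is \<open>G\<close> times a vector of norm at most
  \<open>lam\<close>. With \<open>a\<close> and \<open>b\<close> the energies of \<open>A\<close>
  and \<open>B\<close> at \<open>x\<close>, this gives \<open>b \<le> 9/49 * (a + b)\<close>.
  Solving for \<open>b\<close> gives the ratio 9/40.\<close>

lemma energy_B:
  assumes x: "dim_vec x = r"
  shows "(transpose_mat B *\<^sub>v x) \<bullet> (transpose_mat B *\<^sub>v x)
    \<le> 9 / 40 * ((transpose_mat A *\<^sub>v x) \<bullet> (transpose_mat A *\<^sub>v x))"
proof -
  have xc: "x \<in> carrier_vec r" using x by (intro carrier_vecI)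
  let ?b = "(transpose_mat B *\<^sub>v x) \<bullet> (transpose_mat B *\<^sub>v x)"
  let ?a = "(transpose_mat A *\<^sub>v x) \<bullet> (transpose_mat A *\<^sub>v x)"
  have g: "(G *\<^sub>v x) \<bullet> (G *\<^sub>v x) = ?a + ?b"
  proof -
    have "(G *\<^sub>v x) \<bullet> (G *\<^sub>v x) = x \<bullet> ((G * G) *\<^sub>v x)"
      using x dims by (simp add: mat_vec_assoc scalar_prod_adjoint[of x])
    also have "\<dots> = (transpose_mat F *\<^sub>v x) \<bullet> (transpose_mat F *\<^sub>v x)"
      using x dims F unfolding G(2) F_def[symmetric] by (simp add: mat_vec_assoc scalar_prod_adjoint[of x])
    finally show ?thesis using energy_sum[OF B x] by (simp add: F_def)
  qed
  have "?b = (\<Sum>i<n. (col B i \<bullet> x)\<^sup>2)"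
    using dims x by (subst mat_vec_transpose_norm) auto
  also have "\<dots> = (\<Sum>i\<in>J. (col B i \<bullet> x)\<^sup>2)"
    unfolding sum_split using suppD(2)[OF B] xc by (auto intro!: sum.neutral)
  also have "\<dots> \<le> (\<Sum>i\<in>J. lam\<^sup>2 * ((G *\<^sub>v x) \<bullet> (G *\<^sub>v x)))"
  proof (intro sum_mono)
    fix i assume i: "i \<in> J"
    then have bi: "col B i \<in> carrier_vec r" using dims J by auto
    have "G *\<^sub>v (W *\<^sub>v col B i) = (G * W) *\<^sub>v col B i"
      by (rule mat_vec_assoc[symmetric]) (use dims bi in auto)
    then have e: "col B i = G *\<^sub>v (W *\<^sub>v col B i)" unfolding W(3) using bi by (simp add: one_mat_vec)
    have "col B i \<bullet> x = (W *\<^sub>v col B i) \<bullet> (G *\<^sub>v x)"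
      using dims xc symmetric_scalar_prod[of G r "W *\<^sub>v col B i" x] bi by (subst e) simp
    then have "(col B i \<bullet> x)\<^sup>2 \<le> ((W *\<^sub>v col B i) \<bullet> (W *\<^sub>v col B i)) * ((G *\<^sub>v x) \<bullet> (G *\<^sub>v x))"
      using dims by (simp add: scalar_prod_Cauchy_Schwarz)
    also have "\<dots> \<le> lam\<^sup>2 * ((G *\<^sub>v x) \<bullet> (G *\<^sub>v x))"
      using W_col_B_norm[OF i] by (intro mult_right_mono) auto
    finally show "(col B i \<bullet> x)\<^sup>2 \<le> lam\<^sup>2 * ((G *\<^sub>v x) \<bullet> (G *\<^sub>v x))" .
  qed
  also have "\<dots> = (lam\<^sup>2 * real (card J)) * (?a + ?b)" unfolding g by simp
  also have "\<dots> = 9 / 49 * (?a + ?b)" unfolding lam(2) ..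
  finally show ?thesis by simp
qed

lemma T_vec: "dim_vec y = n \<Longrightarrow> T *\<^sub>v y = Lam *\<^sub>v (y - transpose_mat B *\<^sub>v (H *\<^sub>v (A *\<^sub>v y)))"
  using Lam dims by (simp add: T_def minus_mat_vec mat_vec_minus mat_vec_assoc)

lemma U_T: assumes "dim_vec y = n" shows "transpose_mat U *\<^sub>v (T *\<^sub>v y) = 0\<^sub>v r"
proof -
  have "transpose_mat U *\<^sub>v (Lam *\<^sub>v z) = 0\<^sub>v r" if z: "dim_vec z = n" for z
  proof -
    have "transpose_mat U * Lam = 0\<^sub>m r n"
    proof (rule eq_matI)
      fix a j assume "a < dim_row (0\<^sub>m r n)" "j < dim_col (0\<^sub>m r n)"
      then have aj: "a < r" "j < n" by auto
      have "transpose_mat U *\<^sub>v col Lam j = 0\<^sub>v r"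
        using perp(1,2)[of "dir j"] dir(1)[of j] U aj by (auto simp: col_Lam mat_vec_smult mat_vec_zero)
      then have "(transpose_mat U *\<^sub>v col Lam j) $ a = 0" using aj by simp
      then show "(transpose_mat U * Lam) $$ (a, j) = 0\<^sub>m r n $$ (a, j)" using aj U Lam by simp
    qed (use U Lam in auto)
    moreover have "transpose_mat U *\<^sub>v (Lam *\<^sub>v z) = (transpose_mat U * Lam) *\<^sub>v z"
      by (rule mat_vec_assoc[symmetric]) (use U Lam z in auto)
    ultimately show ?thesis using z by (simp add: zero_mat_vec)
  qed
  then show ?thesis using assms dims by (simp add: T_vec)
qed

lemma T_F: assumes x: "dim_vec x = r" shows "T *\<^sub>v (transpose_mat F *\<^sub>v x) = 0\<^sub>v d"
proof -
  have Ft: "transpose_mat F = transpose_mat A + transpose_mat B"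
    unfolding F_def using dims by (intro transpose_add) auto
  have AF: "A *\<^sub>v (transpose_mat F *\<^sub>v x) = (A * transpose_mat A) *\<^sub>v x"
  proof -
    have "A *\<^sub>v (transpose_mat F *\<^sub>v x) = (A * transpose_mat A) *\<^sub>v x + (A * transpose_mat B) *\<^sub>v x"
      using dims x by (simp add: Ft add_mat_vec mat_vec_add mat_vec_assoc)
    then show ?thesis unfolding A_B using dims x by (simp add: zero_mat_vec right_zero_vec[OF carrier_vecI])
  qed
  have "H *\<^sub>v (A *\<^sub>v (transpose_mat F *\<^sub>v x)) = (H * (A * transpose_mat A)) *\<^sub>v x"
    unfolding AF by (rule mat_vec_assoc[symmetric]) (use dims x in auto)
  also have "\<dots> = x" unfolding H(2) using x by (simp add: one_mat_vec)
  finally have "T *\<^sub>v (transpose_mat F *\<^sub>v x) = Lam *\<^sub>v (transpose_mat F *\<^sub>v x - transpose_mat B *\<^sub>v x)"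
    using F by (simp add: T_vec)
  also have "transpose_mat F *\<^sub>v x - transpose_mat B *\<^sub>v x = transpose_mat A *\<^sub>v x"
    unfolding Ft using dims x by (simp add: add_mat_vec) (intro eq_vecI, auto)
  also have "Lam *\<^sub>v (transpose_mat A *\<^sub>v x) = (Lam * transpose_mat A) *\<^sub>v x"
    by (rule mat_vec_assoc[symmetric]) (use dims x Lam in auto)
  finally show ?thesis unfolding Lam_A using x by (simp add: zero_mat_vec)
qed

text \<open>On the kernel of \<open>F\<close> the images of \<open>y\<close> under \<open>A\<close>
  and \<open>B\<close> are opposite, so the correction becomes
  \<open>u = transpose_mat B *\<^sub>v (H *\<^sub>v (B *\<^sub>v y))\<close>. Then
  \<open>energy_B\<close> turns into \<open>u \<bullet> u \<le> 9/40 * (u \<bullet> y)\<close>, that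
  is, \<open>u\<close> has at most 9/40 of the norm of \<open>y\<close>. Finally
  \<open>3/7 * (1 + 9/40) = 21/40\<close>, which leaves 19/40 for a perturbation.\<close>

lemma T_kernel_norm:
  assumes y: "dim_vec y = n" and Fy: "F *\<^sub>v y = 0\<^sub>v r"
  shows "vec_l2_norm (T *\<^sub>v y) \<le> 21 / 40 * vec_l2_norm y"
proof -
  define z where "z = B *\<^sub>v y"
  define u where "u = transpose_mat B *\<^sub>v (H *\<^sub>v z)"
  have z: "z \<in> carrier_vec r" using dims by (auto simp: z_def intro: carrier_vecI)
  have Hz: "dim_vec (H *\<^sub>v z) = r" using dims by simp
  have u: "dim_vec u = n" using dims by (simp add: u_def)
  have Ay: "A *\<^sub>v y = - z"
  proof (rule eq_vecI)
    fix a assume "a < dim_vec (- z)"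
    then have a: "a < r" using z by simp
    have "(F *\<^sub>v y) $ a = (A *\<^sub>v y + B *\<^sub>v y) $ a" unfolding F_def using dims y by (simp add: add_mat_vec)
    then show "(A *\<^sub>v y) $ a = (- z) $ a" using Fy a dims by (simp add: z_def)
  qed (use dims z in simp)
  have "H *\<^sub>v (- z) = - (H *\<^sub>v z)" using dims z by (intro eq_vecI) auto
  then have "transpose_mat B *\<^sub>v (H *\<^sub>v (A *\<^sub>v y)) = - u"
    unfolding Ay using dims by (simp add: u_def) (intro eq_vecI, auto)
  then have Ty: "T *\<^sub>v y = Lam *\<^sub>v (y + u)" using y u by (simp add: T_vec) (intro arg_cong[where f = "\<lambda>v. Lam *\<^sub>v v"] eq_vecI, auto)
  have "u \<bullet> u \<le> 9 / 40 * ((transpose_mat A *\<^sub>v (H *\<^sub>v z)) \<bullet> (transpose_mat A *\<^sub>v (H *\<^sub>v z)))"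
    unfolding u_def by (rule energy_B[OF Hz])
  also have "(transpose_mat A *\<^sub>v (H *\<^sub>v z)) \<bullet> (transpose_mat A *\<^sub>v (H *\<^sub>v z)) = (H *\<^sub>v z) \<bullet> ((A * transpose_mat A) *\<^sub>v (H *\<^sub>v z))"
    using dims Hz by (simp add: mat_vec_assoc scalar_prod_adjoint[of "H *\<^sub>v z" A])
  also have "(A * transpose_mat A) *\<^sub>v (H *\<^sub>v z) = ((A * transpose_mat A) * H) *\<^sub>v z"
    by (rule mat_vec_assoc[symmetric]) (use dims z in auto)
  also have "\<dots> = z" unfolding H(3) using z by (simp add: one_mat_vec)
  also have "(H *\<^sub>v z) \<bullet> z = u \<bullet> y"
    unfolding u_def using scalar_prod_adjoint[of "H *\<^sub>v z" B y] dims y by (simp add: z_def)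
  finally have "(vec_l2_norm u)\<^sup>2 \<le> 9 / 40 * (u \<bullet> y)" by (simp add: vec_l2_norm_square)
  also have "\<dots> \<le> 9 / 40 * (vec_l2_norm u * vec_l2_norm y)"
    using scalar_prod_le_norms[of u y] u y by simp
  finally have "vec_l2_norm u * vec_l2_norm u \<le> vec_l2_norm u * (9 / 40 * vec_l2_norm y)"
    by (simp add: power2_eq_square)
  then have un: "vec_l2_norm u \<le> 9 / 40 * vec_l2_norm y"
    using vec_l2_norm_nonneg[of u] vec_l2_norm_nonneg[of y]
    by (cases "vec_l2_norm u = 0") (auto simp: mult_le_cancel_left)
  have "vec_l2_norm (T *\<^sub>v y) \<le> 3 / 7 * vec_l2_norm (y + u)"
  proof (rule power2_le_imp_le)
    show "(vec_l2_norm (T *\<^sub>v y))\<^sup>2 \<le> (3 / 7 * vec_l2_norm (y + u))\<^sup>2"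
      using Lam_norm[of "y + u"] u unfolding Ty
      by (simp add: power_mult_distrib vec_l2_norm_square power2_eq_square[of "3 :: real"] power_divide)
  qed simp
  also have "\<dots> \<le> 3 / 7 * (vec_l2_norm y + 9 / 40 * vec_l2_norm y)"
    using vec_l2_norm_triangle[of y u] un u y by simp
  finally show ?thesis by simp
qed

section \<open>Columns and operator norm of the certificate\<close>

lemma col_Q: "i < n \<Longrightarrow> col Q i = U *\<^sub>v (W *\<^sub>v col F i) + T *\<^sub>v unit_vec n i"
proof -
  assume i: "i < n"
  have "col Q i = Q *\<^sub>v unit_vec n i" using Q i by (simp add: mat_vec_unit del: index_mult_mat_vec)
  also have "\<dots> = U *\<^sub>v (W *\<^sub>v (F *\<^sub>v unit_vec n i)) + T *\<^sub>v unit_vec n i"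
    unfolding Q_def using U dims F T by (simp add: add_mat_vec mat_vec_assoc)
  also have "F *\<^sub>v unit_vec n i = col F i" using F i by (simp add: mat_vec_unit del: index_mult_mat_vec)
  finally show ?thesis .
qed

lemma norm_orthogonal_sum:
  assumes "dim_vec x = r" "dim_vec t = d" "transpose_mat U *\<^sub>v t = 0\<^sub>v r"
  shows "(U *\<^sub>v x + t) \<bullet> (U *\<^sub>v x + t) = x \<bullet> x + t \<bullet> t"
proof -
  have "t \<bullet> (U *\<^sub>v x) = 0"
    using scalar_prod_adjoint[of t U x] assms U by (simp add: scalar_prod_left_zero[OF carrier_vecI])
  moreover have "(U *\<^sub>v x) \<bullet> (U *\<^sub>v x) = x \<bullet> x" using isometry_norm[OF UU] U assms by auto
  ultimately show ?thesis
    using assms U by (simp add: scalar_prod_add add_scalar_prod scalar_prod_commute[of "U *\<^sub>v x" t])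
qed

text \<open>The polar factor contributes the component in the range of \<open>U\<close>,
  \<open>Lam\<close> the orthogonal one; together they form the gradient of \<open>lam\<close> times
  the norm at the residual.\<close>

lemma col_Q_outlier: assumes "j \<in> J" shows "col Q j = lam \<cdot>\<^sub>v dir j"
proof -
  have j: "j < n" using assms J by auto
  have "col F j = col B j" using col_sum[OF B j] assms by (simp add: F_def)
  moreover have "A *\<^sub>v unit_vec n j = 0\<^sub>v r" using A j assms by (simp add: mat_vec_unit col_A del: index_mult_mat_vec)
  then have "T *\<^sub>v unit_vec n j = Lam *\<^sub>v (unit_vec n j - 0\<^sub>v n)"
    using dims by (simp add: T_vec mat_vec_zero)
  then have "T *\<^sub>v unit_vec n j = col Lam j" using Lam j by (simp add: mat_vec_unit del: index_mult_mat_vec)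
  ultimately have "col Q j = U *\<^sub>v (lam \<cdot>\<^sub>v (transpose_mat U *\<^sub>v dir j)) + lam \<cdot>\<^sub>v perp (dir j)"
    using j assms by (simp add: col_Q W_col_B col_Lam)
  also have "\<dots> = lam \<cdot>\<^sub>v dir j"
    unfolding perp_def using U dir(1)[of j] by (simp add: mat_vec_smult) (intro eq_vecI, auto simp: algebra_simps)
  finally show ?thesis .
qed

text \<open>The column splits orthogonally into the polar part, of squared norm at most
  \<open>ell\<close>, and the correction, of squared norm at most
  \<open>9/49 * 9/40 * ell = 81/1960 * ell\<close>. The sum \<open>2041/1960 * ell\<close> is below
  \<open>lam\<^sup>2\<close> by the locale assumption.\<close>

lemma col_Q_inlier:
  assumes i: "i < n" "i \<notin> J"
  shows "col Q i \<bullet> col Q i < lam\<^sup>2"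
proof -
  define a where "a = transpose_mat U *\<^sub>v col M i"
  have a: "a \<in> carrier_vec r" using U by (simp add: a_def carrier_vecI)
  have Fi: "col F i = a" using col_sum[OF B i(1)] i by (simp add: F_def a_def)
  have lev: "(a \<bullet> z)\<^sup>2 \<le> ell * ((transpose_mat A *\<^sub>v z) \<bullet> (transpose_mat A *\<^sub>v z))" if "z \<in> carrier_vec r" for z
    using leverage[OF i that] energy_A[of z] that by (simp add: a_def)
  define q where "q = (W *\<^sub>v a) \<bullet> (W *\<^sub>v a)"
  have q: "q \<le> ell"
  proof -
    \<comment> \<open>Testing the leverage bound at this vector makes it self-referential:
      \<open>a \<bullet> z\<close> equals \<open>q\<close> and the inlier energy at \<open>z\<close>
      is at most \<open>q\<close>, so \<open>q\<^sup>2 \<le> ell * q\<close>.\<close>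
    define z where "z = W *\<^sub>v (W *\<^sub>v a)"
    have z: "z \<in> carrier_vec r" using dims by (simp add: z_def carrier_vecI)
    have az: "a \<bullet> z = q"
      unfolding z_def q_def using dims a by (intro symmetric_scalar_prod[of W r]) (auto intro: carrier_vecI)
    have "(transpose_mat A *\<^sub>v z) \<bullet> (transpose_mat A *\<^sub>v z) \<le> (transpose_mat F *\<^sub>v z) \<bullet> (transpose_mat F *\<^sub>v z)"
      using energy_sum[OF B, of z] z by (simp add: F_def)
    also have "\<dots> = z \<bullet> ((G * G) *\<^sub>v z)"
      unfolding G(2) F_def[symmetric] using F z by (simp add: mat_vec_assoc scalar_prod_adjoint[of z F])
    also have "\<dots> = (G *\<^sub>v z) \<bullet> (G *\<^sub>v z)"
      using dims z by (simp add: mat_vec_assoc scalar_prod_adjoint[of z G])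
    also have "G *\<^sub>v z = (G * W) *\<^sub>v (W *\<^sub>v a)"
      unfolding z_def by (rule mat_vec_assoc[symmetric]) (use dims in auto)
    also have "\<dots> = W *\<^sub>v a" unfolding W(3) using dims by (simp add: one_mat_vec)
    finally have "(transpose_mat A *\<^sub>v z) \<bullet> (transpose_mat A *\<^sub>v z) \<le> q" by (simp add: q_def)
    then have "q\<^sup>2 \<le> ell * q" using lev[OF z] ell(1) unfolding az by (meson mult_left_mono order_trans)
    then have "q * q \<le> ell * q" by (simp add: power2_eq_square)
    moreover have "0 \<le> q" by (simp add: q_def)
    ultimately show ?thesis using ell(1) by (cases "q = 0") (auto simp: mult_le_cancel_right)
  qed
  define t where "t = T *\<^sub>v unit_vec n i"
  define u where "u = transpose_mat B *\<^sub>v (H *\<^sub>v a)"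
  have u: "dim_vec u = n" using dims by (simp add: u_def)
  have Hz: "dim_vec (H *\<^sub>v a) = r" using dims by simp
  have tu: "t = Lam *\<^sub>v unit_vec n i - Lam *\<^sub>v u"
  proof -
    have "A *\<^sub>v unit_vec n i = a" using A i by (simp add: mat_vec_unit col_A a_def del: index_mult_mat_vec)
    then show ?thesis using u Lam by (simp add: t_def T_vec u_def[symmetric] mat_vec_minus)
  qed
  have "Lam *\<^sub>v unit_vec n i = 0\<^sub>v d" using Lam i by (simp add: mat_vec_unit col_Lam del: index_mult_mat_vec)
  then have "t \<bullet> t = (Lam *\<^sub>v u) \<bullet> (Lam *\<^sub>v u)" using Lam u by (simp add: tu scalar_prod_def)
  also have "\<dots> \<le> 9 / 49 * (u \<bullet> u)" by (rule Lam_norm[OF u])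
  also have "u \<bullet> u \<le> 9 / 40 * ((transpose_mat A *\<^sub>v (H *\<^sub>v a)) \<bullet> (transpose_mat A *\<^sub>v (H *\<^sub>v a)))"
    unfolding u_def by (rule energy_B[OF Hz])
  also have "(transpose_mat A *\<^sub>v (H *\<^sub>v a)) \<bullet> (transpose_mat A *\<^sub>v (H *\<^sub>v a)) \<le> ell"
  proof -
    \<comment> \<open>The same device with test vector \<open>H *\<^sub>v a\<close>, whose inlier
      energy is exactly \<open>a \<bullet> (H *\<^sub>v a)\<close>.\<close>
    define p where "p = a \<bullet> (H *\<^sub>v a)"
    have "(transpose_mat A *\<^sub>v (H *\<^sub>v a)) \<bullet> (transpose_mat A *\<^sub>v (H *\<^sub>v a))
        = (H *\<^sub>v a) \<bullet> ((A * transpose_mat A) *\<^sub>v (H *\<^sub>v a))"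
      using dims Hz by (simp add: mat_vec_assoc scalar_prod_adjoint[of "H *\<^sub>v a" A])
    also have "(A * transpose_mat A) *\<^sub>v (H *\<^sub>v a) = ((A * transpose_mat A) * H) *\<^sub>v a"
      by (rule mat_vec_assoc[symmetric]) (use dims a in auto)
    also have "\<dots> = a" unfolding H(3) using a by (simp add: one_mat_vec)
    also have "(H *\<^sub>v a) \<bullet> a = p" unfolding p_def using a dims by (intro scalar_prod_commute) auto
    finally have e: "(transpose_mat A *\<^sub>v (H *\<^sub>v a)) \<bullet> (transpose_mat A *\<^sub>v (H *\<^sub>v a)) = p" .
    have "p\<^sup>2 \<le> ell * p"
      using lev[of "H *\<^sub>v a"] Hz unfolding e by (simp add: p_def carrier_vecI)
    then have "p * p \<le> ell * p" by (simp add: power2_eq_square)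
    moreover have "0 \<le> p" using e scalar_prod_self_nonneg[of "transpose_mat A *\<^sub>v (H *\<^sub>v a)"] by simp
    ultimately show ?thesis unfolding e using ell(1) by (cases "p = 0") (auto simp: mult_le_cancel_right)
  qed
  finally have t: "t \<bullet> t \<le> 81 / 1960 * ell" by simp
  have "col Q i \<bullet> col Q i = q + t \<bullet> t"
    unfolding col_Q[OF i(1)] Fi q_def t_def
    using T dims by (intro norm_orthogonal_sum U_T) auto
  then show ?thesis using q t ell(2) by simp
qed

text \<open>\<open>Q\<close> stays a dual certificate under small perturbations orthogonal to \<open>U\<close> and \<open>F\<close>; this slack
  shows that every optimal low-rank part has its columns in the range of \<open>U\<close>.\<close>

lemma contraction_Q_plus:
  assumes E: "E \<in> carrier_mat d n"
    and UE: "\<And>y. dim_vec y = n \<Longrightarrow> transpose_mat U *\<^sub>v (E *\<^sub>v y) = 0\<^sub>v r"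
    and EF: "\<And>x. dim_vec x = r \<Longrightarrow> E *\<^sub>v (transpose_mat F *\<^sub>v x) = 0\<^sub>v d"
    and En: "\<And>y. dim_vec y = n \<Longrightarrow> vec_l2_norm (E *\<^sub>v y) \<le> 19 / 40 * vec_l2_norm y"
  shows "contraction (Q + E)"
  unfolding contraction_def
proof
  fix y :: "real vec" assume "y \<in> carrier_vec (dim_col (Q + E))"
  then have y: "dim_vec y = n" using E by simp
  define w where "w = W *\<^sub>v (F *\<^sub>v y)"
  \<comment> \<open>As \<open>W * W\<close> inverts \<open>F * transpose_mat F\<close>, this is the
    orthogonal projection of \<open>y\<close> onto the row space of \<open>F\<close>. Both
    \<open>T\<close> and \<open>E\<close> vanish on it, while the polar part sees nothing
    else.\<close>
  define v where "v = transpose_mat F *\<^sub>v (W *\<^sub>v w)"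
  define y' where "y' = y - v"
  have w: "dim_vec w = r" using dims by (simp add: w_def)
  have v: "dim_vec v = n" using F by (simp add: v_def)
  have y': "dim_vec y' = n" using v by (simp add: y'_def)
  have yv: "y = y' + v" using y v by (intro eq_vecI) (auto simp: y'_def)
  have Ww: "dim_vec (W *\<^sub>v w) = r" using dims by simp
  have Fv: "F *\<^sub>v v = F *\<^sub>v y"
  proof -
    have "F *\<^sub>v v = (F * transpose_mat F) *\<^sub>v (W *\<^sub>v w)"
      unfolding v_def by (rule mat_vec_assoc[symmetric]) (use F dims in auto)
    also have "\<dots> = G *\<^sub>v (G *\<^sub>v (W *\<^sub>v w))"
      unfolding F_def G(2)[symmetric] using dims by (simp add: mat_vec_assoc)
    also have "G *\<^sub>v (W *\<^sub>v w) = (G * W) *\<^sub>v w" by (rule mat_vec_assoc[symmetric]) (use dims w in auto)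
    also have "\<dots> = w" unfolding W(3) using w by (simp add: one_mat_vec)
    also have "G *\<^sub>v w = (G * W) *\<^sub>v (F *\<^sub>v y)" unfolding w_def by (rule mat_vec_assoc[symmetric]) (use dims F in auto)
    also have "\<dots> = F *\<^sub>v y" unfolding W(3) using F by (simp add: one_mat_vec)
    finally show ?thesis .
  qed
  have Fy': "F *\<^sub>v y' = 0\<^sub>v r"
    unfolding y'_def using F y v by (simp add: mat_vec_minus Fv) (intro eq_vecI, auto)
  have vy: "v \<bullet> x = w \<bullet> (W *\<^sub>v (F *\<^sub>v x))" if "dim_vec x = n" for x
  proof -
    have "v \<bullet> x = (W *\<^sub>v w) \<bullet> (F *\<^sub>v x)"
      unfolding v_def using F Ww that by (simp add: scalar_prod_adjoint)
    also have "\<dots> = w \<bullet> (W *\<^sub>v (F *\<^sub>v x))"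
      using dims F w by (intro symmetric_scalar_prod[of W r w "F *\<^sub>v x", symmetric]) (auto intro: carrier_vecI)
    finally show ?thesis .
  qed
  have "v \<bullet> y' = 0" using vy[OF y'] Fy' dims w by (simp add: mat_vec_zero scalar_prod_def)
  moreover have "v \<bullet> v = w \<bullet> w" using vy[OF v] by (simp add: Fv w_def)
  ultimately have yy: "y \<bullet> y = y' \<bullet> y' + w \<bullet> w"
    using y' v by (subst (1 2) yv) (simp add: scalar_prod_add add_scalar_prod scalar_prod_commute[of y' v])
  define t where "t = T *\<^sub>v y' + E *\<^sub>v y'"
  have "(Q + E) *\<^sub>v y = U *\<^sub>v w + (T *\<^sub>v y + E *\<^sub>v y)"
    using E T U dims F y unfolding Q_def
    by (simp add: add_mat_vec mat_vec_assoc w_def) (intro eq_vecI, auto)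
  also have "T *\<^sub>v y + E *\<^sub>v y = t"
  proof -
    have "T *\<^sub>v y = T *\<^sub>v y' + 0\<^sub>v d" unfolding yv v_def T_F[OF Ww, symmetric]
      using T y' F by (intro mat_vec_add) auto
    moreover have "E *\<^sub>v y = E *\<^sub>v y' + 0\<^sub>v d" unfolding yv v_def EF[OF Ww, symmetric]
      using E y' F by (intro mat_vec_add) auto
    ultimately show ?thesis unfolding t_def using T E by (intro eq_vecI) auto
  qed
  finally have QEy: "(Q + E) *\<^sub>v y = U *\<^sub>v w + t" .
  have t: "dim_vec t = d" using E by (simp add: t_def)
  have "transpose_mat U *\<^sub>v t = 0\<^sub>v r"
    unfolding t_def using U T E y' by (simp add: mat_vec_add UE U_T)
  then have n2: "((Q + E) *\<^sub>v y) \<bullet> ((Q + E) *\<^sub>v y) = w \<bullet> w + t \<bullet> t"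
    unfolding QEy by (rule norm_orthogonal_sum[OF w t])
  \<comment> \<open>The two bounds add up to exactly \<open>21/40 + 19/40 = 1\<close>.\<close>
  have "vec_l2_norm t \<le> vec_l2_norm (T *\<^sub>v y') + vec_l2_norm (E *\<^sub>v y')"
    unfolding t_def using T E by (intro vec_l2_norm_triangle) simp
  also have "\<dots> \<le> vec_l2_norm y'" using T_kernel_norm[OF y' Fy'] En[OF y'] by simp
  finally have "t \<bullet> t \<le> y' \<bullet> y'" by (simp add: vec_l2_norm_def)
  then show "((Q + E) *\<^sub>v y) \<bullet> ((Q + E) *\<^sub>v y) \<le> y \<bullet> y" unfolding n2 yy by simp
qed


section \<open>Duality gap and support of the optimal solutions\<close>

lemma col_M: "i < n \<Longrightarrow> col M i = U *\<^sub>v col F i + (if i \<in> J then resid i else 0\<^sub>v d)"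
proof -
  assume i: "i < n"
  have Fi: "col F i = (if i \<in> J then col B i else transpose_mat U *\<^sub>v col M i)"
    using col_sum[OF B i] by (simp add: F_def)
  show ?thesis
  proof (cases "i \<in> J")
    case True
    then show ?thesis using Fi M U by (intro eq_vecI) (auto simp: resid_def)
  next
    case False
    then have "U *\<^sub>v col F i = col M i" using Fi inlier[OF i False] by simp
    then show ?thesis using False M i by simp
  qed
qed

lemma U_orthogonal:
  assumes "dim_vec x = r" "dim_vec t = d" "transpose_mat U *\<^sub>v t = 0\<^sub>v r"
  shows "t \<bullet> (U *\<^sub>v x) = 0"
  using scalar_prod_adjoint[of t U x] assms U by (simp add: scalar_prod_left_zero[OF carrier_vecI])

text \<open>Zero duality gap at the restricted optimum: in each column the polar part of
  \<open>Q\<close> pairs to the nuclear norm, \<open>lam \<cdot>\<^sub>v dir i\<close> pairs to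
  \<open>lam\<close> times the residual norm, and all cross terms vanish by orthogonality to
  \<open>U\<close>.\<close>

lemma primal_value:
  "lam * norm_1_2 (M - U * F) + nuclear_norm (U * F) = mat_trace (transpose_mat Q * M)"
proof -
  have cF: "dim_vec (col F i) = r" for i using F by simp
  have cols: "col (M - U * F) i = (if i \<in> J then resid i else 0\<^sub>v d)" if i: "i < n" for i
  proof -
    have "col (M - U * F) i = col M i - U *\<^sub>v col F i" using i M U F by (intro eq_vecI) auto
    then show ?thesis unfolding col_M[OF i] using resid(1)[of i] U by (auto intro!: eq_vecI)
  qed
  have "norm_1_2 (M - U * F) = (\<Sum>i<n. vec_l2_norm (if i \<in> J then resid i else 0\<^sub>v d))"
    unfolding norm_1_2_def using M U F cols by (intro sum.cong) auto
  also have "\<dots> = (\<Sum>i<n. if i \<in> J then vec_l2_norm (resid i) else 0)"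
    by (intro sum.cong) (auto simp: vec_l2_norm_def)
  finally have nc: "norm_1_2 (M - U * F) = (\<Sum>i<n. if i \<in> J then vec_l2_norm (resid i) else 0)" .
  have "nuclear_norm (U * F) = mat_trace G"
    by (rule nuclear_norm_isometry_mult(1)[OF U UU F G(1) _ W]) (simp add: G(2) F_def)
  also have "\<dots> = mat_trace (transpose_mat (U * (W * F)) * (U * F))"
    by (rule nuclear_norm_isometry_mult(3)[OF U UU F G(1) _ W, symmetric]) (simp add: G(2) F_def)
  also have "\<dots> = (\<Sum>i<n. col (U * (W * F)) i \<bullet> col (U * F) i)"
    using U F dims by (subst mat_trace_mult_transpose) auto
  also have "\<dots> = (\<Sum>i<n. (U *\<^sub>v (W *\<^sub>v col F i)) \<bullet> (U *\<^sub>v col F i))"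
  proof (intro sum.cong refl)
    fix i assume "i \<in> {..<n}"
    then have i: "i < n" by simp
    have "col (U * (W * F)) i = U *\<^sub>v (W *\<^sub>v col F i)"
      using col_mult2[of U d r "W * F" n i] col_mult2[of W r r F n i] U F dims i by simp
    moreover have "col (U * F) i = U *\<^sub>v col F i" using U F i by (intro col_mult2[of _ d r _ n]) auto
    ultimately show "col (U * (W * F)) i \<bullet> col (U * F) i = (U *\<^sub>v (W *\<^sub>v col F i)) \<bullet> (U *\<^sub>v col F i)" by simp
  qed
  finally have nn: "nuclear_norm (U * F) = (\<Sum>i<n. (U *\<^sub>v (W *\<^sub>v col F i)) \<bullet> (U *\<^sub>v col F i))" .
  have "mat_trace (transpose_mat Q * M) = (\<Sum>i<n. col Q i \<bullet> col M i)"
    using M Q by (subst mat_trace_mult_transpose) auto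
  also have "\<dots> = (\<Sum>i<n. (U *\<^sub>v (W *\<^sub>v col F i)) \<bullet> (U *\<^sub>v col F i) + lam * (if i \<in> J then vec_l2_norm (resid i) else 0))"
  proof (intro sum.cong refl)
    fix i assume "i \<in> {..<n}"
    then have i: "i < n" by simp
    have t: "(T *\<^sub>v unit_vec n i) \<bullet> (U *\<^sub>v col F i) = 0"
      by (rule U_orthogonal[OF cF _ U_T]) (use T in auto)
    have 1: "col Q i \<bullet> (U *\<^sub>v col F i) = (U *\<^sub>v (W *\<^sub>v col F i)) \<bullet> (U *\<^sub>v col F i)"
      unfolding col_Q[OF i] using U T t by (simp add: add_scalar_prod)
    have 2: "col Q i \<bullet> (if i \<in> J then resid i else 0\<^sub>v d) = lam * (if i \<in> J then vec_l2_norm (resid i) else 0)"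
    proof (cases "i \<in> J")
      case True
      have "resid i \<bullet> resid i = vec_l2_norm (resid i) * vec_l2_norm (resid i)"
        using vec_l2_norm_square[of "resid i"] by (simp add: power2_eq_square)
      then show ?thesis using True resid[of i] col_Q_outlier[OF True] by (simp add: dir_def)
    next
      case False
      then show ?thesis using Q i scalar_prod_right_zero[of "col Q i" d] by simp
    qed
    have "col Q i \<bullet> col M i = col Q i \<bullet> (U *\<^sub>v col F i) + col Q i \<bullet> (if i \<in> J then resid i else 0\<^sub>v d)"
      unfolding col_M[OF i] using U Q resid(1)[of i] by (intro scalar_prod_add) auto
    then show "col Q i \<bullet> col M i = (U *\<^sub>v (W *\<^sub>v col F i)) \<bullet> (U *\<^sub>v col F i) + lam * (if i \<in> J then vec_l2_norm (resid i) else 0)"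
      unfolding 1 2 .
  qed
  also have "\<dots> = nuclear_norm (U * F) + lam * norm_1_2 (M - U * F)"
    unfolding nn nc by (simp add: sum.distrib sum_distrib_left)
  finally show ?thesis by simp
qed

text \<open>Weak duality with the perturbed certificate \<open>Q + E\<close>, against
  \<open>primal_value\<close>, forces \<open>eps * N + (\<Sum>i<n. gap i) \<le> 0\<close> with
  nonnegative terms. Vanishing gaps clear \<open>C'\<close> on the inliers, where \<open>Q\<close>
  is strict. Conversely, \<open>N = 0\<close> puts \<open>L'\<close> into the range of
  \<open>U\<close>, which contains no outlier column, so \<open>C'\<close> cannot vanish on
  \<open>J\<close>.\<close>

lemma optimal_support:
  assumes L': "L' \<in> carrier_mat d n" and C': "C' \<in> carrier_mat d n" and LC: "L' + C' = M"
    and opt: "lam * norm_1_2 C' + nuclear_norm L' \<le> lam * norm_1_2 (M - U * F) + nuclear_norm (U * F)"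
  shows "nonzero_cols C' = J"
proof -
  define V where "V = transpose_mat F * W"
  have V: "V \<in> carrier_mat n r" using F dims by (simp add: V_def)
  have Vt: "transpose_mat V = W * F" using F dims by (simp add: V_def mat_transpose_mult)
  have VV: "transpose_mat V * V = 1\<^sub>m r"
  proof -
    have "transpose_mat V * V = W * ((F * transpose_mat F) * W)"
      using F dims by (simp add: Vt, simp add: V_def mat_assoc)
    also have "F * transpose_mat F = G * G" by (simp add: G(2) F_def)
    also have "W * ((G * G) * W) = 1\<^sub>m r"
      using dims W(2,3) by (simp add: mat_assoc mat_cancel_left[OF W(2)])
    finally show ?thesis .
  qed
  define PU where "PU = 1\<^sub>m d - U * transpose_mat U"
  define PV where "PV = 1\<^sub>m n - V * transpose_mat V"
  have PU: "PU \<in> carrier_mat d d" "transpose_mat PU = PU" and PV: "PV \<in> carrier_mat n n" "transpose_mat PV = PV"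
    using U V by (auto simp: PU_def PV_def minus_carrier_mat mat_transpose_minus mat_transpose_mult)
  have PUv: "PU *\<^sub>v x = x - U *\<^sub>v (transpose_mat U *\<^sub>v x)" if "dim_vec x = d" for x
    using U that by (simp add: PU_def minus_mat_vec one_mat_vec mat_vec_assoc)
  have PVv: "PV *\<^sub>v x = x - V *\<^sub>v (transpose_mat V *\<^sub>v x)" if "dim_vec x = n" for x
    using V that by (simp add: PV_def minus_mat_vec one_mat_vec mat_vec_assoc)
  have UPU: "transpose_mat U *\<^sub>v (PU *\<^sub>v x) = 0\<^sub>v r" if "dim_vec x = d" for x
    using perp(2)[OF that] PUv[OF that] by (simp add: perp_def)
  have PVF: "PV *\<^sub>v (transpose_mat F *\<^sub>v x) = 0\<^sub>v n" if x: "dim_vec x = r" for x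
  proof -
    have FV: "transpose_mat F = V * G" using F dims W(2) by (simp add: V_def mat_assoc)
    have "transpose_mat V *\<^sub>v (transpose_mat F *\<^sub>v x) = (transpose_mat V * V) *\<^sub>v (G *\<^sub>v x)"
      unfolding FV using V dims x by (simp add: mat_vec_assoc)
    also have "\<dots> = G *\<^sub>v x" unfolding VV using dims by (simp add: one_mat_vec)
    finally have "PV *\<^sub>v (transpose_mat F *\<^sub>v x) = transpose_mat F *\<^sub>v x - V *\<^sub>v (G *\<^sub>v x)"
      using F by (simp add: PVv)
    also have "V *\<^sub>v (G *\<^sub>v x) = transpose_mat F *\<^sub>v x"
      unfolding FV using V dims x by (simp add: mat_vec_assoc)
    finally show ?thesis using F by (simp add: minus_cancel_vec[OF carrier_vecI])
  qed
  have PUPU: "PU * PU = PU"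
  proof (rule mat_eqI_vec[of _ d d])
    fix x :: "real vec" assume x: "x \<in> carrier_vec d"
    have "PU *\<^sub>v (PU *\<^sub>v x) = PU *\<^sub>v x - U *\<^sub>v (transpose_mat U *\<^sub>v (PU *\<^sub>v x))"
      using PU by (intro PUv) simp
    also have "\<dots> = PU *\<^sub>v x"
      using UPU[of x] x U PU by (simp add: mat_vec_zero minus_zero_vec[OF carrier_vecI])
    finally show "PU * PU *\<^sub>v x = PU *\<^sub>v x" using x PU by (simp add: mat_vec_assoc)
  qed (use PU in auto)
  have PVPV: "PV * PV = PV"
  proof (rule mat_eqI_vec[of _ n n])
    fix x :: "real vec" assume x: "x \<in> carrier_vec n"
    have "PV *\<^sub>v (PV *\<^sub>v x) = PV *\<^sub>v x - PV *\<^sub>v (transpose_mat F *\<^sub>v (W *\<^sub>v (transpose_mat V *\<^sub>v x)))"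
      using x PV V F dims by (subst (2) PVv) (auto simp: mat_vec_minus V_def mat_vec_assoc)
    also have "\<dots> = PV *\<^sub>v x" using PVF[of "W *\<^sub>v (transpose_mat V *\<^sub>v x)"] dims PV
      by (simp add: minus_zero_vec[OF carrier_vecI])
    finally show "PV * PV *\<^sub>v x = PV *\<^sub>v x" using x PV by (simp add: mat_vec_assoc)
  qed (use PV in auto)
  \<comment> \<open>The part of the competitor outside both the range of \<open>U\<close> and the
    row space of \<open>F\<close>. As \<open>PU\<close> and \<open>PV\<close> are projections,
    pairing it with \<open>L'\<close> gives its squared Frobenius norm \<open>N\<close>.\<close>
  define Y where "Y = PU * (L' * PV)"
  have Y: "Y \<in> carrier_mat d n" using PU PV L' by (simp add: Y_def)
  define N where "N = (\<Sum>j<n. col Y j \<bullet> col Y j)"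
  have N0: "0 \<le> N" unfolding N_def by (intro sum_nonneg) auto
  \<comment> \<open>The operator norm of \<open>Y\<close> is at most the square root of
    \<open>N\<close>, hence at most \<open>1 + N\<close>. This form avoids the root and covers
    \<open>N = 0\<close>.\<close>
  define eps where "eps = 19 / 40 / (1 + N)"
  have eps: "0 < eps" using N0 by (simp add: eps_def)
  define E where "E = eps \<cdot>\<^sub>m Y"
  have E: "E \<in> carrier_mat d n" using Y by (simp add: E_def)
  have Ev: "E *\<^sub>v y = eps \<cdot>\<^sub>v (Y *\<^sub>v y)" if "dim_vec y = n" for y
    using that Y by (simp add: E_def smult_mat_vec)
  have con: "contraction (Q + E)"
  proof (rule contraction_Q_plus[OF E])
    fix y :: "real vec" assume y: "dim_vec y = n"
    have "Y *\<^sub>v y = PU *\<^sub>v (L' *\<^sub>v (PV *\<^sub>v y))" using PU PV L' y by (simp add: Y_def mat_vec_assoc)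
    then have "transpose_mat U *\<^sub>v (Y *\<^sub>v y) = 0\<^sub>v r" using L' by (simp add: UPU)
    then show "transpose_mat U *\<^sub>v (E *\<^sub>v y) = 0\<^sub>v r" using U Y y by (simp add: Ev mat_vec_smult smult_vec_zero)
    have "(Y *\<^sub>v y) \<bullet> (Y *\<^sub>v y) \<le> N * (y \<bullet> y)"
      using mat_vec_Frobenius[of y Y] Y y by (simp add: N_def)
    also have "N * (y \<bullet> y) \<le> (1 + N)\<^sup>2 * (y \<bullet> y)"
      using N0 by (intro mult_right_mono) (auto simp: power2_eq_square algebra_simps)
    finally have "(vec_l2_norm (Y *\<^sub>v y))\<^sup>2 \<le> (1 + N)\<^sup>2 * (vec_l2_norm y)\<^sup>2"
      unfolding vec_l2_norm_square .
    then have "vec_l2_norm (Y *\<^sub>v y) \<le> (1 + N) * vec_l2_norm y"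
      using N0 by (intro power2_le_imp_le[of "vec_l2_norm (Y *\<^sub>v y)"]) (auto simp: power_mult_distrib)
    then have "eps * vec_l2_norm (Y *\<^sub>v y) \<le> 19 / 40 * vec_l2_norm y"
      using N0 by (simp add: eps_def field_simps)
    moreover have "vec_l2_norm (E *\<^sub>v y) = eps * vec_l2_norm (Y *\<^sub>v y)"
      using eps by (simp add: Ev[OF y] vec_l2_norm_def real_sqrt_mult mult.assoc[symmetric])
    ultimately show "vec_l2_norm (E *\<^sub>v y) \<le> 19 / 40 * vec_l2_norm y" by simp
  next
    fix x :: "real vec" assume x: "dim_vec x = r"
    have "Y *\<^sub>v (transpose_mat F *\<^sub>v x) = 0\<^sub>v d"
      using PU PV L' F PVF[OF x] by (simp add: Y_def mat_vec_assoc mat_vec_zero)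
    then show "E *\<^sub>v (transpose_mat F *\<^sub>v x) = 0\<^sub>v d" using F by (simp add: Ev smult_vec_zero)
  qed
  have trY: "mat_trace (transpose_mat Y * L') = N"
  proof -
    have "N = mat_trace (transpose_mat Y * Y)"
      using Y by (subst mat_trace_mult_transpose) (auto simp: N_def)
    also have "\<dots> = mat_trace ((transpose_mat Y * (PU * L')) * PV)"
      using Y PU PV L' by (simp add: Y_def mat_assoc)
    also have "\<dots> = mat_trace (PV * (transpose_mat Y * (PU * L')))"
      using Y PU PV L' by (intro mat_trace_mult_commute) auto
    also have "PV * (transpose_mat Y * (PU * L')) = (PV * PV) * (transpose_mat L' * ((PU * PU) * L'))"
      using PU PV L' by (simp add: Y_def mat_transpose_mult mat_assoc)
    also have "\<dots> = transpose_mat Y * L'"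
      unfolding PUPU PVPV using PU PV L' by (simp add: Y_def mat_transpose_mult mat_assoc)
    finally show ?thesis ..
  qed
  have QE: "mat_trace (transpose_mat (Q + E) * L') = mat_trace (transpose_mat Q * L') + eps * N"
  proof -
    have "mat_trace (transpose_mat (Q + E) * L') = (\<Sum>i<n. col Q i \<bullet> col L' i + eps * (col Y i \<bullet> col L' i))"
      using Q E L' Y by (subst mat_trace_mult_transpose)
        (auto simp: E_def add_scalar_prod col_add[of _ d n] intro!: sum.cong)
    also have "\<dots> = mat_trace (transpose_mat Q * L') + eps * mat_trace (transpose_mat Y * L')"
      using Q L' Y by (subst (1 2) mat_trace_mult_transpose) (auto simp: sum.distrib sum_distrib_left)
    finally show ?thesis unfolding trY .
  qed
  have QEc: "Q + E \<in> carrier_mat d n" using Q E by simp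
  have low: "mat_trace (transpose_mat Q * L') + eps * N \<le> nuclear_norm L'"
    using nuclear_norm_dual[OF L' QEc con] QE by simp
  \<comment> \<open>Slack of the columnwise Cauchy-Schwarz bound. It is nonnegative because no
    column of \<open>Q\<close> is longer than \<open>lam\<close>, and positive for a nonzero column
    where the column of \<open>Q\<close> is strictly shorter.\<close>
  define gap where "gap i = lam * vec_l2_norm (col C' i) - col Q i \<bullet> col C' i" for i
  have qn: "vec_l2_norm (col Q i) \<le> lam" "i \<notin> J \<Longrightarrow> vec_l2_norm (col Q i) < lam" if i: "i < n" for i
  proof -
    have s: "vec_l2_norm (col Q i) < lam" if iJ: "i \<notin> J"
    proof -
      have "sqrt (col Q i \<bullet> col Q i) < sqrt (lam\<^sup>2)"
        by (rule real_sqrt_less_mono[OF col_Q_inlier[OF i iJ]])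
      then show ?thesis using lam by (simp add: vec_l2_norm_def)
    qed
    show "i \<notin> J \<Longrightarrow> vec_l2_norm (col Q i) < lam" using s .
    show "vec_l2_norm (col Q i) \<le> lam"
    proof (cases "i \<in> J")
      case True
      then have "vec_l2_norm (col Q i) = lam"
        using dir[of i] lam by (simp add: vec_l2_norm_def col_Q_outlier real_sqrt_mult)
      then show ?thesis by simp
    qed (use s in auto)
  qed
  have gap_ge: "(lam - vec_l2_norm (col Q i)) * vec_l2_norm (col C' i) \<le> gap i" if "i < n" for i
    using scalar_prod_le_norms[of "col Q i" "col C' i"] Q C' that by (simp add: gap_def algebra_simps)
  have gap0: "0 \<le> gap i" if "i < n" for i
  proof -
    have "0 \<le> (lam - vec_l2_norm (col Q i)) * vec_l2_norm (col C' i)"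
      using qn(1)[OF that] by (intro mult_nonneg_nonneg) auto
    then show ?thesis using gap_ge[OF that] by linarith
  qed
  have "mat_trace (transpose_mat Q * M) = mat_trace (transpose_mat Q * L') + (\<Sum>i<n. col Q i \<bullet> col C' i)"
  proof -
    have "mat_trace (transpose_mat Q * M) = (\<Sum>i<n. col Q i \<bullet> col M i)"
      using Q M by (subst mat_trace_mult_transpose) auto
    also have "\<dots> = (\<Sum>i<n. col Q i \<bullet> col L' i + col Q i \<bullet> col C' i)"
    proof (intro sum.cong refl)
      fix i assume "i \<in> {..<n}"
      then have "col M i = col L' i + col C' i" unfolding LC[symmetric] using L' C' by (intro col_add) auto
      then show "col Q i \<bullet> col M i = col Q i \<bullet> col L' i + col Q i \<bullet> col C' i"
        using Q L' C' by (simp add: scalar_prod_add)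
    qed
    also have "\<dots> = mat_trace (transpose_mat Q * L') + (\<Sum>i<n. col Q i \<bullet> col C' i)"
      using Q L' by (subst mat_trace_mult_transpose) (auto simp: sum.distrib)
    finally show ?thesis .
  qed
  moreover have "lam * norm_1_2 C' = (\<Sum>i<n. gap i) + (\<Sum>i<n. col Q i \<bullet> col C' i)"
    using C' by (simp add: norm_1_2_def gap_def sum_distrib_left sum_subtractf)
  ultimately have tot: "eps * N + (\<Sum>i<n. gap i) \<le> 0" using low opt primal_value by simp
  have sg: "0 \<le> (\<Sum>i<n. gap i)" using gap0 by (intro sum_nonneg) auto
  have eN: "0 \<le> eps * N" using eps N0 by simp
  have "eps * N = 0" "(\<Sum>i<n. gap i) = 0" using tot sg eN by linarith+
  then have NN: "N = 0" and gz: "\<And>i. i < n \<Longrightarrow> gap i = 0"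
    using eps gap0 sum_nonneg_eq_0_iff[of "{..<n}" gap] by auto
  have C0: "col C' i = 0\<^sub>v d" if i: "i < n" "i \<notin> J" for i
  proof -
    have "(lam - vec_l2_norm (col Q i)) * vec_l2_norm (col C' i) \<le> 0" using gap_ge[OF i(1)] gz[OF i(1)] by simp
    then have "vec_l2_norm (col C' i) = 0"
      using qn(2)[OF i] vec_l2_norm_nonneg[of "col C' i"] by (simp add: mult_le_0_iff)
    then show ?thesis using vec_l2_norm_eq_0[of "col C' i" d] C' i by simp
  qed
  have Y0: "Y = 0\<^sub>m d n"
  proof (rule eq_matI)
    fix a j assume "a < dim_row (0\<^sub>m d n)" "j < dim_col (0\<^sub>m d n)"
    then have aj: "a < d" "j < n" by auto
    have "col Y j \<bullet> col Y j = 0"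
      using NN aj sum_nonneg_eq_0_iff[of "{..<n}" "\<lambda>j. col Y j \<bullet> col Y j"] by (auto simp: N_def)
    then have "col Y j = 0\<^sub>v d" using scalar_prod_self_eq_0[of "col Y j" d] Y aj by simp
    then have "col Y j $ a = 0" using aj by simp
    then show "Y $$ (a, j) = 0\<^sub>m d n $$ (a, j)" using Y aj by simp
  qed (use Y in auto)
  define X where "X = PU * L'"
  have X: "X \<in> carrier_mat d n" using PU L' by (simp add: X_def)
  have colX: "col X i = PU *\<^sub>v col L' i" if "i < n" for i
    unfolding X_def using PU L' that by (intro col_mult2[of _ d d _ n]) auto
  have X0: "col X i = 0\<^sub>v d" if i: "i < n" "i \<notin> J" for i
  proof -
    have "col M i = col L' i + col C' i" unfolding LC[symmetric] using L' C' i by (intro col_add) auto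
    then have "col L' i = col M i" using C0[OF i] L' i right_zero_vec[of "col L' i" d] by simp
    then have "col X i = col M i - col M i" using colX[OF i(1)] M inlier[OF i] by (simp add: PUv)
    then show ?thesis using M i by simp
  qed
  \<comment> \<open>The vector \<open>y\<close> lies in the range of \<open>V\<close>, so
    \<open>transpose_mat V\<close> preserves its norm. It is also supported on \<open>J\<close>,
    where \<open>transpose_mat V\<close> acts as \<open>W * B\<close>, of squared Frobenius norm at
    most 9/49. Both can hold only for \<open>y = 0\<close>.\<close>
  have Xt: "transpose_mat X *\<^sub>v x = 0\<^sub>v n" if x: "dim_vec x = d" for x
  proof -
    define y where "y = transpose_mat X *\<^sub>v x"
    have y: "dim_vec y = n" using X by (simp add: y_def)
    have yi: "y $ i = 0" if "i < n" "i \<notin> J" for i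
      using X0[OF that] X that x by (simp add: y_def scalar_prod_left_zero[OF carrier_vecI])
    have "PV *\<^sub>v y = transpose_mat Y *\<^sub>v x"
      using PU PV L' x by (simp add: y_def X_def Y_def mat_transpose_mult mat_vec_assoc)
    then have PVy: "PV *\<^sub>v y = 0\<^sub>v n" unfolding Y0 using x by (simp add: zero_mat_vec)
    define v where "v = transpose_mat V *\<^sub>v y"
    have "y \<bullet> (PV *\<^sub>v y) = y \<bullet> y - v \<bullet> v"
      using y V by (simp add: PVv scalar_prod_minus v_def scalar_prod_adjoint[of y V])
    then have yv: "y \<bullet> y = v \<bullet> v" unfolding PVy using y by (simp add: scalar_prod_right_zero[OF carrier_vecI])
    have "F *\<^sub>v y = B *\<^sub>v y"
    proof (rule eq_vecI)
      fix a assume "a < dim_vec (B *\<^sub>v y)"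
      then have a: "a < r" using dims by simp
      have "A $$ (a, i) * y $ i = 0" if "i < n" for i
        using yi[OF that] that a by (cases "i \<in> J") (auto simp: A_def)
      then have "(\<Sum>i = 0..<n. A $$ (a, i) * y $ i) = 0" by (intro sum.neutral) simp
      then have "(A *\<^sub>v y) $ a = 0" using a y dims by (simp add: scalar_prod_def)
      then show "(F *\<^sub>v y) $ a = (B *\<^sub>v y) $ a"
        unfolding F_def using a y dims by (simp add: add_mat_vec del: index_mult_mat_vec)
    qed (use F dims in simp)
    then have v: "v = (W * B) *\<^sub>v y" unfolding v_def Vt using F dims y by (simp add: mat_vec_assoc)
    have WB: "W * B \<in> carrier_mat r n" using dims by simp
    have "(\<Sum>j<n. col (W * B) j \<bullet> col (W * B) j) = (\<Sum>j<n. (W *\<^sub>v col B j) \<bullet> (W *\<^sub>v col B j))"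
    proof (intro sum.cong refl)
      fix j assume "j \<in> {..<n}"
      then have "col (W * B) j = W *\<^sub>v col B j" using dims by (intro col_mult2[of _ r r _ n]) auto
      then show "col (W * B) j \<bullet> col (W * B) j = (W *\<^sub>v col B j) \<bullet> (W *\<^sub>v col B j)" by simp
    qed
    also have "\<dots> \<le> (\<Sum>j\<in>J. lam\<^sup>2)"
    proof -
      have "(W *\<^sub>v col B j) \<bullet> (W *\<^sub>v col B j) = 0" if "j \<in> {..<n} - J" for j
        using that suppD(2)[OF B, of j] dims by (auto simp: mat_vec_zero)
      then have "(\<Sum>j\<in>{..<n} - J. (W *\<^sub>v col B j) \<bullet> (W *\<^sub>v col B j)) = 0" by (intro sum.neutral) blast
      moreover have "(\<Sum>j\<in>J. (W *\<^sub>v col B j) \<bullet> (W *\<^sub>v col B j)) \<le> (\<Sum>j\<in>J. lam\<^sup>2)"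
        by (intro sum_mono W_col_B_norm)
      ultimately show ?thesis unfolding sum_split by linarith
    qed
    also have "\<dots> = 9 / 49" using lam by (simp add: mult.commute)
    finally have fr: "(\<Sum>j<n. col (W * B) j \<bullet> col (W * B) j) \<le> 9 / 49" .
    have "v \<bullet> v \<le> (\<Sum>j<n. col (W * B) j \<bullet> col (W * B) j) * (y \<bullet> y)"
      unfolding v using mat_vec_Frobenius[of y "W * B"] y dims by simp
    then have "y \<bullet> y \<le> (\<Sum>j<n. col (W * B) j \<bullet> col (W * B) j) * (y \<bullet> y)" using yv by simp
    also have "\<dots> \<le> 9 / 49 * (y \<bullet> y)" using fr by (intro mult_right_mono) auto
    finally have "y \<bullet> y = 0" using scalar_prod_self_nonneg[of y] by linarith
    then show ?thesis using scalar_prod_self_eq_0[of y n] y by (simp add: y_def[symmetric] carrier_vecI)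
  qed
  have Cnz: "col C' j \<noteq> 0\<^sub>v d" if j: "j \<in> J" for j
  proof
    assume 0: "col C' j = 0\<^sub>v d"
    have jn: "j < n" using j J by auto
    have "col M j = col L' j + col C' j" unfolding LC[symmetric] using L' C' jn by (intro col_add) auto
    then have "col L' j = col M j" using 0 L' jn right_zero_vec[of "col L' j" d] by simp
    then have Xj: "col X j = col M j - U *\<^sub>v (transpose_mat U *\<^sub>v col M j)"
      using colX[OF jn] M by (simp add: PUv)
    have "(transpose_mat X *\<^sub>v col X j) $ j = 0" using Xt[of "col X j"] X jn by simp
    then have "col X j \<bullet> col X j = 0" using X jn by simp
    then have X0: "col X j = 0\<^sub>v d" using scalar_prod_self_eq_0[of "col X j" d] X jn by simp
    have "U *\<^sub>v (transpose_mat U *\<^sub>v col M j) = col M j"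
    proof (rule eq_vecI)
      fix a assume "a < dim_vec (col M j)"
      then have a: "a < d" using M by simp
      have "(col M j - U *\<^sub>v (transpose_mat U *\<^sub>v col M j)) $ a = 0"
        using a unfolding Xj[symmetric] X0 by simp
      then show "(U *\<^sub>v (transpose_mat U *\<^sub>v col M j)) $ a = col M j $ a" using a U M by simp
    qed (use U M in simp)
    then show False using outlier[OF j] by simp
  qed
  show ?thesis
    unfolding nonzero_cols_def using C' C0 Cnz J by auto
qed

end

context outlier_pursuit
begin

theorem solution_support:
  assumes "L' \<in> carrier_mat d n" "C' \<in> carrier_mat d n" "L' + C' = M"
    and opt: "\<And>L C. L \<in> carrier_mat d n \<Longrightarrow> C \<in> carrier_mat d n \<Longrightarrow> L + C = M \<Longrightarrow>
      lam * norm_1_2 C' + nuclear_norm L' \<le> lam * norm_1_2 C + nuclear_norm L"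
  shows "nonzero_cols C' = J"
proof -
  obtain B where B: "supp B" "\<And>B'. supp B' \<Longrightarrow> restricted_cost B \<le> restricted_cost B'"
    using restricted_cost_minimizer by blast
  obtain G W where G: "pos_def r G" "G * G = (A + B) * transpose_mat (A + B)"
    and W: "pos_def r W" "W * G = 1\<^sub>m r" "G * W = 1\<^sub>m r"
    using pos_def_sqrt[OF gram_pos_def[OF B(1)]] by metis
  obtain H where H: "pos_def r H" "H * (A * transpose_mat A) = 1\<^sub>m r" "(A * transpose_mat A) * H = 1\<^sub>m r"
    using pos_def_inverse[OF gram_A_pos_def] by metis
  interpret outlier_certificate M U d n r J lam ell B G W H
    using B G W H by unfold_locales auto
  have UF: "U * F \<in> carrier_mat d n" "M - U * F \<in> carrier_mat d n"
    using U F M by (auto simp: minus_carrier_mat)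
  show ?thesis
  proof (rule optimal_support[OF assms(1-3)], rule opt[OF UF])
    show "U * F + (M - U * F) = M" using U F M by (intro eq_matI) auto
  qed
qed

end

section \<open>Trace inequalities for rank-one updates\<close>

text \<open>A supermartingale estimate in counting form, with mean factor \<open>c / card A\<close>
  per draw. New draws enter at the head, matching the recursions of \<open>gram\<close> and
  \<open>resolvent\<close>, and the bound on the length lets \<open>c\<close> depend on the final
  sample size.\<close>

lemma sum_lists_bound:
  fixes f :: "'b list \<Rightarrow> real"
  assumes "finite A" "0 \<le> c"
    and step: "\<And>xs. set xs \<subseteq> A \<Longrightarrow> length xs < n \<Longrightarrow> (\<Sum>x\<in>A. f (x # xs)) \<le> c * f xs"
  shows "(\<Sum>xs | set xs \<subseteq> A \<and> length xs = n. f xs) \<le> c ^ n * f []"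
  using step
proof (induction n)
  case 0
  have "{xs. set xs \<subseteq> A \<and> length xs = 0} = {[]}" by auto
  then show ?case by simp
next
  case (Suc n)
  let ?L = "\<lambda>n. {xs. set xs \<subseteq> A \<and> length xs = n}"
  have fin: "finite (?L n)" using assms(1) by (rule finite_lists_length_eq)
  have "(\<Sum>xs\<in>?L (Suc n). f xs) = (\<Sum>p\<in>?L n \<times> A. f (snd p # fst p))"
    unfolding lists_length_Suc_eq by (subst sum.reindex) (auto simp: inj_on_def case_prod_beta)
  also have "\<dots> = (\<Sum>xs\<in>?L n. \<Sum>x\<in>A. f (x # xs))"
    using fin assms(1) by (subst sum.cartesian_product) (simp add: case_prod_beta)
  also have "\<dots> \<le> (\<Sum>xs\<in>?L n. c * f xs)" using Suc.prems by (intro sum_mono) auto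
  also have "\<dots> = c * (\<Sum>xs\<in>?L n. f xs)" by (simp add: sum_distrib_left)
  also have "\<dots> \<le> c * (c ^ n * f [])" using Suc.IH Suc.prems assms(2) by (intro mult_left_mono) auto
  finally show ?case by (simp add: mult.assoc)
qed

section \<open>Moments of positive semidefinite matrices\<close>

abbreviation pw :: "real mat \<Rightarrow> nat \<Rightarrow> real vec \<Rightarrow> real vec" where
  "pw A k \<equiv> (mult_mat_vec A ^^ k)"

definition psd :: "nat \<Rightarrow> real mat \<Rightarrow> bool" where
  "psd r A \<longleftrightarrow> A \<in> carrier_mat r r \<and> transpose_mat A = A \<and> (\<forall>x \<in> carrier_vec r. 0 \<le> x \<bullet> (A *\<^sub>v x))"

lemma pw_carrier: "A \<in> carrier_mat r r \<Longrightarrow> x \<in> carrier_vec r \<Longrightarrow> pw A k x \<in> carrier_vec r"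
  by (induction k) auto

lemma pw_add: "A \<in> carrier_mat r r \<Longrightarrow> x \<in> carrier_vec r \<Longrightarrow> y \<in> carrier_vec r \<Longrightarrow> pw A k (x + y) = pw A k x + pw A k y"
proof (induction k)
  case (Suc k)
  then have "dim_vec (pw A k x) = r" "dim_vec (pw A k y) = r"
    using pw_carrier[of A r x k] pw_carrier[of A r y k] by auto
  then show ?case using Suc by (simp add: mat_vec_add)
qed simp

lemma pw_smult: "A \<in> carrier_mat r r \<Longrightarrow> x \<in> carrier_vec r \<Longrightarrow> pw A k (a \<cdot>\<^sub>v x) = a \<cdot>\<^sub>v pw A k x"
proof (induction k)
  case (Suc k)
  then have "dim_vec (pw A k x) = r" using pw_carrier[of A r x k] by auto
  then show ?case using Suc by (simp add: mat_vec_smult)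
qed simp

lemma pw_symmetric:
  "A \<in> carrier_mat r r \<Longrightarrow> transpose_mat A = A \<Longrightarrow> x \<in> carrier_vec r \<Longrightarrow> y \<in> carrier_vec r \<Longrightarrow>
    x \<bullet> pw A k y = pw A k x \<bullet> y"
proof (induction k arbitrary: x)
  case (Suc k)
  have "x \<bullet> (A *\<^sub>v pw A k y) = (A *\<^sub>v x) \<bullet> pw A k y"
    using Suc.prems pw_carrier by (intro symmetric_scalar_prod[of A r]) auto
  also have "\<dots> = pw A k (A *\<^sub>v x) \<bullet> y" using Suc by (intro Suc.IH) auto
  finally show ?case by (simp add: funpow_swap1)
qed simp

lemma pw_pw: "pw A (k + l) x = pw A k (pw A l x)"
  by (simp add: funpow_add)

lemma pw_split:
  assumes "A \<in> carrier_mat r r" "transpose_mat A = A" "x \<in> carrier_vec r"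
  shows "x \<bullet> pw A (2 * q) x = pw A q x \<bullet> pw A q x"
    and "x \<bullet> pw A (2 * q + 1) x = pw A q x \<bullet> (A *\<^sub>v pw A q x)"
proof -
  have q: "pw A q x \<in> carrier_vec r" using assms pw_carrier by blast
  show "x \<bullet> pw A (2 * q) x = pw A q x \<bullet> pw A q x"
    using pw_symmetric[OF assms(1,2,3) q, of q] by (simp add: mult_2 pw_pw)
  have "pw A (2 * q + 1) x = pw A q (A *\<^sub>v pw A q x)"
    using pw_pw[of q "Suc q" A x] by (simp add: mult_2)
  then show "x \<bullet> pw A (2 * q + 1) x = pw A q x \<bullet> (A *\<^sub>v pw A q x)"
    using pw_symmetric[OF assms(1,2,3), of "A *\<^sub>v pw A q x" q] assms q by simp
qed

lemma psd_pw: assumes "psd r A" "x \<in> carrier_vec r" shows "0 \<le> x \<bullet> pw A k x"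
proof -
  have A: "A \<in> carrier_mat r r" "transpose_mat A = A" using assms by (auto simp: psd_def)
  obtain q where "k = 2 * q \<or> k = 2 * q + 1" by (metis oddE evenE)
  then show ?thesis
  proof
    assume "k = 2 * q"
    then show ?thesis using pw_split(1)[OF A assms(2)] by simp
  next
    assume k: "k = 2 * q + 1"
    have "0 \<le> pw A q x \<bullet> (A *\<^sub>v pw A q x)" using assms(1) pw_carrier[OF A(1) assms(2)] by (auto simp: psd_def)
    then show ?thesis unfolding k using pw_split(2)[OF A assms(2)] by simp
  qed
qed

text \<open>In an eigenbasis the moments are sums of \<open>d i ^ k\<close> with common nonnegative
  weights. As \<open>d i \<ge> 0\<close>, the powers with exponents \<open>a\<close> and
  \<open>b\<close> are ordered alike, and Chebyshev's sum inequality applies.\<close>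

lemma psd_moments_log_convex:
  assumes R: "psd r R" and v: "v \<in> carrier_vec r"
  shows "(v \<bullet> pw R a v) * (v \<bullet> pw R b v) \<le> (v \<bullet> v) * (v \<bullet> pw R (a + b) v)"
proof -
  have Rc: "R \<in> carrier_mat r r" "transpose_mat R = R" using R by (auto simp: psd_def)
  obtain Q d where Q: "Q \<in> carrier_mat r r" "transpose_mat Q * Q = 1\<^sub>m r"
    "R = Q * mat_diag r d * transpose_mat Q"
    using symmetric_diagonalization[OF Rc] by blast
  have d: "0 \<le> d i" if "i < r" for i
  proof -
    have "0 \<le> col Q i \<bullet> (R *\<^sub>v col Q i)" using R Q(1) that by (simp add: psd_def)
    then show ?thesis unfolding Q(3) conj_diag_col(1)[OF Q(1,2) that] .
  qed
  define y where "y = transpose_mat Q *\<^sub>v v"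
  have y: "y \<in> carrier_vec r" using Q v by (simp add: y_def)
  have key: "(transpose_mat Q *\<^sub>v pw R k v) $ i = d i ^ k * y $ i" if i: "i < r" for i k
    using i
  proof (induction k)
    case (Suc k)
    have w: "pw R k v \<in> carrier_vec r" using pw_carrier[OF Rc(1) v] .
    have "transpose_mat Q *\<^sub>v (R *\<^sub>v pw R k v)
        = transpose_mat Q *\<^sub>v (Q *\<^sub>v (mat_diag r d *\<^sub>v (transpose_mat Q *\<^sub>v pw R k v)))"
      using Q(1) w by (subst Q(3)) (simp add: mat_vec_assoc)
    also have "\<dots> = (transpose_mat Q * Q) *\<^sub>v (mat_diag r d *\<^sub>v (transpose_mat Q *\<^sub>v pw R k v))"
      by (rule mat_vec_assoc[symmetric]) (use Q(1) in auto)
    also have "\<dots> = mat_diag r d *\<^sub>v (transpose_mat Q *\<^sub>v pw R k v)"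
      unfolding Q(2) by (simp add: one_mat_vec)
    finally have "(transpose_mat Q *\<^sub>v pw R (Suc k) v) $ i = d i * (transpose_mat Q *\<^sub>v pw R k v) $ i"
      using Q(1) i by (simp add: mat_diag_vec del: index_mult_mat_vec)
    then show ?case using Suc by (simp del: index_mult_mat_vec funpow.simps)
  qed (simp add: y_def del: index_mult_mat_vec)
  have QQ: "transpose_mat (transpose_mat Q) * transpose_mat Q = 1\<^sub>m r"
    using Q mat_mult_left_right_inverse[of "transpose_mat Q" r Q] by simp
  have mom: "v \<bullet> pw R k v = (\<Sum>i<r. d i ^ k * (y $ i)\<^sup>2)" for k
  proof -
    have "v \<bullet> pw R k v = y \<bullet> (transpose_mat Q *\<^sub>v pw R k v)"
      unfolding y_def using isometry_norm[OF QQ, of "pw R k v" v] Q v pw_carrier[OF Rc(1) v, of k] by simp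
    also have "\<dots> = (\<Sum>i<r. y $ i * (transpose_mat Q *\<^sub>v pw R k v) $ i)"
      using Q by (simp add: scalar_prod_def[of y] atLeast0LessThan del: index_mult_mat_vec)
    also have "\<dots> = (\<Sum>i<r. d i ^ k * (y $ i)\<^sup>2)"
      by (intro sum.cong refl) (simp add: key power2_eq_square del: index_mult_mat_vec)
    finally show ?thesis .
  qed
  let ?w = "\<lambda>i. (y $ i)\<^sup>2"
  \<comment> \<open>Both differences have the same sign in every term; expanding the symmetric
    double sum gives twice the claimed difference.\<close>
  have "0 \<le> (\<Sum>i<r. \<Sum>j<r. ?w i * ?w j * ((d i ^ a - d j ^ a) * (d i ^ b - d j ^ b)))"
  proof (intro sum_nonneg mult_nonneg_nonneg[of "_ * _"])
    fix i j assume "i \<in> {..<r}" "j \<in> {..<r}"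
    then have ij: "0 \<le> d i" "0 \<le> d j" using d by auto
    show "0 \<le> (d i ^ a - d j ^ a) * (d i ^ b - d j ^ b)"
    proof (cases "d i \<le> d j")
      case True
      then show ?thesis using ij by (intro mult_nonpos_nonpos) (auto intro: power_mono)
    next
      case False
      then show ?thesis using ij by (intro mult_nonneg_nonneg) (auto intro: power_mono)
    qed
  qed auto
  also have "\<dots> = 2 * ((\<Sum>i<r. ?w i) * (\<Sum>i<r. d i ^ (a + b) * ?w i) - (\<Sum>i<r. d i ^ a * ?w i) * (\<Sum>i<r. d i ^ b * ?w i))"
  proof -
    have "(\<Sum>i<r. \<Sum>j<r. ?w i * ?w j * ((d i ^ a - d j ^ a) * (d i ^ b - d j ^ b))) =
      (\<Sum>i<r. \<Sum>j<r. (d i ^ (a + b) * ?w i) * ?w j) + (\<Sum>i<r. \<Sum>j<r. ?w i * (d j ^ (a + b) * ?w j))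
      - (\<Sum>i<r. \<Sum>j<r. (d i ^ a * ?w i) * (d j ^ b * ?w j)) - (\<Sum>i<r. \<Sum>j<r. (d i ^ b * ?w i) * (d j ^ a * ?w j))"
      unfolding sum.distrib[symmetric] sum_subtractf[symmetric]
      by (intro sum.cong refl) (simp add: power_add algebra_simps)
    then show ?thesis unfolding sum_product[symmetric] by (simp add: mult.commute)
  qed
  finally show ?thesis using mom[of 0] by (simp add: mom)
qed

text \<open>Jensen's inequality for the spectral measure of \<open>R\<close> at \<open>v\<close>,
  obtained by adding one power at a time through \<open>psd_moments_log_convex\<close>.\<close>

lemma psd_moment_power:
  assumes R: "psd r R" and v: "v \<in> carrier_vec r" "v \<bullet> v = 1"
  shows "(v \<bullet> (R *\<^sub>v v)) ^ k \<le> v \<bullet> pw R k v"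
proof (induction k)
  case (Suc k)
  have "(v \<bullet> (R *\<^sub>v v)) ^ Suc k \<le> (v \<bullet> (R *\<^sub>v v)) * (v \<bullet> pw R k v)"
    using Suc psd_pw[OF R v(1), of 1] by (simp add: mult_left_mono)
  also have "\<dots> \<le> v \<bullet> pw R (Suc k) v" using psd_moments_log_convex[OF R v(1), of 1 k] v(2) by simp
  finally show ?case .
qed (use v in simp)

section \<open>Traces of powers under rank-one updates\<close>

definition trace_pow :: "nat \<Rightarrow> real mat \<Rightarrow> nat \<Rightarrow> real" where
  "trace_pow r A p = (\<Sum>i<r. unit_vec r i \<bullet> pw A p (unit_vec r i))"

text \<open>Replacing one factor \<open>A\<close> by \<open>D\<close> changes a mixed moment by
  \<open>t\<close> times a product of a pure \<open>D\<close>-moment and a pure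
  \<open>A\<close>-moment, both nonnegative. Dropping these products gives the first claim, keeping
  and telescoping them the second.\<close>

lemma rank_one_moments:
  assumes A: "psd r A" and D: "psd r D" and u: "u \<in> carrier_vec r" and t: "0 \<le> t"
    and AD: "\<And>x. x \<in> carrier_vec r \<Longrightarrow> A *\<^sub>v x = D *\<^sub>v x + (t * (u \<bullet> x)) \<cdot>\<^sub>v u"
  shows "u \<bullet> pw D (a + b) u \<le> u \<bullet> pw D a (pw A b u)"
    and "i \<le> j \<Longrightarrow> u \<bullet> pw A j u = u \<bullet> pw D i (pw A (j - i) u) + t * (\<Sum>a<i. (u \<bullet> pw D a u) * (u \<bullet> pw A (j - Suc a) u))"
proof -
  have c: "A \<in> carrier_mat r r" "transpose_mat A = A" "D \<in> carrier_mat r r" "transpose_mat D = D"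
    using A D by (auto simp: psd_def)
  have step: "u \<bullet> pw D a (pw A (Suc b) u) = u \<bullet> pw D (Suc a) (pw A b u) + t * (u \<bullet> pw D a u) * (u \<bullet> pw A b u)" for a b
  proof -
    define w where "w = pw A b u"
    have w: "w \<in> carrier_vec r" using pw_carrier c u by (simp add: w_def)
    have Dw: "D *\<^sub>v w \<in> carrier_vec r" "pw D a (D *\<^sub>v w) \<in> carrier_vec r" "pw D a u \<in> carrier_vec r"
      using c w u pw_carrier[of D r] by auto
    have "pw D a (A *\<^sub>v w) = pw D a (D *\<^sub>v w) + (t * (u \<bullet> w)) \<cdot>\<^sub>v pw D a u"
      unfolding AD[OF w] using c u Dw by (simp add: pw_add pw_smult)
    then have "u \<bullet> pw D a (A *\<^sub>v w) = u \<bullet> pw D a (D *\<^sub>v w) + t * (u \<bullet> w) * (u \<bullet> pw D a u)"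
      using u Dw by (simp add: scalar_prod_add)
    then show ?thesis by (simp add: w_def funpow_swap1 mult.commute mult.left_commute)
  qed
  show "u \<bullet> pw D (a + b) u \<le> u \<bullet> pw D a (pw A b u)"
  proof (induction b arbitrary: a)
    case (Suc b)
    have "u \<bullet> pw D (a + Suc b) u \<le> u \<bullet> pw D (Suc a) (pw A b u)" using Suc[of "Suc a"] by simp
    also have "\<dots> \<le> u \<bullet> pw D a (pw A (Suc b) u)"
      unfolding step using t psd_pw[OF D u, of a] psd_pw[OF A u, of b] by simp
    finally show ?case .
  qed simp
  show "i \<le> j \<Longrightarrow> u \<bullet> pw A j u = u \<bullet> pw D i (pw A (j - i) u) + t * (\<Sum>a<i. (u \<bullet> pw D a u) * (u \<bullet> pw A (j - Suc a) u))"
  proof (induction i)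
    case (Suc i)
    then have "j - i = Suc (j - Suc i)" by simp
    then show ?case using Suc step[of i "j - Suc i"] by (simp add: algebra_simps del: funpow.simps)
  qed simp
qed

text \<open>Substitute for the Golden--Thompson inequality: the powers of \<open>A\<close> and \<open>D\<close> are compared through
  scalar recurrences for their moments at \<open>u\<close>, so no matrix exponential is needed.\<close>

lemma trace_pow_rank_one:
  assumes A: "psd r A" and D: "psd r D" and u: "u \<in> carrier_vec r" and t: "0 \<le> t"
    and AD: "\<And>x. x \<in> carrier_vec r \<Longrightarrow> A *\<^sub>v x = D *\<^sub>v x + (t * (u \<bullet> x)) \<cdot>\<^sub>v u"
  shows "trace_pow r D (Suc p) + t * real (Suc p) * (u \<bullet> pw D p u) \<le> trace_pow r A (Suc p)"
proof -
  note c = A[unfolded psd_def] D[unfolded psd_def]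
  have cA: "A \<in> carrier_mat r r" "transpose_mat A = A" and cD: "D \<in> carrier_mat r r" "transpose_mat D = D"
    using c by auto
  \<comment> \<open>Interpolates between the trace of the power of \<open>D\<close> at
    \<open>k = 0\<close> and that of \<open>A\<close> at \<open>k = Suc p\<close>, trading one
    factor at a time. Each trade gains a mixed moment that is at least
    \<open>t * (u \<bullet> pw D p u)\<close>.\<close>
  define g where "g k = (\<Sum>i<r. unit_vec r i \<bullet> pw A k (pw D (Suc p - k) (unit_vec r i)))" for k
  have gs: "g (Suc k) - g k = t * (u \<bullet> pw D (p - k) (pw A k u))" if k: "k < Suc p" for k
  proof -
    have "g (Suc k) = g k + (\<Sum>i<r. t * (pw A k u $ i * pw D (p - k) u $ i))"
      unfolding g_def sum.distrib[symmetric]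
    proof (intro sum.cong refl)
      fix i assume "i \<in> {..<r}"
      then have i: "i < r" by simp
      define x where "x = pw D (p - k) (unit_vec r i)"
      have x: "x \<in> carrier_vec r" using pw_carrier cD by (simp add: x_def)
      have "pw D (Suc p - k) (unit_vec r i) = D *\<^sub>v x" using k by (simp add: Suc_diff_le x_def)
      moreover have "pw A (Suc k) x = pw A k (D *\<^sub>v x) + (t * (u \<bullet> x)) \<cdot>\<^sub>v pw A k u"
        using cA cD x u by (simp add: funpow_swap1 AD pw_add pw_smult)
      moreover have "u \<bullet> x = pw D (p - k) u $ i"
        unfolding x_def using pw_symmetric[OF cD u, of "unit_vec r i"] pw_carrier[OF cD(1) u] i by simp
      moreover have "pw A k (D *\<^sub>v x) \<in> carrier_vec r" "pw A k u \<in> carrier_vec r"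
        using pw_carrier[OF cA(1)] u x cD by auto
      ultimately show "unit_vec r i \<bullet> pw A (Suc k) (pw D (Suc p - Suc k) (unit_vec r i)) =
          unit_vec r i \<bullet> pw A k (pw D (Suc p - k) (unit_vec r i)) + t * (pw A k u $ i * pw D (p - k) u $ i)"
        using i by (simp add: x_def[symmetric] scalar_prod_add del: funpow.simps)
    qed
    also have "(\<Sum>i<r. t * (pw A k u $ i * pw D (p - k) u $ i)) = t * (pw A k u \<bullet> pw D (p - k) u)"
      using pw_carrier[OF cD(1) u, of "p - k"] by (simp add: scalar_prod_def sum_distrib_left atLeast0LessThan)
    also have "pw A k u \<bullet> pw D (p - k) u = u \<bullet> pw D (p - k) (pw A k u)"
    proof -
      have a: "pw A k u \<in> carrier_vec r" by (rule pw_carrier[OF cA(1) u])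
      show ?thesis
        using pw_symmetric[OF cD a u, of "p - k"] pw_carrier[OF cD(1) a, of "p - k"] u
        by (simp add: scalar_prod_commute)
    qed
    finally show ?thesis by simp
  qed
  have "g (Suc p) - g 0 = (\<Sum>k<Suc p. t * (u \<bullet> pw D (p - k) (pw A k u)))"
    unfolding sum_lessThan_telescope[symmetric] by (intro sum.cong) (auto simp: gs)
  also have "\<dots> \<ge> (\<Sum>k<Suc p. t * (u \<bullet> pw D p u))"
  proof (intro sum_mono mult_left_mono t)
    fix k assume "k \<in> {..<Suc p}"
    then show "u \<bullet> pw D p u \<le> u \<bullet> pw D (p - k) (pw A k u)"
      using rank_one_moments(1)[OF A D u t AD, of "p - k" k] by simp
  qed
  finally show ?thesis by (simp add: g_def trace_pow_def algebra_simps)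
qed

section \<open>Random samples of a Parseval frame\<close>

primrec gram :: "nat \<Rightarrow> (nat \<Rightarrow> real vec) \<Rightarrow> nat list \<Rightarrow> real mat" where
  "gram r v [] = 0\<^sub>m r r"
| "gram r v (j # js) = gram r v js + outer (v j) (v j)"

text \<open>The inverse of \<open>1 + kap \<cdot> gram r v js\<close>, computed by Sherman--Morrison updates.\<close>

primrec resolvent :: "real \<Rightarrow> nat \<Rightarrow> (nat \<Rightarrow> real vec) \<Rightarrow> nat list \<Rightarrow> real mat" where
  "resolvent kap r v [] = 1\<^sub>m r"
| "resolvent kap r v (j # js) = (let u = resolvent kap r v js *\<^sub>v v j in
     resolvent kap r v js - (kap / (1 + kap * (v j \<bullet> u))) \<cdot>\<^sub>m outer u u)"

locale parseval_frame =
  fixes r N :: nat and v :: "nat \<Rightarrow> real vec" and rho :: real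
  assumes v: "\<And>j. j < N \<Longrightarrow> v j \<in> carrier_vec r"
    and parseval: "\<And>x y. x \<in> carrier_vec r \<Longrightarrow> y \<in> carrier_vec r \<Longrightarrow> (\<Sum>j<N. (v j \<bullet> x) * (v j \<bullet> y)) = x \<bullet> y"
    and norm_le: "\<And>j. j < N \<Longrightarrow> v j \<bullet> v j \<le> rho"
    and N: "0 < N"
begin

text \<open>The Parseval identity on the unit vectors shows that the squared norms of the frame
  vectors sum to \<open>r\<close>.\<close>

lemma N_rho: "real r \<le> real N * rho"
proof -
  have "(\<Sum>j<N. v j \<bullet> v j) = (\<Sum>j<N. \<Sum>i<r. (v j \<bullet> unit_vec r i) * (v j \<bullet> unit_vec r i))"
  proof (intro sum.cong refl)
    fix j assume "j \<in> {..<N}"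
    then have vj: "v j \<in> carrier_vec r" using v by simp
    then show "v j \<bullet> v j = (\<Sum>i<r. (v j \<bullet> unit_vec r i) * (v j \<bullet> unit_vec r i))"
      by (simp add: scalar_prod_def[of "v j" "v j"] atLeast0LessThan)
  qed
  also have "\<dots> = (\<Sum>i<r. \<Sum>j<N. (v j \<bullet> unit_vec r i) * (v j \<bullet> unit_vec r i))" by (rule sum.swap)
  also have "\<dots> = (\<Sum>i<r. 1)"
  proof (intro sum.cong refl)
    fix i assume "i \<in> {..<r}"
    then show "(\<Sum>j<N. (v j \<bullet> unit_vec r i) * (v j \<bullet> unit_vec r i)) = 1" by (subst parseval) auto
  qed
  finally have "real r = (\<Sum>j<N. v j \<bullet> v j)" by simp
  also have "\<dots> \<le> (\<Sum>j<N. rho)" using norm_le by (intro sum_mono) simp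
  finally show ?thesis by simp
qed

end

text \<open>Positivity of \<open>rho\<close> is kept apart from \<open>parseval_frame\<close>
  because in the application it is deduced from \<open>N_rho\<close> and
  \<open>r > 0\<close>.\<close>

locale tight_frame = parseval_frame +
  assumes rho: "0 < rho"
begin

section \<open>Resolvents of sampled Gram matrices\<close>

lemma gram: "set js \<subseteq> {..<N} \<Longrightarrow> gram r v js \<in> carrier_mat r r"
proof (induction js)
  case (Cons j js)
  then have "v j \<in> carrier_vec r" using v by simp
  then show ?case using Cons by (intro carrier_matI) auto
qed simp

lemma gram_quadratic:
  "set js \<subseteq> {..<N} \<Longrightarrow> x \<in> carrier_vec r \<Longrightarrow> x \<bullet> (gram r v js *\<^sub>v x) = (\<Sum>j\<leftarrow>js. (v j \<bullet> x)\<^sup>2)"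
proof (induction js)
  case (Cons j js)
  have vj: "v j \<in> carrier_vec r" using Cons v by simp
  have g: "gram r v js \<in> carrier_mat r r" using Cons gram by simp
  have "gram r v (j # js) *\<^sub>v x = gram r v js *\<^sub>v x + (v j \<bullet> x) \<cdot>\<^sub>v v j"
    using g vj Cons by (simp add: add_mat_vec outer_vec)
  then have "x \<bullet> (gram r v (j # js) *\<^sub>v x) = x \<bullet> (gram r v js *\<^sub>v x) + (v j \<bullet> x) * (x \<bullet> v j)"
    using g vj Cons by (simp add: scalar_prod_add)
  then show ?case
    using Cons vj by (simp add: scalar_prod_commute[of x] power2_eq_square)
qed (simp add: zero_mat_vec)

lemma gram_upper:
  assumes js: "set js \<subseteq> {..<N}" and x: "x \<in> carrier_vec r"
  shows "x \<bullet> (gram r v js *\<^sub>v x) \<le> real (length js) * rho * (x \<bullet> x)"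
proof -
  have "(\<Sum>j\<leftarrow>js. (v j \<bullet> x)\<^sup>2) \<le> (\<Sum>j\<leftarrow>js. rho * (x \<bullet> x))"
  proof (rule sum_list_mono)
    fix j assume "j \<in> set js"
    then have j: "j < N" using js by auto
    have "(v j \<bullet> x)\<^sup>2 \<le> (v j \<bullet> v j) * (x \<bullet> x)" using v[OF j] x by (intro scalar_prod_Cauchy_Schwarz) simp
    also have "\<dots> \<le> rho * (x \<bullet> x)" using norm_le[OF j] by (intro mult_right_mono) auto
    finally show "(v j \<bullet> x)\<^sup>2 \<le> rho * (x \<bullet> x)" .
  qed
  then show ?thesis by (simp add: gram_quadratic[OF js x] sum_list_triv mult.assoc)
qed

text \<open>For \<open>y = R *\<^sub>v x\<close> one has
  \<open>x = y + kap \<cdot>\<^sub>v (gram r v js *\<^sub>v y)\<close>, and the Gram form is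
  nonnegative. The inverse property enters as a hypothesis because \<open>resolvent_props\<close>
  needs this fact inside its induction.\<close>

lemma resolvent_psd_of_inverse:
  assumes R: "R \<in> carrier_mat r r" "transpose_mat R = R" and kap: "0 \<le> kap" and js: "set js \<subseteq> {..<N}"
    and inv: "\<And>x. x \<in> carrier_vec r \<Longrightarrow> R *\<^sub>v (x + kap \<cdot>\<^sub>v (gram r v js *\<^sub>v x)) = x"
    and x: "x \<in> carrier_vec r"
  shows "(R *\<^sub>v x) \<bullet> (R *\<^sub>v x) \<le> x \<bullet> (R *\<^sub>v x)"
proof -
  note g = gram[OF js]
  define K where "K = 1\<^sub>m r + kap \<cdot>\<^sub>m gram r v js"
  have K: "K \<in> carrier_mat r r" using g by (simp add: K_def)
  have Kx: "K *\<^sub>v x = x + kap \<cdot>\<^sub>v (gram r v js *\<^sub>v x)" if "x \<in> carrier_vec r" for x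
    using that g by (simp add: K_def add_mat_vec smult_mat_vec one_mat_vec)
  have "R * K = 1\<^sub>m r"
    using R K inv by (intro mat_eqI_vec[of _ r r]) (auto simp: mat_vec_assoc one_mat_vec Kx)
  then have KR: "K * R = 1\<^sub>m r" using R K by (intro mat_mult_left_right_inverse[of R r]) auto
  define y where "y = R *\<^sub>v x"
  have y: "y \<in> carrier_vec r" using R x by (simp add: y_def)
  have "K *\<^sub>v y = (K * R) *\<^sub>v x" unfolding y_def by (rule mat_vec_assoc[symmetric]) (use K R x in auto)
  then have "x = K *\<^sub>v y" unfolding KR using x by (simp add: one_mat_vec)
  also have "\<dots> = y + kap \<cdot>\<^sub>v (gram r v js *\<^sub>v y)" by (rule Kx[OF y])
  finally have xe: "x = y + kap \<cdot>\<^sub>v (gram r v js *\<^sub>v y)" .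
  have "y \<bullet> x = y \<bullet> y + kap * (y \<bullet> (gram r v js *\<^sub>v y))"
    using y g by (subst xe) (simp add: scalar_prod_add)
  moreover have "0 \<le> y \<bullet> (gram r v js *\<^sub>v y)" unfolding gram_quadratic[OF js y] by (intro sum_list_nonneg) auto
  ultimately show ?thesis using kap x y scalar_prod_commute[of x y] by (simp add: y_def[symmetric])
qed

text \<open>Sherman-Morrison. The denominator is positive because the resolvent of the shorter list
  is already positive semidefinite.\<close>

lemma resolvent_props:
  assumes kap: "0 \<le> kap" and js: "set js \<subseteq> {..<N}"
  shows "resolvent kap r v js \<in> carrier_mat r r \<and> transpose_mat (resolvent kap r v js) = resolvent kap r v js \<and>
    (\<forall>x \<in> carrier_vec r. resolvent kap r v js *\<^sub>v (x + kap \<cdot>\<^sub>v (gram r v js *\<^sub>v x)) = x)"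
  using js
proof (induction js)
  case Nil
  show ?case by (auto simp: zero_mat_vec one_mat_vec intro!: eq_vecI)
next
  case (Cons j js)
  define R where "R = resolvent kap r v js"
  have js: "set js \<subseteq> {..<N}" and j: "j < N" using Cons.prems by auto
  have R: "R \<in> carrier_mat r r" "transpose_mat R = R"
    and inv: "\<And>x. x \<in> carrier_vec r \<Longrightarrow> R *\<^sub>v (x + kap \<cdot>\<^sub>v (gram r v js *\<^sub>v x)) = x"
    using Cons.IH[OF js] by (auto simp: R_def)
  note g = gram[OF js] and vj = v[OF j]
  define u where "u = R *\<^sub>v v j"
  have u: "u \<in> carrier_vec r" using R vj by (simp add: u_def)
  define a where "a = v j \<bullet> u"
  have a: "0 \<le> a"
    using order_trans[OF scalar_prod_self_nonneg resolvent_psd_of_inverse[OF R kap js inv vj]]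
    by (simp add: a_def u_def)
  define t where "t = kap / (1 + kap * a)"
  have pos: "0 < 1 + kap * a" using a kap by (simp add: add_pos_nonneg)
  have Re: "resolvent kap r v (j # js) = R - t \<cdot>\<^sub>m outer u u"
    by (simp add: Let_def R_def[symmetric] u_def[symmetric] a_def[symmetric] t_def)
  have Rc: "R - t \<cdot>\<^sub>m outer u u \<in> carrier_mat r r" using u by (intro carrier_matI) auto
  have "(R - t \<cdot>\<^sub>m outer u u) *\<^sub>v (x + kap \<cdot>\<^sub>v (gram r v (j # js) *\<^sub>v x)) = x" if x: "x \<in> carrier_vec r" for x
  proof -
    define s where "s = kap * (v j \<bullet> x)"
    define x' where "x' = x + kap \<cdot>\<^sub>v (gram r v js *\<^sub>v x)"
    have x': "x' \<in> carrier_vec r" using x g by (simp add: x'_def)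
    have e: "x + kap \<cdot>\<^sub>v (gram r v (j # js) *\<^sub>v x) = x' + s \<cdot>\<^sub>v v j"
      using x g vj by (simp add: add_mat_vec outer_vec x'_def s_def) (intro eq_vecI, auto simp: algebra_simps)
    have R1: "R *\<^sub>v (x' + s \<cdot>\<^sub>v v j) = x + s \<cdot>\<^sub>v u"
      using R x x' vj inv[OF x] by (simp add: mat_vec_add mat_vec_smult u_def x'_def[symmetric])
    have "u \<bullet> (x' + s \<cdot>\<^sub>v v j) = v j \<bullet> (R *\<^sub>v (x' + s \<cdot>\<^sub>v v j))"
      unfolding u_def using R vj x' by (intro symmetric_scalar_prod[symmetric]) auto
    also have "\<dots> = v j \<bullet> x + s * a" unfolding R1 using x vj u by (simp add: scalar_prod_add a_def)
    finally have ux: "u \<bullet> (x' + s \<cdot>\<^sub>v v j) = (v j \<bullet> x) * (1 + kap * a)" by (simp add: s_def algebra_simps)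
    have "(R - t \<cdot>\<^sub>m outer u u) *\<^sub>v (x' + s \<cdot>\<^sub>v v j) = (x + s \<cdot>\<^sub>v u) - (t * ((v j \<bullet> x) * (1 + kap * a))) \<cdot>\<^sub>v u"
      using R u x' vj R1 ux by (simp add: minus_mat_vec smult_mat_vec outer_vec smult_smult_assoc)
    also have "t * ((v j \<bullet> x) * (1 + kap * a)) = s" using pos by (simp add: t_def s_def)
    finally show ?thesis unfolding e using x u by (intro eq_vecI) auto
  qed
  moreover have "transpose_mat (R - t \<cdot>\<^sub>m outer u u) = R - t \<cdot>\<^sub>m outer u u"
    using R u by (simp add: mat_transpose_minus mat_transpose_smult outer_transpose)
  ultimately show ?case unfolding Re using Rc by blast
qed

lemma resolvent_contractive:
  assumes kap: "0 \<le> kap" and js: "set js \<subseteq> {..<N}" and x: "x \<in> carrier_vec r"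
  shows "(resolvent kap r v js *\<^sub>v x) \<bullet> (resolvent kap r v js *\<^sub>v x) \<le> x \<bullet> (resolvent kap r v js *\<^sub>v x)"
  using resolvent_props[OF kap js] resolvent_psd_of_inverse[OF _ _ kap js _ x] by blast

lemma resolvent_psd:
  assumes kap: "0 \<le> kap" and js: "set js \<subseteq> {..<N}"
  shows "psd r (resolvent kap r v js)"
proof -
  have "0 \<le> x \<bullet> (resolvent kap r v js *\<^sub>v x)" if "x \<in> carrier_vec r" for x
    using resolvent_contractive[OF kap js that] scalar_prod_self_nonneg order_trans by blast
  then show ?thesis using resolvent_props[OF kap js] by (auto simp: psd_def)
qed

text \<open>With \<open>z\<close> the preimage of \<open>y\<close> under the resolvent, expand the
  nonnegative form at \<open>y - c \<cdot>\<^sub>v z\<close>. The choice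
  \<open>c = 1 / (1 + kap * lam)\<close> is the best one given the bound on
  \<open>z \<bullet> y\<close>.\<close>

lemma resolvent_lower:
  assumes kap: "0 \<le> kap" and js: "set js \<subseteq> {..<N}" and y: "y \<in> carrier_vec r"
    and lam: "0 \<le> lam" "y \<bullet> (gram r v js *\<^sub>v y) \<le> lam * (y \<bullet> y)"
  shows "(y \<bullet> y) / (1 + kap * lam) \<le> y \<bullet> (resolvent kap r v js *\<^sub>v y)"
proof -
  define R where "R = resolvent kap r v js"
  have R: "R \<in> carrier_mat r r" "transpose_mat R = R"
    and inv: "R *\<^sub>v (y + kap \<cdot>\<^sub>v (gram r v js *\<^sub>v y)) = y"
    using resolvent_props[OF kap js] y by (auto simp: R_def)
  note g = gram[OF js]
  define z where "z = y + kap \<cdot>\<^sub>v (gram r v js *\<^sub>v y)"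
  have z: "z \<in> carrier_vec r" using y g by (simp add: z_def)
  have Rz: "R *\<^sub>v z = y" using inv by (simp add: z_def)
  define c where "c = 1 / (1 + kap * lam)"
  have c: "0 < c" "c * (1 + kap * lam) = 1"
    using kap lam add_pos_nonneg[of 1 "kap * lam"] by (auto simp: c_def)
  have zy: "z \<bullet> y \<le> (1 + kap * lam) * (y \<bullet> y)"
  proof -
    have "z \<bullet> y = y \<bullet> z" using y z by (simp add: scalar_prod_commute)
    also have "\<dots> = y \<bullet> y + kap * (y \<bullet> (gram r v js *\<^sub>v y))" using y g by (simp add: z_def scalar_prod_add)
    also have "\<dots> \<le> y \<bullet> y + kap * (lam * (y \<bullet> y))" using lam kap by (intro add_left_mono mult_left_mono) auto
    finally show ?thesis by (simp add: algebra_simps)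
  qed
  have w: "y - c \<cdot>\<^sub>v z \<in> carrier_vec r" using y z by simp
  have Rw: "R *\<^sub>v (y - c \<cdot>\<^sub>v z) = R *\<^sub>v y - c \<cdot>\<^sub>v y"
    using R y z Rz by (simp add: mat_vec_minus mat_vec_smult)
  have zRy: "z \<bullet> (R *\<^sub>v y) = y \<bullet> y"
    using symmetric_scalar_prod[OF R z y] Rz by simp
  have "0 \<le> (y - c \<cdot>\<^sub>v z) \<bullet> (R *\<^sub>v (y - c \<cdot>\<^sub>v z))"
    using resolvent_psd[OF kap js] w by (auto simp: psd_def R_def)
  also have "\<dots> = y \<bullet> (R *\<^sub>v y) - 2 * c * (y \<bullet> y) + c * (c * (z \<bullet> y))"
    unfolding Rw using y z R zRy
    by (simp add: scalar_prod_minus minus_scalar_prod algebra_simps)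
  also have "c * (c * (z \<bullet> y)) \<le> c * (c * ((1 + kap * lam) * (y \<bullet> y)))"
    using c zy by (intro mult_left_mono) auto
  also have "c * (c * ((1 + kap * lam) * (y \<bullet> y))) = c * (y \<bullet> y)"
    using c(2) by (simp add: mult.assoc[symmetric])
  finally have "c * (y \<bullet> y) \<le> y \<bullet> (R *\<^sub>v y)" by simp
  then show ?thesis by (simp add: c_def R_def)
qed

lemma parseval_trace_pow:
  assumes R: "psd r R"
  shows "(\<Sum>j<N. v j \<bullet> pw R p (v j)) = trace_pow r R p"
proof -
  have c: "R \<in> carrier_mat r r" "transpose_mat R = R" using R by (auto simp: psd_def)
  have "(\<Sum>j<N. v j \<bullet> pw R p (v j)) = (\<Sum>j<N. \<Sum>i<r. (v j \<bullet> unit_vec r i) * (v j \<bullet> pw R p (unit_vec r i)))"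
  proof (intro sum.cong refl)
    fix j assume "j \<in> {..<N}"
    then have vj: "v j \<in> carrier_vec r" using v by simp
    have "pw R p (v j) $ i = v j \<bullet> pw R p (unit_vec r i)" if "i < r" for i
      using pw_symmetric[OF c vj, of "unit_vec r i" p] pw_carrier[OF c(1) vj] that by simp
    then show "v j \<bullet> pw R p (v j) = (\<Sum>i<r. (v j \<bullet> unit_vec r i) * (v j \<bullet> pw R p (unit_vec r i)))"
      using vj pw_carrier[OF c(1) vj, of p] by (simp add: scalar_prod_def[of "v j" "pw R p (v j)"] atLeast0LessThan)
  qed
  also have "\<dots> = (\<Sum>i<r. \<Sum>j<N. (v j \<bullet> unit_vec r i) * (v j \<bullet> pw R p (unit_vec r i)))" by (rule sum.swap)
  also have "\<dots> = trace_pow r R p"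
    unfolding trace_pow_def using pw_carrier[OF c(1)] by (intro sum.cong refl parseval) auto
  finally show ?thesis .
qed

text \<open>One draw replaces \<open>R\<close> by \<open>D = R - t u u^T\<close> with
  \<open>u = R v_j\<close>. The gain from \<open>trace_pow_rank_one\<close> involves a moment of
  \<open>D\<close>, and returning to moments of \<open>R\<close> costs the factor
  \<open>1 - s\<close>. The denominator \<open>1 + s / (2 * q)\<close> comes from Sherman-Morrison.
  The denominator \<open>1 + s * m / (2 * q)\<close> comes from the lower bound on \<open>R\<close>,
  applied after averaging over the frame.\<close>

lemma resolvent_trace_step:
  assumes s: "0 < s" "s < 1" and q: "0 < q" and kap: "kap = s / (real (2 * q) * rho)"
    and js: "set js \<subseteq> {..<N}" "length js \<le> m"
  shows "(\<Sum>j<N. trace_pow r (resolvent kap r v (j # js)) (2 * q))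
    \<le> (real N - s * (1 - s) / (rho * (1 + s / real (2 * q)) * (1 + s * real m / real (2 * q))))
      * trace_pow r (resolvent kap r v js) (2 * q)"
proof -
  define R where "R = resolvent kap r v js"
  define p where "p = 2 * q - 1"
  have p: "2 * q = Suc p" using q by (simp add: p_def)
  have kap0: "0 < kap" using kap s q rho by simp
  have kr: "kap * rho = s / real (2 * q)" using rho by (simp add: kap)
  have R: "psd r R" using resolvent_psd[OF _ js(1)] kap0 by (simp add: R_def)
  have Rc: "R \<in> carrier_mat r r" "transpose_mat R = R" using R by (auto simp: psd_def)
  have contr: "(R *\<^sub>v x) \<bullet> (R *\<^sub>v x) \<le> x \<bullet> (R *\<^sub>v x)" if "x \<in> carrier_vec r" for x
    using resolvent_contractive[OF _ js(1) that] kap0 by (simp add: R_def)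
  define beta where "beta = s * (1 - s) / (rho * (1 + s / real (2 * q)))"
  have beta0: "0 \<le> beta" using s rho q by (simp add: beta_def)
  have one: "trace_pow r (resolvent kap r v (j # js)) (2 * q) + beta * (v j \<bullet> pw R (2 * q + 1) (v j)) \<le> trace_pow r R (2 * q)"
    if j: "j < N" for j
  proof -
    note vj = v[OF j]
    define u where "u = R *\<^sub>v v j"
    have u: "u \<in> carrier_vec r" using Rc vj by (simp add: u_def)
    define a where "a = v j \<bullet> u"
    have uu: "u \<bullet> u \<le> a" using contr[OF vj] by (simp add: a_def u_def)
    then have a0: "0 \<le> a" using scalar_prod_self_nonneg[of u] by linarith
    have "a\<^sup>2 \<le> (v j \<bullet> v j) * (u \<bullet> u)" unfolding a_def using vj u by (intro scalar_prod_Cauchy_Schwarz) simp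
    also have "\<dots> \<le> rho * a" using uu norm_le[OF j] a0 rho by (intro mult_mono) auto
    finally have ar: "a \<le> rho" using a0 rho by (cases "a = 0") (auto simp: power2_eq_square)
    define t where "t = kap / (1 + kap * a)"
    have pos: "0 < 1 + kap * a" using a0 kap0 by (simp add: add_pos_nonneg)
    have t0: "0 \<le> t" using kap0 pos by (simp add: t_def)
    have tk: "t \<le> kap" using kap0 a0 pos by (simp add: t_def divide_le_eq mult_left_le)
    have t_ge: "kap / (1 + s / real (2 * q)) \<le> t"
      unfolding t_def kr[symmetric] using kap0 ar pos a0 by (intro divide_left_mono) (auto intro!: mult_pos_pos add_pos_nonneg)
    define D where "D = resolvent kap r v (j # js)"
    have D: "psd r D" using resolvent_psd[of kap "j # js"] kap0 js j by (simp add: D_def)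
    have De: "D = R - t \<cdot>\<^sub>m outer u u"
      by (simp add: D_def Let_def R_def[symmetric] u_def[symmetric] a_def[symmetric] t_def)
    have AD: "R *\<^sub>v x = D *\<^sub>v x + (t * (u \<bullet> x)) \<cdot>\<^sub>v u" if "x \<in> carrier_vec r" for x
      using that u Rc by (simp add: De minus_mat_vec smult_mat_vec outer_vec smult_smult_assoc) (intro eq_vecI, auto)
    define mu where "mu k = v j \<bullet> pw R k (v j)" for k
    have um: "u \<bullet> pw R k u = mu (k + 2)" for k
    proof -
      have "u \<bullet> pw R k u = v j \<bullet> (R *\<^sub>v pw R k u)"
        unfolding u_def using pw_carrier[OF Rc(1)] vj Rc by (intro symmetric_scalar_prod[symmetric]) auto
      then show ?thesis by (simp add: mu_def u_def funpow_swap1)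
    qed
    have mu0: "0 \<le> mu k" for k unfolding mu_def by (rule psd_pw[OF R vj])
    \<comment> \<open>Lowers the exponent by one, so that all cross terms are measured by the same
      moment as the main term.\<close>
    have mu_dec: "mu (2 * q + 2) \<le> mu (2 * q + 1)"
      using pw_split[OF Rc vj, of "Suc q"] pw_split[OF Rc vj, of q] contr[of "pw R q (v j)"] pw_carrier[OF Rc(1) vj, of q]
      by (simp add: mu_def)
    \<comment> \<open>The exponents of the two moments of \<open>R\<close> always add up to
      \<open>2 * q + 2\<close>, so log-convexity bounds every cross term by the same
      quantity.\<close>
    have prod: "(u \<bullet> pw D b u) * (u \<bullet> pw R (p - Suc b) u) \<le> rho * mu (2 * q + 1)" if b: "b < p" for b
    proof -
      have "(u \<bullet> pw D b u) * (u \<bullet> pw R (p - Suc b) u) \<le> mu (b + 2) * mu (p - Suc b + 2)"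
        using rank_one_moments(1)[OF R D u t0 AD, of 0 b] psd_pw[OF D u, of b] mu0
        unfolding um by (intro mult_mono) (auto simp: um)
      also have "\<dots> \<le> (v j \<bullet> v j) * mu (b + 2 + (p - Suc b + 2))"
        unfolding mu_def by (rule psd_moments_log_convex[OF R vj])
      also have "b + 2 + (p - Suc b + 2) = 2 * q + 2" using b p by simp
      also have "(v j \<bullet> v j) * mu (2 * q + 2) \<le> rho * mu (2 * q + 1)"
        using norm_le[OF j] mu_dec mu0 rho by (intro mult_mono) auto
      finally show ?thesis .
    qed
    have "mu (2 * q + 1) = u \<bullet> pw R p u" using um[of p] p by simp
    also have "\<dots> = u \<bullet> pw D p (pw R (p - p) u) + t * (\<Sum>b<p. (u \<bullet> pw D b u) * (u \<bullet> pw R (p - Suc b) u))"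
      by (rule rank_one_moments(2)[OF R D u t0 AD]) auto
    also have "\<dots> \<le> u \<bullet> pw D p u + t * (\<Sum>b<p. rho * mu (2 * q + 1))"
      unfolding diff_self_eq_0 funpow_0 using prod t0
      by (intro add_left_mono mult_left_mono sum_mono) auto
    \<comment> \<open>There are \<open>p < 2 * q\<close> cross terms and \<open>t \<le> kap\<close>;
      the normalization \<open>kap * (2 * q) * rho = s\<close> makes their total an
      \<open>s\<close>-fraction of the main moment.\<close>
    also have "t * (\<Sum>b<p. rho * mu (2 * q + 1)) \<le> s * mu (2 * q + 1)"
    proof -
      have "t * real p * rho \<le> kap * real (2 * q) * rho"
        using tk t0 rho p kap0 by (intro mult_right_mono mult_mono) auto
      also have "\<dots> = s" using kr q by (simp add: field_simps)
      finally have "(t * real p * rho) * mu (2 * q + 1) \<le> s * mu (2 * q + 1)" using mu0 by (intro mult_right_mono) auto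
      then show ?thesis by (simp add: algebra_simps)
    qed
    finally have n_ge: "(1 - s) * mu (2 * q + 1) \<le> u \<bullet> pw D p u" by (simp add: algebra_simps)
    have "beta * mu (2 * q + 1) = (kap / (1 + s / real (2 * q))) * real (2 * q) * ((1 - s) * mu (2 * q + 1))"
      using rho q s by (simp add: beta_def kap)
    also have "\<dots> \<le> t * real (Suc p) * (u \<bullet> pw D p u)"
      unfolding p[symmetric] using t_ge t0 n_ge s mu0 by (intro mult_mono) auto
    finally have "beta * mu (2 * q + 1) \<le> t * real (Suc p) * (u \<bullet> pw D p u)" .
    then show ?thesis
      using trace_pow_rank_one[OF R D u t0 AD, of p] unfolding p D_def mu_def by simp
  qed
  define c where "c = 1 / (1 + s * real m / real (2 * q))"
  have c0: "0 \<le> c" using s by (simp add: c_def)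
  have kmr: "kap * (real m * rho) = s * real m / real (2 * q)" using kr by (metis mult.assoc mult.commute times_divide_eq_left)
  have low: "c * (\<Sum>j<N. v j \<bullet> pw R (2 * q) (v j)) \<le> (\<Sum>j<N. v j \<bullet> pw R (2 * q + 1) (v j))"
    unfolding sum_distrib_left
  proof (intro sum_mono)
    fix j assume "j \<in> {..<N}"
    then have vj: "v j \<in> carrier_vec r" using v by simp
    define y where "y = pw R q (v j)"
    have y: "y \<in> carrier_vec r" unfolding y_def by (rule pw_carrier[OF Rc(1) vj])
    have "y \<bullet> (gram r v js *\<^sub>v y) \<le> real (length js) * rho * (y \<bullet> y)" by (rule gram_upper[OF js(1) y])
    also have "\<dots> \<le> real m * rho * (y \<bullet> y)" using js rho by (intro mult_right_mono) auto
    finally have "(y \<bullet> y) / (1 + kap * (real m * rho)) \<le> y \<bullet> (R *\<^sub>v y)"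
      unfolding R_def using kap0 rho by (intro resolvent_lower[OF _ js(1) y]) auto
    then show "c * (v j \<bullet> pw R (2 * q) (v j)) \<le> v j \<bullet> pw R (2 * q + 1) (v j)"
      unfolding pw_split[OF Rc vj] y_def[symmetric] kmr by (simp add: c_def)
  qed
  have "(\<Sum>j<N. trace_pow r (resolvent kap r v (j # js)) (2 * q))
      \<le> (\<Sum>j<N. trace_pow r R (2 * q) - beta * (v j \<bullet> pw R (2 * q + 1) (v j)))"
    using one by (intro sum_mono) (simp add: algebra_simps)
  also have "\<dots> = real N * trace_pow r R (2 * q) - beta * (\<Sum>j<N. v j \<bullet> pw R (2 * q + 1) (v j))"
    by (simp add: sum_subtractf sum_distrib_left)
  also have "\<dots> \<le> real N * trace_pow r R (2 * q) - beta * (c * trace_pow r R (2 * q))"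
    using low beta0 unfolding parseval_trace_pow[OF R] by (intro diff_left_mono mult_left_mono) auto
  also have "\<dots> = (real N - beta * c) * trace_pow r R (2 * q)" by (simp add: algebra_simps)
  also have "beta * c = s * (1 - s) / (rho * (1 + s / real (2 * q)) * (1 + s * real m / real (2 * q)))"
    by (simp add: beta_def c_def)
  finally show ?thesis by (simp add: R_def)
qed

text \<open>The norm of \<open>pw R q z\<close> is at most the Hilbert-Schmidt norm of the
  \<open>q\<close>-th power, whose square is the trace.\<close>

lemma trace_pow_ge_quadratic:
  assumes R: "psd r R" and z: "z \<in> carrier_vec r" "z \<bullet> z = 1"
  shows "z \<bullet> pw R (2 * q) z \<le> trace_pow r R (2 * q)"
proof -
  have c: "R \<in> carrier_mat r r" "transpose_mat R = R" using R by (auto simp: psd_def)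
  have "z \<bullet> pw R (2 * q) z = pw R q z \<bullet> pw R q z" by (rule pw_split(1)[OF c z(1)])
  also have "\<dots> = (\<Sum>i<r. (pw R q (unit_vec r i) \<bullet> z)\<^sup>2)"
  proof -
    have "pw R q z $ i = pw R q (unit_vec r i) \<bullet> z" if "i < r" for i
      using pw_symmetric[OF c _ z(1), of "unit_vec r i" q] pw_carrier[OF c(1) z(1), of q] that by simp
    then show ?thesis
      using pw_carrier[OF c(1) z(1), of q] by (simp add: scalar_prod_def[of "pw R q z"] atLeast0LessThan power2_eq_square)
  qed
  also have "\<dots> \<le> (\<Sum>i<r. (pw R q (unit_vec r i) \<bullet> pw R q (unit_vec r i)) * (z \<bullet> z))"
  proof (intro sum_mono scalar_prod_Cauchy_Schwarz)
    fix i show "dim_vec (pw R q (unit_vec r i)) = dim_vec z"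
      using pw_carrier[OF c(1), of "unit_vec r i" q] z by simp
  qed
  also have "\<dots> = trace_pow r R (2 * q)"
    unfolding trace_pow_def using z pw_split(1)[OF c, of "unit_vec r _" q] by simp
  finally show ?thesis .
qed


text \<open>The resolvent power approximates the matrix exponential: for \<open>kap = s / (2 * q * rho)\<close> and
  \<open>q\<close> large, \<open>resolvent kap r v js\<close> to the power \<open>2 * q\<close> is close to \<open>exp (- (s / rho) * gram r v js)\<close>.
  With \<open>s = 2/5\<close> a sample multiplies the mean trace by at most \<open>1 - 0.238 / (N * rho)\<close>, while a
  degenerate list has trace at least \<open>exp (- 0.1 * m / (N * rho))\<close>.\<close>

theorem card_degenerate_samples:
  "real (card {js. set js \<subseteq> {..<N} \<and> length js = m \<and>
      (\<exists>z \<in> carrier_vec r. (\<Sum>j\<leftarrow>js. (v j \<bullet> z)\<^sup>2) < real m / (4 * real N) * (z \<bullet> z))})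
    \<le> real N ^ m * (real r * exp (- (138 / 1000) * (real m / (real N * rho))))"
  (is "real (card ?bad) \<le> _")
proof (cases "r = 0")
  case True
  have e: "?bad = {}"
  proof -
    have "z \<bullet> z = 0" if "z \<in> carrier_vec r" for z :: "real vec" using that True by (simp add: scalar_prod_def)
    moreover have "0 \<le> (\<Sum>j\<leftarrow>js. (v j \<bullet> z)\<^sup>2)" for js z by (intro sum_list_nonneg) auto
    ultimately show ?thesis by (auto simp: not_less)
  qed
  show ?thesis unfolding e by simp
next
  case False
  \<comment> \<open>Large enough that both denominators of \<open>resolvent_trace_step\<close> are
    at most 1.002, so that 0.24 loses at most the factor 1.005 and stays above 0.238.\<close>
  define q where "q = 100 * (m + 1)"
  \<comment> \<open>The ideal net rate \<open>s * (1 - s) - s / 4\<close> peaks at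
    \<open>3/8\<close> with value 9/64; \<open>2/5\<close> still gives 0.14.\<close>
  define s :: real where "s = 2 / 5"
  define kap where "kap = s / (real (2 * q) * rho)"
  have q: "0 < q" "200 * (real m + 1) = real (2 * q)" by (auto simp: q_def)
  have s: "0 < s" "s < 1" by (auto simp: s_def)
  have kap0: "0 \<le> kap" using s rho by (simp add: kap_def)
  define f where "f js = trace_pow r (resolvent kap r v js) (2 * q)" for js
  define X where "X = real m / (real N * rho)"
  have Nr: "1 \<le> real N * rho" using N_rho False by (metis One_nat_def Suc_leI le_trans neq0_conv of_nat_1 of_nat_mono order_trans)
  have f0: "0 \<le> f js" if "set js \<subseteq> {..<N}" for js
    unfolding f_def trace_pow_def using resolvent_psd[OF kap0 that] psd_pw by (intro sum_nonneg) auto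
  have step: "(\<Sum>j\<in>{..<N}. f (j # js)) \<le> (real N - 238 / 1000 / rho) * f js"
    if js: "set js \<subseteq> {..<N}" "length js < m" for js
  proof -
    define a where "a = (1 + s / real (2 * q)) * (1 + s * real m / real (2 * q))"
    have a1: "1 + s / real (2 * q) \<le> 1002 / 1000"
      using s q by (simp add: s_def field_simps)
    have a2: "1 + s * real m / real (2 * q) \<le> 1002 / 1000"
      using s q(2) q(1) by (simp add: s_def field_simps)
    have "a \<le> (1002 / 1000) * (1002 / 1000)" unfolding a_def using a1 a2 s by (intro mult_mono) auto
    then have a: "a \<le> 1005 / 1000" by simp
    have a0: "0 < a" unfolding a_def using s by (intro mult_pos_pos add_pos_nonneg) auto
    have "238 / 1000 * a \<le> s * (1 - s)" using a by (simp add: s_def)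
    then have "238 / 1000 / rho \<le> s * (1 - s) / (rho * a)" using a0 rho by (simp add: field_simps)
    then have "real N - s * (1 - s) / (rho * (1 + s / real (2 * q)) * (1 + s * real m / real (2 * q))) \<le> real N - 238 / 1000 / rho"
      by (simp add: a_def mult.assoc)
    then show ?thesis
      using resolvent_trace_step[OF s q(1) kap_def js(1), of m] js(2) f0[OF js(1)] mult_right_mono
      unfolding f_def[symmetric] by (smt (verit, best) less_imp_le)
  qed
  have c0: "0 \<le> real N - 238 / 1000 / rho" using Nr rho by (simp add: field_simps)
  let ?L = "{js. set js \<subseteq> {..<N} \<and> length js = m}"
  have finL: "finite ?L" by (rule finite_lists_length_eq) simp
  have "(\<Sum>js\<in>?L. f js) \<le> (real N - 238 / 1000 / rho) ^ m * f []"
    by (rule sum_lists_bound[OF _ c0 step]) auto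
  also have "f [] = real r"
  proof -
    have "pw (1\<^sub>m r) k (unit_vec r i) = unit_vec r i" for k i by (induction k) (auto simp: one_mat_vec)
    then show ?thesis by (simp add: f_def trace_pow_def)
  qed
  also have "real N - 238 / 1000 / rho = real N * (1 - 238 / 1000 / (real N * rho))" using N by (simp add: field_simps)
  also have "(\<dots>) ^ m * real r \<le> (real N * exp (- (238 / 1000 / (real N * rho)))) ^ m * real r"
  proof (intro mult_right_mono power_mono mult_left_mono)
    show "1 - 238 / 1000 / (real N * rho) \<le> exp (- (238 / 1000 / (real N * rho)))"
      using exp_ge_add_one_self[of "- (238 / 1000 / (real N * rho))"] by simp
    show "0 \<le> real N * (1 - 238 / 1000 / (real N * rho))" using Nr by (intro mult_nonneg_nonneg) (auto simp: field_simps)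
  qed auto
  also have "\<dots> = real N ^ m * (real r * exp (- (238 / 1000) * X))"
    by (simp add: power_mult_distrib exp_of_nat_mult[symmetric] X_def)
  finally have tot: "(\<Sum>js\<in>?L. f js) \<le> real N ^ m * (real r * exp (- (238 / 1000) * X))" .
  \<comment> \<open>A direction \<open>y\<close> with small Gram form has a resolvent form of at
    least \<open>exp (- kap * lam)\<close>. Raising to the power \<open>2 * q\<close> gives exponent
    \<open>s / rho * m / (4 * N)\<close>, which is \<open>X / 10\<close>.\<close>
  have bad: "exp (- (1 / 10) * X) \<le> f js" if js: "js \<in> ?bad" for js
  proof -
    have jsN: "set js \<subseteq> {..<N}" using js by simp
    obtain z where z: "z \<in> carrier_vec r" "(\<Sum>j\<leftarrow>js. (v j \<bullet> z)\<^sup>2) < real m / (4 * real N) * (z \<bullet> z)"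
      using js by auto
    define lam where "lam = real m / (4 * real N)"
    have lam0: "0 \<le> lam" by (simp add: lam_def)
    have "0 \<le> (\<Sum>j\<leftarrow>js. (v j \<bullet> z)\<^sup>2)" by (intro sum_list_nonneg) auto
    then have "z \<bullet> z \<noteq> 0" using z(2) by auto
    then have zz: "0 < z \<bullet> z" using scalar_prod_self_nonneg[of z] by linarith
    define y where "y = (1 / sqrt (z \<bullet> z)) \<cdot>\<^sub>v z"
    have y: "y \<in> carrier_vec r" "y \<bullet> y = 1" using z zz by (auto simp: y_def)
    have "y \<bullet> (gram r v js *\<^sub>v y) = (z \<bullet> (gram r v js *\<^sub>v z)) / (z \<bullet> z)"
      using z zz gram[OF jsN] by (simp add: y_def mat_vec_smult)
    also have "\<dots> \<le> lam * (y \<bullet> y)"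
      using z zz unfolding gram_quadratic[OF jsN z(1)] by (simp add: y(2) lam_def divide_le_eq)
    finally have g: "y \<bullet> (gram r v js *\<^sub>v y) \<le> lam * (y \<bullet> y)" .
    have low: "1 / (1 + kap * lam) \<le> y \<bullet> (resolvent kap r v js *\<^sub>v y)"
      using resolvent_lower[OF kap0 jsN y(1) lam0 g] y(2) by simp
    have R: "psd r (resolvent kap r v js)" by (rule resolvent_psd[OF kap0 jsN])
    have pos: "0 < 1 + kap * lam" using kap0 lam0 by (simp add: add_pos_nonneg)
    have "exp (- (kap * lam)) \<le> 1 / (1 + kap * lam)"
      unfolding exp_minus inverse_eq_divide using exp_ge_add_one_self[of "kap * lam"] pos
      by (intro divide_left_mono) auto
    then have "exp (- (kap * lam)) ^ (2 * q) \<le> (y \<bullet> (resolvent kap r v js *\<^sub>v y)) ^ (2 * q)"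
      using low by (intro power_mono) auto
    also have "\<dots> \<le> y \<bullet> pw (resolvent kap r v js) (2 * q) y" by (rule psd_moment_power[OF R y])
    also have "\<dots> \<le> f js" unfolding f_def by (rule trace_pow_ge_quadratic[OF R y])
    finally have "exp (- (kap * lam)) ^ (2 * q) \<le> f js" .
    moreover have "real (2 * q) * (- (kap * lam)) = - (1 / 10) * X"
    proof -
      have "kap * real (2 * q) = s / rho" using q(1) by (simp add: kap_def)
      then have "real (2 * q) * (- (kap * lam)) = - (s / rho * lam)" by (metis mult.assoc mult.commute mult_minus_right)
      then show ?thesis by (simp add: lam_def X_def s_def)
    qed
    ultimately show ?thesis by (simp only: exp_of_nat_mult[symmetric])
  qed
  have sub: "?bad \<subseteq> ?L" by auto
  \<comment> \<open>Markov's inequality in counting form.\<close>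
  have "real (card ?bad) * exp (- (1 / 10) * X) = (\<Sum>js\<in>?bad. exp (- (1 / 10) * X))" by simp
  also have "\<dots> \<le> (\<Sum>js\<in>?bad. f js)" using bad by (intro sum_mono) blast
  also have "\<dots> \<le> (\<Sum>js\<in>?L. f js)" using finL sub f0 by (intro sum_mono2) auto
  also have "\<dots> \<le> real N ^ m * (real r * exp (- (238 / 1000) * X))" by (rule tot)
  also have "exp (- (238 / 1000) * X) = exp (- (138 / 1000) * X) * exp (- (1 / 10) * X)"
    by (simp add: exp_add[symmetric])
  finally have "real (card ?bad) * exp (- (1 / 10) * X) \<le> (real N ^ m * (real r * exp (- (138 / 1000) * X))) * exp (- (1 / 10) * X)"
    by (simp add: mult.assoc)
  then have "real (card ?bad) \<le> real N ^ m * (real r * exp (- (138 / 1000) * X))"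
    by (simp add: mult_le_cancel_right)
  then show ?thesis by (simp add: X_def)
qed

text \<open>The orthogonal projection onto the complement of the span of the listed vectors.\<close>

primrec compl_proj :: "nat list \<Rightarrow> real mat" where
  "compl_proj [] = 1\<^sub>m r"
| "compl_proj (i # is) = (let w = compl_proj is *\<^sub>v v i in
     if w \<bullet> w = 0 then compl_proj is else compl_proj is - (1 / (w \<bullet> w)) \<cdot>\<^sub>m outer w w)"

text \<open>The trace is the codimension of the span. Its integrality is recorded because a nonzero
  complement then has trace at least 1, which is what Markov's inequality needs.\<close>

definition proj_props :: "nat list \<Rightarrow> real mat \<Rightarrow> bool" where
  "proj_props is P \<longleftrightarrow> P \<in> carrier_mat r r \<and> transpose_mat P = P \<and>
    (\<forall>x \<in> carrier_vec r. P *\<^sub>v (P *\<^sub>v x) = P *\<^sub>v x) \<and> (\<forall>i \<in> set is. P *\<^sub>v v i = 0\<^sub>v r) \<and>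
    (\<forall>x \<in> carrier_vec r. (\<forall>i \<in> set is. v i \<bullet> x = 0) \<longrightarrow> P *\<^sub>v x = x) \<and> trace_pow r P 1 \<in> \<nat>"

lemma trace_pow_1_rank_one:
  assumes P: "P \<in> carrier_mat r r" and w: "w \<in> carrier_vec r"
  shows "trace_pow r (P - c \<cdot>\<^sub>m outer w w) 1 = trace_pow r P 1 - c * (w \<bullet> w)"
proof -
  have "trace_pow r (P - c \<cdot>\<^sub>m outer w w) 1 = (\<Sum>i<r. unit_vec r i \<bullet> (P *\<^sub>v unit_vec r i) - c * (w $ i * w $ i))"
    unfolding trace_pow_def
  proof (intro sum.cong refl)
    fix i assume "i \<in> {..<r}"
    then have i: "i < r" by simp
    have "(P - c \<cdot>\<^sub>m outer w w) *\<^sub>v unit_vec r i = P *\<^sub>v unit_vec r i - (c * w $ i) \<cdot>\<^sub>v w"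
      using P w i by (simp add: minus_mat_vec smult_mat_vec outer_vec smult_smult_assoc)
    then show "unit_vec r i \<bullet> pw (P - c \<cdot>\<^sub>m outer w w) 1 (unit_vec r i) = unit_vec r i \<bullet> (P *\<^sub>v unit_vec r i) - c * (w $ i * w $ i)"
      using P w i by (simp add: scalar_prod_minus del: index_mult_mat_vec)
  qed
  then show ?thesis
    using w by (simp add: trace_pow_def sum_subtractf sum_distrib_left scalar_prod_def[of w w] atLeast0LessThan)
qed

lemma compl_proj_norm:
  assumes "proj_props is P" "x \<in> carrier_vec r"
  shows "(P *\<^sub>v x) \<bullet> (P *\<^sub>v x) = x \<bullet> (P *\<^sub>v x)"
proof -
  have P: "P \<in> carrier_mat r r" "transpose_mat P = P" "P *\<^sub>v (P *\<^sub>v x) = P *\<^sub>v x"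
    using assms by (auto simp: proj_props_def)
  then show ?thesis using symmetric_scalar_prod[OF P(1,2) assms(2), of "P *\<^sub>v x"] assms(2) by simp
qed

text \<open>Gram-Schmidt at the level of projections: the direction \<open>w\<close> of the new
  vector outside the span is removed and the trace drops by exactly 1; if \<open>w = 0\<close>
  nothing changes.\<close>

lemma compl_proj: "set is \<subseteq> {..<N} \<Longrightarrow> proj_props is (compl_proj is)"
proof (induction "is")
  case Nil
  have "trace_pow r (1\<^sub>m r) 1 = real r" by (simp add: trace_pow_def one_mat_vec)
  then show ?case by (simp add: proj_props_def one_mat_vec)
next
  case (Cons i "is")
  define P where "P = compl_proj is"
  have PP: "proj_props is P" using Cons by (simp add: P_def)
  then have P: "P \<in> carrier_mat r r" "transpose_mat P = P"
    and idem: "\<And>x. x \<in> carrier_vec r \<Longrightarrow> P *\<^sub>v (P *\<^sub>v x) = P *\<^sub>v x"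
    and kills: "\<And>j. j \<in> set is \<Longrightarrow> P *\<^sub>v v j = 0\<^sub>v r"
    and fixes_: "\<And>x. x \<in> carrier_vec r \<Longrightarrow> (\<And>j. j \<in> set is \<Longrightarrow> v j \<bullet> x = 0) \<Longrightarrow> P *\<^sub>v x = x"
    and nat: "trace_pow r P 1 \<in> \<nat>"
    by (auto simp: proj_props_def)
  have vi: "v i \<in> carrier_vec r" and vs: "\<And>j. j \<in> set is \<Longrightarrow> v j \<in> carrier_vec r"
    using Cons.prems v by auto
  define w where "w = P *\<^sub>v v i"
  have w: "w \<in> carrier_vec r" using P vi by (simp add: w_def)
  have Pw: "P *\<^sub>v w = w" unfolding w_def by (rule idem[OF vi])
  have wP: "w \<bullet> (P *\<^sub>v x) = w \<bullet> x" if "x \<in> carrier_vec r" for x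
    using symmetric_scalar_prod[OF P w that] Pw by simp
  have wv: "w \<bullet> v i = w \<bullet> w" using wP[OF vi] by (simp add: w_def)
  show ?case
  proof (cases "w \<bullet> w = 0")
    case True
    then have w0: "P *\<^sub>v v i = 0\<^sub>v r" using scalar_prod_self_eq_0[OF w] by (simp add: w_def)
    have "compl_proj (i # is) = P" using True by (simp add: Let_def P_def[symmetric] w_def[symmetric])
    moreover have "proj_props (i # is) P"
      using P idem kills fixes_ nat w0 unfolding proj_props_def by auto
    ultimately show ?thesis by simp
  next
    case False
    define c where "c = 1 / (w \<bullet> w)"
    have c: "c * (w \<bullet> w) = 1" using False by (simp add: c_def)
    define D where "D = P - c \<cdot>\<^sub>m outer w w"
    have De: "compl_proj (i # is) = D" using False by (simp add: Let_def P_def[symmetric] w_def[symmetric] D_def c_def)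
    have D: "D \<in> carrier_mat r r" using P w unfolding D_def by (intro carrier_matI) auto
    have Dx: "D *\<^sub>v x = P *\<^sub>v x - (c * (w \<bullet> x)) \<cdot>\<^sub>v w" if "x \<in> carrier_vec r" for x
      using that P w by (simp add: D_def minus_mat_vec smult_mat_vec outer_vec smult_smult_assoc)
    have wD: "w \<bullet> (D *\<^sub>v x) = 0" if x: "x \<in> carrier_vec r" for x
    proof -
      have "w \<bullet> (D *\<^sub>v x) = w \<bullet> x - (c * (w \<bullet> w)) * (w \<bullet> x)"
        using P w x by (simp add: Dx scalar_prod_minus wP)
      then show ?thesis using c by simp
    qed
    have idemD: "D *\<^sub>v (D *\<^sub>v x) = D *\<^sub>v x" if x: "x \<in> carrier_vec r" for x
    proof -
      have "D *\<^sub>v (D *\<^sub>v x) = P *\<^sub>v (D *\<^sub>v x) - (c * 0) \<cdot>\<^sub>v w"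
        unfolding wD[OF x, symmetric] using D x by (intro Dx) simp
      also have "P *\<^sub>v (D *\<^sub>v x) = D *\<^sub>v x"
        using P w x idem[OF x] Pw by (simp add: Dx mat_vec_minus mat_vec_smult)
      finally show ?thesis using D w by (intro eq_vecI) auto
    qed
    have Dvi: "D *\<^sub>v v i = 0\<^sub>v r"
      using w c by (simp add: Dx[OF vi] wv w_def[symmetric])
    have Dk: "D *\<^sub>v v j = 0\<^sub>v r" if j: "j \<in> set is" for j
    proof -
      have "w \<bullet> v j = 0" using wP[OF vs[OF j]] kills[OF j] w by simp
      then show ?thesis using w kills[OF j] by (simp add: Dx[OF vs[OF j]]) (intro eq_vecI, auto)
    qed
    have Df: "D *\<^sub>v x = x" if x: "x \<in> carrier_vec r" "v i \<bullet> x = 0" "\<And>j. j \<in> set is \<Longrightarrow> v j \<bullet> x = 0" for x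
    proof -
      have Px: "P *\<^sub>v x = x" using fixes_[OF x(1)] x(3) by blast
      have "w \<bullet> x = v i \<bullet> (P *\<^sub>v x)" unfolding w_def using symmetric_scalar_prod[OF P vi x(1)] by simp
      then have "w \<bullet> x = 0" using Px x(2) by simp
      then show ?thesis using Px x w by (simp add: Dx) (intro eq_vecI, auto)
    qed
    have tr: "trace_pow r D 1 = trace_pow r P 1 - 1"
      unfolding D_def trace_pow_1_rank_one[OF P(1) w] c ..
    have "0 \<le> trace_pow r D 1"
    proof -
      have sym: "transpose_mat D = D"
        using P w by (simp add: D_def mat_transpose_minus mat_transpose_smult outer_transpose)
      have "0 \<le> x \<bullet> (D *\<^sub>v x)" if "x \<in> carrier_vec r" for x
        using symmetric_scalar_prod[OF D sym that, of "D *\<^sub>v x"] D that idemD[OF that] by simp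
      then show ?thesis unfolding trace_pow_def by (intro sum_nonneg) simp
    qed
    then have "trace_pow r D 1 \<in> \<nat>"
      using nat unfolding tr by (auto elim!: Nats_cases intro!: Nats_diff)
    moreover have "transpose_mat D = D"
      using P w by (simp add: D_def mat_transpose_minus mat_transpose_smult outer_transpose)
    ultimately show ?thesis unfolding De proj_props_def using D idemD Dvi Dk Df by auto
  qed
qed

lemma compl_proj_psd: "set is \<subseteq> {..<N} \<Longrightarrow> psd r (compl_proj is)"
  using compl_proj[of "is"] compl_proj_norm[of "is" "compl_proj is"]
  unfolding psd_def by (metis proj_props_def scalar_prod_self_nonneg)

lemma compl_proj_step:
  assumes isN: "set is \<subseteq> {..<N}" "distinct is"
  shows "(\<Sum>i\<in>{..<N} - set is. trace_pow r (compl_proj (i # is)) 1)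
    \<le> (real N - real (length is)) * ((1 - 1 / (real N * rho)) * trace_pow r (compl_proj is) 1)"
proof -
  define P where "P = compl_proj is"
  define d where "d = trace_pow r P 1"
  note PP = compl_proj[OF isN(1), folded P_def]
  have P: "P \<in> carrier_mat r r" and kills: "\<And>j. j \<in> set is \<Longrightarrow> P *\<^sub>v v j = 0\<^sub>v r"
    using PP by (auto simp: proj_props_def)
  have psdP: "psd r P" using compl_proj_psd[OF isN(1)] by (simp add: P_def)
  have d0: "0 \<le> d" unfolding d_def trace_pow_def by (intro sum_nonneg psd_pw[OF psdP]) auto
  define e where "e i = (P *\<^sub>v v i) \<bullet> (P *\<^sub>v v i)" for i
  have e_le: "e i \<le> rho" if i: "i < N" for i
  proof -
    have ev: "e i = v i \<bullet> (P *\<^sub>v v i)" unfolding e_def by (rule compl_proj_norm[OF PP v[OF i]])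
    have "(e i)\<^sup>2 \<le> (v i \<bullet> v i) * e i"
      unfolding ev using P v[OF i] compl_proj_norm[OF PP v[OF i]] scalar_prod_Cauchy_Schwarz[of "v i" "P *\<^sub>v v i"] by simp
    also have "\<dots> \<le> rho * e i" using norm_le[OF i] by (intro mult_right_mono) (auto simp: e_def)
    finally have "e i * e i \<le> rho * e i" by (simp add: power2_eq_square)
    moreover have "0 \<le> e i" by (simp add: e_def)
    ultimately show ?thesis using rho by (cases "e i = 0") auto
  qed
  have upd: "trace_pow r (compl_proj (i # is)) 1 \<le> d - e i / rho" if i: "i < N" for i
  proof (cases "e i = 0")
    case True
    then have "compl_proj (i # is) = P" by (simp add: Let_def P_def[symmetric] e_def)
    then show ?thesis using True by (simp add: d_def)
  next
    case False
    have w: "P *\<^sub>v v i \<in> carrier_vec r" using P v[OF i] by simp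
    have "compl_proj (i # is) = P - (1 / e i) \<cdot>\<^sub>m outer (P *\<^sub>v v i) (P *\<^sub>v v i)"
      using False by (simp add: Let_def P_def[symmetric] e_def)
    then have "trace_pow r (compl_proj (i # is)) 1 = d - 1"
      using trace_pow_1_rank_one[OF P w, of "1 / e i"] False by (simp add: d_def e_def)
    moreover have "e i / rho \<le> 1" using e_le[OF i] rho by simp
    ultimately show ?thesis by simp
  qed
  have "d = (\<Sum>i<N. v i \<bullet> pw P 1 (v i))" unfolding d_def by (rule parseval_trace_pow[OF psdP, symmetric])
  also have "\<dots> = (\<Sum>i<N. e i)"
    unfolding e_def using compl_proj_norm[OF PP] v by (intro sum.cong) auto
  also have "\<dots> = (\<Sum>i\<in>{..<N} - set is. e i)"
    using isN(1) kills by (intro sum.mono_neutral_right) (auto simp: e_def)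
  finally have d_sum: "(\<Sum>i\<in>{..<N} - set is. e i) = d" by simp
  have card: "real (card ({..<N} - set is)) = real N - real (length is)"
    using isN card_mono[OF _ isN(1)] by (simp add: card_Diff_subset distinct_card of_nat_diff)
  have "(\<Sum>i\<in>{..<N} - set is. trace_pow r (compl_proj (i # is)) 1) \<le> (\<Sum>i\<in>{..<N} - set is. d - e i / rho)"
    using upd by (intro sum_mono) auto
  also have "\<dots> = (real N - real (length is)) * d - d / rho"
    using card d_sum by (simp add: sum_subtractf sum_divide_distrib[symmetric])
  also have "\<dots> \<le> (real N - real (length is)) * ((1 - 1 / (real N * rho)) * d)"
  proof -
    have "(real N - real (length is)) * (d / (real N * rho)) \<le> real N * (d / (real N * rho))"
      using d0 rho by (intro mult_right_mono) auto
    also have "\<dots> = d / rho" using N by simp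
    finally show ?thesis by (simp add: algebra_simps)
  qed
  finally show ?thesis by (simp add: d_def P_def)
qed

text \<open>Markov's inequality for the codimension of the sampled span: it starts at
  \<open>r\<close>, shrinks on average by the factor \<open>gam\<close> per draw, and is at least 1
  on every deficient list.\<close>

theorem card_rank_deficient_samples:
  "real (card {is. length is = m \<and> distinct is \<and> set is \<subseteq> {..<N} \<and>
      (\<exists>x \<in> carrier_vec r. x \<noteq> 0\<^sub>v r \<and> (\<forall>i \<in> set is. v i \<bullet> x = 0))})
    \<le> real (card {is. length is = m \<and> distinct is \<and> set is \<subseteq> {..<N}}) * (real r * exp (- (real m / (real N * rho))))"
  (is "real (card ?bad) \<le> _")
proof (cases "r = 0")
  case True
  then have e: "?bad = {}" by auto
  show ?thesis unfolding e by simp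
next
  case False
  have "1 \<le> real r" using False by simp
  then have Nr: "1 \<le> real N * rho" using N_rho by linarith
  let ?D = "\<lambda>n. {is. length is = n \<and> distinct is \<and> set is \<subseteq> {..<N}}"
  define f where "f is = trace_pow r (compl_proj is) 1" for "is"
  define gam where "gam = 1 - 1 / (real N * rho)"
  have gam0: "0 \<le> gam" using Nr by (simp add: gam_def)
  have fin: "finite (?D n)" for n
    by (rule finite_subset[OF _ finite_lists_length_eq[of "{..<N}" n]]) auto
  have split: "?D (Suc n) = (\<lambda>(is, i). i # is) ` (SIGMA is:?D n. {..<N} - set is)" for n
  proof (intro equalityI subsetI)
    fix xs assume "xs \<in> ?D (Suc n)"
    then show "xs \<in> (\<lambda>(is, i). i # is) ` (SIGMA is:?D n. {..<N} - set is)"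
      by (cases xs) (auto intro!: image_eqI[of _ _ "(tl xs, hd xs)"])
  qed auto
  have sum_split: "(\<Sum>is\<in>?D (Suc n). h is) = (\<Sum>is\<in>?D n. \<Sum>i\<in>{..<N} - set is. h (i # is))" for h :: "nat list \<Rightarrow> real" and n
  proof -
    have "(\<Sum>is\<in>?D (Suc n). h is) = (\<Sum>p\<in>(SIGMA is:?D n. {..<N} - set is). h (snd p # fst p))"
      unfolding split by (subst sum.reindex) (auto simp: inj_on_def case_prod_beta)
    also have "\<dots> = (\<Sum>is\<in>?D n. \<Sum>i\<in>{..<N} - set is. h (i # is))"
      using fin by (subst sum.Sigma) (auto simp: case_prod_beta)
    finally show ?thesis .
  qed
  have cardS: "real (card (?D (Suc n))) = (\<Sum>is\<in>?D n. real N - real n)" for n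
  proof -
    have "real (card (?D (Suc n))) = (\<Sum>is\<in>?D (Suc n). 1)" by simp
    also have "\<dots> = (\<Sum>is\<in>?D n. \<Sum>i\<in>{..<N} - set is. 1)" by (rule sum_split)
    also have "\<dots> = (\<Sum>is\<in>?D n. real N - real n)"
    proof (intro sum.cong refl)
      fix "is" assume "is \<in> ?D n"
      then have i: "set is \<subseteq> {..<N}" "distinct is" "length is = n" by auto
      then show "(\<Sum>i\<in>{..<N} - set is. 1) = real N - real n"
        using card_mono[OF _ i(1)] by (simp add: card_Diff_subset distinct_card of_nat_diff)
    qed
    finally show ?thesis .
  qed
  have bound: "(\<Sum>is\<in>?D n. f is) \<le> real (card (?D n)) * (gam ^ n * real r)" for n
  proof (induction n)
    case 0
    have "?D 0 = {[]}" by auto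
    then show ?case by (simp add: f_def trace_pow_def one_mat_vec)
  next
    case (Suc n)
    show ?case
    proof (cases "n < N")
      case True
      have "(\<Sum>is\<in>?D (Suc n). f is) \<le> (\<Sum>is\<in>?D n. (real N - real n) * (gam * f is))"
        unfolding sum_split f_def gam_def using compl_proj_step by (intro sum_mono) auto
      also have "\<dots> = (real N - real n) * gam * (\<Sum>is\<in>?D n. f is)" by (simp add: sum_distrib_left mult.assoc)
      also have "\<dots> \<le> (real N - real n) * gam * (real (card (?D n)) * (gam ^ n * real r))"
        using Suc True gam0 by (intro mult_left_mono) auto
      also have "\<dots> = real (card (?D (Suc n))) * (gam ^ Suc n * real r)"
        unfolding cardS by simp
      finally show ?thesis .
    next
      case False
      \<comment> \<open>For \<open>n \<ge> N\<close> there is no distinct list of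
        \<open>n + 1\<close> indices, so both sides vanish where the factor \<open>N - n\<close> has
        the wrong sign for the induction.\<close>
      have e: "?D (Suc n) = {}"
      proof -
        have "length xs \<le> N" if "distinct xs" "set xs \<subseteq> {..<N}" for xs
          using that card_mono[of "{..<N}" "set xs"] by (simp add: distinct_card)
        then show ?thesis using False by force
      qed
      show ?thesis unfolding e by simp
    qed
  qed
  \<comment> \<open>A vector orthogonal to the sample is fixed by the projection. An integral trace
    below 1 would be 0, and a positive semidefinite projection with zero diagonal annihilates all
    unit vectors, hence this vector too.\<close>
  have bad: "1 \<le> f is" if i: "is \<in> ?bad" for "is"
  proof (rule ccontr)
    assume "\<not> 1 \<le> f is"
    have isN: "set is \<subseteq> {..<N}" using i by simp
    note PP = compl_proj[OF isN]
    have "f is \<in> \<nat>" using PP by (simp add: proj_props_def f_def)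
    then have f0: "f is = 0" using \<open>\<not> 1 \<le> f is\<close> by (auto elim!: Nats_cases)
    obtain x where x: "x \<in> carrier_vec r" "x \<noteq> 0\<^sub>v r" "\<forall>i \<in> set is. v i \<bullet> x = 0" using i by auto
    define y where "y = (1 / sqrt (x \<bullet> x)) \<cdot>\<^sub>v x"
    have xx: "0 < x \<bullet> x" using x scalar_prod_self_pos by blast
    have Px: "compl_proj is *\<^sub>v x = x" using PP x by (auto simp: proj_props_def)
    have P: "compl_proj is \<in> carrier_mat r r" using PP by (simp add: proj_props_def)
    have z: "unit_vec r k \<bullet> (compl_proj is *\<^sub>v unit_vec r k) = 0" if "k < r" for k
    proof -
      have "0 \<le> unit_vec r l \<bullet> (compl_proj is *\<^sub>v unit_vec r l)" for l
        using compl_proj_psd[OF isN] by (simp add: psd_def)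
      then show ?thesis
        using f0 that sum_nonneg_eq_0_iff[of "{..<r}" "\<lambda>l. unit_vec r l \<bullet> (compl_proj is *\<^sub>v unit_vec r l)"]
        by (auto simp: f_def trace_pow_def)
    qed
    have Pk: "compl_proj is *\<^sub>v unit_vec r k = 0\<^sub>v r" if "k < r" for k
      using z[OF that] compl_proj_norm[OF PP, of "unit_vec r k"] P
        scalar_prod_self_eq_0[of "compl_proj is *\<^sub>v unit_vec r k" r] by simp
    have "x $ k = 0" if k: "k < r" for k
    proof -
      have "x $ k = unit_vec r k \<bullet> (compl_proj is *\<^sub>v x)" using Px x k by simp
      also have "\<dots> = (compl_proj is *\<^sub>v unit_vec r k) \<bullet> x"
        using PP x by (intro symmetric_scalar_prod[of _ r]) (auto simp: proj_props_def)
      finally show ?thesis using Pk[OF k] x by simp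
    qed
    then have "x = 0\<^sub>v r" using x by (intro eq_vecI) auto
    then show False using x by simp
  qed
  have f_nonneg: "0 \<le> f is" if "is \<in> ?D m" for "is"
    unfolding f_def trace_pow_def using that by (intro sum_nonneg psd_pw[OF compl_proj_psd]) auto
  have "real (card ?bad) = (\<Sum>is\<in>?bad. 1)" by simp
  also have "\<dots> \<le> (\<Sum>is\<in>?bad. f is)" using bad by (intro sum_mono) blast
  also have "\<dots> \<le> (\<Sum>is\<in>?D m. f is)" using fin f_nonneg by (intro sum_mono2) auto
  also have "\<dots> \<le> real (card (?D m)) * (gam ^ m * real r)" by (rule bound)
  also have "\<dots> \<le> real (card (?D m)) * (exp (- (1 / (real N * rho))) ^ m * real r)"
    using gam0 exp_ge_add_one_self[of "- (1 / (real N * rho))"]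
    by (intro mult_left_mono mult_right_mono power_mono) (auto simp: gam_def)
  also have "exp (- (1 / (real N * rho))) ^ m = exp (- (real m / (real N * rho)))"
    by (simp add: exp_of_nat_mult[symmetric])
  finally show ?thesis by (simp add: mult.commute)
qed

end

text \<open>Chernoff's method in counting form: each draw multiplies the mean exponential moment by
  \<open>1 + p * (exp th - 1)\<close> with \<open>p = card I / N\<close>, at most the exponential of
  \<open>p * (exp th - 1)\<close>.\<close>

lemma card_many_hits:
  assumes I: "I \<subseteq> {..<N}" and N: "0 < N" and th: "0 \<le> th"
  shows "real (card {js. set js \<subseteq> {..<N} \<and> length js = m \<and> t < real (length (filter (\<lambda>j. j \<in> I) js))})
    \<le> real N ^ m * exp (real m * (real (card I) / real N) * (exp th - 1) - th * t)"
  (is "real (card ?bad) \<le> _")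
proof -
  define f where "f js = exp (th * real (length (filter (\<lambda>j. j \<in> I) js)))" for js
  define c where "c = real N * exp (real (card I) / real N * (exp th - 1))"
  have c0: "0 \<le> c" by (simp add: c_def)
  have step: "(\<Sum>j\<in>{..<N}. f (j # js)) \<le> c * f js" for js
  proof -
    have "(\<Sum>j\<in>{..<N}. f (j # js)) = (\<Sum>j<N. f js + (if j \<in> I then (exp th - 1) * f js else 0))"
      by (intro sum.cong refl) (auto simp: f_def exp_add distrib_left algebra_simps)
    also have "\<dots> = real N * f js + real (card I) * ((exp th - 1) * f js)"
      using I by (simp add: sum.distrib sum.If_cases Int_absorb1)
    also have "\<dots> = real N * (1 + real (card I) / real N * (exp th - 1)) * f js"
      using N by (simp add: field_simps)
    also have "\<dots> \<le> c * f js"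
      unfolding c_def by (intro mult_right_mono mult_left_mono exp_ge_add_one_self) (auto simp: f_def)
    finally show ?thesis .
  qed
  let ?L = "{js. set js \<subseteq> {..<N} \<and> length js = m}"
  have finL: "finite ?L" by (rule finite_lists_length_eq) simp
  have "(\<Sum>js\<in>?L. f js) \<le> c ^ m * f []" by (rule sum_lists_bound[OF _ c0 step]) auto
  also have "\<dots> = real N ^ m * exp (real m * (real (card I) / real N) * (exp th - 1))"
    by (simp add: c_def f_def power_mult_distrib exp_of_nat_mult[symmetric] mult.assoc)
  finally have tot: "(\<Sum>js\<in>?L. f js) \<le> real N ^ m * exp (real m * (real (card I) / real N) * (exp th - 1))" .
  have "real (card ?bad) * exp (th * t) = (\<Sum>js\<in>?bad. exp (th * t))" by simp
  also have "\<dots> \<le> (\<Sum>js\<in>?bad. f js)" using th by (intro sum_mono) (auto simp: f_def intro!: mult_left_mono)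
  also have "\<dots> \<le> (\<Sum>js\<in>?L. f js)" using finL by (intro sum_mono2) (auto simp: f_def)
  finally have "real (card ?bad) * exp (th * t) \<le> real N ^ m * exp (real m * (real (card I) / real N) * (exp th - 1))"
    using tot by linarith
  then show ?thesis by (simp add: exp_diff field_simps)
qed

section \<open>The algorithm on a good sample\<close>

lemma vspan_cols:
  assumes "B \<in> carrier_mat n k"
  shows "vspan n (set (cols B)) = {B *\<^sub>v c |c. c \<in> carrier_vec k}"
proof -
  interpret vec_space "TYPE(real)" n .
  show ?thesis using col_space_eq[OF assms] assms by (auto simp: col_space_def)
qed

lemma colspace_eq:
  assumes "B \<in> carrier_mat n k"
  shows "colspace B = {B *\<^sub>v c |c. c \<in> carrier_vec k}"
  using vspan_cols[OF assms] assms by (simp add: vec_space.col_space_def)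

lemma rowspace_eq:
  assumes "B \<in> carrier_mat n k"
  shows "rowspace B = {transpose_mat B *\<^sub>v c |c. c \<in> carrier_vec n}"
  using vspan_cols[of "transpose_mat B" k n] assms by (simp add: vec_space.row_space_def)

lemma col_in_colspace:
  assumes "L \<in> carrier_mat n k" "j < k" shows "col L j \<in> colspace L"
  unfolding colspace_eq[OF assms(1)] using assms mat_vec_unit[of L k j] by (metis (mono_tags, lifting) carrier_matD(2) mem_Collect_eq unit_vec_carrier)

lemma orthonormal_basis_project:
  assumes B: "B \<in> carrier_mat n k" and b: "orthonormal_basis B W" and x: "x \<in> carrier_vec n"
  shows "B *\<^sub>v (transpose_mat B *\<^sub>v x) = x \<longleftrightarrow> x \<in> W"
proof
  have W: "W = {B *\<^sub>v c |c. c \<in> carrier_vec k}"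
    using b vspan_cols[OF B] B by (simp add: orthonormal_basis_def)
  show "B *\<^sub>v (transpose_mat B *\<^sub>v x) = x \<Longrightarrow> x \<in> W"
  proof -
    assume "B *\<^sub>v (transpose_mat B *\<^sub>v x) = x"
    moreover have "transpose_mat B *\<^sub>v x \<in> carrier_vec k" using B x by simp
    ultimately show "x \<in> W" unfolding W by (metis (mono_tags, lifting) mem_Collect_eq)
  qed
  assume "x \<in> W"
  then obtain c where c: "c \<in> carrier_vec k" "x = B *\<^sub>v c" unfolding W by auto
  have "transpose_mat B *\<^sub>v (B *\<^sub>v c) = (transpose_mat B * B) *\<^sub>v c"
    by (rule mat_vec_assoc[symmetric]) (use B c in auto)
  also have "transpose_mat B * B = 1\<^sub>m k" using b B by (simp add: orthonormal_basis_def)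
  finally show "B *\<^sub>v (transpose_mat B *\<^sub>v x) = x" using c by (simp add: one_mat_vec)
qed

lemma col_selection:
  assumes "set js \<subseteq> {..<n}"
  shows "col_selection n js \<in> carrier_mat n (length js)"
    and "A \<in> carrier_mat k n \<Longrightarrow> j < length js \<Longrightarrow> col (A * col_selection n js) j = col A (js ! j)"
proof -
  show c: "col_selection n js \<in> carrier_mat n (length js)"
    using mat_of_cols_carrier(1)[of n "map (unit_vec n) js"] by (simp add: col_selection_def)
  assume A: "A \<in> carrier_mat k n" and j: "j < length js"
  have jn: "js ! j < n" using assms j by (auto simp: subset_eq)
  have "col (A * col_selection n js) j = A *\<^sub>v col (col_selection n js) j"
    using A c j by (intro col_mult2[of _ k n _ "length js"]) auto
  also have "col (col_selection n js) j = unit_vec n (js ! j)"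
    using j by (simp add: col_selection_def)
  finally show "col (A * col_selection n js) j = col A (js ! j)" using A jn by (simp add: mat_vec_unit)
qed

lemma row_selection:
  assumes "set is \<subseteq> {..<n}"
  shows "row_selection n is \<in> carrier_mat (length is) n"
    and "x \<in> carrier_vec n \<Longrightarrow> a < length is \<Longrightarrow> (row_selection n is *\<^sub>v x) $ a = x $ (is ! a)"
proof -
  show c: "row_selection n is \<in> carrier_mat (length is) n"
    using mat_of_rows_carrier(1)[of n "map (unit_vec n) is"] by (simp add: row_selection_def)
  assume x: "x \<in> carrier_vec n" and a: "a < length is"
  have "is ! a < n" using assms a by (auto simp: subset_eq)
  then show "(row_selection n is *\<^sub>v x) $ a = x $ (is ! a)"
    using c x a by (simp add: row_selection_def)
qed

lemma mat_of_cols_mult: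
  fixes A :: "real mat"
  assumes "A \<in> carrier_mat n k" "\<And>x. x \<in> set xs \<Longrightarrow> x \<in> carrier_vec k"
  shows "mat_of_cols n (map (mult_mat_vec A) xs) = A * mat_of_cols k xs"
  using assms by (intro eq_matI) (auto simp: mat_of_cols_index col_mat_of_cols)

text \<open>All that is needed of the good event, with randomness removed: \<open>rows_full\<close>
  from the row sample, \<open>generic\<close> from the Gaussian entries, \<open>lower\<close> and
  \<open>few\<close> from the column sample. With \<open>ell = rho / low\<close>, \<open>few\<close>
  is the leverage condition of \<open>outlier_pursuit\<close> multiplied by the number of sampled
  outliers.\<close>

locale sampled_model =
  fixes N1 N2 r :: nat and L C U V :: "real mat" and I :: "nat set" and js "is" :: "nat list" and rho low :: real
  assumes L: "L \<in> carrier_mat N1 N2" and C: "C \<in> carrier_mat N1 N2" and C_cols: "nonzero_cols C = I"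
    and L_cols: "\<And>i. i \<in> I \<Longrightarrow> col L i = 0\<^sub>v N1"
    and U: "U \<in> carrier_mat N1 r" "orthonormal_basis U (colspace L)"
    and V: "V \<in> carrier_mat N2 r" "orthonormal_basis V (rowspace L)"
    and js: "set js \<subseteq> {..<N2}" and isN: "set is \<subseteq> {..<N1}"
    and rows_full: "\<And>x. x \<in> carrier_vec r \<Longrightarrow> (\<And>i. i \<in> set is \<Longrightarrow> row U i \<bullet> x = 0) \<Longrightarrow> x = 0\<^sub>v r"
    and generic: "\<And>i c. i \<in> I \<Longrightarrow> c \<in> carrier_vec r \<Longrightarrow> row_selection N1 is *\<^sub>v col C i \<noteq> row_selection N1 is *\<^sub>v (U *\<^sub>v c)"
    and lower: "\<And>z. z \<in> carrier_vec r \<Longrightarrow> low * (z \<bullet> z) \<le> (\<Sum>j\<leftarrow>js. (row V j \<bullet> z)\<^sup>2)"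
    and low: "0 < low"
    and row_norm: "\<And>j. j < N2 \<Longrightarrow> row V j \<bullet> row V j \<le> rho"
    and rho: "0 \<le> rho"
    and few: "rho / low * 2041 / 1960 * real (length (filter (\<lambda>j. j \<in> I) js)) < 9 / 49"
begin

definition D where "D = L + C"
definition S where "S = col_selection N2 js"
definition Phi where "Phi = row_selection N1 is"
definition Ds where "Ds = D * S"
definition M where "M = Phi * Ds"
definition m where "m = length js"
definition k where "k = length is"
definition J where "J = {j. j < m \<and> js ! j \<in> I}"
definition P where "P = L * V"
definition PU where "PU = Phi * U"
definition R where "R = {PU *\<^sub>v c |c. c \<in> carrier_vec r}"

section \<open>The compressed data matrix\<close>

lemma I: "I \<subseteq> {..<N2}" using C_cols C by (auto simp: nonzero_cols_def)

lemma D: "D \<in> carrier_mat N1 N2" using L C by (simp add: D_def)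

lemma Phi: "Phi \<in> carrier_mat k N1" using row_selection(1)[OF isN] by (simp add: Phi_def k_def)

lemma P: "P \<in> carrier_mat N1 r" using L V by (simp add: P_def)

lemma PU: "PU \<in> carrier_mat k r" using Phi U by (simp add: PU_def)

lemma col_D: "i < N2 \<Longrightarrow> col D i = (if i \<in> I then col C i else col L i)"
proof -
  assume i: "i < N2"
  have "col D i = col L i + col C i" unfolding D_def using L C i by (intro col_add) auto
  moreover have "i \<notin> I \<Longrightarrow> col C i = 0\<^sub>v N1" using C_cols C i by (auto simp: nonzero_cols_def)
  ultimately show ?thesis using L_cols[of i] L C i by auto
qed

lemma Ds: "Ds \<in> carrier_mat N1 m" "j < m \<Longrightarrow> col Ds j = col D (js ! j)"
  using D col_selection[OF js] by (auto simp: Ds_def S_def m_def)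

lemma M: "M \<in> carrier_mat k m" "j < m \<Longrightarrow> col M j = Phi *\<^sub>v col D (js ! j)"
proof -
  show "M \<in> carrier_mat k m" using Phi Ds by (simp add: M_def)
  assume j: "j < m"
  have "col M j = Phi *\<^sub>v col Ds j" unfolding M_def using Phi Ds j by (intro col_mult2[of _ k N1 _ m]) auto
  then show "col M j = Phi *\<^sub>v col D (js ! j)" using Ds(2)[OF j] by simp
qed

lemma js_nth: "j < m \<Longrightarrow> js ! j < N2" using js by (auto simp: m_def subset_eq)

lemma L_project: "U *\<^sub>v (transpose_mat U *\<^sub>v (L *\<^sub>v y)) = L *\<^sub>v y" if "y \<in> carrier_vec N2"
proof -
  have "L *\<^sub>v y \<in> carrier_vec N1" using L that by simp
  moreover have "L *\<^sub>v y \<in> colspace L" unfolding colspace_eq[OF L] using that by blast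
  ultimately show ?thesis using orthonormal_basis_project[OF U] by blast
qed

lemma P_project: "U *\<^sub>v (transpose_mat U *\<^sub>v (P *\<^sub>v y)) = P *\<^sub>v y" if "y \<in> carrier_vec r"
  using L_project[of "V *\<^sub>v y"] L V that by (simp add: P_def mat_vec_assoc)

lemma L_eq: "L = P * transpose_mat V"
proof (rule mat_eqI_vec[of _ N1 N2])
  fix x :: "real vec" assume x: "x \<in> carrier_vec N2"
  show "L *\<^sub>v x = P * transpose_mat V *\<^sub>v x"
  proof (rule eq_vecI)
    fix i assume "i < dim_vec (P * transpose_mat V *\<^sub>v x)"
    then have i: "i < N1" using P by simp
    have ri: "row L i \<in> carrier_vec N2" using L i by simp
    have "transpose_mat L *\<^sub>v unit_vec N1 i = row L i" using L i by (simp add: mat_vec_unit)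
    from this[symmetric] have "row L i \<in> rowspace L"
      unfolding rowspace_eq[OF L] using unit_vec_carrier[of N1 i] by blast
    then have e: "V *\<^sub>v (transpose_mat V *\<^sub>v row L i) = row L i"
      using orthonormal_basis_project[OF V ri] by blast
    have "(L *\<^sub>v x) $ i = (V *\<^sub>v (transpose_mat V *\<^sub>v row L i)) \<bullet> x" using L i e by simp
    also have "\<dots> = x \<bullet> (V *\<^sub>v (transpose_mat V *\<^sub>v row L i))" using V x by (intro scalar_prod_commute) simp
    also have "\<dots> = (transpose_mat V *\<^sub>v x) \<bullet> (transpose_mat V *\<^sub>v row L i)"
      using V x by (intro scalar_prod_adjoint) auto
    also have "\<dots> = (V *\<^sub>v (transpose_mat V *\<^sub>v x)) \<bullet> row L i"
      using V x L by (subst scalar_prod_adjoint) auto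
    also have "\<dots> = row L i \<bullet> (V *\<^sub>v (transpose_mat V *\<^sub>v x))" using V L by (intro scalar_prod_commute) simp
    also have "\<dots> = (P * transpose_mat V *\<^sub>v x) $ i"
      using L V x i by (simp add: P_def mat_vec_assoc del: index_mult_mat_vec) simp
    finally show "(L *\<^sub>v x) $ i = (P * transpose_mat V *\<^sub>v x) $ i" .
  qed (use L P in simp)
qed (use L P V in auto)

lemma col_L: "j < N2 \<Longrightarrow> col L j = P *\<^sub>v row V j"
proof -
  assume j: "j < N2"
  have "col L j = P *\<^sub>v col (transpose_mat V) j"
    by (subst L_eq, rule col_mult2[of _ N1 r _ N2]) (use P V j in auto)
  then show ?thesis using V j by simp
qed

text \<open>The row space is spanned by rows of \<open>L\<close>, whose entries at outlier positions
  are zero. A sum over all sampled rows of \<open>V\<close> is therefore a sum over the sampled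
  inliers.\<close>

lemma row_V_outlier: assumes "j \<in> I" shows "row V j = 0\<^sub>v r"
proof (rule eq_vecI)
  fix a assume "a < dim_vec (0\<^sub>v r)"
  then have a: "a < r" by simp
  have j: "j < N2" using assms I by auto
  have "col V a = V *\<^sub>v unit_vec r a" using V a by (simp add: mat_vec_unit)
  moreover have "rowspace L = {V *\<^sub>v c |c. c \<in> carrier_vec r}"
    using V vspan_cols[OF V(1)] by (simp add: orthonormal_basis_def)
  ultimately have "col V a \<in> rowspace L" using unit_vec_carrier[of r a] by blast
  then obtain c where c: "c \<in> carrier_vec N1" "col V a = transpose_mat L *\<^sub>v c"
    unfolding rowspace_eq[OF L] by auto
  have "row V j $ a = col V a $ j" using V a j by simp
  also have "\<dots> = col L j \<bullet> c" unfolding c(2) using L j by simp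
  finally show "row V j $ a = 0\<^sub>v r $ a" using a c L_cols[OF assms] by simp
qed (use V in simp)

lemma PU_inj: assumes "x \<in> carrier_vec r" "PU *\<^sub>v x = 0\<^sub>v k" shows "x = 0\<^sub>v r"
proof (rule rows_full[OF assms(1)])
  fix i assume "i \<in> set is"
  then obtain a where a: "a < k" "is ! a = i" by (auto simp: in_set_conv_nth k_def)
  have i: "i < N1" using \<open>i \<in> set is\<close> isN by auto
  have "(PU *\<^sub>v x) $ a = (U *\<^sub>v x) $ i"
    using row_selection(2)[OF isN, of "U *\<^sub>v x" a] a U assms Phi
    by (simp add: PU_def Phi_def[symmetric] k_def[symmetric] mat_vec_assoc del: index_mult_mat_vec)
  then show "row U i \<bullet> x = 0" using assms(2) a i U by simp
qed

lemma PU_inj2: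
  assumes "x \<in> carrier_vec r" "y \<in> carrier_vec r" "PU *\<^sub>v x = PU *\<^sub>v y" shows "x = y"
proof -
  have "PU *\<^sub>v (x - y) = 0\<^sub>v k" using assms PU by (auto simp: mat_vec_minus intro!: eq_vecI)
  then have z: "x - y = 0\<^sub>v r" using assms by (intro PU_inj) auto
  show ?thesis
  proof (rule eq_vecI)
    fix i assume i: "i < dim_vec y"
    have "(x - y) $ i = 0" unfolding z using i assms by simp
    then show "x $ i = y $ i" using i by simp
  qed (use assms in simp)
qed

lemma inlier_col: assumes "i < N2" "i \<notin> I"
  shows "Phi *\<^sub>v col D i = PU *\<^sub>v (transpose_mat U *\<^sub>v col L i)" "Phi *\<^sub>v col D i = (Phi * P) *\<^sub>v row V i"
proof -
  have Lc: "col L i \<in> carrier_vec N1" using L assms by simp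
  have "U *\<^sub>v (transpose_mat U *\<^sub>v col L i) = col L i"
    using orthonormal_basis_project[OF U Lc] col_in_colspace[OF L assms(1)] by simp
  then show "Phi *\<^sub>v col D i = PU *\<^sub>v (transpose_mat U *\<^sub>v col L i)"
    using assms Phi U Lc by (simp add: col_D PU_def mat_vec_assoc)
  show "Phi *\<^sub>v col D i = (Phi * P) *\<^sub>v row V i"
    using assms Phi P V by (simp add: col_D col_L mat_vec_assoc)
qed

lemma outlier_col: assumes "i \<in> I" shows "Phi *\<^sub>v col D i \<notin> R"
proof
  assume "Phi *\<^sub>v col D i \<in> R"
  then obtain c where c: "c \<in> carrier_vec r" "Phi *\<^sub>v col D i = PU *\<^sub>v c" by (auto simp: R_def)
  have "Phi *\<^sub>v col C i = Phi *\<^sub>v (U *\<^sub>v c)"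
    using c assms I Phi U by (simp add: col_D PU_def mat_vec_assoc subset_eq)
  then show False using generic[OF assms c(1)] by (simp add: Phi_def)
qed

lemma colspace_range: "colspace L = {U *\<^sub>v c |c. c \<in> carrier_vec r}"
  using U vspan_cols[OF U(1)] by (simp add: orthonormal_basis_def)

lemma U_range_P: assumes "c \<in> carrier_vec r" obtains y where "y \<in> carrier_vec r" "U *\<^sub>v c = P *\<^sub>v y"
proof -
  have "U *\<^sub>v c \<in> colspace L" unfolding colspace_range using assms by blast
  then obtain x where x: "x \<in> carrier_vec N2" "U *\<^sub>v c = L *\<^sub>v x" unfolding colspace_eq[OF L] by auto
  have "L *\<^sub>v x = P *\<^sub>v (transpose_mat V *\<^sub>v x)" by (subst L_eq) (use x P V in \<open>simp add: mat_vec_assoc\<close>)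
  then show thesis using that[of "transpose_mat V *\<^sub>v x"] x V by simp
qed

lemma sum_inliers:
  "(\<Sum>i\<in>{..<m} - J. (row V (js ! i) \<bullet> z)\<^sup>2) = (\<Sum>j\<leftarrow>js. (row V j \<bullet> z)\<^sup>2)" if z: "z \<in> carrier_vec r"
proof -
  have "(\<Sum>j\<leftarrow>js. (row V j \<bullet> z)\<^sup>2) = (\<Sum>i<m. (row V (js ! i) \<bullet> z)\<^sup>2)"
    by (simp add: sum_list_sum_nth m_def atLeast0LessThan)
  also have "\<dots> = (\<Sum>i\<in>{..<m} - J. (row V (js ! i) \<bullet> z)\<^sup>2)"
    using row_V_outlier z by (intro sum.mono_neutral_right) (auto simp: J_def)
  finally show ?thesis ..
qed

text \<open>Instantiates \<open>outlier_pursuit\<close>. Pairing a compressed inlier with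
  \<open>z\<close> equals pairing the corresponding row of \<open>V\<close> with
  \<open>tz z\<close>, so the bounds \<open>row_norm\<close> and \<open>lower\<close> transfer with
  the ratio \<open>rho / low\<close> intact and no condition number of the row-sampled basis
  enters.\<close>

lemma support:
  assumes sol: "program_solution (card (nonzero_cols (C * S))) M (Lh, Ch)"
  shows "nonzero_cols Ch = J" "dim_col Ch = m"
proof -
  have CS: "C * S \<in> carrier_mat N1 m" using C col_selection(1)[OF js] by (simp add: S_def m_def)
  have "col (C * S) j = col C (js ! j)" if "j < m" for j
    using col_selection(2)[OF js C, of j] that by (simp add: S_def m_def)
  then have nz: "nonzero_cols (C * S) = J"
    using CS C js_nth C_cols unfolding nonzero_cols_def J_def by auto
  have cardJ: "card J = length (filter (\<lambda>j. j \<in> I) js)"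
    unfolding J_def m_def by (rule length_filter_conv_card[symmetric])
  have feas: "Lh \<in> carrier_mat k m" "Ch \<in> carrier_mat k m" "Lh + Ch = M"
    using sol M(1) by (auto simp: program_solution_def feasible_def)
  then show "dim_col Ch = m" by simp
  show "nonzero_cols Ch = J"
  proof (cases "card J = 0")
    case True
    have "finite J" by (simp add: J_def)
    then have "J = {}" using True by simp
    moreover have "Ch = 0\<^sub>m k m" using sol True M(1) by (simp add: program_solution_def nz)
    then have "nonzero_cols Ch = {}" by (auto simp: nonzero_cols_def)
    ultimately show ?thesis by simp
  next
    case False
    define lam where "lam = 3 / (7 * sqrt (real (card J)))"
    have lam: "0 < lam" "lam\<^sup>2 * real (card J) = 9 / 49"
      using False by (simp_all add: lam_def power_divide power_mult_distrib)
    have opt: "lam * norm_1_2 Ch + nuclear_norm Lh \<le> lam * norm_1_2 C' + nuclear_norm L'"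
      if "L' \<in> carrier_mat k m" "C' \<in> carrier_mat k m" "L' + C' = M" for L' C'
    proof -
      have "feasible M (L', C')" using that M(1) by (simp add: feasible_def)
      then have "objective lam (Lh, Ch) \<le> objective lam (L', C')"
        using sol False unfolding program_solution_def nz lam_def by auto
      then show ?thesis by (simp add: objective_def)
    qed
    have pd: "pos_def r (transpose_mat PU * PU)"
      unfolding pos_def_def
    proof (intro conjI ballI impI)
      fix x :: "real vec" assume x: "x \<in> carrier_vec r" "x \<noteq> 0\<^sub>v r"
      have "x \<bullet> (transpose_mat PU * PU *\<^sub>v x) = (PU *\<^sub>v x) \<bullet> (PU *\<^sub>v x)"
        using x PU by (simp add: mat_vec_assoc scalar_prod_adjoint[of x])
      moreover have "PU *\<^sub>v x \<noteq> 0\<^sub>v k" using PU_inj x by blast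
      ultimately show "0 < x \<bullet> (transpose_mat PU * PU *\<^sub>v x)"
        using scalar_prod_self_pos[of "PU *\<^sub>v x" k] PU x by simp
    qed (use PU in \<open>auto simp: mat_transpose_mult\<close>)
    obtain G W where G: "pos_def r G" and W: "pos_def r W" "G * G = transpose_mat PU * PU"
      "W * G = 1\<^sub>m r" "G * W = 1\<^sub>m r" using pos_def_sqrt[OF pd] by metis
    note d = pos_def_dims[OF G] pos_def_dims[OF W(1)]
    \<comment> \<open>Symmetric orthonormalization of the compressed basis; the inverse root exists
      because \<open>PU\<close> is injective.\<close>
    define U0 where "U0 = PU * W"
    have U0: "U0 \<in> carrier_mat k r" using PU d by (simp add: U0_def)
    have "transpose_mat U0 * U0 = W * ((transpose_mat PU * PU) * W)"
      using PU d by (simp add: U0_def mat_transpose_mult mat_assoc)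
    also have "\<dots> = 1\<^sub>m r" unfolding W(2)[symmetric] using d W(3,4) by (simp add: mat_assoc)
    finally have UU: "transpose_mat U0 * U0 = 1\<^sub>m r" .
    have U0U: "transpose_mat U0 *\<^sub>v (U0 *\<^sub>v x) = x" if "x \<in> carrier_vec r" for x
    proof -
      have "transpose_mat U0 *\<^sub>v (U0 *\<^sub>v x) = (transpose_mat U0 * U0) *\<^sub>v x"
        by (rule mat_vec_assoc[symmetric]) (use U0 that in auto)
      then show ?thesis unfolding UU using that by (simp add: one_mat_vec)
    qed
    have PUU0: "PU *\<^sub>v c = U0 *\<^sub>v (G *\<^sub>v c)" if "c \<in> carrier_vec r" for c
    proof -
      have "U0 *\<^sub>v (G *\<^sub>v c) = PU *\<^sub>v ((W * G) *\<^sub>v c)" using PU d that by (simp add: U0_def mat_vec_assoc)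
      then show ?thesis unfolding W(3) using that by (simp add: one_mat_vec)
    qed
    have proj: "U0 *\<^sub>v (transpose_mat U0 *\<^sub>v x) = x \<longleftrightarrow> x \<in> R" if x: "x \<in> carrier_vec k" for x
    proof
      assume a: "U0 *\<^sub>v (transpose_mat U0 *\<^sub>v x) = x"
      have "x = PU *\<^sub>v (W *\<^sub>v (transpose_mat U0 *\<^sub>v x))"
        using a PU d U0 x by (simp add: U0_def mat_vec_assoc)
      moreover have "W *\<^sub>v (transpose_mat U0 *\<^sub>v x) \<in> carrier_vec r" using d by (intro carrier_vecI) simp
      ultimately show "x \<in> R" unfolding R_def by blast
    next
      assume "x \<in> R"
      then obtain c where c: "c \<in> carrier_vec r" "x = PU *\<^sub>v c" by (auto simp: R_def)
      have "G *\<^sub>v c \<in> carrier_vec r" using d c by simp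
      then show "U0 *\<^sub>v (transpose_mat U0 *\<^sub>v x) = x" unfolding c(2) PUU0[OF c(1)] by (simp add: U0U)
    qed
    have Mc: "col M i \<in> carrier_vec k" if "i < m" for i using M(1) that by simp
    have in_R: "col M i \<in> R" if "i < m" "i \<notin> J" for i
    proof -
      have "js ! i < N2" "js ! i \<notin> I" using that js_nth by (auto simp: J_def)
      then have "col M i = PU *\<^sub>v (transpose_mat U *\<^sub>v col L (js ! i))" using inlier_col(1) M(2) that by simp
      moreover have "transpose_mat U *\<^sub>v col L (js ! i) \<in> carrier_vec r" using U by (intro carrier_vecI) simp
      ultimately show ?thesis unfolding R_def by blast
    qed
    \<comment> \<open>The adjoint of the map that sends coordinates in the row space to compressed
      columns.\<close>
    define tz where "tz z = transpose_mat (Phi * P) *\<^sub>v (U0 *\<^sub>v z)" for z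
    have tz: "tz z \<in> carrier_vec r" for z unfolding tz_def using P Phi by (intro carrier_vecI) simp
    have coord: "(transpose_mat U0 *\<^sub>v col M i) \<bullet> z = row V (js ! i) \<bullet> tz z"
      if "i < m" "i \<notin> J" "z \<in> carrier_vec r" for i z
    proof -
      have i: "js ! i < N2" "js ! i \<notin> I" using that js_nth by (auto simp: J_def)
      have Mi: "col M i = (Phi * P) *\<^sub>v row V (js ! i)" using inlier_col(2)[OF i] M(2) that by simp
      have "(transpose_mat U0 *\<^sub>v col M i) \<bullet> z = col M i \<bullet> (U0 *\<^sub>v z)"
        using U0 M(1) that by (intro scalar_prod_adjoint[symmetric]) auto
      also have "\<dots> = (U0 *\<^sub>v z) \<bullet> ((Phi * P) *\<^sub>v row V (js ! i))"
        unfolding Mi using U0 Phi by (intro scalar_prod_commute) simp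
      also have "\<dots> = tz z \<bullet> row V (js ! i)"
        unfolding tz_def using U0 P Phi V i by (intro scalar_prod_adjoint) auto
      also have "\<dots> = row V (js ! i) \<bullet> tz z" using tz[of z] V i by (intro scalar_prod_commute) simp
      finally show ?thesis .
    qed
    have energy: "(\<Sum>i\<in>{..<m} - J. ((transpose_mat U0 *\<^sub>v col M i) \<bullet> z)\<^sup>2) = (\<Sum>j\<leftarrow>js. (row V j \<bullet> tz z)\<^sup>2)"
      if z: "z \<in> carrier_vec r" for z
      unfolding sum_inliers[OF tz, symmetric] using z by (intro sum.cong) (auto simp: coord)
    have "outlier_pursuit M U0 k m r J lam (rho / low)"
    proof
      show "M \<in> carrier_mat k m" "U0 \<in> carrier_mat k r" "transpose_mat U0 * U0 = 1\<^sub>m r"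
        "J \<subseteq> {..<m}" "0 < lam" "lam\<^sup>2 * real (card J) = 9 / 49" "0 \<le> rho / low"
        using M(1) U0 UU lam rho low by (auto simp: J_def)
      show "U0 *\<^sub>v (transpose_mat U0 *\<^sub>v col M i) = col M i" if "i < m" "i \<notin> J" for i
        using proj[OF Mc[OF that(1)]] in_R[OF that] by simp
      show "U0 *\<^sub>v (transpose_mat U0 *\<^sub>v col M j) \<noteq> col M j" if "j \<in> J" for j
      proof -
        have j: "j < m" "js ! j \<in> I" using that by (auto simp: J_def)
        then have "col M j \<notin> R" using outlier_col M(2) by simp
        then show ?thesis using proj[OF Mc[OF j(1)]] by simp
      qed
      show "0 < (\<Sum>i\<in>{..<m} - J. ((transpose_mat U0 *\<^sub>v col M i) \<bullet> z)\<^sup>2)"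
        if z: "z \<in> carrier_vec r" "z \<noteq> 0\<^sub>v r" for z
      proof -
        \<comment> \<open>The range of \<open>U0\<close> lies in the range of
          \<open>Phi * P\<close>. If the adjoint annihilated \<open>U0 *\<^sub>v z\<close>, this
          vector would be orthogonal to itself, although \<open>U0\<close> is an isometry.\<close>
        have "tz z \<noteq> 0\<^sub>v r"
        proof
          assume t0: "tz z = 0\<^sub>v r"
          have Wz: "W *\<^sub>v z \<in> carrier_vec r" using d z by simp
          obtain y where y: "y \<in> carrier_vec r" "U *\<^sub>v (W *\<^sub>v z) = P *\<^sub>v y" using U_range_P[OF Wz] .
          have "U0 *\<^sub>v z = (Phi * P) *\<^sub>v y"
            using y U P Phi d z PU by (simp add: U0_def PU_def mat_vec_assoc)
          then have "(U0 *\<^sub>v z) \<bullet> (U0 *\<^sub>v z) = (U0 *\<^sub>v z) \<bullet> ((Phi * P) *\<^sub>v y)" by simp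
          also have "\<dots> = tz z \<bullet> y" unfolding tz_def using U0 P Phi y by (intro scalar_prod_adjoint) auto
          finally have "(U0 *\<^sub>v z) \<bullet> (U0 *\<^sub>v z) = 0" using y t0 by simp
          moreover have "(U0 *\<^sub>v z) \<bullet> (U0 *\<^sub>v z) = z \<bullet> z" by (rule isometry_norm[OF UU]) (use U0 z in auto)
          ultimately show False using scalar_prod_self_pos[OF z] by simp
        qed
        then have "0 < low * (tz z \<bullet> tz z)" using scalar_prod_self_pos[OF tz] low by simp
        also have "\<dots> \<le> (\<Sum>j\<leftarrow>js. (row V j \<bullet> tz z)\<^sup>2)" by (rule lower[OF tz])
        finally show ?thesis using energy[OF z(1)] by simp
      qed
      show "((transpose_mat U0 *\<^sub>v col M i) \<bullet> z)\<^sup>2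
          \<le> rho / low * (\<Sum>i\<in>{..<m} - J. ((transpose_mat U0 *\<^sub>v col M i) \<bullet> z)\<^sup>2)"
        if i: "i < m" "i \<notin> J" and z: "z \<in> carrier_vec r" for i z
      proof -
        have ji: "js ! i < N2" using js_nth i by simp
        have "(row V (js ! i) \<bullet> tz z)\<^sup>2 \<le> (row V (js ! i) \<bullet> row V (js ! i)) * (tz z \<bullet> tz z)"
          using V ji tz[of z] by (intro scalar_prod_Cauchy_Schwarz) simp
        also have "\<dots> \<le> rho * (tz z \<bullet> tz z)" using row_norm[OF ji] by (intro mult_right_mono) auto
        also have "\<dots> = rho / low * (low * (tz z \<bullet> tz z))" using low by simp
        also have "\<dots> \<le> rho / low * (\<Sum>j\<leftarrow>js. (row V j \<bullet> tz z)\<^sup>2)"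
          using lower[OF tz] rho low by (intro mult_left_mono) auto
        finally show ?thesis unfolding coord[OF i z] energy[OF z] .
      qed
      \<comment> \<open>Multiplication by \<open>card J\<close> reduces the strict leverage bound to
        \<open>few\<close>, because \<open>lam\<^sup>2 * card J = 9/49\<close>.\<close>
      have "(rho / low * 2041 / 1960) * real (card J) < lam\<^sup>2 * real (card J)"
        unfolding lam(2) using few by (simp add: cardJ)
      then show "rho / low * 2041 / 1960 < lam\<^sup>2" by (rule mult_right_less_imp_less) simp
    qed
    then show ?thesis using outlier_pursuit.solution_support[OF _ feas opt] by blast
  qed
qed

text \<open>By \<open>lower\<close> the sampled rows of \<open>V\<close> span all coordinates, so
  the sampled inliers already generate the whole compressed column space.\<close>

lemma inlier_span_eq:
  assumes "nonzero_cols Ch = J" "dim_col Ch = m"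
  shows "inlier_span M Ch = R"
proof -
  define ks where "ks = filter (\<lambda>i. i \<notin> J) [0..<m]"
  have dec: "declared_inliers Ch = set ks" using assms by (auto simp: declared_inliers_def ks_def)
  define Vs where "Vs = mat_of_cols r (map (\<lambda>i. row V (js ! i)) ks)"
  have Vs: "Vs \<in> carrier_mat r (length ks)" using mat_of_cols_carrier(1)[of r "map (\<lambda>i. row V (js ! i)) ks"] by (simp add: Vs_def)
  have rV: "row V (js ! i) \<in> carrier_vec r" if "i \<in> set ks" for i using that V(1) js_nth[of i] by (auto simp: ks_def)
  have PP: "Phi * P \<in> carrier_mat k r" using Phi P by simp
  have Mi: "map (col M) ks = map (mult_mat_vec (Phi * P)) (map (\<lambda>i. row V (js ! i)) ks)"
    using inlier_col(2) M(2) js_nth by (auto simp: ks_def J_def)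
  have "col M ` declared_inliers Ch = set (map (col M) ks)" using dec by simp
  also have "\<dots> = set (cols (mat_of_cols k (map (col M) ks)))"
    using M(1) by (subst cols_mat_of_cols) (auto simp: ks_def)
  also have "mat_of_cols k (map (col M) ks) = (Phi * P) * Vs"
    unfolding Mi Vs_def using PP rV by (intro mat_of_cols_mult) auto
  finally have span: "inlier_span M Ch = {(Phi * P) * Vs *\<^sub>v c |c. c \<in> carrier_vec (length ks)}"
    using M(1) vspan_cols[of "(Phi * P) * Vs" k "length ks"] PP Vs by (simp add: inlier_span_def)
  have VVpd: "pos_def r (Vs * transpose_mat Vs)"
    unfolding pos_def_def
  proof (intro conjI ballI impI)
    fix x :: "real vec" assume x: "x \<in> carrier_vec r" "x \<noteq> 0\<^sub>v r"
    have "x \<bullet> (Vs * transpose_mat Vs *\<^sub>v x) = (\<Sum>i<length ks. (col Vs i \<bullet> x)\<^sup>2)"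
      using Vs x by (subst mat_vec_transpose_norm(2)) auto
    also have "\<dots> = (\<Sum>i<length ks. (row V (js ! (ks ! i)) \<bullet> x)\<^sup>2)"
      using rV by (intro sum.cong) (auto simp: Vs_def col_mat_of_cols)
    also have "\<dots> = (\<Sum>i\<leftarrow>ks. (row V (js ! i) \<bullet> x)\<^sup>2)" by (simp add: sum_list_sum_nth atLeast0LessThan)
    also have "\<dots> = (\<Sum>i\<in>set ks. (row V (js ! i) \<bullet> x)\<^sup>2)"
      by (rule sum_list_distinct_conv_sum_set) (simp add: ks_def)
    also have "set ks = {..<m} - J" by (auto simp: ks_def)
    finally have e: "x \<bullet> (Vs * transpose_mat Vs *\<^sub>v x) = (\<Sum>j\<leftarrow>js. (row V j \<bullet> x)\<^sup>2)"
      using sum_inliers[OF x(1)] by simp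
    have "0 < low * (x \<bullet> x)" using scalar_prod_self_pos[OF x] low by simp
    also have "\<dots> \<le> (\<Sum>j\<leftarrow>js. (row V j \<bullet> x)\<^sup>2)" by (rule lower[OF x(1)])
    finally show "0 < x \<bullet> (Vs * transpose_mat Vs *\<^sub>v x)" unfolding e .
  qed (use Vs in \<open>auto simp: mat_transpose_mult\<close>)
  obtain H where H: "pos_def r H" "(Vs * transpose_mat Vs) * H = 1\<^sub>m r" using pos_def_inverse[OF VVpd] by metis
  note d = pos_def_dims[OF H(1)]
  show ?thesis
  proof (intro equalityI subsetI)
    fix x assume "x \<in> inlier_span M Ch"
    then obtain c where c: "c \<in> carrier_vec (length ks)" "x = (Phi * P) * Vs *\<^sub>v c" unfolding span by auto
    have y: "Vs *\<^sub>v c \<in> carrier_vec r" using Vs c by simp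
    have "x = Phi *\<^sub>v (P *\<^sub>v (Vs *\<^sub>v c))" using c Phi P Vs by (simp add: mat_vec_assoc)
    also have "P *\<^sub>v (Vs *\<^sub>v c) = U *\<^sub>v (transpose_mat U *\<^sub>v (P *\<^sub>v (Vs *\<^sub>v c)))" using P_project[OF y] by simp
    finally have "x = PU *\<^sub>v (transpose_mat U *\<^sub>v (P *\<^sub>v (Vs *\<^sub>v c)))"
      using Phi U by (simp add: PU_def mat_vec_assoc)
    moreover have "transpose_mat U *\<^sub>v (P *\<^sub>v (Vs *\<^sub>v c)) \<in> carrier_vec r" using U by (intro carrier_vecI) simp
    ultimately show "x \<in> R" unfolding R_def by blast
  next
    fix x assume "x \<in> R"
    then obtain c where c: "c \<in> carrier_vec r" "x = PU *\<^sub>v c" by (auto simp: R_def)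
    obtain y where y: "y \<in> carrier_vec r" "U *\<^sub>v c = P *\<^sub>v y" using U_range_P[OF c(1)] .
    \<comment> \<open>\<open>transpose_mat Vs * H\<close> is a right inverse of \<open>Vs\<close>,
      so \<open>e\<close> solves \<open>Vs *\<^sub>v e = y\<close>.\<close>
    define e where "e = transpose_mat Vs *\<^sub>v (H *\<^sub>v y)"
    have e: "e \<in> carrier_vec (length ks)" unfolding e_def using Vs by (intro carrier_vecI) simp
    have "Vs *\<^sub>v e = ((Vs * transpose_mat Vs) * H) *\<^sub>v y" using Vs d y by (simp add: e_def mat_vec_assoc)
    also have "\<dots> = y" unfolding H(2) using y by (simp add: one_mat_vec)
    finally have Ve: "Vs *\<^sub>v e = y" .
    have "x = Phi *\<^sub>v (P *\<^sub>v y)" using c y Phi U by (simp add: PU_def mat_vec_assoc)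
    also have "\<dots> = (Phi * P) * Vs *\<^sub>v e" using Phi P Vs e by (simp add: mat_vec_assoc Ve)
    finally show "x \<in> inlier_span M Ch" unfolding span using e by blast
  qed
qed

text \<open>A linear relation among the columns of \<open>T\<close> survives row sampling, so
  independence lifts from \<open>Phi * T\<close>. Spanning lifts because row sampling is injective
  on the column space of \<open>L\<close>, which contains the columns of \<open>T\<close>.\<close>

lemma output_basis:
  assumes Ch: "nonzero_cols Ch = J" "dim_col Ch = m" and out: "rrd_output Ds M Ch T"
  shows "columns_basis T (colspace L)"
proof -
  obtain ks where ks: "set ks \<subseteq> declared_inliers Ch"
    and basis: "columns_basis (mat_of_cols k (map (col M) ks)) R"
    and T: "T = mat_of_cols N1 (map (col Ds) ks)"
    using out Ds(1) M(1) inlier_span_eq[OF Ch] by (auto simp: rrd_output_def)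
  have ksm: "i < m" "i \<notin> J" if "i \<in> set ks" for i using ks that Ch by (auto simp: declared_inliers_def)
  have Tc: "T \<in> carrier_mat N1 (length ks)" using mat_of_cols_carrier(1)[of N1 "map (col Ds) ks"] by (simp add: T)
  have Dsc: "col Ds i \<in> carrier_vec N1" if "i \<in> set ks" for i using Ds(1) ksm[OF that] by simp
  have Mc: "col M i \<in> carrier_vec k" if "i \<in> set ks" for i using M(1) ksm[OF that] by simp
  have colsT: "cols T = map (col Ds) ks" unfolding T using Dsc by (intro cols_mat_of_cols) auto
  have "map (col M) ks = map (mult_mat_vec Phi) (map (col Ds) ks)" using ksm Ds(2) M(2) by auto
  then have BM: "mat_of_cols k (map (col M) ks) = Phi * T"
    unfolding T by (simp only:) (intro mat_of_cols_mult[OF Phi], use Dsc in auto)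
  have PT: "Phi * T \<in> carrier_mat k (length ks)" using Phi Tc by simp
  have "cols (Phi * T) = map (col M) ks" unfolding BM[symmetric] using Mc by (intro cols_mat_of_cols) auto
  also have "\<dots> = map (mult_mat_vec Phi) (cols T)" unfolding colsT using ksm Ds(2) M(2) by auto
  finally have cols: "cols (Phi * T) = map (mult_mat_vec Phi) (cols T)" .
  have b: "distinct (cols (Phi * T))" "lin_independent k (set (cols (Phi * T)))" "vspan k (set (cols (Phi * T))) = R"
    using basis carrier_matD(1)[OF PT] unfolding BM columns_basis_def by metis+
  have dist: "distinct (cols T)" using b(1) unfolding cols by (simp add: distinct_map)
  have "lin_independent N1 (set (cols T))"
  proof
    assume dep: "LinearCombinations.module.lin_dep class_ring (module_vec TYPE(real) N1) (set (cols T))"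
    obtain x where x: "x \<in> carrier_vec (length ks)" "x \<noteq> 0\<^sub>v (length ks)" "T *\<^sub>v x = 0\<^sub>v N1"
      using vec_space.lin_depE[OF Tc dep dist] by blast
    have "(Phi * T) *\<^sub>v x = 0\<^sub>v k" using x Tc Phi by (simp add: mat_vec_assoc mat_vec_zero)
    then show False using vec_space.lin_depI[OF PT x(1,2) _ b(1)] b(2) by blast
  qed
  moreover have "vspan N1 (set (cols T)) = colspace L"
  proof -
    have UT: "U *\<^sub>v (transpose_mat U *\<^sub>v (T *\<^sub>v c)) = T *\<^sub>v c" if c: "c \<in> carrier_vec (length ks)" for c
    proof -
      have "U * (transpose_mat U * T) = T"
      proof (rule eq_matI)
        fix a i assume "a < dim_row T" "i < dim_col T"
        then have ai: "a < N1" "i < length ks" using Tc by auto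
        have i: "ks ! i < m" "ks ! i \<notin> J" using ksm ai by auto
        have cT: "col T i = col L (js ! (ks ! i))"
        proof -
          have "col T i = cols T ! i" using Tc ai by simp
          also have "\<dots> = col Ds (ks ! i)" unfolding colsT using ai by simp
          also have "\<dots> = col L (js ! (ks ! i))"
            using i Ds(2) js_nth col_D[of "js ! (ks ! i)"] by (simp add: J_def)
          finally show ?thesis .
        qed
        have "col (U * (transpose_mat U * T)) i = U *\<^sub>v (transpose_mat U *\<^sub>v col T i)"
          using col_mult2[of U N1 r "transpose_mat U * T" "length ks" i] col_mult2[of "transpose_mat U" r N1 T "length ks" i]
            U Tc ai by simp
        also have "\<dots> = col T i"
          unfolding cT using orthonormal_basis_project[OF U, of "col L (js ! (ks ! i))"] L js_nth[OF i(1)]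
            col_in_colspace[OF L js_nth[OF i(1)]] by simp
        finally have "col (U * (transpose_mat U * T)) i $ a = col T i $ a" by simp
        then show "(U * (transpose_mat U * T)) $$ (a, i) = T $$ (a, i)" using ai U Tc by simp
      qed (use U Tc in auto)
      moreover have "U *\<^sub>v (transpose_mat U *\<^sub>v (T *\<^sub>v c)) = (U * (transpose_mat U * T)) *\<^sub>v c"
        using U Tc c by (simp add: mat_vec_assoc)
      ultimately show ?thesis by simp
    qed
    have sT: "vspan N1 (set (cols T)) = {T *\<^sub>v c |c. c \<in> carrier_vec (length ks)}" by (rule vspan_cols[OF Tc])
    show ?thesis
    proof (intro equalityI subsetI)
      fix x assume "x \<in> vspan N1 (set (cols T))"
      then obtain c where c: "c \<in> carrier_vec (length ks)" "x = T *\<^sub>v c" unfolding sT by auto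
      then have "x = U *\<^sub>v (transpose_mat U *\<^sub>v (T *\<^sub>v c))" using UT by simp
      moreover have "transpose_mat U *\<^sub>v (T *\<^sub>v c) \<in> carrier_vec r" using U by (intro carrier_vecI) simp
      ultimately show "x \<in> colspace L" unfolding colspace_range by blast
    next
      fix x assume "x \<in> colspace L"
      then obtain c where c: "c \<in> carrier_vec r" "x = U *\<^sub>v c" unfolding colspace_range by auto
      have "PU *\<^sub>v c \<in> vspan k (set (cols (Phi * T)))" unfolding b(3) R_def using c by blast
      then obtain e where e: "e \<in> carrier_vec (length ks)" "PU *\<^sub>v c = (Phi * T) *\<^sub>v e"
        unfolding vspan_cols[OF PT] by auto
      define w where "w = transpose_mat U *\<^sub>v (T *\<^sub>v e)"
      have w: "w \<in> carrier_vec r" unfolding w_def using U by (intro carrier_vecI) simp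
      have "PU *\<^sub>v w = Phi *\<^sub>v (U *\<^sub>v w)" using Phi U w by (simp add: PU_def mat_vec_assoc)
      also have "\<dots> = PU *\<^sub>v c" using e Phi Tc UT[OF e(1)] by (simp add: w_def mat_vec_assoc)
      \<comment> \<open>\<open>w\<close> holds the coordinates of \<open>T *\<^sub>v e\<close> in
        the basis \<open>U\<close>; injectivity of \<open>PU\<close> turns agreement on the sampled
        rows into agreement on all rows.\<close>
      finally have "w = c" using PU_inj2[OF w c(1)] by simp
      then have "x = T *\<^sub>v e" using c(2) UT[OF e(1)] by (simp add: w_def)
      then show "x \<in> vspan N1 (set (cols T))" unfolding sT using e by blast
    qed
  qed
  ultimately show ?thesis using dist Tc by (simp add: columns_basis_def)
qed

lemma residual_support:
  assumes Uh: "dim_row Uh = k" "orthonormal_basis Uh R"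
  shows "nonzero_cols ((1\<^sub>m k - Uh * transpose_mat Uh) * (Phi * D)) = I"
proof -
  obtain q where Uhc: "Uh \<in> carrier_mat k q" using Uh by auto
  define X where "X = 1\<^sub>m k - Uh * transpose_mat Uh"
  have X: "X \<in> carrier_mat k k" using Uhc by (auto simp: X_def)
  have XD: "X * (Phi * D) \<in> carrier_mat k N2" using X Phi D by simp
  have "col (X * (Phi * D)) i = 0\<^sub>v k \<longleftrightarrow> i \<notin> I" if i: "i < N2" for i
  proof -
    define x where "x = Phi *\<^sub>v col D i"
    have x: "x \<in> carrier_vec k" using Phi by (auto simp: x_def intro: carrier_vecI)
    have "col (X * (Phi * D)) i = X *\<^sub>v x"
      using col_mult2[of X k k "Phi * D" N2 i] col_mult2[of Phi k N1 D N2 i] X Phi D i by (simp add: x_def)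
    also have "\<dots> = x - Uh *\<^sub>v (transpose_mat Uh *\<^sub>v x)"
      using x Uhc Uh(1) by (simp add: X_def minus_mat_vec one_mat_vec mat_vec_assoc)
    finally have e: "col (X * (Phi * D)) i = x - Uh *\<^sub>v (transpose_mat Uh *\<^sub>v x)" .
    have "x - Uh *\<^sub>v (transpose_mat Uh *\<^sub>v x) = 0\<^sub>v k \<longleftrightarrow> Uh *\<^sub>v (transpose_mat Uh *\<^sub>v x) = x"
    proof
      assume a: "x - Uh *\<^sub>v (transpose_mat Uh *\<^sub>v x) = 0\<^sub>v k"
      show "Uh *\<^sub>v (transpose_mat Uh *\<^sub>v x) = x"
      proof (rule eq_vecI)
        fix l assume l: "l < dim_vec x"
        have "(x - Uh *\<^sub>v (transpose_mat Uh *\<^sub>v x)) $ l = 0" unfolding a using l x by simp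
        then show "(Uh *\<^sub>v (transpose_mat Uh *\<^sub>v x)) $ l = x $ l" using l x Uh(1) by simp
      qed (use x Uh(1) in simp)
    next
      assume "Uh *\<^sub>v (transpose_mat Uh *\<^sub>v x) = x"
      then show "x - Uh *\<^sub>v (transpose_mat Uh *\<^sub>v x) = 0\<^sub>v k" using x by simp
    qed
    also have "\<dots> \<longleftrightarrow> x \<in> R" by (rule orthonormal_basis_project[OF Uhc Uh(2) x])
    also have "\<dots> \<longleftrightarrow> i \<notin> I"
    proof (cases "i \<in> I")
      case True
      then show ?thesis using outlier_col by (simp add: x_def)
    next
      case False
      have "transpose_mat U *\<^sub>v col L i \<in> carrier_vec r" using U by (intro carrier_vecI) simp
      then have "x \<in> R" unfolding x_def inlier_col(1)[OF i False] R_def by blast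
      then show ?thesis using False by simp
    qed
    finally show ?thesis unfolding e .
  qed
  then show ?thesis using I X D unfolding X_def[symmetric] nonzero_cols_def by auto
qed

theorem success: "rrd_success L C js is"
proof -
  have dims: "dim_col (L + C) = N2" "dim_row (L + C) = N1" using L C by auto
  have dM: "dim_row M = k" using M(1) by simp
  show ?thesis
    unfolding rrd_success_def Let_def dims
    unfolding S_def[symmetric] Phi_def[symmetric] D_def[symmetric]
    unfolding Ds_def[symmetric]
    unfolding M_def[symmetric] dM C_cols
  proof (intro allI impI conjI)
    fix Lh Ch assume sol: "program_solution (card (nonzero_cols (C * S))) M (Lh, Ch)"
    note s = support[OF sol]
    show "columns_basis T (colspace L)" if "rrd_output Ds M Ch T" for T by (rule output_basis[OF s that])
    show "nonzero_cols ((1\<^sub>m k - Uh * transpose_mat Uh) * (Phi * D)) = I"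
      if "dim_row Uh = k \<and> orthonormal_basis Uh (inlier_span M Ch)" for Uh
      using residual_support[of Uh] that inlier_span_eq[OF s] by simp
  qed
qed

end

section \<open>Probability of a good sample\<close>

lemma pmf_replicate: "length xs = n \<Longrightarrow> pmf (replicate_pmf n p) xs = (\<Prod>x\<leftarrow>xs. pmf p x)"
proof (induction n arbitrary: xs)
  case (Suc n)
  then obtain y ys where xs: "xs = y # ys" "length ys = n" by (metis length_Suc_conv)
  have "replicate_pmf (Suc n) p = map_pmf (\<lambda>(x, xs). x # xs) (pair_pmf p (replicate_pmf n p))"
    by (simp add: pair_pmf_def map_bind_pmf)
  then have "pmf (replicate_pmf (Suc n) p) xs
      = pmf (map_pmf (\<lambda>(x, xs). x # xs) (pair_pmf p (replicate_pmf n p))) ((\<lambda>(x, xs). x # xs) (y, ys))"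
    by (simp add: xs)
  also have "\<dots> = pmf (pair_pmf p (replicate_pmf n p)) (y, ys)"
    by (rule pmf_map_inj') (auto simp: inj_def)
  finally show ?case using Suc.IH[OF xs(2)] by (simp add: pmf_pair xs)
qed simp

lemma prob_column_sampling:
  assumes N: "0 < N" and bad: "real (card Bad) \<le> real N ^ m * e" "Bad \<subseteq> {js. set js \<subseteq> {..<N} \<and> length js = m}"
  shows "1 - e \<le> measure (column_sampling N m) ({js. set js \<subseteq> {..<N} \<and> length js = m} - Bad)"
proof -
  let ?L = "{js. set js \<subseteq> {..<N} \<and> length js = m}"
  have fin: "finite ?L" by (rule finite_lists_length_eq) simp
  have "pmf (column_sampling N m) js = (1 / real N) ^ m" if "js \<in> ?L" for js
  proof -
    have "pmf (column_sampling N m) js = (\<Prod>j\<leftarrow>js. pmf (pmf_of_set {..<N}) j)"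
      unfolding column_sampling_def by (rule pmf_replicate) (use that in simp)
    also have "\<dots> = (\<Prod>j\<leftarrow>js. 1 / real N)"
      using that N by (intro arg_cong[where f = prod_list] map_cong refl) (auto simp: subset_eq lessThan_empty_iff)
    also have "\<dots> = (1 / real N) ^ m" using that by (simp add: map_replicate_const prod_list_replicate)
    finally show ?thesis .
  qed
  then have "measure (column_sampling N m) (?L - Bad) = (\<Sum>js\<in>?L - Bad. (1 / real N) ^ m)"
    using fin by (subst measure_measure_pmf_finite) auto
  also have "\<dots> = (real (card ?L) - real (card Bad)) / real N ^ m"
    using card_mono[OF fin bad(2)] finite_subset[OF bad(2) fin] bad(2)
    by (simp add: card_Diff_subset of_nat_diff power_divide)
  also have "card ?L = N ^ m" by (subst card_lists_length_eq) auto
  also have "(real (N ^ m) - real (card Bad)) / real N ^ m \<ge> 1 - e"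
    using bad(1) N by (simp add: field_simps)
  finally show ?thesis .
qed

lemma prob_row_sampling:
  assumes m: "m \<le> N"
    and bad: "real (card Bad) \<le> real (card {is. length is = m \<and> distinct is \<and> set is \<subseteq> {..<N}}) * e"
      "Bad \<subseteq> {is. length is = m \<and> distinct is \<and> set is \<subseteq> {..<N}}"
  shows "1 - e \<le> measure (row_sampling N m) ({is. length is = m \<and> distinct is \<and> set is \<subseteq> {..<N}} - Bad)"
proof -
  let ?D = "{is. length is = m \<and> distinct is \<and> set is \<subseteq> {..<N}}"
  have fin: "finite ?D" by (rule finite_subset[OF _ finite_lists_length_eq[of "{..<N}" m]]) auto
  have "[0..<m] \<in> ?D" using m by auto
  then have ne: "?D \<noteq> {}" by blast
  then have c0: "0 < card ?D" using fin by (simp add: card_gt_0_iff)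
  have "measure (row_sampling N m) (?D - Bad) = real (card (?D \<inter> (?D - Bad))) / real (card ?D)"
    unfolding row_sampling_def by (rule measure_pmf_of_set[OF ne fin])
  also have "?D \<inter> (?D - Bad) = ?D - Bad" by blast
  also have "real (card (?D - Bad)) = real (card ?D) - real (card Bad)"
    using card_mono[OF fin bad(2)] finite_subset[OF bad(2) fin] bad(2)
    by (simp add: card_Diff_subset of_nat_diff)
  also have "1 - e \<le> (real (card ?D) - real (card Bad)) / real (card ?D)"
    using bad(1) c0 by (simp add: field_simps)
  finally show ?thesis .
qed

section \<open>Almost sure genericity of the outliers\<close>

lemma prob_space_normal: "0 < \<sigma> \<Longrightarrow> prob_space (density lborel (normal_density 0 \<sigma>))"
  by (rule prob_space_normal_density)

lemma prob_space_gaussian_entries: "0 < \<sigma> \<Longrightarrow> prob_space (gaussian_entries N I \<sigma>)"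
  unfolding gaussian_entries_def by (intro prob_space_PiM prob_space_normal)

text \<open>By Tonelli: with all coordinates other than \<open>k\<close> fixed, the equation has
  exactly one solution in coordinate \<open>k\<close>, and a single point has measure zero under a
  density.\<close>

lemma AE_gaussian_affine_nonzero:
  fixes h :: "('i \<Rightarrow> real) \<Rightarrow> real"
  assumes s: "0 < \<sigma>" and K: "finite K" "k \<in> K" and a: "a \<noteq> 0"
    and h: "h \<in> borel_measurable (PiM K (\<lambda>_. density lborel (normal_density 0 \<sigma>)))"
    and indep: "\<And>x y. h (x(k := y)) = h x"
  shows "AE x in PiM K (\<lambda>_. density lborel (normal_density 0 \<sigma>)). a * x k + h x \<noteq> 0"
proof -
  let ?N = "density lborel (normal_density 0 \<sigma>)"
  interpret prob_space ?N using s by (rule prob_space_normal)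
  interpret P: product_sigma_finite "\<lambda>_ :: 'i. ?N" by standard
  define K' where "K' = K - {k}"
  have K': "finite K'" "k \<notin> K'" "K = insert k K'" using K by (auto simp: K'_def)
  have hm: "h \<in> borel_measurable (PiM (insert k K') (\<lambda>_. ?N))" using h K'(3) by simp
  have [measurable]: "(\<lambda>x. a * x k + h x) \<in> borel_measurable (PiM (insert k K') (\<lambda>_. ?N))"
  proof -
    have "(\<lambda>x. x k) \<in> measurable (PiM (insert k K') (\<lambda>_. ?N)) ?N" by (rule measurable_component_singleton) simp
    then have "(\<lambda>x. x k) \<in> borel_measurable (PiM (insert k K') (\<lambda>_. ?N))" by simp
    then show ?thesis using hm by (intro borel_measurable_add borel_measurable_times) auto
  qed
  define f :: "('i \<Rightarrow> real) \<Rightarrow> ennreal" where "f x = indicator {0} (a * x k + h x)" for x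
  have fm: "f \<in> borel_measurable (PiM (insert k K') (\<lambda>_. ?N))" unfolding f_def by measurable
  have "(\<integral>\<^sup>+ x. f x \<partial>PiM (insert k K') (\<lambda>_. ?N)) = (\<integral>\<^sup>+ x. (\<integral>\<^sup>+ y. f (x(k := y)) \<partial>?N) \<partial>PiM K' (\<lambda>_. ?N))"
    by (rule P.product_nn_integral_insert[OF K'(1,2) fm])
  also have "\<dots> = (\<integral>\<^sup>+ x. 0 \<partial>PiM K' (\<lambda>_. ?N))"
  proof (rule nn_integral_cong)
    fix x
    have "f (x(k := y)) = indicator {- h x / a} y" for y
      using a by (auto simp: f_def indep indicator_def field_simps add_eq_0_iff)
    then have "(\<integral>\<^sup>+ y. f (x(k := y)) \<partial>?N) = emeasure ?N {- h x / a}" by simp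
    also have "\<dots> = 0" by (subst emeasure_density) (auto simp: nn_integral_null_set[where N = "{_}"] intro!: nn_integral_null_set)
    finally show "(\<integral>\<^sup>+ y. f (x(k := y)) \<partial>?N) = 0" .
  qed
  finally have "(\<integral>\<^sup>+ x. f x \<partial>PiM (insert k K') (\<lambda>_. ?N)) = 0" by simp
  then have "AE x in PiM (insert k K') (\<lambda>_. ?N). f x = 0" using nn_integral_0_iff_AE[OF fm] by simp
  then show ?thesis unfolding K'(3)[symmetric] by eventually_elim (auto simp: f_def indicator_def split: if_splits)
qed

text \<open>Padding with zero rows makes the matrix square with vanishing determinant.\<close>

lemma wide_mat_kernel:
  fixes A :: "real mat"
  assumes A: "A \<in> carrier_mat r m" and rm: "r < m"
  shows "\<exists>x \<in> carrier_vec m. x \<noteq> 0\<^sub>v m \<and> A *\<^sub>v x = 0\<^sub>v r"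
proof -
  define B where "B = mat m m (\<lambda>(i, j). if i < r then A $$ (i, j) else 0)"
  have B: "B \<in> carrier_mat m m" by (simp add: B_def)
  have "transpose_mat B *\<^sub>v unit_vec m r = 0\<^sub>v m"
    using rm by (intro eq_vecI) (auto simp: B_def)
  moreover have "unit_vec m r \<noteq> (0\<^sub>v m :: real vec)" using rm by (simp add: unit_vec_nonzero)
  ultimately have "det (transpose_mat B) = 0"
    using det_0_iff_vec_prod_zero_field[of "transpose_mat B" m] B unit_vec_carrier[of m r]
    by (metis transpose_carrier_mat)
  then have "det B = 0" using det_transpose[OF B] by simp
  then obtain x where x: "x \<in> carrier_vec m" "x \<noteq> 0\<^sub>v m" "B *\<^sub>v x = 0\<^sub>v m"
    using det_0_iff_vec_prod_zero_field[OF B] by auto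
  have "A *\<^sub>v x = 0\<^sub>v r"
  proof (rule eq_vecI)
    fix i assume "i < dim_vec (0\<^sub>v r)"
    then have i: "i < r" "i < m" using rm by auto
    have "row A i = row B i" using i A by (intro eq_vecI) (auto simp: B_def)
    moreover have "(B *\<^sub>v x) $ i = 0" using x i by simp
    ultimately show "(A *\<^sub>v x) $ i = 0\<^sub>v r $ i" using i A B by simp
  qed (use A in simp)
  then show ?thesis using x by blast
qed

text \<open>Some nonzero \<open>w\<close> annihilates the range of the row-sampled \<open>U\<close>.
  One affine inequation in the Gaussian entries,
  \<open>w \<bullet> (Phi *\<^sub>v col C i) \<noteq> 0\<close>, then excludes all coefficient
  vectors \<open>c\<close> at once, so no uncountable union of null sets arises.\<close>

lemma AE_generic_outlier:
  assumes s: "0 < \<sigma>" and I: "finite I" "I \<subseteq> {..<N2}" "i \<in> I" and U: "U \<in> carrier_mat N1 r"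
    and isN: "distinct is" "set is \<subseteq> {..<N1}" and r: "r < length is"
  shows "AE x in gaussian_entries N1 I \<sigma>. \<forall>c \<in> carrier_vec r.
    row_selection N1 is *\<^sub>v col (outlier_mat N1 N2 I x) i \<noteq> row_selection N1 is *\<^sub>v (U *\<^sub>v c)"
proof -
  define m where "m = length is"
  define Phi where "Phi = row_selection N1 is"
  have Phi: "Phi \<in> carrier_mat m N1" using row_selection(1)[OF isN(2)] by (simp add: Phi_def m_def)
  have PU: "transpose_mat (Phi * U) \<in> carrier_mat r m" using Phi U by simp
  obtain w where w: "w \<in> carrier_vec m" "w \<noteq> 0\<^sub>v m" "transpose_mat (Phi * U) *\<^sub>v w = 0\<^sub>v r"
    using wide_mat_kernel[OF PU] r by (auto simp: m_def)
  obtain a where a: "a < m" "w $ a \<noteq> 0" using w(1,2) by (metis carrier_vecD eq_vecI index_zero_vec)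
  let ?N = "\<lambda>_ :: nat \<times> nat. density lborel (normal_density 0 \<sigma>)"
  define K where "K = {..<N1} \<times> I"
  have inN: "is ! b < N1" if "b < m" for b using isN(2) that by (auto simp: m_def subset_eq)
  define h where "h x = (\<Sum>b\<in>{..<m} - {a}. w $ b * x (is ! b, i))" for x :: "nat \<times> nat \<Rightarrow> real"
  have hm: "h \<in> borel_measurable (PiM K ?N)"
    unfolding h_def
  proof (intro borel_measurable_sum borel_measurable_times borel_measurable_const)
    fix b assume "b \<in> {..<m} - {a}"
    then have "(is ! b, i) \<in> K" using inN I by (simp add: K_def)
    then have "(\<lambda>x. x (is ! b, i)) \<in> measurable (PiM K ?N) (?N (is ! b, i))" by (rule measurable_component_singleton)
    then show "(\<lambda>x. x (is ! b, i)) \<in> borel_measurable (PiM K ?N)" by simp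
  qed
  \<comment> \<open>The sampled rows are distinct, so no other term reads the entry
    \<open>(is ! a, i)\<close>.\<close>
  have "h (x((is ! a, i) := y)) = h x" for x y
    unfolding h_def using isN(1) a by (intro sum.cong refl) (auto simp: nth_eq_iff_index_eq m_def)
  moreover have "finite K" "(is ! a, i) \<in> K" using I a inN by (auto simp: K_def)
  ultimately have "AE x in PiM K ?N. w $ a * x (is ! a, i) + h x \<noteq> 0"
    using AE_gaussian_affine_nonzero[OF s _ _ a(2) hm] by blast
  then show ?thesis unfolding gaussian_entries_def K_def[symmetric]
  proof eventually_elim
    case (elim x)
    show ?case
    proof
      fix c :: "real vec" assume c: "c \<in> carrier_vec r"
      define C where "C = outlier_mat N1 N2 I x"
      have C: "C \<in> carrier_mat N1 N2" by (simp add: C_def outlier_mat_def)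
      have iN: "i < N2" using I by auto
      have Ci: "col C i \<in> carrier_vec N1" using C iN by simp
      have "w \<bullet> (Phi *\<^sub>v col C i) = (\<Sum>b<m. w $ b * x (is ! b, i))"
      proof -
        have "(Phi *\<^sub>v col C i) $ b = x (is ! b, i)" if "b < m" for b
          using row_selection(2)[OF isN(2) Ci, of b] that inN[OF that] iN I
          by (simp add: Phi_def m_def C_def outlier_mat_def del: index_mult_mat_vec)
        then show ?thesis
          using Phi by (simp add: scalar_prod_def[of w] atLeast0LessThan del: index_mult_mat_vec)
      qed
      also have "\<dots> = w $ a * x (is ! a, i) + h x" using a by (simp add: h_def sum.remove[of "{..<m}" a])
      finally have 1: "w \<bullet> (Phi *\<^sub>v col C i) \<noteq> 0" using elim by simp
      have "w \<bullet> ((Phi * U) *\<^sub>v c) = (transpose_mat (Phi * U) *\<^sub>v w) \<bullet> c"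
        using Phi U w c by (intro scalar_prod_adjoint) auto
      then have "w \<bullet> (Phi *\<^sub>v (U *\<^sub>v c)) = 0" using w(3) c Phi U by (simp add: mat_vec_assoc)
      then show "row_selection N1 is *\<^sub>v col (outlier_mat N1 N2 I x) i \<noteq> row_selection N1 is *\<^sub>v (U *\<^sub>v c)"
        using 1 unfolding Phi_def C_def by metis
    qed
  qed
qed

text \<open>Chernoff exponent for the number of sampled outliers, with mean \<open>m * p\<close> and threshold
  \<open>3.5 * m / beta\<close>. When \<open>p\<close> is far below \<open>1 / beta\<close> the hypothesis on \<open>m * t\<^sup>2\<close> is useless, and
  the lower bound on \<open>m\<close> coming from the incoherence takes over.\<close>

lemma chernoff_exponent:
  fixes m p beta L t :: real
  assumes beta: "0 < beta" and L: "0 < L" and p: "0 < p" and t: "0 < t"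
    and bt: "beta * (p + t) \<le> 1" and mt: "3 * p * L \<le> m * t\<^sup>2" and mL: "1224 / 10000 * (beta * L) \<le> m"
  obtains th where "0 \<le> th" "m * p * (exp th - 1) - th * (7 / 2 * m / beta) \<le> - L"
proof -
  define y where "y = m / beta"
  define s where "s = p * beta"
  have y: "1224 / 10000 * L \<le> y" using mL beta by (simp add: y_def field_simps)
  have s: "0 < s" "s < 1" using p beta t bt by (auto simp: s_def algebra_simps) (smt (verit) mult_pos_pos)
  have m: "m * p = y * s" "7 / 2 * m / beta = 7 / 2 * y" using beta by (auto simp: y_def s_def)
  have y0: "0 < y" using y L by linarith
  have ys: "3 * s * L \<le> y * (1 - s)\<^sup>2"
  proof -
    have "(beta * t)\<^sup>2 \<le> (1 - s)\<^sup>2" using bt beta t by (intro power_mono) (auto simp: s_def algebra_simps)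
    then have "y * (beta * t)\<^sup>2 \<le> y * (1 - s)\<^sup>2" using y0 by (intro mult_left_mono) auto
    moreover have "y * (beta * t)\<^sup>2 = beta * (m * t\<^sup>2)" using beta by (simp add: y_def power2_eq_square)
    moreover have "beta * (3 * p * L) \<le> beta * (m * t\<^sup>2)" using mt beta by (intro mult_left_mono) auto
    moreover have "3 * s * L = beta * (3 * p * L)" by (simp add: s_def)
    ultimately show ?thesis by linarith
  qed
  have e1: "exp 1 < (272 / 100 :: real)" by (rule e_less_272)
  \<comment> \<open>Two fixed parameters replace the optimal one: 3 when the mean
    \<open>y * s\<close> is at most a tenth of \<open>y\<close>, and 1 otherwise.\<close>
  show thesis
  proof (cases "s \<le> 1 / 10")
    case True
    \<comment> \<open>The exponent per unit of \<open>y\<close> is at most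
      \<open>1/10 * 19.13 - 10.5 = -8.587\<close>, and \<open>8.587 * 0.1224\<close> exceeds
      1.\<close>
    have "exp (3 :: real) = exp 1 ^ 3" by (simp add: exp_of_nat_mult[symmetric])
    also have "\<dots> \<le> (272 / 100) ^ 3" using e1 by (intro power_mono) auto
    finally have e3: "exp (3 :: real) - 1 \<le> 1913 / 100" by (simp add: power3_eq_cube)
    have "s * (exp 3 - 1) \<le> 1 / 10 * (1913 / 100)" using True s e3 by (intro mult_mono) auto
    then have "y * (s * (exp 3 - 1) - 21 / 2) \<le> y * (- 8587 / 1000)" using y0 by (intro mult_left_mono) auto
    also have "\<dots> \<le> - L" using y L by simp
    finally have "m * p * (exp 3 - 1) - 3 * (7 / 2 * m / beta) \<le> - L" unfolding m by (simp add: algebra_simps)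
    then show thesis using that[of 3] by simp
  next
    case False
    have d: "0 < (1 - s)\<^sup>2" using s by simp
    \<comment> \<open>Since 1.72 bounds \<open>exp 1 - 1\<close>, this inequality makes the gain at
      \<open>th = 1\<close> large enough. It follows from
      \<open>(10 * s - 1) * (1 - s) \<ge> 0\<close>, whose expansion the difference
      dominates.\<close>
    have "(1 - s)\<^sup>2 \<le> 3 * s * (7 / 2 - 172 / 100 * s)"
    proof -
      define sq where "sq = s * s"
      have "0 \<le> (10 * s - 1) * (1 - s)" using False s by (intro mult_nonneg_nonneg) auto
      also have "\<dots> = 11 * s - 10 * sq - 1" by (simp add: sq_def algebra_simps)
      finally have "0 \<le> 11 * s - 10 * sq - 1" .
      moreover have "3 * s * (7 / 2 - 172 / 100 * s) - (1 - s)\<^sup>2 = 25 / 2 * s - 616 / 100 * sq - 1"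
        by (simp add: sq_def power2_eq_square algebra_simps)
      ultimately have "0 \<le> 3 * s * (7 / 2 - 172 / 100 * s) - (1 - s)\<^sup>2" using False by simp
      then show ?thesis by simp
    qed
    then have "L * (1 - s)\<^sup>2 \<le> L * (3 * s * (7 / 2 - 172 / 100 * s))" using L by (intro mult_left_mono) auto
    also have "\<dots> = (3 * s * L) * (7 / 2 - 172 / 100 * s)" by simp
    also have "\<dots> \<le> (y * (1 - s)\<^sup>2) * (7 / 2 - 172 / 100 * s)" using ys s by (intro mult_right_mono) auto
    also have "\<dots> = (y * (7 / 2 - 172 / 100 * s)) * (1 - s)\<^sup>2" by simp
    finally have 1: "L \<le> y * (7 / 2 - 172 / 100 * s)" using d by (simp add: mult_le_cancel_right)
    have "s * (exp 1 - 1) \<le> s * (172 / 100)" using s e1 by (intro mult_left_mono) auto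
    then have "y * (s * (exp 1 - 1) - 7 / 2) \<le> y * (s * (172 / 100) - 7 / 2)" using y0 by (intro mult_left_mono) auto
    also have "\<dots> \<le> - L" using 1 by (simp add: algebra_simps)
    finally have "m * p * (exp 1 - 1) - 1 * (7 / 2 * m / beta) \<le> - L" unfolding m by (simp add: algebra_simps)
    then show thesis using that[of 1] by simp
  qed
qed

lemma parseval_frame_rows:
  assumes B: "B \<in> carrier_mat n r" "transpose_mat B * B = 1\<^sub>m r" and n: "0 < n"
    and le: "\<And>j. j < n \<Longrightarrow> row B j \<bullet> row B j \<le> rho"
  shows "parseval_frame r n (row B) rho"
proof
  show "(\<Sum>j<n. (row B j \<bullet> x) * (row B j \<bullet> y)) = x \<bullet> y" if "x \<in> carrier_vec r" "y \<in> carrier_vec r" for x y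
  proof -
    have "(\<Sum>j<n. (row B j \<bullet> x) * (row B j \<bullet> y)) = (B *\<^sub>v x) \<bullet> (B *\<^sub>v y)"
      using B by (simp add: scalar_prod_def[of "B *\<^sub>v x"] atLeast0LessThan)
    also have "\<dots> = x \<bullet> y" using isometry_norm[OF B(2)] B that by auto
    finally show ?thesis .
  qed
qed (use assms in auto)

lemma prob_product_event:
  assumes "prob_space M" "E \<in> sets M" "emeasure M E = 1"
  shows "A \<times> (B \<times> E) \<in> sets (measure_pmf p \<Otimes>\<^sub>M (measure_pmf q \<Otimes>\<^sub>M M))"
    and "measure (measure_pmf p \<Otimes>\<^sub>M (measure_pmf q \<Otimes>\<^sub>M M)) (A \<times> (B \<times> E)) = measure p A * measure q B"
proof -
  interpret M: prob_space M by fact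
  interpret q: prob_space "measure_pmf q" by (rule prob_space_measure_pmf)
  interpret qM: pair_prob_space "measure_pmf q" M ..
  have BE: "B \<times> E \<in> sets (measure_pmf q \<Otimes>\<^sub>M M)" using assms(2) by (intro pair_measureI) auto
  show "A \<times> (B \<times> E) \<in> sets (measure_pmf p \<Otimes>\<^sub>M (measure_pmf q \<Otimes>\<^sub>M M))"
    by (rule pair_measureI[OF _ BE]) simp
  have "emeasure (measure_pmf q \<Otimes>\<^sub>M M) (B \<times> E) = emeasure q B"
    using assms by (subst M.emeasure_pair_measure_Times) auto
  moreover have "emeasure (measure_pmf p \<Otimes>\<^sub>M (measure_pmf q \<Otimes>\<^sub>M M)) (A \<times> (B \<times> E))
      = emeasure p A * emeasure (measure_pmf q \<Otimes>\<^sub>M M) (B \<times> E)"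
    using BE by (intro qM.emeasure_pair_measure_Times) auto
  ultimately show "measure (measure_pmf p \<Otimes>\<^sub>M (measure_pmf q \<Otimes>\<^sub>M M)) (A \<times> (B \<times> E)) = measure p A * measure q B"
    by (simp add: measure_def enn2real_mult)
qed

section \<open>Numerical bounds and the final event\<close>

lemma incoherence_bound:
  assumes U: "U \<in> carrier_mat N1 r" and N1: "0 < N1" and r: "0 < r" and i: "i < N1"
    and eta: "eta = sqrt (real N1) * Max ((\<lambda>ij. \<bar>U $$ ij\<bar>) ` ({..<N1} \<times> {..<r}))"
  shows "row U i \<bullet> row U i \<le> real r * eta\<^sup>2 / real N1"
proof -
  define mx where "mx = Max ((\<lambda>ij. \<bar>U $$ ij\<bar>) ` ({..<N1} \<times> {..<r}))"
  have le: "\<bar>U $$ (i, a)\<bar> \<le> mx" if "a < r" for a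
    unfolding mx_def using i that by (intro Max_ge) auto
  have "row U i \<bullet> row U i = (\<Sum>a<r. \<bar>U $$ (i, a)\<bar>\<^sup>2)"
    using U i by (simp add: scalar_prod_def atLeast0LessThan power2_eq_square)
  also have "\<dots> \<le> (\<Sum>a<r. mx\<^sup>2)" using le by (intro sum_mono power_mono) auto
  also have "\<dots> = real r * eta\<^sup>2 / real N1" using N1 by (simp add: eta mx_def[symmetric] power_mult_distrib)
  finally show ?thesis .
qed

text \<open>A union bound needs the sum of the two logarithms, and twice their maximum is at least
  that sum; hence the constant 2.\<close>

lemma row_sampling_failure:
  fixes r :: nat and eta \<delta> m :: real
  assumes r: "0 < r" and eta: "0 < eta\<^sup>2" and d: "0 < \<delta>" "\<delta> < 1"
    and m: "real r * eta\<^sup>2 * max (2 * ln (real r)) (2 * ln (3 / \<delta>)) \<le> m"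
  shows "real r * exp (- (m / (real r * eta\<^sup>2))) \<le> \<delta> / 3"
proof -
  have pos: "0 < real r * eta\<^sup>2" using r eta by simp
  have "ln (real r) + ln (3 / \<delta>) \<le> max (2 * ln (real r)) (2 * ln (3 / \<delta>))" by linarith
  also have "\<dots> \<le> m / (real r * eta\<^sup>2)" using m pos by (simp add: le_divide_eq mult.commute)
  finally have "exp (- (m / (real r * eta\<^sup>2))) \<le> exp (- (ln (real r) + ln (3 / \<delta>)))" by simp
  also have "\<dots> = \<delta> / (3 * real r)" using r d by (simp add: exp_diff exp_minus field_simps)
  finally have "real r * exp (- (m / (real r * eta\<^sup>2))) \<le> real r * (\<delta> / (3 * real r))" by (intro mult_left_mono) auto
  then show ?thesis using r by simp
qed

text \<open>The factor 10 of the hypothesis meets the rate 0.138 of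
  \<open>card_degenerate_samples\<close>, and their product 1.38 exceeds 1.\<close>

lemma column_sampling_failure:
  fixes r :: nat and R \<delta> m :: real
  assumes r: "0 < r" and R: "0 < R" and d: "0 < \<delta>" "\<delta> < 1" and m: "10 * R * ln (2 * real r / \<delta>) \<le> m"
  shows "real r * exp (- (138 / 1000) * (m / R)) \<le> \<delta> / 2"
proof -
  have "1 < 2 * real r / \<delta>" using r d by (simp add: field_simps)
  then have l: "0 < ln (2 * real r / \<delta>)" by simp
  have "10 * ln (2 * real r / \<delta>) \<le> m / R" using m R by (simp add: le_divide_eq algebra_simps)
  then have "ln (2 * real r / \<delta>) \<le> 138 / 1000 * (m / R)" using l by linarith
  then have "exp (- (138 / 1000) * (m / R)) \<le> exp (- ln (2 * real r / \<delta>))" by simp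
  also have "\<dots> = \<delta> / (2 * real r)" using r d by (simp add: exp_minus)
  finally have "real r * exp (- (138 / 1000) * (m / R)) \<le> real r * (\<delta> / (2 * real r))" by (intro mult_left_mono) auto
  then show ?thesis using r by simp
qed

lemma column_sample_bounds:
  fixes n n' K g R L L' m \<beta> :: real
  assumes n: "0 < n" "0 < n'" "0 < K" and R: "1 \<le> R" and L: "0 < L" "L \<le> L'"
    and beta: "\<beta> = 1 + 6 * R * (121 / 9)" and g: "n' / n * \<beta> \<le> g"
    and K: "K / n' \<le> (g * (n / n') - \<beta>) / (g * \<beta>)"
    and m: "n / n' * max (3 * g\<^sup>2 * (K / n') * L) (n' / n * 10 * R * L') \<le> m"
  shows "10 * R * L' \<le> m"
    and "\<exists>th \<ge> 0. m * (K / n) * (exp th - 1) - th * (7 / 2 * m / \<beta>) \<le> - L"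
proof -
  have b0: "0 < \<beta>" using R by (simp add: beta)
  have g0: "0 < g" using g n b0 by (smt (verit) divide_pos_pos mult_pos_pos)
  have nn: "0 < n / n'" using n by simp
  have m1: "n / n' * (3 * g\<^sup>2 * (K / n') * L) \<le> m" and m2: "n / n' * (n' / n * 10 * R * L') \<le> m"
    using order_trans[OF mult_left_mono[OF max.cobounded1 less_imp_le[OF nn]] m]
      order_trans[OF mult_left_mono[OF max.cobounded2 less_imp_le[OF nn]] m] by auto
  show mR: "10 * R * L' \<le> m" using m2 n by simp
  \<comment> \<open>With \<open>p = K / n\<close> the fraction of outliers, this \<open>t\<close>
    turns the bound on \<open>K / n'\<close> into \<open>\<beta> * (p + t) \<le> 1\<close> and the
    first entry of the maximum into \<open>3 * p * L \<le> m * t\<^sup>2\<close>, the hypotheses of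
    \<open>chernoff_exponent\<close>.\<close>
  define t where "t = n' / (g * n)"
  have t0: "0 < t" using n g0 by (simp add: t_def)
  have bt: "\<beta> * (K / n + t) \<le> 1"
  proof -
    have "(K / n') * (g * \<beta>) \<le> g * (n / n') - \<beta>" using K g0 b0 by (simp add: le_divide_eq)
    then have "((K / n') * (g * \<beta>)) * (n' / (g * n)) \<le> (g * (n / n') - \<beta>) * (n' / (g * n))"
      using n g0 by (intro mult_right_mono) auto
    moreover have "((K / n') * (g * \<beta>)) * (n' / (g * n)) = \<beta> * (K / n)" using n g0 by simp
    moreover have "(g * (n / n') - \<beta>) * (n' / (g * n)) = 1 - \<beta> * t" using n g0 by (simp add: t_def field_simps)
    ultimately show ?thesis by (simp add: algebra_simps)
  qed
  have mt: "3 * (K / n) * L \<le> m * t\<^sup>2"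
  proof -
    have "(n / n' * (3 * g\<^sup>2 * (K / n') * L)) * t\<^sup>2 \<le> m * t\<^sup>2" using m1 by (intro mult_right_mono) auto
    moreover have "(n / n' * (3 * g\<^sup>2 * (K / n') * L)) * t\<^sup>2 = 3 * (K / n) * L"
      using n g0 by (simp add: t_def power2_eq_square)
    ultimately show ?thesis by simp
  qed
  \<comment> \<open>As \<open>R \<ge> 1\<close>, \<open>\<beta>\<close> is at most
    \<open>(1 + 6 * 121/9) * R = 245/3 * R\<close>, and \<open>10 / (245/3)\<close> is slightly more
    than 0.1224.\<close>
  have mL: "1224 / 10000 * (\<beta> * L) \<le> m"
  proof -
    have "1224 / 10000 * \<beta> \<le> 10 * R" using R by (simp add: beta)
    then have "(1224 / 10000 * \<beta>) * L \<le> (10 * R) * L" using L by (intro mult_right_mono) auto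
    also have "\<dots> \<le> 10 * R * L'" using L R by (intro mult_left_mono) auto
    finally show ?thesis using mR by (simp add: mult.assoc)
  qed
  have "0 < K / n" using n by simp
  then show "\<exists>th \<ge> 0. m * (K / n) * (exp th - 1) - th * (7 / 2 * m / \<beta>) \<le> - L"
    using chernoff_exponent[OF b0 L(1) _ t0 bt mt mL] by metis
qed

lemma exact_recovery_event:
  fixes N1 N2 N2' K r m1 m2 :: nat
  assumes s: "0 < \<sigma>"
    and model: "AE x in gaussian_entries N1 I \<sigma>. data_model N1 N2 r K N2' L (outlier_mat N1 N2 I x) I"
    and K: "1 \<le> K" and N2': "1 \<le> N2'"
    and U: "U \<in> carrier_mat N1 r" "orthonormal_basis U (colspace L)"
    and V: "V \<in> carrier_mat N2 r" "orthonormal_basis V (rowspace L)"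
    and mu: "\<forall>i<N2. (vec_l2_norm (transpose_mat V *\<^sub>v unit_vec N2 i))\<^sup>2 \<le> real r * \<mu>v / real N2"
    and eta: "\<eta>u = sqrt (real N1) * Max ((\<lambda>ij. \<bar>U $$ ij\<bar>) ` ({..<N1} \<times> {..<r}))"
    and d: "0 < \<delta>" "\<delta> < 1 / 4"
    and m1: "real N2 / real N2' * max (3 * g\<^sup>2 * (real K / real N2') * ln (2 / \<delta>))
              (real N2' / real N2 * 10 * real r * \<mu>v * ln (2 * real r / \<delta>)) \<le> real m1"
    and g: "real N2' / real N2 * (1 + 6 * real r * \<mu>v * (121 / 9)) \<le> g"
    and Kle: "real K / real N2' \<le>
        (g * (real N2 / real N2') - (1 + 6 * real r * \<mu>v * (121 / 9))) /
        (g * (1 + 6 * real r * \<mu>v * (121 / 9)))"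
    and m2: "max (real r * \<eta>u\<^sup>2 * max (2 * ln (real r)) (2 * ln (3 / \<delta>)))
        (real r + 1 + 2 * ln (2 * real K / \<delta>) + sqrt (8 * ln (2 * real K / \<delta>))) \<le> real m2"
    and m2_le: "m2 \<le> N1"
  shows "\<exists>E \<in> sets (rrd_space N1 N2 m1 m2 I \<sigma>). measure (rrd_space N1 N2 m1 m2 I \<sigma>) E \<ge> 1 - 4 * \<delta> \<and>
         (\<forall>(js, is, x) \<in> E. rrd_success L (outlier_mat N1 N2 I x) js is)"
proof -
  interpret G: prob_space "gaussian_entries N1 I \<sigma>" by (rule prob_space_gaussian_entries[OF s])
  \<comment> \<open>An almost sure property holds for at least one sample. The facts about
    \<open>L\<close>, \<open>I\<close> and the counts extracted from it do not depend on the
    sample.\<close>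
  obtain x0 where "data_model N1 N2 r K N2' L (outlier_mat N1 N2 I x0) I"
  proof (rule ccontr)
    assume "\<not> thesis"
    then have "\<not> data_model N1 N2 r K N2' L (outlier_mat N1 N2 I x) I" for x using that by blast
    then show False using model by simp
  qed
  then have L: "L \<in> carrier_mat N1 N2" and I: "I \<subseteq> {..<N2}" and cI: "card I = K"
    and L0: "\<And>i. i \<in> I \<Longrightarrow> col L i = 0\<^sub>v N1" and cL: "N2' = card (nonzero_cols L)" and N2: "N2 = K + N2'"
    by (auto simp: data_model_def nonzero_cols_def outlier_mat_def)
  have finI: "finite I" using I finite_subset by blast
  have N2pos: "0 < N2" using N2 K by simp
  have UU: "transpose_mat U * U = 1\<^sub>m r" and VV: "transpose_mat V * V = 1\<^sub>m r"
    using U V by (auto simp: orthonormal_basis_def)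
  \<comment> \<open>There is a nonzero inlier column, and a basis without columns spans only zero.
    Positivity of \<open>r\<close> makes the logarithms and the maximum over the entries of
    \<open>U\<close> meaningful.\<close>
  have r: "0 < r"
  proof (rule ccontr)
    assume "\<not> 0 < r"
    then have r0: "r = 0" by simp
    have "nonzero_cols L \<noteq> {}" using cL N2' by (metis card.empty not_one_le_zero)
    then obtain j where j: "j < N2" "col L j \<noteq> 0\<^sub>v N1" using L by (auto simp: nonzero_cols_def)
    have cj: "col L j \<in> carrier_vec N1" using L j by simp
    have "U *\<^sub>v (transpose_mat U *\<^sub>v col L j) = col L j"
      using orthonormal_basis_project[OF U cj] col_in_colspace[OF L j(1)] by simp
    moreover have "U *\<^sub>v (transpose_mat U *\<^sub>v col L j) = 0\<^sub>v N1"
      using U(1) r0 by (intro eq_vecI) (auto simp: scalar_prod_def)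
    ultimately show False using j by simp
  qed
  have N1pos: "0 < N1"
  proof (rule ccontr)
    assume "\<not> 0 < N1"
    then have "(transpose_mat U * U) $$ (0, 0) = 0" using U(1) r by (simp add: scalar_prod_def)
    then show False using UU r by simp
  qed
  define R where "R = real r * \<mu>v"
  define rho where "rho = R / real N2"
  have row_V: "row V j \<bullet> row V j \<le> rho" if "j < N2" for j
  proof -
    have e: "transpose_mat V *\<^sub>v unit_vec N2 j = row V j" using V(1) that by (simp add: mat_vec_unit)
    have "(vec_l2_norm (transpose_mat V *\<^sub>v unit_vec N2 j))\<^sup>2 \<le> real r * \<mu>v / real N2" using mu that by blast
    then show ?thesis unfolding e vec_l2_norm_square rho_def R_def .
  qed
  interpret pV: parseval_frame r N2 "row V" rho by (rule parseval_frame_rows[OF V(1) VV N2pos row_V])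
  have rR: "real r \<le> R" using pV.N_rho N2pos by (simp add: rho_def)
  have R1: "1 \<le> R" using rR r by linarith
  have rho0: "0 < rho" using R1 N2pos by (simp add: rho_def)
  interpret tV: tight_frame r N2 "row V" rho by standard (rule rho0)
  define rhoU where "rhoU = real r * \<eta>u\<^sup>2 / real N1"
  interpret pU: parseval_frame r N1 "row U" rhoU
    unfolding rhoU_def by (rule parseval_frame_rows[OF U(1) UU N1pos incoherence_bound[OF U(1) N1pos r _ eta]])
  have NrU: "real N1 * rhoU = real r * \<eta>u\<^sup>2" using N1pos by (simp add: rhoU_def)
  have eta1: "0 < \<eta>u\<^sup>2" using pU.N_rho r unfolding NrU by (metis linorder_not_le mult_eq_0_iff nle_le of_nat_0_less_iff order_less_le_trans zero_le_power2 less_le)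
  have rhoU0: "0 < rhoU" using eta1 r N1pos by (simp add: rhoU_def)
  interpret tU: tight_frame r N1 "row U" rhoU by standard (rule rhoU0)
  define \<beta> where "\<beta> = 1 + 6 * R * (121 / 9)"
  have beta_eq: "1 + 6 * real r * \<mu>v * (121 / 9) = \<beta>" by (simp add: \<beta>_def R_def)
  have b0: "0 < \<beta>" using R1 by (simp add: \<beta>_def)
  have lnpos: "0 < ln (2 / \<delta>)" using d by simp
  have ln_le: "ln (2 / \<delta>) \<le> ln (2 * real r / \<delta>)" using d r by (simp add: divide_right_mono)
  have m1': "real N2 / real N2' * max (3 * g\<^sup>2 * (real K / real N2') * ln (2 / \<delta>))
      (real N2' / real N2 * 10 * R * ln (2 * real r / \<delta>)) \<le> real m1"
    using m1 by (simp add: R_def mult.assoc)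
  have bounds: "10 * R * ln (2 * real r / \<delta>) \<le> real m1"
    "\<exists>th \<ge> 0. real m1 * (real K / real N2) * (exp th - 1) - th * (7 / 2 * real m1 / \<beta>) \<le> - ln (2 / \<delta>)"
    using column_sample_bounds[OF _ _ _ R1 lnpos ln_le \<beta>_def _ _ m1'] g Kle K N2' N2pos
    unfolding beta_eq by auto
  obtain th where th: "0 \<le> th" "real m1 * (real K / real N2) * (exp th - 1) - th * (7 / 2 * real m1 / \<beta>) \<le> - ln (2 / \<delta>)"
    using bounds(2) by blast
  let ?L = "{js. set js \<subseteq> {..<N2} \<and> length js = m1}"
  let ?D = "{is. length is = m2 \<and> distinct is \<and> set is \<subseteq> {..<N1}}"
  define Bad1 where "Bad1 = {js. set js \<subseteq> {..<N2} \<and> length js = m1 \<and>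
      (\<exists>z \<in> carrier_vec r. (\<Sum>j\<leftarrow>js. (row V j \<bullet> z)\<^sup>2) < real m1 / (4 * real N2) * (z \<bullet> z))}"
  define Bad2 where "Bad2 = {js. set js \<subseteq> {..<N2} \<and> length js = m1 \<and>
      7 / 2 * real m1 / \<beta> < real (length (filter (\<lambda>j. j \<in> I) js))}"
  define Bad3 where "Bad3 = {is. length is = m2 \<and> distinct is \<and> set is \<subseteq> {..<N1} \<and>
      (\<exists>x \<in> carrier_vec r. x \<noteq> 0\<^sub>v r \<and> (\<forall>i \<in> set is. row U i \<bullet> x = 0))}"
  define A where "A = ?L - (Bad1 \<union> Bad2)"
  define B where "B = ?D - Bad3"
  have "real (card Bad1) \<le> real N2 ^ m1 * (real r * exp (- (138 / 1000) * (real m1 / (real N2 * rho))))"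
    unfolding Bad1_def by (rule tV.card_degenerate_samples)
  also have "\<dots> \<le> real N2 ^ m1 * (\<delta> / 2)"
    using column_sampling_failure[OF r _ d(1) _ bounds(1)] R1 d N2pos by (intro mult_left_mono) (auto simp: rho_def)
  finally have c1: "real (card Bad1) \<le> real N2 ^ m1 * (\<delta> / 2)" .
  have "real (card Bad2) \<le> real N2 ^ m1 * exp (real m1 * (real (card I) / real N2) * (exp th - 1) - th * (7 / 2 * real m1 / \<beta>))"
    unfolding Bad2_def by (rule card_many_hits[OF I N2pos th(1)])
  also have "\<dots> \<le> real N2 ^ m1 * exp (- ln (2 / \<delta>))"
    using th(2) unfolding cI by (intro mult_left_mono) auto
  also have "exp (- ln (2 / \<delta>)) = \<delta> / 2" using d by (simp add: exp_minus)
  finally have c2: "real (card Bad2) \<le> real N2 ^ m1 * (\<delta> / 2)" .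
  have "real (card (Bad1 \<union> Bad2)) \<le> real (card Bad1) + real (card Bad2)"
    using card_Un_le[of Bad1 Bad2] by linarith
  also have "\<dots> \<le> real N2 ^ m1 * \<delta>" using c1 c2 by (simp add: algebra_simps)
  finally have c12: "real (card (Bad1 \<union> Bad2)) \<le> real N2 ^ m1 * \<delta>" .
  have pA: "1 - \<delta> \<le> measure (column_sampling N2 m1) A"
    unfolding A_def by (rule prob_column_sampling[OF N2pos c12]) (auto simp: Bad1_def Bad2_def)
  have "real (card Bad3) \<le> real (card ?D) * (real r * exp (- (real m2 / (real N1 * rhoU))))"
    unfolding Bad3_def by (rule tU.card_rank_deficient_samples)
  also have "\<dots> \<le> real (card ?D) * (\<delta> / 3)"
    unfolding NrU using row_sampling_failure[OF r eta1 d(1), of "real m2"] m2 d by (intro mult_left_mono) auto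
  finally have c3: "real (card Bad3) \<le> real (card ?D) * (\<delta> / 3)" .
  have pB: "1 - \<delta> / 3 \<le> measure (row_sampling N1 m2) B"
    unfolding B_def by (rule prob_row_sampling[OF m2_le c3]) (auto simp: Bad3_def)
  have finB: "finite B"
    unfolding B_def by (rule finite_subset[OF _ finite_lists_length_eq[of "{..<N1}" m2]]) auto
  \<comment> \<open>Since \<open>2 * K / \<delta> \<ge> 1\<close>, the logarithmic terms are
    nonnegative, which leaves \<open>r + 1 \<le> m2\<close>.\<close>
  have rm2: "r < m2"
  proof -
    have "1 \<le> 2 * real K / \<delta>" using K d by (simp add: field_simps)
    then have "0 \<le> ln (2 * real K / \<delta>)" by simp
    then have "0 \<le> 2 * ln (2 * real K / \<delta>) + sqrt (8 * ln (2 * real K / \<delta>))" by simp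
    then show ?thesis using m2 by linarith
  qed
  have "AE x in gaussian_entries N1 I \<sigma>. \<forall>is\<in>B. \<forall>i\<in>I. \<forall>c \<in> carrier_vec r.
    row_selection N1 is *\<^sub>v col (outlier_mat N1 N2 I x) i \<noteq> row_selection N1 is *\<^sub>v (U *\<^sub>v c)"
  proof (rule AE_finite_allI[OF finB], rule AE_finite_allI[OF finI])
    fix "is" i assume "is \<in> B" "i \<in> I"
    then show "AE x in gaussian_entries N1 I \<sigma>. \<forall>c \<in> carrier_vec r.
      row_selection N1 is *\<^sub>v col (outlier_mat N1 N2 I x) i \<noteq> row_selection N1 is *\<^sub>v (U *\<^sub>v c)"
      using rm2 by (intro AE_generic_outlier[OF s finI I _ U(1)]) (auto simp: B_def)
  qed
  with model have "AE x in gaussian_entries N1 I \<sigma>. data_model N1 N2 r K N2' L (outlier_mat N1 N2 I x) I \<and>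
    (\<forall>is\<in>B. \<forall>i\<in>I. \<forall>c \<in> carrier_vec r.
    row_selection N1 is *\<^sub>v col (outlier_mat N1 N2 I x) i \<noteq> row_selection N1 is *\<^sub>v (U *\<^sub>v c))"
    by eventually_elim auto
  \<comment> \<open>The set of good entries is not claimed to be measurable; the event uses the
    complement of a measurable null set that covers the bad ones.\<close>
  then obtain Z where Z: "{x \<in> space (gaussian_entries N1 I \<sigma>). \<not> (data_model N1 N2 r K N2' L (outlier_mat N1 N2 I x) I \<and>
    (\<forall>is\<in>B. \<forall>i\<in>I. \<forall>c \<in> carrier_vec r.
    row_selection N1 is *\<^sub>v col (outlier_mat N1 N2 I x) i \<noteq> row_selection N1 is *\<^sub>v (U *\<^sub>v c)))} \<subseteq> Z"
    "emeasure (gaussian_entries N1 I \<sigma>) Z = 0" "Z \<in> sets (gaussian_entries N1 I \<sigma>)"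
    by (rule AE_E)
  define X where "X = space (gaussian_entries N1 I \<sigma>) - Z"
  have Xs: "X \<in> sets (gaussian_entries N1 I \<sigma>)" using Z(3) by (auto simp: X_def)
  have X1: "emeasure (gaussian_entries N1 I \<sigma>) X = 1"
    unfolding X_def using Z by (subst emeasure_compl) (auto simp: G.emeasure_space_1)
  note ev = prob_product_event[OF G.prob_space_axioms Xs X1]
  show ?thesis
  proof (rule bexI[of _ "A \<times> (B \<times> X)"], intro conjI ballI)
    show "A \<times> (B \<times> X) \<in> sets (rrd_space N1 N2 m1 m2 I \<sigma>)" unfolding rrd_space_def by (rule ev(1))
    \<comment> \<open>The columns fail with probability at most \<open>\<delta>\<close>, split
      evenly between the Gram bound and the outlier count, the rows with probability at most
      \<open>\<delta> / 3\<close>.\<close>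
    have "(1 - \<delta>) * (1 - \<delta> / 3) \<le> measure (column_sampling N2 m1) A * measure (row_sampling N1 m2) B"
      using pA pB d by (intro mult_mono) auto
    moreover have "1 - 4 * \<delta> \<le> (1 - \<delta>) * (1 - \<delta> / 3)" using d by (simp add: algebra_simps)
    ultimately show "1 - 4 * \<delta> \<le> measure (rrd_space N1 N2 m1 m2 I \<sigma>) (A \<times> (B \<times> X))"
      unfolding rrd_space_def ev(2) by linarith
    fix y assume "y \<in> A \<times> (B \<times> X)"
    then obtain js "is" x where y: "y = (js, is, x)" "js \<in> A" "is \<in> B" "x \<in> X" by auto
    have dm: "data_model N1 N2 r K N2' L (outlier_mat N1 N2 I x) I"
      and gen: "\<forall>is\<in>B. \<forall>i\<in>I. \<forall>c \<in> carrier_vec r.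
        row_selection N1 is *\<^sub>v col (outlier_mat N1 N2 I x) i \<noteq> row_selection N1 is *\<^sub>v (U *\<^sub>v c)"
      using y(4) Z(1) unfolding X_def by blast+
    have m1pos: "0 < real m1"
    proof -
      have "0 < 10 * R * ln (2 * real r / \<delta>)" using R1 lnpos ln_le by (intro mult_pos_pos) auto
      then show ?thesis using bounds(1) by linarith
    qed
    have "sampled_model N1 N2 r L (outlier_mat N1 N2 I x) U V I js is rho (real m1 / (4 * real N2))"
    proof
      show "L \<in> carrier_mat N1 N2" "U \<in> carrier_mat N1 r" "orthonormal_basis U (colspace L)"
        "V \<in> carrier_mat N2 r" "orthonormal_basis V (rowspace L)" by fact+
      show "outlier_mat N1 N2 I x \<in> carrier_mat N1 N2" by (simp add: outlier_mat_def)
      show "nonzero_cols (outlier_mat N1 N2 I x) = I" using dm unfolding data_model_def by blast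
      show "\<And>i. i \<in> I \<Longrightarrow> col L i = 0\<^sub>v N1" by fact
      show "set js \<subseteq> {..<N2}" "set is \<subseteq> {..<N1}" using y by (auto simp: A_def B_def)
      show "z = 0\<^sub>v r" if "z \<in> carrier_vec r" "\<And>i. i \<in> set is \<Longrightarrow> row U i \<bullet> z = 0" for z
        using y(3) that unfolding B_def Bad3_def by blast
      show "row_selection N1 is *\<^sub>v col (outlier_mat N1 N2 I x) i \<noteq> row_selection N1 is *\<^sub>v (U *\<^sub>v c)"
        if "i \<in> I" "c \<in> carrier_vec r" for i c using gen y(3) that by blast
      show "real m1 / (4 * real N2) * (z \<bullet> z) \<le> (\<Sum>j\<leftarrow>js. (row V j \<bullet> z)\<^sup>2)" if "z \<in> carrier_vec r" for z
        using y(2) that unfolding A_def Bad1_def by force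
      show "0 < real m1 / (4 * real N2)" using m1pos N2pos by simp
      show "\<And>j. j < N2 \<Longrightarrow> row V j \<bullet> row V j \<le> rho" by (rule row_V)
      show "0 \<le> rho" using rho0 by simp
      define Ks where "Ks = real (length (filter (\<lambda>j. j \<in> I) js))"
      have Ks: "Ks \<le> 7 / 2 * real m1 / \<beta>" using y(2) unfolding A_def Bad2_def Ks_def by force
      \<comment> \<open>As \<open>rho = R / N2\<close>, both \<open>N2\<close> and \<open>m1\<close>
        cancel and only the ratio \<open>R / \<beta>\<close> remains, which is below
        \<open>3/242\<close>.\<close>
      have "rho / (real m1 / (4 * real N2)) * 2041 / 1960 * Ks \<le> (4 * R / real m1 * 2041 / 1960) * (7 / 2 * real m1 / \<beta>)"
        using Ks R1 N2pos m1pos by (intro mult_mono) (auto simp: rho_def Ks_def)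
      also have "\<dots> = (4 * 2041 / 1960 * 7 / 2) * R / \<beta>" using m1pos by simp
      also have "\<dots> < 9 / 49" using R1 b0 by (simp add: divide_less_eq \<beta>_def)
      finally show "rho / (real m1 / (4 * real N2)) * 2041 / 1960 * real (length (filter (\<lambda>j. j \<in> I) js)) < 9 / 49"
        unfolding Ks_def .
    qed
    then have "rrd_success L (outlier_mat N1 N2 I x) js is" by (rule sampled_model.success)
    then show "case y of (js, is, x) \<Rightarrow> rrd_success L (outlier_mat N1 N2 I x) js is" by (simp add: y(1))
  qed
qed

text \<open>The data model is required almost surely because Gaussian columns may vanish or be
  degenerate on a null set. The bound \<open>m2 \<le> N1\<close> makes sampling without replacement
  possible. Success is stated through a measurable event contained in the success set, so
  measurability of the success set itself is not asserted.\<close>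

theorem theorem4:
  shows "\<exists>c1 c2 :: real. c1 > 0 \<and> c2 > 0 \<and>
    (\<forall>(N1::nat) (N2::nat) (N2'::nat) (K::nat) (r::nat) (m1::nat) (m2::nat)
       (I :: nat set) (L :: real mat) (U :: real mat) (V :: real mat)
       (\<sigma>::real) (\<mu>v::real) (\<eta>u::real) (g::real) (\<delta>::real) (\<zeta>::real).
      \<sigma> > 0 \<longrightarrow>
      (AE x in gaussian_entries N1 I \<sigma>. data_model N1 N2 r K N2' L (outlier_mat N1 N2 I x) I) \<longrightarrow>
      K \<ge> 1 \<longrightarrow> N2' \<ge> 1 \<longrightarrow>
      U \<in> carrier_mat N1 r \<longrightarrow> orthonormal_basis U (colspace L) \<longrightarrow>
      V \<in> carrier_mat N2 r \<longrightarrow> orthonormal_basis V (rowspace L) \<longrightarrow>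
      (\<forall>i<N2. (vec_l2_norm (transpose_mat V *\<^sub>v unit_vec N2 i))\<^sup>2 \<le> real r * \<mu>v / real N2) \<longrightarrow>
      \<eta>u = sqrt (real N1) * Max ((\<lambda>ij. \<bar>U $$ ij\<bar>) ` ({..<N1} \<times> {..<r})) \<longrightarrow>
      0 < \<delta> \<longrightarrow> \<delta> < 1 / 4 \<longrightarrow>
      \<zeta> = max (3 * g\<^sup>2 * (real K / real N2') * ln (2 / \<delta>))
              (real N2' / real N2 * 10 * real r * \<mu>v * ln (2 * real r / \<delta>)) \<longrightarrow>
      real m1 \<ge> real N2 / real N2' * \<zeta> \<longrightarrow>
      g \<ge> real N2' / real N2 * (1 + 6 * real r * \<mu>v * (121 / 9)) \<longrightarrow>
      real K / real N2' \<le>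
        (g * (real N2 / real N2') - (1 + 6 * real r * \<mu>v * (121 / 9))) /
        (g * (1 + 6 * real r * \<mu>v * (121 / 9))) \<longrightarrow>
      real m2 \<ge> max (real r * \<eta>u\<^sup>2 * max (c1 * ln (real r)) (c2 * ln (3 / \<delta>)))
                    (real r + 1 + 2 * ln (2 * real K / \<delta>) + sqrt (8 * ln (2 * real K / \<delta>))) \<longrightarrow>
      m2 \<le> N1 \<longrightarrow>
      (\<exists>E \<in> sets (rrd_space N1 N2 m1 m2 I \<sigma>).
         measure (rrd_space N1 N2 m1 m2 I \<sigma>) E \<ge> 1 - 4 * \<delta> \<and>
         (\<forall>(js, is, x) \<in> E. rrd_success L (outlier_mat N1 N2 I x) js is)))"
\<comment> \<open>Both witnesses are the constant 2 of \<open>row_sampling_failure\<close>.\<close>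
proof (rule exI[of _ 2], rule exI[of _ 2], intro conjI allI impI)
  fix N1 N2 N2' K r m1 m2 :: nat and I :: "nat set" and L U V :: "real mat"
    and \<sigma> \<mu>v \<eta>u g \<delta> \<zeta> :: real
  assume *: "0 < \<sigma>" "AE x in gaussian_entries N1 I \<sigma>. data_model N1 N2 r K N2' L (outlier_mat N1 N2 I x) I"
    "1 \<le> K" "1 \<le> N2'" "U \<in> carrier_mat N1 r" "orthonormal_basis U (colspace L)"
    "V \<in> carrier_mat N2 r" "orthonormal_basis V (rowspace L)"
    "\<forall>i<N2. (vec_l2_norm (transpose_mat V *\<^sub>v unit_vec N2 i))\<^sup>2 \<le> real r * \<mu>v / real N2"
    "\<eta>u = sqrt (real N1) * Max ((\<lambda>ij. \<bar>U $$ ij\<bar>) ` ({..<N1} \<times> {..<r}))" "0 < \<delta>" "\<delta> < 1 / 4"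
  assume z: "\<zeta> = max (3 * g\<^sup>2 * (real K / real N2') * ln (2 / \<delta>))
      (real N2' / real N2 * 10 * real r * \<mu>v * ln (2 * real r / \<delta>))"
    and m1: "real N2 / real N2' * \<zeta> \<le> real m1"
  assume **: "real N2' / real N2 * (1 + 6 * real r * \<mu>v * (121 / 9)) \<le> g"
    "real K / real N2' \<le> (g * (real N2 / real N2') - (1 + 6 * real r * \<mu>v * (121 / 9))) /
      (g * (1 + 6 * real r * \<mu>v * (121 / 9)))"
    "max (real r * \<eta>u\<^sup>2 * max (2 * ln (real r)) (2 * ln (3 / \<delta>)))
      (real r + 1 + 2 * ln (2 * real K / \<delta>) + sqrt (8 * ln (2 * real K / \<delta>))) \<le> real m2"
    "m2 \<le> N1"
  show "\<exists>E \<in> sets (rrd_space N1 N2 m1 m2 I \<sigma>). 1 - 4 * \<delta> \<le> measure (rrd_space N1 N2 m1 m2 I \<sigma>) E \<and>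
      (\<forall>(js, is, x) \<in> E. rrd_success L (outlier_mat N1 N2 I x) js is)"
    by (rule exact_recovery_event[OF * m1[unfolded z] **])
qed simp_all

end
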